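(* Let $\mathcal{G}$ be a finite-dimensional complex Lie algebra with a nondegenerate, symmetric, invariant bilinear form $B:\mathcal{G}\times\mathcal{G}\to\mathbb{C}$, let $\mu$ be an automorphism of $\mathcal{G}$ of finite order $N$ that preserves $B$ and has nonzero fixed points, and let $\mathcal{G}_0\neq\{0\}$ be the fixed point subalgebra of $\mu$. Fix $\tau\in\mathbb{C}$ with $\Im(\tau)>0$, put $\Omega=\mathbb{Z}+\tau\mathbb{Z}$, and let $r^\tau:\mathcal{B}^\tau\times(\mathbb{C}\setminus\Omega)\to\mathcal{G}\otimes\mathcal{G}$, with $\mathcal{B}^\tau\subset\mathcal{G}_0$, be the function $$r^\tau(\omega,z)=B\big(T_\alpha,\mathcal{R}_\tau(\omega,z)T_\beta\big)\,T^\alpha\otimes T^\beta$$ defined in the context. Then $r^\tau$ satisfies the spectral-parameter-dependent classical dynamical Yang–Baxter equation $$[r^\tau_{12}(\omega,z_{12}),r^\tau_{13}(\omega,z_{13})]+[r^\tau_{12}(\omega,z_{12}),r^\tau_{23}(\omega,z_{23})]+[r^\tau_{13}(\omega,z_{13}),r^\tau_{23}(\omega,z_{23})]$$ $$+\,T_j^1\frac{\partial}{\partial\omega_j}r^\tau_{23}(\omega,z_{23})-T_j^2\frac{\partial}{\partial\omega_j}r^\tau_{13}(\omega,z_{13})+T_j^3\frac{\partial}{\partial\omega_j}r^\tau_{12}(\omega,z_{12})=0$$ for all $\omega\in\mathcal{B}^\tau$ and all $z_1,z_2,z_3\in\mathbb{C}$ such that $z_{\alpha\beta}=z_\alpha-z_\beta\in\mathbb{C}\setminus\Omega$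 for $(\alpha,\beta)=(1,2),(1,3),(2,3)$, where $\{T_j\}$ is a basis of $\mathcal{G}_0$, $\omega_j:=B(\omega,T_j)$, and summation over $j$ is understood. Furthermore, $r^\tau$ has the properties $$\mathrm{Res}_{z=0}\,r^\tau(\omega,z)=\frac{1}{2\pi i}T^\alpha\otimes T_\alpha,\qquad \big(r^\tau(\omega,z)\big)^T+r^\tau(\omega,-z)=0,$$ where $\big(r^\tau(\omega,z)\big)^T:=B(T_\alpha,\mathcal{R}_\tau(\omega,z)T_\beta)\,T^\beta\otimes T^\alpha$, and $$\frac{d}{dx}r^\tau\big(e^{x\,\mathrm{ad}\,T}(\omega),z\big)\Big\vert_{x=0}=[T\otimes1+1\otimes T,\,r^\tau(\omega,z)]\qquad\forall T\in\mathcal{G}_0 .$$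
   Context: Eigenspaces: $\mathcal{G}=\oplus_{a\in\mathcal{E}_\mu}\mathcal{G}_a$, where $\mathcal{G}_a=\{\xi\in\mathcal{G}\mid\mu(\xi)=e^{2\pi i a/N}\xi\}$ and $\mathcal{E}_\mu\subset\{0,1,\dots,N-1\}$ is the set of those $a$ with $\mathcal{G}_a\neq\{0\}$; by assumption $0\in\mathcal{E}_\mu$. The form $B$ restricted to $\mathcal{G}_0$ is nondegenerate. Functions: the theta function is $$\theta_1(z\vert\tau)=-\sum_{j\in\mathbb{Z}}\exp\Big(\pi i(j+\tfrac12)^2\tau+2\pi i(j+\tfrac12)(z+\tfrac12)\Big),$$ which is entire in $z$ with simple zeros exactly at the points of $\Omega$. Put $$\chi(w,z\vert\tau)=\frac{1}{2\pi i}\,\frac{\theta_1(\frac{w}{2\pi i}+z\vert\tau)\,\theta_1'(0\vert\tau)}{\theta_1(z\vert\tau)\,\theta_1(\frac{w}{2\pi i}\vert\tau)},$$ where $\theta_1'$ is the derivative in the first argument, and for $a\in\{0,1,\dots,N-1\}$ $$\chi_a(w,z\vert\tau)=e^{\frac{2\pi i a z}{N}}\Big(\chi\big(w+2\pi i\tfrac aN\tau,z\vert\tau\big)-\frac{\delta_{a,0}}{w}\Big).$$ The function $\chi_a$ is holomorphic in $w$ and $z$ on $(\mathbb{C}\setminus2\pi i\,\Omega_a)\times(\mathbb{C}\setminus\Omega)$, where $\Omega_a:=(\Omega-\frac aN\tau)\setminus\{0\}$ (for $a=0$ the singularity at $w=0$ is removable). Domain: for $\omega\in\mathcal{G}_0$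 let $(\mathrm{ad}\,\omega)_a:=\mathrm{ad}\,\omega\vert_{\mathcal{G}_a}\in\mathrm{End}(\mathcal{G}_a)$ with spectrum $\sigma((\mathrm{ad}\,\omega)_a)$, and $$\mathcal{B}^\tau:=\{\omega\in\mathcal{G}_0\mid\sigma((\mathrm{ad}\,\omega)_a)\cap2\pi i\,\Omega_a=\emptyset\ \ \forall a\in\mathcal{E}_\mu\},$$ an open subset of $\mathcal{G}_0$ containing the origin. The operator: $\mathcal{R}_\tau:\mathcal{B}^\tau\times(\mathbb{C}\setminus\Omega)\to\mathrm{End}(\mathcal{G})$ is given by $\mathcal{R}_\tau(\omega,z)\vert_{\mathcal{G}_a}:=\chi_a((\mathrm{ad}\,\omega)_a,z\vert\tau)$ for $a\in\mathcal{E}_\mu$, defined by the holomorphic functional calculus in the variable $w$, i.e. $H(A)=\frac{1}{2\pi i}\oint_\Gamma H(w)(wI-A)^{-1}dw$ with $\Gamma$ encircling each eigenvalue of $A$ inside the holomorphy domain of $H$. Tensor notation: $\{T_\alpha\}$, $\{T^\beta\}$ are dual bases of $\mathcal{G}$, $B(T_\alpha,T^\beta)=\delta_\alpha^\beta$, with summation over repeated indices understood. $T_j^1=T_j\otimes1\otimes1$, $T_j^2=1\otimes T_j\otimes1$, $T_j^3=1\otimes1\otimes T_j$, and $r_{12}=r\otimes1$ etc., where $r_{\alpha\beta}$ denotes $r$ placed in the tensor factors $\alpha,\beta$ of the triple tensor product of the universal enveloping algebra of $\mathcal{G}$. The quantities $\omega_j=B(\omega,T_j)$ are used as linear coordinates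 on $\mathcal{G}_0$. *)

theory Defs
  imports
    "HOL-Complex_Analysis.Complex_Analysis"
    "HOL-Library.Poly_Mapping"
    "HOL-Library.Function_Algebras"
begin

section \<open>Complex vector spaces\<close>

class complex_vector = ab_group_add +
  fixes scaleC :: "complex \<Rightarrow> 'a \<Rightarrow> 'a" (infixr \<open>*\<^sub>C\<close> 75)
  assumes scaleC_add_right: "a *\<^sub>C (x + y) = a *\<^sub>C x + a *\<^sub>C y"
    and scaleC_add_left: "(a + b) *\<^sub>C x = a *\<^sub>C x + b *\<^sub>C x"
    and scaleC_scaleC: "a *\<^sub>C b *\<^sub>C x = (a * b) *\<^sub>C x"
    and scaleC_one: "1 *\<^sub>C x = x"

global_interpretation complex_vector: vector_space "scaleC :: complex \<Rightarrow> 'a \<Rightarrow> 'a :: complex_vector"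
  by unfold_locales
    (simp_all add: scaleC_add_right scaleC_add_left scaleC_scaleC scaleC_one)

abbreviation clinear :: "('a::complex_vector \<Rightarrow> 'b::complex_vector) \<Rightarrow> bool"
  where "clinear \<equiv> Vector_Spaces.linear scaleC scaleC"

abbreviation cfunctional :: "('a::complex_vector \<Rightarrow> complex) \<Rightarrow> bool"
  where "cfunctional \<equiv> Vector_Spaces.linear scaleC (*)"

definition fin_dim_space :: "'a::complex_vector itself \<Rightarrow> bool"
  where "fin_dim_space _ \<longleftrightarrow> (\<exists>S :: 'a set. finite S \<and> complex_vector.span S = UNIV)"

definition is_basis :: "'a::complex_vector set \<Rightarrow> nat \<Rightarrow> (nat \<Rightarrow> 'a) \<Rightarrow> bool"
  where "is_basis V n T \<longleftrightarrow> inj_on T {..<n} \<and> \<not> complex_vector.dependent (T ` {..<n})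
           \<and> complex_vector.span (T ` {..<n}) = V"

text \<open>
  A finite-dimensional complex vector space carries a unique Hausdorff vector space topology.
  In it a function is differentiable, integrable etc. iff its composition with every
  linear functional is, so the analytic notions for vector-valued functions are expressed through
  linear functionals, without choosing a norm or a basis.
\<close>

definition has_vec_deriv ::
    "(complex \<Rightarrow> 'a::complex_vector) \<Rightarrow> 'a \<Rightarrow> complex \<Rightarrow> bool"
  where "has_vec_deriv F D x \<longleftrightarrow>
    (\<forall>\<phi>. cfunctional \<phi> \<longrightarrow> ((\<lambda>t. \<phi> (F t)) has_field_derivative \<phi> D) (at x))"

definition vec_contour_integral ::
    "(real \<Rightarrow> complex) \<Rightarrow> (complex \<Rightarrow> 'a::complex_vector) \<Rightarrow> 'a"
  where "vec_contour_integral \<gamma> F = (THE I.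
    \<forall>\<phi>. cfunctional \<phi> \<longrightarrow> ((\<lambda>w. \<phi> (F w)) has_contour_integral \<phi> I) \<gamma>)"

definition has_vec_residue ::
    "(complex \<Rightarrow> 'a::complex_vector) \<Rightarrow> 'a \<Rightarrow> complex \<Rightarrow> bool"
  where "has_vec_residue F R z \<longleftrightarrow> (\<forall>\<phi>. cfunctional \<phi> \<longrightarrow>
    isolated_singularity_at (\<lambda>w. \<phi> (F w)) z \<and> residue (\<lambda>w. \<phi> (F w)) z = \<phi> R)"

definition vec_suminf :: "(nat \<Rightarrow> 'a::complex_vector) \<Rightarrow> 'a"
  where "vec_suminf f = (THE s. \<forall>\<phi>. cfunctional \<phi> \<longrightarrow> (\<lambda>k. \<phi> (f k)) sums \<phi> s)"

definition endo_exp :: "('a::complex_vector \<Rightarrow> 'a) \<Rightarrow> 'a \<Rightarrow> 'a"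
  where "endo_exp A v = vec_suminf (\<lambda>k. inverse (fact k) *\<^sub>C (A ^^ k) v)"

definition spectrum_on :: "'a::complex_vector set \<Rightarrow> ('a \<Rightarrow> 'a) \<Rightarrow> complex set"
  where "spectrum_on V A = {w. \<not> bij_betw (\<lambda>v. w *\<^sub>C v - A v) V V}"

text \<open>
  \<open>hol_calculus V D H A\<close> is \<open>H(A)\<close> for an endomorphism \<open>A\<close> of the subspace \<open>V\<close> and \<open>H\<close> holomorphic
  on \<open>D\<close>: the contour \<open>\<Gamma>\<close> consists of one circle about each eigenvalue, of a common radius so small
  that each closed disc lies in \<open>D\<close> and contains no further eigenvalue. By Cauchy's theorem the
  result does not depend on the chosen radius.
\<close>

definition hol_calculus :: "'a::complex_vector set \<Rightarrow> complex set \<Rightarrow> (complex \<Rightarrow> complex)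
    \<Rightarrow> ('a \<Rightarrow> 'a) \<Rightarrow> 'a \<Rightarrow> 'a"
  where "hol_calculus V D H A v =
    (let \<epsilon> = (SOME \<epsilon>. 0 < \<epsilon> \<and> (\<forall>l\<in>spectrum_on V A.
                cball l \<epsilon> \<subseteq> D \<and> cball l \<epsilon> \<inter> spectrum_on V A = {l}))
     in (1 / (2 * pi * \<i>)) *\<^sub>C (\<Sum>l\<in>spectrum_on V A. vec_contour_integral (circlepath l \<epsilon>)
           (\<lambda>w. H w *\<^sub>C inv_into V (\<lambda>u. w *\<^sub>C u - A u) v)))"

section \<open>The tensor square\<close>

inductive_set tensor2_null :: "(('a::complex_vector \<times> 'a) \<Rightarrow>\<^sub>0 complex) set" where
  zero: "0 \<in> tensor2_null"
| add_left: "p \<in> tensor2_null \<Longrightarrow>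
    p + (Poly_Mapping.single (x + y, u) c - Poly_Mapping.single (x, u) c
          - Poly_Mapping.single (y, u) c) \<in> tensor2_null"
| add_right: "p \<in> tensor2_null \<Longrightarrow>
    p + (Poly_Mapping.single (u, x + y) c - Poly_Mapping.single (u, x) c
          - Poly_Mapping.single (u, y) c) \<in> tensor2_null"
| scale_left: "p \<in> tensor2_null \<Longrightarrow>
    p + (Poly_Mapping.single (a *\<^sub>C x, u) c - Poly_Mapping.single (x, u) (a * c)) \<in> tensor2_null"
| scale_right: "p \<in> tensor2_null \<Longrightarrow>
    p + (Poly_Mapping.single (u, a *\<^sub>C x) c - Poly_Mapping.single (u, x) (a * c)) \<in> tensor2_null"

lemma tensor2_null_add:
  assumes "p \<in> tensor2_null" "q \<in> tensor2_null"
  shows "p + q \<in> tensor2_null"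
  using assms(2)
proof induction
  case zero
  then show ?case using assms(1) by simp
next
  case (add_left q x y u c)
  show ?case using tensor2_null.add_left[OF add_left.IH] by (simp only: add.assoc)
next
  case (add_right q u x y c)
  show ?case using tensor2_null.add_right[OF add_right.IH] by (simp only: add.assoc)
next
  case (scale_left q a x u c)
  show ?case using tensor2_null.scale_left[OF scale_left.IH] by (simp only: add.assoc)
next
  case (scale_right q u a x c)
  show ?case using tensor2_null.scale_right[OF scale_right.IH] by (simp only: add.assoc)
qed

definition fscale :: "complex \<Rightarrow> ('k \<Rightarrow>\<^sub>0 complex) \<Rightarrow> ('k \<Rightarrow>\<^sub>0 complex)"
  where "fscale c = Poly_Mapping.map ((*) c)"

lemma lookup_fscale [simp]: "Poly_Mapping.lookup (fscale c p) k = c * Poly_Mapping.lookup p k"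
  unfolding fscale_def by (transfer) (simp add: when_def)

lemma fscale_add: "fscale c (p + q) = fscale c p + fscale c q"
  by (rule poly_mapping_eqI) (simp add: lookup_add algebra_simps)

lemma fscale_diff: "fscale c (p - q) = fscale c p - fscale c q"
  by (rule poly_mapping_eqI) (simp add: lookup_minus algebra_simps)

lemma fscale_single: "fscale c (Poly_Mapping.single k a) = Poly_Mapping.single k (c * a)"
  by (rule poly_mapping_eqI) (simp add: lookup_single when_def)

lemma tensor2_null_fscale:
  assumes "p \<in> tensor2_null"
  shows "fscale b p \<in> tensor2_null"
  using assms
proof induction
  case zero
  have "fscale b 0 = (0 :: ('a \<times> 'a) \<Rightarrow>\<^sub>0 complex)"
    by (rule poly_mapping_eqI) simp
  then show ?case by (simp add: tensor2_null.zero)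
next
  case (add_left p x y u c)
  show ?case using tensor2_null.add_left[OF add_left.IH]
    by (simp only: fscale_add fscale_diff fscale_single)
next
  case (add_right p u x y c)
  show ?case using tensor2_null.add_right[OF add_right.IH]
    by (simp only: fscale_add fscale_diff fscale_single)
next
  case (scale_left p a x u c)
  show ?case using tensor2_null.scale_left[OF scale_left.IH, of a x u "b * c"]
    by (simp only: fscale_add fscale_diff fscale_single mult.left_commute[of b])
next
  case (scale_right p u a x c)
  show ?case using tensor2_null.scale_right[OF scale_right.IH, of u a x "b * c"]
    by (simp only: fscale_add fscale_diff fscale_single mult.left_commute[of b])
qed

lemma fscale_minus_one: "fscale (- 1) p = - p"
  by (rule poly_mapping_eqI) simp

lemma tensor2_null_uminus: "p \<in> tensor2_null \<Longrightarrow> - p \<in> tensor2_null"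
  using tensor2_null_fscale[of p "- 1"] by (simp add: fscale_minus_one)

definition tensor2_rel ::
    "(('a::complex_vector \<times> 'a) \<Rightarrow>\<^sub>0 complex) \<Rightarrow> (('a \<times> 'a) \<Rightarrow>\<^sub>0 complex) \<Rightarrow> bool"
  where "tensor2_rel p q \<longleftrightarrow> p - q \<in> tensor2_null"

lemma equivp_tensor2_rel: "equivp tensor2_rel"
proof (rule equivpI)
  show "reflp tensor2_rel"
    by (rule reflpI) (simp add: tensor2_rel_def tensor2_null.zero)
  show "symp tensor2_rel"
    by (rule sympI, unfold tensor2_rel_def, drule tensor2_null_uminus, simp only: minus_diff_eq)
  show "transp tensor2_rel"
    by (rule transpI, unfold tensor2_rel_def, drule (1) tensor2_null_add, simp)
qed

quotient_type (overloaded) 'a tensor2 =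
    "('a::complex_vector \<times> 'a) \<Rightarrow>\<^sub>0 complex" / tensor2_rel
  by (rule equivp_tensor2_rel)

instantiation tensor2 :: (complex_vector) complex_vector
begin

lift_definition zero_tensor2 :: "'a tensor2" is 0 .

lift_definition plus_tensor2 :: "'a tensor2 \<Rightarrow> 'a tensor2 \<Rightarrow> 'a tensor2" is "(+)"
  unfolding tensor2_rel_def by (simp only: tensor2_null_add add_diff_add)

lift_definition uminus_tensor2 :: "'a tensor2 \<Rightarrow> 'a tensor2" is uminus
  unfolding tensor2_rel_def by (simp only: tensor2_null_uminus minus_diff_minus)

lift_definition minus_tensor2 :: "'a tensor2 \<Rightarrow> 'a tensor2 \<Rightarrow> 'a tensor2" is "(-)"
proof -
  fix p p' q q' :: "('a \<times> 'a) \<Rightarrow>\<^sub>0 complex"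
  assume "tensor2_rel p p'" "tensor2_rel q q'"
  then have "(p - p') + - (q - q') \<in> tensor2_null"
    unfolding tensor2_rel_def by (intro tensor2_null_add tensor2_null_uminus)
  then show "tensor2_rel (p - q) (p' - q')"
    unfolding tensor2_rel_def by (simp add: algebra_simps)
qed

lift_definition scaleC_tensor2 :: "complex \<Rightarrow> 'a tensor2 \<Rightarrow> 'a tensor2" is fscale
  unfolding tensor2_rel_def by (simp only: tensor2_null_fscale fscale_diff[symmetric])

lemma tensor2_relI: "p = q \<Longrightarrow> tensor2_rel p q"
  by (simp add: tensor2_rel_def tensor2_null.zero)

instance
proof
  fix a b c :: "'a tensor2" and s t :: complex
  show "a + b + c = a + (b + c)"
    by transfer (rule tensor2_relI, simp add: add.assoc)
  show "a + b = b + a"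
    by transfer (rule tensor2_relI, simp add: add.commute)
  show "0 + a = a"
    by transfer (rule tensor2_relI, simp)
  show "- a + a = 0"
    by transfer (rule tensor2_relI, simp)
  show "a - b = a + - b"
    by transfer (rule tensor2_relI, simp)
  show "s *\<^sub>C (a + b) = s *\<^sub>C a + s *\<^sub>C b"
    by transfer (rule tensor2_relI, simp add: fscale_add)
  show "(s + t) *\<^sub>C a = s *\<^sub>C a + t *\<^sub>C a"
    by transfer (rule tensor2_relI, rule poly_mapping_eqI, simp add: lookup_add algebra_simps)
  show "s *\<^sub>C t *\<^sub>C a = (s * t) *\<^sub>C a"
    by transfer (rule tensor2_relI, rule poly_mapping_eqI, simp)
  show "1 *\<^sub>C a = a"
    by transfer (rule tensor2_relI, rule poly_mapping_eqI, simp)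
qed

end

lift_definition tens :: "'a::complex_vector \<Rightarrow> 'a \<Rightarrow> 'a tensor2" (infix \<open>\<otimes>\<^sub>t\<close> 76)
  is "\<lambda>x y. Poly_Mapping.single (x, y) 1" .

section \<open>Lie algebras and tensor powers of the universal enveloping algebra\<close>

class complex_lie_algebra = complex_vector +
  fixes lie :: "'a \<Rightarrow> 'a \<Rightarrow> 'a"
  assumes lie_add_left: "lie (x + y) z = lie x z + lie y z"
    and lie_add_right: "lie x (y + z) = lie x y + lie x z"
    and lie_scale_left: "lie (a *\<^sub>C x) y = a *\<^sub>C lie x y"
    and lie_scale_right: "lie x (a *\<^sub>C y) = a *\<^sub>C lie x y"
    and lie_self: "lie x x = 0"
    and lie_jacobi: "lie x (lie y z) + lie y (lie z x) + lie z (lie x y) = 0"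

text \<open>The free monoid, written additively so that \<open>'a word \<Rightarrow>\<^sub>0 complex\<close> is the free algebra.\<close>

datatype 'a word = Word (letters: "'a list")

instantiation word :: (type) monoid_add
begin

definition zero_word :: "'a word" where "zero_word = Word []"

definition plus_word :: "'a word \<Rightarrow> 'a word \<Rightarrow> 'a word"
  where "plus_word v w = Word (letters v @ letters w)"

instance by standard (simp_all add: zero_word_def plus_word_def)

end

text \<open>
  \<open>('n \<Rightarrow> 'a word) \<Rightarrow>\<^sub>0 complex\<close> is the tensor power, with factors indexed by \<open>'n\<close>, of the free algebra
  on the set of all vectors of \<open>'a\<close>. Dividing by the ideal generated, in every factor, by the
  defining relations of the universal enveloping algebra gives the corresponding tensor power of
  that enveloping algebra. With \<open>'n = 3\<close> the factors are \<open>1\<close>, \<open>2\<close>, \<open>3\<close>, where \<open>3 = 0\<close> in this type.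
\<close>

definition free_gen :: "'n \<Rightarrow> 'a \<Rightarrow> ('n::finite \<Rightarrow> 'a word) \<Rightarrow>\<^sub>0 complex"
  where "free_gen k x = Poly_Mapping.single (\<lambda>i. if i = k then Word [x] else 0) 1"

definition free_scal :: "complex \<Rightarrow> ('n::finite \<Rightarrow> 'a word) \<Rightarrow>\<^sub>0 complex"
  where "free_scal c = Poly_Mapping.single 0 c"

definition uea_relators :: "(('n::finite \<Rightarrow> 'a::complex_lie_algebra word) \<Rightarrow>\<^sub>0 complex) set"
  where "uea_relators =
      {free_gen k (x + y) - free_gen k x - free_gen k y | k x y. True}
    \<union> {free_gen k (c *\<^sub>C x) - free_scal c * free_gen k x | k c x. True}
    \<union> {free_gen k x * free_gen k y - free_gen k y * free_gen k x - free_gen k (lie x y) | k x y. True}"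

inductive_set uea_ideal :: "(('n::finite \<Rightarrow> 'a::complex_lie_algebra word) \<Rightarrow>\<^sub>0 complex) set" where
  zero: "0 \<in> uea_ideal"
| step: "i \<in> uea_ideal \<Longrightarrow> g \<in> uea_relators \<Longrightarrow> i + p * g * q \<in> uea_ideal"

lemma uea_ideal_add:
  assumes "i \<in> uea_ideal" "j \<in> uea_ideal"
  shows "i + j \<in> uea_ideal"
  using assms(2)
proof induction
  case zero
  then show ?case using assms(1) by simp
next
  case (step j g p q)
  show ?case using uea_ideal.step[OF step.IH step.hyps(2)] by (simp only: add.assoc)
qed

lemma uea_ideal_mult:
  assumes "i \<in> uea_ideal"
  shows "a * i * b \<in> uea_ideal"
  using assms
proof induction
  case zero
  then show ?case by (simp add: uea_ideal.zero)
next
  case (step i g p q)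
  show ?case using uea_ideal.step[OF step.IH step.hyps(2), of "a * p" "q * b"]
    by (simp add: algebra_simps)
qed

lemma uea_ideal_uminus: "i \<in> uea_ideal \<Longrightarrow> - i \<in> uea_ideal"
  using uea_ideal_mult[of i "- 1" 1] by simp

lemma uea_ideal_diff: "i \<in> uea_ideal \<Longrightarrow> j \<in> uea_ideal \<Longrightarrow> i - j \<in> uea_ideal"
  using uea_ideal_add[of i "- j"] by (simp add: uea_ideal_uminus)

definition uea_rel :: "(('n::finite \<Rightarrow> 'a::complex_lie_algebra word) \<Rightarrow>\<^sub>0 complex)
    \<Rightarrow> (('n \<Rightarrow> 'a word) \<Rightarrow>\<^sub>0 complex) \<Rightarrow> bool"
  where "uea_rel p q \<longleftrightarrow> p - q \<in> uea_ideal"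

lemma equivp_uea_rel: "equivp uea_rel"
proof (rule equivpI)
  show "reflp uea_rel"
    by (rule reflpI) (simp add: uea_rel_def uea_ideal.zero)
  show "symp uea_rel"
    by (rule sympI, unfold uea_rel_def, drule uea_ideal_uminus, simp only: minus_diff_eq)
  show "transp uea_rel"
    by (rule transpI, unfold uea_rel_def, drule (1) uea_ideal_add, simp)
qed

quotient_type (overloaded) ('a, 'n) uea_power =
    "('n::finite \<Rightarrow> 'a::complex_lie_algebra word) \<Rightarrow>\<^sub>0 complex" / uea_rel
  by (rule equivp_uea_rel)

lemma uea_relI: "p = q \<Longrightarrow> uea_rel p q"
  by (simp add: uea_rel_def uea_ideal.zero)

lemma free_scal_add: "free_scal (a + b) = free_scal a + free_scal b"
  by (simp add: free_scal_def single_add)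

lemma free_scal_mult: "free_scal (a * b) = free_scal a * free_scal b"
  by (simp add: free_scal_def mult_single)

lemma free_scal_one: "free_scal 1 = 1"
  by (simp add: free_scal_def)

instantiation uea_power :: (complex_lie_algebra, finite) ring
begin

lift_definition zero_uea_power :: "('a, 'b) uea_power" is 0 .

lift_definition plus_uea_power ::
    "('a, 'b) uea_power \<Rightarrow> ('a, 'b) uea_power \<Rightarrow> ('a, 'b) uea_power" is "(+)"
  unfolding uea_rel_def by (simp only: uea_ideal_add add_diff_add)

lift_definition uminus_uea_power :: "('a, 'b) uea_power \<Rightarrow> ('a, 'b) uea_power" is uminus
  unfolding uea_rel_def by (simp only: uea_ideal_uminus minus_diff_minus)

lift_definition minus_uea_power ::
    "('a, 'b) uea_power \<Rightarrow> ('a, 'b) uea_power \<Rightarrow> ('a, 'b) uea_power" is "(-)"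
proof -
  fix p p' q q' :: "('b \<Rightarrow> 'a word) \<Rightarrow>\<^sub>0 complex"
  assume "uea_rel p p'" "uea_rel q q'"
  then have "(p - p') - (q - q') \<in> uea_ideal"
    unfolding uea_rel_def by (rule uea_ideal_diff)
  then show "uea_rel (p - q) (p' - q')"
    unfolding uea_rel_def by (simp add: algebra_simps)
qed

lift_definition times_uea_power ::
    "('a, 'b) uea_power \<Rightarrow> ('a, 'b) uea_power \<Rightarrow> ('a, 'b) uea_power" is "(*)"
proof -
  fix p p' q q' :: "('b \<Rightarrow> 'a word) \<Rightarrow>\<^sub>0 complex"
  assume "uea_rel p p'" "uea_rel q q'"
  then have "1 * (p - p') * q + p' * (q - q') * 1 \<in> uea_ideal"
    unfolding uea_rel_def by (intro uea_ideal_add uea_ideal_mult)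
  then show "uea_rel (p * q) (p' * q')"
    unfolding uea_rel_def by (simp add: algebra_simps)
qed

instance
proof
  fix a b c :: "('a, 'b) uea_power"
  show "a + b + c = a + (b + c)" by transfer (rule uea_relI, simp add: add.assoc)
  show "a + b = b + a" by transfer (rule uea_relI, simp add: add.commute)
  show "0 + a = a" by transfer (rule uea_relI, simp)
  show "- a + a = 0" by transfer (rule uea_relI, simp)
  show "a - b = a + - b" by transfer (rule uea_relI, simp)
  show "a * b * c = a * (b * c)" by transfer (rule uea_relI, simp add: mult.assoc)
  show "(a + b) * c = a * c + b * c" by transfer (rule uea_relI, simp add: algebra_simps)
  show "a * (b + c) = a * b + a * c" by transfer (rule uea_relI, simp add: algebra_simps)
qed

end

instantiation uea_power :: (complex_lie_algebra, finite) complex_vector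
begin

lift_definition scaleC_uea_power ::
    "complex \<Rightarrow> ('a, 'b) uea_power \<Rightarrow> ('a, 'b) uea_power" is "\<lambda>c p. free_scal c * p"
proof -
  fix c and p q :: "('b \<Rightarrow> 'a word) \<Rightarrow>\<^sub>0 complex"
  assume "uea_rel p q"
  then show "uea_rel (free_scal c * p) (free_scal c * q)"
    using uea_ideal_mult[of "p - q" "free_scal c" 1]
    unfolding uea_rel_def by (simp add: algebra_simps)
qed

instance
proof
  fix a b :: "('a, 'b) uea_power" and s t :: complex
  show "s *\<^sub>C (a + b) = s *\<^sub>C a + s *\<^sub>C b"
    by transfer (rule uea_relI, simp add: algebra_simps)
  show "(s + t) *\<^sub>C a = s *\<^sub>C a + t *\<^sub>C a"
    by transfer (rule uea_relI, simp add: free_scal_add algebra_simps)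
  show "s *\<^sub>C t *\<^sub>C a = (s * t) *\<^sub>C a"
    by transfer (rule uea_relI, simp add: free_scal_mult mult.assoc)
  show "1 *\<^sub>C a = a"
    by transfer (rule uea_relI, simp add: free_scal_one)
qed

end

text \<open>\<open>leg k x\<close> is \<open>1 \<otimes> \<dots> \<otimes> x \<otimes> \<dots> \<otimes> 1\<close> with \<open>x\<close> in the factor \<open>k\<close>.\<close>

lift_definition leg :: "'n::finite \<Rightarrow> 'a::complex_lie_algebra \<Rightarrow> ('a, 'n) uea_power"
  is free_gen .

lemma uea_rel_add: "uea_rel (free_gen k (x + y)) (free_gen k x + free_gen k y)"
proof -
  have "free_gen k (x + y) - free_gen k x - free_gen k y \<in> uea_relators"
    unfolding uea_relators_def by blast
  from uea_ideal.step[OF uea_ideal.zero this, of 1 1]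
  show ?thesis by (simp add: uea_rel_def algebra_simps)
qed

lemma uea_rel_scale: "uea_rel (free_gen k (c *\<^sub>C x)) (free_scal c * free_gen k x)"
proof -
  have "free_gen k (c *\<^sub>C x) - free_scal c * free_gen k x \<in> uea_relators"
    unfolding uea_relators_def by blast
  from uea_ideal.step[OF uea_ideal.zero this, of 1 1]
  show ?thesis by (simp add: uea_rel_def)
qed

lemma uea_rel_lie:
  "uea_rel (free_gen k x * free_gen k y - free_gen k y * free_gen k x) (free_gen k (lie x y))"
proof -
  have "free_gen k x * free_gen k y - free_gen k y * free_gen k x - free_gen k (lie x y)
      \<in> uea_relators"
    unfolding uea_relators_def by blast
  from uea_ideal.step[OF uea_ideal.zero this, of 1 1]
  show ?thesis by (simp add: uea_rel_def)
qed

lemma leg_add: "leg k (x + y) = leg k x + leg k y"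
  by transfer (rule uea_rel_add)

lemma leg_scale: "leg k (c *\<^sub>C x) = c *\<^sub>C leg k x"
  by transfer (rule uea_rel_scale)

lemma leg_lie: "leg k x * leg k y - leg k y * leg k x = leg k (lie x y)"
  by transfer (rule uea_rel_lie)

lemma uea_rel_commute:
  assumes "k \<noteq> l"
  shows "uea_rel (free_gen k x * free_gen l y) (free_gen l y * free_gen k x)"
proof (rule uea_relI)
  have "(\<lambda>i. if i = k then Word [x] else 0) + (\<lambda>i. if i = l then Word [y] else 0)
      = (\<lambda>i. if i = l then Word [y] else 0) + (\<lambda>i. if i = k then Word [x] else 0)"
    using assms by (auto simp: fun_eq_iff)
  then show "free_gen k x * free_gen l y = free_gen l y * free_gen k x"
    by (simp add: free_gen_def mult_single)
qed

lemma leg_commute: "k \<noteq> l \<Longrightarrow> leg k x * leg l y = leg l y * leg k x"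
  by transfer (rule uea_rel_commute)

lemma free_scal_commute: "free_scal c * p = p * free_scal c"
proof (induction p rule: update_induct)
  case const
  then show ?case by simp
next
  case (update f k a)
  have "Poly_Mapping.update k a f = f + Poly_Mapping.single k a"
    using update.hyps(1)
    by (intro poly_mapping_eqI)
      (simp add: lookup_update lookup_add lookup_single when_def in_keys_iff, auto)
  moreover have "free_scal c * Poly_Mapping.single k a = Poly_Mapping.single k a * free_scal c"
    by (simp add: free_scal_def mult_single mult.commute)
  ultimately show ?case using update.IH by (simp add: distrib_left distrib_right)
qed

lemma scaleC_mult_left: "c *\<^sub>C a * b = c *\<^sub>C (a * b)"
  for a b :: "('a::complex_lie_algebra, 'n::finite) uea_power"
  by transfer (rule uea_relI, simp add: mult.assoc)

lemma scaleC_mult_right: "a * c *\<^sub>C b = c *\<^sub>C (a * b)"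
  for a b :: "('a::complex_lie_algebra, 'n::finite) uea_power"
  by transfer (rule uea_relI, metis free_scal_commute mult.assoc)

definition free_lin :: "('k \<Rightarrow> 'v::complex_vector) \<Rightarrow> ('k \<Rightarrow>\<^sub>0 complex) \<Rightarrow> 'v"
  where "free_lin f p = (\<Sum>k\<in>Poly_Mapping.keys p. Poly_Mapping.lookup p k *\<^sub>C f k)"

lemma free_lin_superset:
  assumes "finite S" "Poly_Mapping.keys p \<subseteq> S"
  shows "free_lin f p = (\<Sum>k\<in>S. Poly_Mapping.lookup p k *\<^sub>C f k)"
  unfolding free_lin_def
  by (rule sum.mono_neutral_left) (use assms in \<open>auto simp: in_keys_iff\<close>)

lemma free_lin_add: "free_lin f (p + q) = free_lin f p + free_lin f q"
proof -
  let ?S = "Poly_Mapping.keys p \<union> Poly_Mapping.keys q"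
  have "Poly_Mapping.keys (p + q) \<subseteq> ?S" by (rule Poly_Mapping.keys_add)
  then show ?thesis
    by (simp add: free_lin_superset[of ?S] lookup_add complex_vector.scale_left_distrib
        sum.distrib)
qed

lemma free_lin_diff: "free_lin f (p - q) = free_lin f p - free_lin f q"
  using free_lin_add[of f "p - q" q] by (simp add: algebra_simps)

lemma free_lin_single: "free_lin f (Poly_Mapping.single k c) = c *\<^sub>C f k"
  by (simp add: free_lin_def)

lemma free_lin_null:
  assumes "p \<in> tensor2_null"
    and "\<And>x y u. f (x + y, u) = f (x, u) + f (y, u)" "\<And>x y u. f (u, x + y) = f (u, x) + f (u, y)"
    and "\<And>a x u. f (a *\<^sub>C x, u) = a *\<^sub>C f (x, u)" "\<And>a x u. f (u, a *\<^sub>C x) = a *\<^sub>C f (u, x)"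
  shows "free_lin f p = 0"
  using assms(1)
  by induction
    (simp_all add: free_lin_add free_lin_diff free_lin_single assms(2-5)
      complex_vector.scale_right_distrib mult.commute, simp add: free_lin_def)

text \<open>\<open>place k l\<close> sends \<open>x \<otimes> y\<close> to the element with \<open>x\<close> in the factor \<open>k\<close> and \<open>y\<close> in the factor \<open>l\<close>.\<close>

lift_definition place ::
    "'n::finite \<Rightarrow> 'n \<Rightarrow> 'a::complex_lie_algebra tensor2 \<Rightarrow> ('a, 'n) uea_power"
  is "\<lambda>k l. free_lin (\<lambda>(x, y). leg k x * leg l y)"
proof -
  fix k l :: 'n and p q :: "('a \<times> 'a) \<Rightarrow>\<^sub>0 complex"
  assume "tensor2_rel p q"
  then have "free_lin (\<lambda>(x, y). leg k x * leg l y) (p - q) = 0"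
    unfolding tensor2_rel_def
    by (rule free_lin_null)
      (simp_all add: leg_add leg_scale distrib_left distrib_right scaleC_mult_left scaleC_mult_right)
  then show "free_lin (\<lambda>(x, y). leg k x * leg l y) p = free_lin (\<lambda>(x, y). leg k x * leg l y) q"
    by (simp add: free_lin_diff)
qed

lemma place_tens: "place k l (x \<otimes>\<^sub>t y) = leg k x * leg l y"
  by transfer (simp add: free_lin_single)

definition commutator :: "'r::ring \<Rightarrow> 'r \<Rightarrow> 'r"
  where "commutator x y = x * y - y * x"

section \<open>The elliptic functions\<close>

definition theta1 :: "complex \<Rightarrow> complex \<Rightarrow> complex"
  where "theta1 \<tau> z = - (\<Sum>\<^sub>\<infinity>j\<in>(UNIV :: int set).
    exp (pi * \<i> * (of_int j + 1/2)\<^sup>2 * \<tau> + 2 * pi * \<i> * (of_int j + 1/2) * (z + 1/2)))"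

definition chi :: "complex \<Rightarrow> complex \<Rightarrow> complex \<Rightarrow> complex"
  where "chi \<tau> w z = 1 / (2 * pi * \<i>) *
    (theta1 \<tau> (w / (2 * pi * \<i>) + z) * deriv (theta1 \<tau>) 0)
      / (theta1 \<tau> z * theta1 \<tau> (w / (2 * pi * \<i>)))"

text \<open>For \<open>a = 0\<close> the value at the removable singularity \<open>w = 0\<close> is filled in by the limit.\<close>

definition chi_a :: "nat \<Rightarrow> complex \<Rightarrow> nat \<Rightarrow> complex \<Rightarrow> complex \<Rightarrow> complex"
  where "chi_a N \<tau> a w z =
    (let h = (\<lambda>w. exp (2 * pi * \<i> * of_nat a * z / of_nat N) *
                (chi \<tau> (w + 2 * pi * \<i> * (of_nat a / of_nat N) * \<tau>) z - (if a = 0 then 1 else 0) / w))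
     in if a = 0 \<and> w = 0 then Lim (at 0) h else h w)"

definition period_lattice :: "complex \<Rightarrow> complex set"
  where "period_lattice \<tau> = {of_int m + \<tau> * of_int n | m n. True}"

definition lattice_a :: "nat \<Rightarrow> complex \<Rightarrow> nat \<Rightarrow> complex set"
  where "lattice_a N \<tau> a = (\<lambda>p. p - of_nat a / of_nat N * \<tau>) ` period_lattice \<tau> - {0}"

definition sing_a :: "nat \<Rightarrow> complex \<Rightarrow> nat \<Rightarrow> complex set"
  where "sing_a N \<tau> a = (\<lambda>p. 2 * pi * \<i> * p) ` lattice_a N \<tau> a"

section \<open>The dynamical r-matrix\<close>

definition invariant_form :: "('a::complex_lie_algebra \<Rightarrow> 'a \<Rightarrow> complex) \<Rightarrow> bool"
  where "invariant_form B \<longleftrightarrow>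
    (\<forall>x. cfunctional (B x)) \<and> (\<forall>y. cfunctional (\<lambda>x. B x y)) \<and>
    (\<forall>x y. B x y = B y x) \<and>
    (\<forall>x. (\<forall>y. B x y = 0) \<longrightarrow> x = 0) \<and>
    (\<forall>x y z. B (lie x y) z = B x (lie y z))"

definition lie_automorphism :: "('a::complex_lie_algebra \<Rightarrow> 'a) \<Rightarrow> bool"
  where "lie_automorphism \<mu> \<longleftrightarrow> clinear \<mu> \<and> bij \<mu> \<and> (\<forall>x y. \<mu> (lie x y) = lie (\<mu> x) (\<mu> y))"

definition has_order :: "('a \<Rightarrow> 'a) \<Rightarrow> nat \<Rightarrow> bool"
  where "has_order \<mu> N \<longleftrightarrow> 0 < N \<and> \<mu> ^^ N = id \<and> (\<forall>k. 0 < k \<and> k < N \<longrightarrow> \<mu> ^^ k \<noteq> id)"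

definition dual_bases :: "('a::complex_vector \<Rightarrow> 'a \<Rightarrow> complex) \<Rightarrow> nat \<Rightarrow> (nat \<Rightarrow> 'a)
    \<Rightarrow> (nat \<Rightarrow> 'a) \<Rightarrow> bool"
  where "dual_bases B n T T' \<longleftrightarrow> is_basis UNIV n T \<and> is_basis UNIV n T' \<and>
    (\<forall>\<alpha><n. \<forall>\<beta><n. B (T \<alpha>) (T' \<beta>) = (if \<alpha> = \<beta> then 1 else 0))"

definition eigenspace :: "('a::complex_vector \<Rightarrow> 'a) \<Rightarrow> nat \<Rightarrow> nat \<Rightarrow> 'a set"
  where "eigenspace \<mu> N a = {\<xi>. \<mu> \<xi> = exp (2 * pi * \<i> * of_nat a / of_nat N) *\<^sub>C \<xi>}"

definition eigen_index :: "('a::complex_vector \<Rightarrow> 'a) \<Rightarrow> nat \<Rightarrow> nat set"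
  where "eigen_index \<mu> N = {a. a < N \<and> eigenspace \<mu> N a \<noteq> {0}}"

definition fixed_points :: "('a \<Rightarrow> 'a) \<Rightarrow> 'a set"
  where "fixed_points \<mu> = {\<xi>. \<mu> \<xi> = \<xi>}"

definition dyn_domain :: "('a::complex_lie_algebra \<Rightarrow> 'a) \<Rightarrow> nat \<Rightarrow> complex \<Rightarrow> 'a set"
  where "dyn_domain \<mu> N \<tau> = {\<omega> \<in> fixed_points \<mu>. \<forall>a\<in>eigen_index \<mu> N.
    spectrum_on (eigenspace \<mu> N a) (lie \<omega>) \<inter> sing_a N \<tau> a = {}}"

definition R_op :: "('a::complex_lie_algebra \<Rightarrow> 'a) \<Rightarrow> nat \<Rightarrow> complex \<Rightarrow> 'a \<Rightarrow> complex \<Rightarrow> 'a \<Rightarrow> 'a"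
  where "R_op \<mu> N \<tau> \<omega> z = (THE R. clinear R \<and>
    (\<forall>a\<in>eigen_index \<mu> N. \<forall>x\<in>eigenspace \<mu> N a.
       R x = hol_calculus (eigenspace \<mu> N a) (- sing_a N \<tau> a) (\<lambda>w. chi_a N \<tau> a w z) (lie \<omega>) x))"

definition r_mat :: "('a::complex_lie_algebra \<Rightarrow> 'a \<Rightarrow> complex) \<Rightarrow> ('a \<Rightarrow> 'a) \<Rightarrow> nat \<Rightarrow> nat
    \<Rightarrow> (nat \<Rightarrow> 'a) \<Rightarrow> (nat \<Rightarrow> 'a) \<Rightarrow> complex \<Rightarrow> 'a \<Rightarrow> complex \<Rightarrow> 'a tensor2"
  where "r_mat B \<mu> N n T T' \<tau> \<omega> z =
    (\<Sum>\<alpha><n. \<Sum>\<beta><n. B (T \<alpha>) (R_op \<mu> N \<tau> \<omega> z (T \<beta>)) *\<^sub>C (T' \<alpha> \<otimes>\<^sub>t T' \<beta>))"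

definition r_mat_transposed :: "('a::complex_lie_algebra \<Rightarrow> 'a \<Rightarrow> complex) \<Rightarrow> ('a \<Rightarrow> 'a) \<Rightarrow> nat \<Rightarrow> nat
    \<Rightarrow> (nat \<Rightarrow> 'a) \<Rightarrow> (nat \<Rightarrow> 'a) \<Rightarrow> complex \<Rightarrow> 'a \<Rightarrow> complex \<Rightarrow> 'a tensor2"
  where "r_mat_transposed B \<mu> N n T T' \<tau> \<omega> z =
    (\<Sum>\<alpha><n. \<Sum>\<beta><n. B (T \<alpha>) (R_op \<mu> N \<tau> \<omega> z (T \<beta>)) *\<^sub>C (T' \<beta> \<otimes>\<^sub>t T' \<alpha>))"

text \<open>
  For a basis \<open>S\<close> of the subspace \<open>V\<close>, on which \<open>B\<close> is nondegenerate, the numbers \<open>B \<omega> (S i)\<close>, \<open>i < m\<close>,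
  are linear coordinates of \<open>\<omega> \<in> V\<close>; \<open>coord_point\<close> recovers the point from them. The \<open>j\<close>-th partial
  derivative varies the \<open>j\<close>-th of these coordinates; it is not the derivative in direction \<open>S j\<close>.
\<close>

definition coord_point :: "('a::complex_vector \<Rightarrow> 'a \<Rightarrow> complex) \<Rightarrow> 'a set \<Rightarrow> nat \<Rightarrow> (nat \<Rightarrow> 'a)
    \<Rightarrow> (nat \<Rightarrow> complex) \<Rightarrow> 'a"
  where "coord_point B V m S c = (THE \<omega>. \<omega> \<in> V \<and> (\<forall>i<m. B \<omega> (S i) = c i))"

definition has_partial_deriv :: "('a::complex_vector \<Rightarrow> 'a \<Rightarrow> complex) \<Rightarrow> 'a set \<Rightarrow> nat \<Rightarrow> (nat \<Rightarrow> 'a)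
    \<Rightarrow> nat \<Rightarrow> ('a \<Rightarrow> 'v::complex_vector) \<Rightarrow> 'v \<Rightarrow> 'a \<Rightarrow> bool"
  where "has_partial_deriv B V m S j F D \<omega> \<longleftrightarrow>
    has_vec_deriv (\<lambda>t. F (coord_point B V m S ((\<lambda>i. B \<omega> (S i))(j := t)))) D (B \<omega> (S j))"

definition partial_deriv :: "('a::complex_vector \<Rightarrow> 'a \<Rightarrow> complex) \<Rightarrow> 'a set \<Rightarrow> nat \<Rightarrow> (nat \<Rightarrow> 'a)
    \<Rightarrow> nat \<Rightarrow> ('a \<Rightarrow> 'v::complex_vector) \<Rightarrow> 'a \<Rightarrow> 'v"
  where "partial_deriv B V m S j F \<omega> = (THE D. has_partial_deriv B V m S j F D \<omega>)"

end

theory Submission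
  imports Defs "HOL-Computational_Algebra.Fundamental_Theorem_Algebra"
begin

text \<open>
  Written with operators, the tensor is \<open>r = \<Sum> R (T \<beta>) \<otimes> T' \<beta>\<close>, where \<open>R\<close> acts on the eigenspace \<open>G a\<close> of
  \<open>\<mu>\<close> as the function \<open>chi_a\<close> of \<open>ad \<omega>\<close>. Pairing the dynamical Yang-Baxter equation with three vectors
  turns it into the vanishing of a trilinear form \<open>yang_baxter\<close> in \<open>X\<close>, \<open>Y\<close>, \<open>Z\<close>. Because \<open>ad \<omega>\<close> is a derivation, on a
  bracket of \<open>Y\<close> and \<open>Z\<close> it acts as \<open>\<alpha> + \<beta>\<close>, where \<open>\<alpha>\<close> and \<open>\<beta>\<close> denote the commuting actions of \<open>ad \<omega>\<close> on \<open>Y\<close>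
  and on \<open>Z\<close>. Every term of the form is then a function of \<open>\<alpha>\<close> and \<open>\<beta>\<close> applied to the bracket:
  the commutators give the products \<open>chi \<alpha> x * chi \<beta> y\<close>, \<open>chi (\<alpha> + \<beta>) x * chi \<beta> (y - x)\<close> and
  \<open>chi (\<alpha> + \<beta>) y * chi \<alpha> (x - y)\<close>. The derivative of a function \<open>H\<close> of \<open>ad \<omega>\<close> in the direction of \<open>Y\<close>, applied to \<open>Z\<close>,
  is the divided difference \<open>(H (\<alpha> + \<beta>) - H \<beta>) / \<alpha>\<close>. So the equation is the Fay identity for \<open>chi\<close>,
  in which the poles \<open>1 / w\<close> subtracted from \<open>chi\<close> in the definition of \<open>chi_a\<close> at index \<open>0\<close> account exactly for the
  divided differences (\<open>chi_a_fay\<close>).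

  The Fay identity is a rewriting of the Weierstrass identity \<open>theta1_weierstrass\<close>, which holds because a product
  \<open>theta1 (x + y) * theta1 (x - y)\<close> is a two by two determinant in two theta series of period \<open>2 * \<tau>\<close>
  (\<open>theta1_product\<close>); the identity is then the Pluecker relation. The same determinant shows that \<open>theta1\<close> is
  odd, that its zeros are the points of the lattice and that the zero at the origin is simple.

  The operators \<open>ad \<omega>\<close> need not be diagonalizable, so the identity between functions has to be used with
  nilpotent parts. Each eigenspace of \<open>\<mu>\<close> is spanned by generalized eigenvectors of \<open>ad \<omega>\<close> (\<open>gev_induct\<close>), and for
  generalized eigenvectors \<open>Y\<close> at \<open>v\<close> and \<open>Z\<close> at \<open>w\<close> a function of \<open>\<alpha>\<close> and \<open>\<beta>\<close> acts through its power series
  at \<open>(v, w)\<close>. The Fay identity therefore becomes an identity of power series in two variables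
  (\<open>chi_a_fay_fps\<close>). It is multiplied by \<open>\<alpha> * \<beta> * (\<alpha> + \<beta>)\<close> to be free of denominators; as power
  series over a domain have no zero divisors, the factor can be cancelled afterwards (\<open>yang_baxter_gev\<close>).

  Differentiability in \<open>\<omega>\<close> comes from the contour integral: for \<open>\<omega>'\<close> near \<open>\<omega>\<close> the spectrum stays inside the
  discs bounded by the contours for \<open>\<omega>\<close>, so the contours can be kept fixed, and the resolvent identity gives the derivative of the
  integrand (\<open>calculus_deriv\<close>). The derivative is a contour integral \<open>dcalc\<close> of two resolvents,
  which yields the divided differences and, along an orbit of the adjoint action, the commutator in the
  equivariance statement (\<open>dcalc_orbit\<close>). The skew symmetry of \<open>r\<close> follows from the oddness of \<open>theta1\<close> together with the skewness of
  \<open>ad \<omega>\<close> (\<open>Rop_skew\<close>). For the residue at \<open>z = 0\<close>, only the value of \<open>chi_a\<close> has a pole there, while its \<open>w\<close>-derivatives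
  of positive order stay regular (\<open>chi_a_deriv_residue\<close>); so the residue of \<open>R\<close> is a multiple of the identity.
\<close>

section \<open>Theta series\<close>

lemma summable_exp_neg_abs: "(\<lambda>j::int. exp (- \<bar>real_of_int j\<bar>)) summable_on UNIV"
proof -
  have s: "summable (\<lambda>n. norm (exp (- 1) ^ n :: real))"
    by (simp add: summable_geometric norm_power)
  have e: "exp (- real n) = exp (-1) ^ n" for n
    by (simp add: exp_of_nat_mult[symmetric])
  have N: "(\<lambda>n. exp (- real n)) summable_on UNIV"
    unfolding e using s by (rule norm_summable_imp_summable_on)
  have P: "(\<lambda>j::int. exp (- \<bar>real_of_int j\<bar>)) summable_on range int"
    by (subst summable_on_reindex) (use N in \<open>auto simp: o_def\<close>)
  have Q: "(\<lambda>j::int. exp (- \<bar>real_of_int j\<bar>)) summable_on range (\<lambda>n. - int n)"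
    by (subst summable_on_reindex) (use N in \<open>auto simp: o_def inj_on_def\<close>)
  have "range int \<union> (range (\<lambda>n. - int n) - range int) = UNIV"
  proof (rule set_eqI, rule iffI)
    fix j :: int
    show "j \<in> range int \<union> (range (\<lambda>n. - int n) - range int)"
      by (cases j rule: int_cases2) auto
  qed simp
  moreover have "(\<lambda>j::int. exp (- \<bar>real_of_int j\<bar>)) summable_on (range int \<union> (range (\<lambda>n. - int n) - range int))"
    by (rule summable_on_Un_disjoint[OF P summable_on_subset_banach[OF Q]]) auto
  ultimately show ?thesis by simp
qed

text \<open>
  The theta series with characteristic \<open>e\<close>: besides \<open>theta1\<close> itself (\<open>e = 1/2\<close>), the two series of period
  \<open>2 * \<tau>\<close> that occur in the product formula are of this form.
\<close>

definition thseries :: "complex \<Rightarrow> real \<Rightarrow> complex \<Rightarrow> complex" where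
  "thseries \<sigma> e x = (\<Sum>\<^sub>\<infinity>j\<in>(UNIV::int set).
     exp (pi * \<i> * \<sigma> * (of_int j + of_real e)\<^sup>2 + 2 * pi * \<i> * (of_int j + of_real e) * x))"

text \<open>
  The quadratic term dominates the linear one; after completing the square a term decays faster than any exponential, in particular
  faster than \<open>exp (- \<bar>j\<bar>)\<close>, uniformly in a horizontal strip.
\<close>

lemma thterm_bound:
  assumes "Im \<sigma> > 0"
  obtains K where "\<And>j x. \<bar>Im x\<bar> \<le> M \<Longrightarrow> norm (exp (pi * \<i> * \<sigma> * (of_int j + of_real e)\<^sup>2
     + 2 * pi * \<i> * (of_int j + of_real e) * x)) \<le> K * exp (- \<bar>real_of_int j\<bar>)"
proof -
  define a where "a = pi * Im \<sigma>"
  \<comment> \<open>The linear growth is at most \<open>b - 1\<close> on the strip; the additional \<open>1\<close> leaves room for the factor \<open>exp (- \<bar>j\<bar>)\<close>.\<close>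
  define b where "b = 2 * pi * \<bar>M\<bar> + 1"
  have a: "a > 0" using assms by (simp add: a_def)
  show thesis
  proof (rule that[of "exp (b\<^sup>2 / (4 * a) + \<bar>e\<bar>)"])
    fix j :: int and x :: complex
    assume x: "\<bar>Im x\<bar> \<le> M"
    define m where "m = real_of_int j + e"
    have m: "of_int j + of_real e = (of_real m :: complex)" by (simp add: m_def)
    have "norm (exp (pi * \<i> * \<sigma> * (of_int j + of_real e)\<^sup>2 + 2 * pi * \<i> * (of_int j + of_real e) * x))
       = exp (- a * m\<^sup>2 - 2 * pi * m * Im x)"
      unfolding m by (simp add: a_def power2_eq_square algebra_simps flip: of_real_mult)
    also have "\<dots> \<le> exp (b\<^sup>2 / (4 * a) + \<bar>e\<bar> - \<bar>real_of_int j\<bar>)"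
    proof -
      have "- (2 * pi * m * Im x) \<le> \<bar>2 * pi * m * Im x\<bar>" by (rule abs_ge_minus_self)
      also have "\<dots> = 2 * pi * (\<bar>m\<bar> * \<bar>Im x\<bar>)" by (simp add: abs_mult)
      also have "\<dots> \<le> 2 * pi * (\<bar>m\<bar> * \<bar>M\<bar>)"
        using x by (intro mult_left_mono) auto
      finally have 1: "- (2 * pi * m * Im x) \<le> (b - 1) * \<bar>m\<bar>" by (simp add: b_def algebra_simps)
      have "0 \<le> a * (\<bar>m\<bar> - b / (2 * a))\<^sup>2" using a by simp
      also have "\<dots> = a * m\<^sup>2 - b * \<bar>m\<bar> + b\<^sup>2 / (4 * a)"
        using a by (simp add: power2_eq_square field_simps)
      finally have 2: "- a * m\<^sup>2 + b * \<bar>m\<bar> \<le> b\<^sup>2 / (4 * a)" by simp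
      have 3: "\<bar>real_of_int j\<bar> \<le> \<bar>m\<bar> + \<bar>e\<bar>" by (simp add: m_def)
      show ?thesis using 1 2 3 by (simp add: algebra_simps)
    qed
    finally show "norm (exp (pi * \<i> * \<sigma> * (of_int j + of_real e)\<^sup>2 + 2 * pi * \<i> * (of_int j + of_real e) * x))
      \<le> exp (b\<^sup>2 / (4 * a) + \<bar>e\<bar>) * exp (- \<bar>real_of_int j\<bar>)"
      by (simp add: mult_exp_exp)
  qed
qed

lemma thseries_abs_summable:
  assumes "Im \<sigma> > 0"
  shows "(\<lambda>j::int. norm (exp (pi * \<i> * \<sigma> * (of_int j + of_real e)\<^sup>2 + 2 * pi * \<i> * (of_int j + of_real e) * x)))
    summable_on UNIV"
proof -
  obtain K where K: "\<And>j y. \<bar>Im y\<bar> \<le> \<bar>Im x\<bar> \<Longrightarrow> norm (exp (pi * \<i> * \<sigma> * (of_int j + of_real e)\<^sup>2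
     + 2 * pi * \<i> * (of_int j + of_real e) * y)) \<le> K * exp (- \<bar>real_of_int j\<bar>)"
    by (rule thterm_bound[OF assms, where M = "\<bar>Im x\<bar>" and e = e]) (auto simp only:)
  have "(\<lambda>j::int. norm (K * exp (- \<bar>real_of_int j\<bar>))) summable_on UNIV"
    by (rule summable_on_iff_abs_summable_on_real[THEN iffD1, OF summable_on_cmult_right[OF summable_exp_neg_abs]])
  then show ?thesis
    by (rule Infinite_Sum.abs_summable_on_comparison_test)
      (use order.trans[OF K[OF order.refl] abs_ge_self] in \<open>simp only: real_norm_def\<close>)
qed

lemma thseries_uniform_limit:
  assumes "Im \<sigma> > 0" and "\<And>x. x \<in> S \<Longrightarrow> \<bar>Im x\<bar> \<le> M"
  shows "uniform_limit S (\<lambda>X x. \<Sum>j\<in>X. exp (pi * \<i> * \<sigma> * (of_int j + of_real e)\<^sup>2 + 2 * pi * \<i> * (of_int j + of_real e) * x))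
    (thseries \<sigma> e) (finite_subsets_at_top (UNIV::int set))"
proof -
  obtain K where K: "\<And>j y. \<bar>Im y\<bar> \<le> M \<Longrightarrow> norm (exp (pi * \<i> * \<sigma> * (of_int j + of_real e)\<^sup>2
     + 2 * pi * \<i> * (of_int j + of_real e) * y)) \<le> K * exp (- \<bar>real_of_int j\<bar>)"
    by (rule thterm_bound[OF assms(1), where M = M and e = e]) (auto simp only:)
  show ?thesis unfolding thseries_def
    by (rule Weierstrass_m_test_general[OF K[OF assms(2)] summable_on_cmult_right[OF summable_exp_neg_abs]])
qed

lemma thseries_holomorphic:
  assumes "Im \<sigma> > 0"
  shows "thseries \<sigma> e holomorphic_on UNIV"
proof -
  have "thseries \<sigma> e holomorphic_on ball z 1" for z
  proof (rule holomorphic_uniform_limit)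
    show "uniform_limit (cball z 1) (\<lambda>X x. \<Sum>j\<in>X. exp (pi * \<i> * \<sigma> * (of_int j + of_real e)\<^sup>2 + 2 * pi * \<i> * (of_int j + of_real e) * x))
    (thseries \<sigma> e) (finite_subsets_at_top (UNIV::int set))"
    proof (rule thseries_uniform_limit[OF assms, where M = "\<bar>Im z\<bar> + 1"])
      fix x assume "x \<in> cball z 1"
      then have "\<bar>Im (z - x)\<bar> \<le> 1" using abs_Im_le_cmod[of "z - x"] by (simp add: dist_norm)
      then show "\<bar>Im x\<bar> \<le> \<bar>Im z\<bar> + 1" by simp
    qed
  qed (auto intro!: always_eventually continuous_intros holomorphic_intros)
  then have "thseries \<sigma> e field_differentiable at z" for z
    by (meson centre_in_ball holomorphic_on_imp_differentiable_at open_ball zero_less_one)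
  then show ?thesis by (simp add: holomorphic_on_def field_differentiable_at_within)
qed

lemma exp_2pi_int: "exp (2 * pi * \<i> * of_int j) = 1"
  by (simp add: exp_eq_1 algebra_simps)

lemma thseries_shift_1:
  "thseries \<sigma> e (x + 1) = exp (2 * pi * \<i> * e) * thseries \<sigma> e x"
  unfolding thseries_def 
proof (subst infsum_cmult_right'[symmetric], rule infsum_cong)
  fix j :: int
  note exp_2pi_int[of j]
  then show "exp (pi * \<i> * \<sigma> * (of_int j + of_real e)\<^sup>2 + 2 * pi * \<i> * (of_int j + of_real e) * (x + 1))
   = exp (2 * pi * \<i> * e) * exp (pi * \<i> * \<sigma> * (of_int j + of_real e)\<^sup>2 + 2 * pi * \<i> * (of_int j + of_real e) * x)"
    by (simp add: algebra_simps exp_add)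
qed

lemma thseries_index_1: "thseries \<sigma> (e + 1) = thseries \<sigma> e"
proof
  fix x
  show "thseries \<sigma> (e + 1) x = thseries \<sigma> e x"
    unfolding thseries_def
    by (rule infsum_reindex_bij_witness[where i = "\<lambda>j. j - 1" and j = "\<lambda>j. j + 1"])
      (auto simp: algebra_simps)
qed

lemma thseries_neg: "thseries \<sigma> e (- x) = thseries \<sigma> (- e) x"
  unfolding thseries_def
  by (rule infsum_reindex_bij_witness[where i = "uminus" and j = "uminus"])
    (auto simp: algebra_simps power2_eq_square)

lemma thseries_half_period:
  "thseries \<sigma> e (x + \<sigma> / 2) = exp (- pi * \<i> * \<sigma> / 4 - pi * \<i> * x) * thseries \<sigma> (e + 1/2) x"
  unfolding thseries_def 
  by (subst infsum_cmult_right'[symmetric], rule infsum_cong, subst exp_add[symmetric], rule arg_cong[where f = exp])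
    (simp add: power2_eq_square algebra_simps add_divide_distrib)

text \<open>
  On the real line the series is, up to the factor \<open>exp (2 * pi * \<i> * e * x)\<close>, a uniformly convergent Fourier series with
  nonzero constant coefficient.
\<close>

lemma thseries_nonzero:
  assumes "Im \<sigma> > 0"
  shows "\<exists>x. thseries \<sigma> e x \<noteq> 0"
proof (rule ccontr)
  assume "\<not> ?thesis"
  then have z: "thseries \<sigma> e x = 0" for x by auto
  define a where "a j = exp (pi * \<i> * \<sigma> * (of_int j + of_real e)\<^sup>2)" for j
  define f where "f X x = (\<Sum>j\<in>X. a j * exp (2 * pi * \<i> * of_int j * of_real x))" for X and x :: real
  have "uniform_limit {0..1::real} (\<lambda>X x. exp (- 2 * pi * \<i> * e * of_real x) * (\<Sum>j\<in>X. exp (pi * \<i> * \<sigma> * (of_int j + of_real e)\<^sup>2 + 2 * pi * \<i> * (of_int j + of_real e) * of_real x)))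
    (\<lambda>x. exp (- 2 * pi * \<i> * e * of_real x) * thseries \<sigma> e (of_real x)) (finite_subsets_at_top (UNIV::int set))"
  proof (rule uniform_limit_intros)
    show "uniform_limit {0..1::real} (\<lambda>X x. \<Sum>j\<in>X. exp (pi * \<i> * \<sigma> * (of_int j + of_real e)\<^sup>2 + 2 * pi * \<i> * (of_int j + of_real e) * of_real x))
       (\<lambda>x. thseries \<sigma> e (of_real x)) (finite_subsets_at_top (UNIV::int set))"
      by (rule uniform_limit_compose'[OF thseries_uniform_limit[OF assms, where M = 0 and S = "of_real ` {0..1}"]]) auto
    show "bounded ((\<lambda>x. exp (- 2 * pi * \<i> * e * of_real x)) ` {0..1})"
      by (intro compact_imp_bounded compact_continuous_image continuous_intros) auto
  qed (use z in \<open>auto intro!: uniform_limit_const simp: image_constant_conv\<close>)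
  then have lim: "uniform_limit {0..1} f (\<lambda>x. 0) (finite_subsets_at_top UNIV)"
    unfolding f_def a_def
    by (simp add: z sum_distrib_left mult_exp_exp exp_add[symmetric] algebra_simps)
  obtain I J where I: "\<And>X. (f X has_integral I X) {0..1}" and J: "((\<lambda>x. 0) has_integral J) {0..1::real}"
    and IJ: "(I \<longlongrightarrow> J) (finite_subsets_at_top UNIV)"
  proof (rule uniform_limit_integral[OF lim])
    show "continuous_on {0..1} (f X)" for X unfolding f_def by (intro continuous_intros)
  qed auto
  have int: "((\<lambda>x. exp (2 * pi * \<i> * of_int j * of_real x)) has_integral (if j = 0 then 1 else 0)) {0..1::real}" for j :: int
  proof (cases "j = 0")
    case True
    then show ?thesis using has_integral_const_real[of "1::complex" 0 1] by simp
  next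
    case False
    define c where "c = 2 * pi * \<i> * of_int j"
    have c: "c \<noteq> 0" "exp c = 1"
      using False exp_2pi_int[of j] by (auto simp: c_def)
    have "((\<lambda>x. exp (c * of_real x)) has_integral (exp (c * of_real 1) / c - exp (c * of_real 0) / c)) {0..1::real}"
      by (rule fundamental_theorem_of_calculus)
        (auto intro!: derivative_eq_intros has_vector_derivative_real_field simp: c)
    then show ?thesis using c False by (simp add: c_def)
  qed
  have "I X = a 0" if "0 \<in> X" "finite X" for X
  proof -
    have "(f X has_integral (\<Sum>j\<in>X. a j * (if j = 0 then 1 else 0))) {0..1}"
      unfolding f_def by (intro has_integral_sum has_integral_mult_right int that)
    then have "I X = (\<Sum>j\<in>X. a j * (if j = 0 then 1 else 0))" using I has_integral_unique by blast
    then show ?thesis using that by (simp add: if_distrib cong: if_cong)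
  qed
  then have "eventually (\<lambda>X. I X = a 0) (finite_subsets_at_top UNIV)"
    by (auto simp: eventually_finite_subsets_at_top intro!: exI[of _ "{0}"])
  then have "(I \<longlongrightarrow> a 0) (finite_subsets_at_top UNIV)" by (rule tendsto_eventually)
  then have "J = a 0" using IJ by (meson finite_subsets_at_top_neq_bot tendsto_unique)
  moreover have "J = 0" using J has_integral_0 has_integral_unique by blast
  ultimately show False by (simp add: a_def)
qed

section \<open>The theta function\<close>

text \<open>
  The Cauchy product for absolutely convergent families, without an enumeration of the index sets.
\<close>

lemma infsum_times:
  fixes f g :: "_ \<Rightarrow> complex"
  assumes f: "(\<lambda>i. norm (f i)) summable_on A" and g: "(\<lambda>j. norm (g j)) summable_on B"
  shows "(\<lambda>(i, j). f i * g j) summable_on A \<times> B"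
    and "infsum f A * infsum g B = infsum (\<lambda>(i, j). f i * g j) (A \<times> B)"
proof -
  have "(\<lambda>x. norm (case x of (i, j) \<Rightarrow> f i * g j)) summable_on Sigma A (\<lambda>_. B)"
  proof (subst Infinite_Sum.abs_summable_on_Sigma_iff, intro conjI ballI)
    fix x assume "x \<in> A"
    show "(\<lambda>y. norm (case (x, y) of (i, j) \<Rightarrow> f i * g j)) summable_on B"
      by (simp add: norm_mult summable_on_cmult_right g)
  next
    have "(\<lambda>x. norm (f x) * infsum (\<lambda>y. norm (g y)) B) summable_on A"
      using f by (rule summable_on_cmult_left)
    then have "(\<lambda>x. infsum (\<lambda>y. norm (f x) * norm (g y)) B) summable_on A"
      by (simp add: infsum_cmult_right')
    then have "(\<lambda>x. norm (infsum (\<lambda>y. norm (f x) * norm (g y)) B)) summable_on A"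
      by (rule summable_on_iff_abs_summable_on_real[THEN iffD1])
    then show "(\<lambda>x. norm (infsum (\<lambda>y. norm (case (x, y) of (i, j) \<Rightarrow> f i * g j)) B)) summable_on A"
      by (simp add: norm_mult)
  qed
  then show s: "(\<lambda>(i, j). f i * g j) summable_on A \<times> B" by (rule abs_summable_summable)
  have "infsum (\<lambda>x. infsum (\<lambda>y. f x * g y) B) A = infsum (\<lambda>(i, j). f i * g j) (A \<times> B)"
    using infsum_Sigma'_banach[OF s] .
  then show "infsum f A * infsum g B = infsum (\<lambda>(i, j). f i * g j) (A \<times> B)"
    by (simp add: infsum_cmult_right' infsum_cmult_left')
qed

lemma theta1_thseries: "theta1 \<tau> z = - thseries \<tau> (1/2) (z + 1/2)"
  unfolding theta1_def thseries_def by (simp add: mult_ac)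

text \<open>
  The series over the integers (\<open>thE\<close>) and over the half integers (\<open>thO\<close>) with period \<open>2 * \<tau>\<close>. They arise from the
  product of two theta series by the substitution that replaces the two summation indices by their half sum and half difference.
\<close>

definition thE :: "complex \<Rightarrow> complex \<Rightarrow> complex" where "thE \<tau> x = thseries (2 * \<tau>) 0 (2 * x)"
definition thO :: "complex \<Rightarrow> complex \<Rightarrow> complex" where "thO \<tau> x = thseries (2 * \<tau>) (1/2) (2 * x)"

text \<open>
  A pair of integers is determined by its half sum and half difference, which are integers or half integers
  according to the parity of the sum.
\<close>

lemma int_pair_parity_split:
  "range (\<lambda>(p, q). (p + q, p - q - 1 :: int)) \<inter> range (\<lambda>(p, q). (p + q, p - q)) = {}"
  "range (\<lambda>(p, q). (p + q, p - q - 1 :: int)) \<union> range (\<lambda>(p, q). (p + q, p - q)) = UNIV"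
proof -
  show "range (\<lambda>(p, q). (p + q, p - q - 1 :: int)) \<inter> range (\<lambda>(p, q). (p + q, p - q)) = {}"
  proof (rule equals0I)
    fix x assume "x \<in> range (\<lambda>(p, q). (p + q, p - q - 1 :: int)) \<inter> range (\<lambda>(p, q). (p + q, p - q))"
    then obtain a b where "x = (case a of (p, q) \<Rightarrow> (p + q, p - q - 1))" "x = (case b of (p, q) \<Rightarrow> (p + q, p - q))"
      by blast
    then show False by (cases a, cases b) (simp, presburger)
  qed
  have "(a, b) \<in> range (\<lambda>(p, q). (p + q, p - q - 1 :: int)) \<union> range (\<lambda>(p, q). (p + q, p - q))" for a b
  proof (cases "even (a + b)")
    case True
    then obtain p where p: "a + b = 2 * p" by blast
    have e: "(a, b) = (\<lambda>(p, q). (p + q, p - q)) (p, a - p)" using p by simp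
    show ?thesis by (subst e) (intro UnI2 rangeI)
  next
    case False
    then obtain p where p: "a + b = 2 * p + 1" by (blast elim: oddE)
    have e: "(a, b) = (\<lambda>(p, q). (p + q, p - q - 1)) (p + 1, a - (p + 1))" using p by simp
    show ?thesis by (subst e) (intro UnI1 rangeI)
  qed
  then show "range (\<lambda>(p, q). (p + q, p - q - 1 :: int)) \<union> range (\<lambda>(p, q). (p + q, p - q)) = UNIV"
    by auto
qed

text \<open>
  The exponent is a sum of two squares, and \<open>s\<^sup>2 + t\<^sup>2 = ((s + t)\<^sup>2 + (s - t)\<^sup>2) / 2\<close>. Passing to half sum and half difference
  decouples the double series. The two parity classes of index pairs give the two products of the determinant, and the
  characters at \<open>1/2\<close> give the sign between them.
\<close>

lemma theta1_product:
  assumes \<tau>: "Im \<tau> > 0"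
  shows "theta1 \<tau> (x + y) * theta1 \<tau> (x - y) = thE \<tau> x * thO \<tau> y - thO \<tau> x * thE \<tau> y"
proof -
  define t where "t \<sigma> e j x = exp (pi * \<i> * \<sigma> * (of_int j + of_real e)\<^sup>2 + 2 * pi * \<i> * (of_int j + of_real e) * x)"
    for \<sigma> :: complex and e :: real and j :: int and x :: complex
  have th: "thseries \<sigma> e x = infsum (\<lambda>j. t \<sigma> e j x) UNIV" for \<sigma> e x
    by (simp add: thseries_def t_def)
  have ts: "(\<lambda>j. norm (t \<sigma> e j x)) summable_on UNIV" if "Im \<sigma> > 0" for \<sigma> e x
    unfolding t_def by (rule thseries_abs_summable[OF that])
  have \<tau>2: "Im (2 * \<tau>) > 0" using \<tau> by simp
  define F where "F = (\<lambda>(j, k). t \<tau> (1/2) j (x + y + 1/2) * t \<tau> (1/2) k (x - y + 1/2))"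
  have F: "F summable_on UNIV" "theta1 \<tau> (x + y) * theta1 \<tau> (x - y) = infsum F UNIV"
    unfolding F_def theta1_thseries th
    using infsum_times[OF ts[OF \<tau>, of "1/2" "x + y + 1/2"] ts[OF \<tau>, of "1/2" "x - y + 1/2"]] by simp_all
  let ?p = "\<lambda>(p, q). (p + q, p - q - 1 :: int)" and ?q = "\<lambda>(p, q). (p + q, p - q :: int)"
  have inj: "inj ?p" "inj ?q" by (auto simp: inj_def)
  have e1: "exp (2 * pi * \<i> * of_int p) = 1" for p :: int by (rule exp_2pi_int)
  have Fp: "F (?p (p, q)) = t (2 * \<tau>) 0 p (2 * x) * t (2 * \<tau>) (1/2) q (2 * y)" for p q
  proof -
    have "F (?p (p, q)) = t (2 * \<tau>) 0 p (2 * x) * t (2 * \<tau>) (1/2) q (2 * y) * exp (2 * pi * \<i> * of_int p)"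
      unfolding F_def t_def prod.case exp_add[symmetric]
      by (rule arg_cong[where f = exp]) (simp add: field_simps power2_eq_square)
    then show ?thesis by (simp only: e1 mult_1_right)
  qed
  have Fq: "F (?q (p, q)) = - (t (2 * \<tau>) (1/2) p (2 * x) * t (2 * \<tau>) 0 q (2 * y))" for p q
  proof -
    have "F (?q (p, q)) = t (2 * \<tau>) (1/2) p (2 * x) * t (2 * \<tau>) 0 q (2 * y) * exp (2 * pi * \<i> * of_int p + pi * \<i>)"
      unfolding F_def t_def prod.case exp_add[symmetric]
      by (rule arg_cong[where f = exp]) (simp add: field_simps power2_eq_square)
    also have "exp (2 * pi * \<i> * of_int p + pi * \<i>) = -1"
      by (simp only: exp_add e1) (simp add: exp_eq_polar)
    finally show ?thesis by simp
  qed
  have "infsum F UNIV = infsum F (range ?p \<union> range ?q)"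
    by (simp only: int_pair_parity_split)
  also have "\<dots> = infsum F (range ?p) + infsum F (range ?q)"
    by (rule infsum_Un_disjoint[OF summable_on_subset_banach[OF F(1)] summable_on_subset_banach[OF F(1)] int_pair_parity_split(1)])
      simp_all
  also have "infsum F (range ?p) = infsum (\<lambda>(p, q). t (2 * \<tau>) 0 p (2 * x) * t (2 * \<tau>) (1/2) q (2 * y)) (UNIV \<times> UNIV)"
    by (subst infsum_reindex[OF inj(1)]) (simp only: UNIV_Times_UNIV, rule infsum_cong, use Fp in auto)
  also have "\<dots> = thE \<tau> x * thO \<tau> y"
    unfolding thE_def thO_def th
    by (rule infsum_times(2)[symmetric]) (rule ts[OF \<tau>2])+
  also have "infsum F (range ?q) = infsum (\<lambda>(p, q). - (t (2 * \<tau>) (1/2) p (2 * x) * t (2 * \<tau>) 0 q (2 * y))) (UNIV \<times> UNIV)"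
    by (subst infsum_reindex[OF inj(2)]) (simp only: UNIV_Times_UNIV, rule infsum_cong, use Fq in auto)
  also have "\<dots> = - (thO \<tau> x * thE \<tau> y)"
    unfolding thE_def thO_def th
    by (subst infsum_times(2)[OF ts[OF \<tau>2] ts[OF \<tau>2]]) (simp add: infsum_uminus[symmetric] case_prod_unfold)
  finally show ?thesis using F(2) by simp
qed

text \<open>
  By \<open>theta1_product\<close> each product of two values is a minor of the two by four matrix with columns
  \<open>(thE, thO)\<close> at \<open>p\<close>, \<open>q\<close>, \<open>r\<close>, \<open>s\<close>, so this is the Pluecker relation between the minors.
\<close>

lemma theta1_weierstrass:
  assumes \<tau>: "Im \<tau> > 0"
  shows "theta1 \<tau> (p + q) * theta1 \<tau> (p - q) * (theta1 \<tau> (r + s) * theta1 \<tau> (r - s))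
    - theta1 \<tau> (p + r) * theta1 \<tau> (p - r) * (theta1 \<tau> (q + s) * theta1 \<tau> (q - s))
    + theta1 \<tau> (p + s) * theta1 \<tau> (p - s) * (theta1 \<tau> (q + r) * theta1 \<tau> (q - r)) = 0"
  unfolding theta1_product[OF \<tau>] by algebra

lemma theta1_holomorphic:
  assumes "Im \<tau> > 0" shows "theta1 \<tau> holomorphic_on UNIV"
proof -
  have "(\<lambda>z. - thseries \<tau> (1/2) (z + 1/2)) holomorphic_on UNIV"
    by (intro holomorphic_intros holomorphic_on_compose_gen[OF _ thseries_holomorphic[OF assms], unfolded o_def]) auto
  then show ?thesis by (simp add: theta1_thseries[abs_def])
qed

lemma thE_holomorphic:
  assumes "Im \<tau> > 0" shows "thE \<tau> holomorphic_on UNIV"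
  unfolding thE_def[abs_def]
  by (intro holomorphic_intros holomorphic_on_compose_gen[OF _ thseries_holomorphic, unfolded o_def]) (use assms in auto)

lemma thO_holomorphic:
  assumes "Im \<tau> > 0" shows "thO \<tau> holomorphic_on UNIV"
  unfolding thO_def[abs_def]
  by (intro holomorphic_intros holomorphic_on_compose_gen[OF _ thseries_holomorphic, unfolded o_def]) (use assms in auto)

lemma theta1_nonzero:
  assumes "Im \<tau> > 0" obtains x where "theta1 \<tau> x \<noteq> 0"
proof -
  obtain x where "thseries \<tau> (1/2) x \<noteq> 0" using thseries_nonzero[OF assms] by blast
  then have "theta1 \<tau> (x - 1/2) \<noteq> 0" by (simp add: theta1_thseries)
  then show ?thesis by (rule that)
qed

text \<open>
  The determinant in \<open>theta1_product\<close> changes sign when \<open>x\<close> and \<open>y\<close> are exchanged; one nonzero value of \<open>theta1\<close> is cancelled.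
\<close>

lemma theta1_odd:
  assumes "Im \<tau> > 0" shows "theta1 \<tau> (- z) = - theta1 \<tau> z"
proof -
  obtain s where s: "theta1 \<tau> s \<noteq> 0" using theta1_nonzero[OF assms] .
  have "theta1 \<tau> (x + y) * theta1 \<tau> (x - y) = - (theta1 \<tau> (y + x) * theta1 \<tau> (y - x))" for x y
    unfolding theta1_product[OF assms] by simp
  from this[of "(s - z) / 2" "(s + z) / 2"] 
  have "theta1 \<tau> s * theta1 \<tau> (- z) = theta1 \<tau> s * (- theta1 \<tau> z)" by (simp add: field_simps)
  then show ?thesis using s by (simp only: mult_cancel_left) simp
qed

lemma theta1_0: "Im \<tau> > 0 \<Longrightarrow> theta1 \<tau> 0 = 0"
  using theta1_odd[of \<tau> 0] by simp

lemma theta1_plus_1: "theta1 \<tau> (z + 1) = - theta1 \<tau> z"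
proof -
  have "theta1 \<tau> (z + 1) = - thseries \<tau> (1/2) ((z + 1/2) + 1)"
    unfolding theta1_thseries by (simp add: algebra_simps)
  also have "\<dots> = - theta1 \<tau> z"
    unfolding thseries_shift_1 theta1_thseries by (simp add: exp_eq_polar)
  finally show ?thesis .
qed

lemma theta1_plus_tau: "theta1 \<tau> (z + \<tau>) = - exp (- pi * \<i> * \<tau> - 2 * pi * \<i> * z) * theta1 \<tau> z"
proof -
  have "theta1 \<tau> (z + \<tau>) = - thseries \<tau> (1/2) ((z + 1/2 + \<tau>/2) + \<tau>/2)"
    unfolding theta1_thseries by (simp add: algebra_simps)
  also have "\<dots> = - (exp (- pi * \<i> * \<tau> / 4 - pi * \<i> * (z + 1/2 + \<tau>/2)) *
     (exp (- pi * \<i> * \<tau> / 4 - pi * \<i> * (z + 1/2)) * thseries \<tau> (1/2) (z + 1/2)))"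
    using thseries_half_period[of \<tau> "1/2" "z + 1/2 + \<tau>/2"] thseries_half_period[of \<tau> 1 "z + 1/2"]
      thseries_index_1[of \<tau> "1/2"] by simp
  also have "\<dots> = exp (- pi * \<i> * \<tau> / 4 - pi * \<i> * (z + 1/2 + \<tau>/2) + (- pi * \<i> * \<tau> / 4 - pi * \<i> * (z + 1/2))) * theta1 \<tau> z"
    unfolding theta1_thseries exp_add by simp
  also have "- pi * \<i> * \<tau> / 4 - pi * \<i> * (z + 1/2 + \<tau>/2) + (- pi * \<i> * \<tau> / 4 - pi * \<i> * (z + 1/2))
     = (- pi * \<i> * \<tau> - 2 * pi * \<i> * z) - pi * \<i>"
    by (simp add: field_simps)
  also have "exp \<dots> = - exp (- pi * \<i> * \<tau> - 2 * pi * \<i> * z)"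
    unfolding exp_diff[of _ "pi * \<i>"] by simp
  finally show ?thesis .
qed

lemma theta1_lattice:
  assumes "Im \<tau> > 0" "z \<in> period_lattice \<tau>" shows "theta1 \<tau> z = 0"
proof -
  have 1: "theta1 \<tau> (z + of_int m) = 0 \<longleftrightarrow> theta1 \<tau> z = 0" for z m
  proof (induction m rule: int_induct[where k = 0])
    case (step1 i) then show ?case using theta1_plus_1[of \<tau> "z + of_int i"] by (simp add: algebra_simps)
  next
    case (step2 i) then show ?case using theta1_plus_1[of \<tau> "z + of_int (i - 1)"] by (simp add: algebra_simps)
  qed simp
  have 2: "theta1 \<tau> (z + \<tau> * of_int m) = 0 \<longleftrightarrow> theta1 \<tau> z = 0" for z m
  proof (induction m rule: int_induct[where k = 0])
    case (step1 i) then show ?case using theta1_plus_tau[of \<tau> "z + \<tau> * of_int i"] by (simp add: algebra_simps)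
  next
    case (step2 i) then show ?case using theta1_plus_tau[of \<tau> "z + \<tau> * of_int (i - 1)"] by (simp add: algebra_simps)
  qed simp
  obtain m n where "z = of_int m + \<tau> * of_int n" using assms(2) by (auto simp: period_lattice_def)
  then show ?thesis using 1[of 0 m] 2[of "of_int m" n] theta1_0[OF assms(1)] by simp
qed

text \<open>
  A common zero \<open>x\<close> of both components would make \<open>theta1 (x + y) * theta1 (x - y)\<close> vanish for all \<open>y\<close>, although \<open>theta1\<close> is
  holomorphic and not identically zero.
\<close>

lemma theta_vector_nonzero:
  assumes \<tau>: "Im \<tau> > 0" shows "thE \<tau> x \<noteq> 0 \<or> thO \<tau> x \<noteq> 0"
proof (rule ccontr)
  assume "\<not> ?thesis"
  then have z: "theta1 \<tau> (x + y) * theta1 \<tau> (x - y) = 0" for y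
    unfolding theta1_product[OF \<tau>] by simp
  obtain s where s: "theta1 \<tau> s \<noteq> 0" using theta1_nonzero[OF \<tau>] .
  have "theta1 \<tau> (2 * x - u) = 0" if "theta1 \<tau> u \<noteq> 0" for u
    using z[of "u - x"] that by (simp add: algebra_simps)
  then have a: "theta1 \<tau> u * theta1 \<tau> (2 * x - u) = 0" for u by (cases "theta1 \<tau> u = 0") auto
  have h: "theta1 \<tau> holomorphic_on UNIV" by (rule theta1_holomorphic[OF \<tau>])
  have "eventually (\<lambda>u. theta1 \<tau> u \<noteq> 0) (at s)"
    using h s by (metis UNIV_I continuous_at_imp_continuous_at_within continuous_on_eq_continuous_at holomorphic_on_imp_continuous_on open_UNIV tendsto_imp_eventually_ne continuous_within)
  then have "eventually (\<lambda>u. theta1 \<tau> (2 * x - u) = 0) (at s)"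
    by eventually_elim (use a in auto)
  then obtain d where d: "d > 0" "\<And>u. u \<noteq> s \<Longrightarrow> dist u s < d \<Longrightarrow> theta1 \<tau> (2 * x - u) = 0"
    by (auto simp: eventually_at)
  have "theta1 \<tau> w = 0" for w
  proof (rule analytic_continuation[OF h, of "ball (2 * x - s) d" "2 * x - s"])
    show "2 * x - s islimpt ball (2 * x - s) d" using d by (simp add: islimpt_ball)
    fix u assume "u \<in> ball (2 * x - s) d"
    then have "dist (2 * x - u) s < d" by (simp add: dist_norm algebra_simps norm_minus_commute)
    then show "theta1 \<tau> u = 0"
      using d(2)[of "2 * x - u"] a[of s] s by (cases "2 * x - u = s") (auto simp: algebra_simps)
  qed auto
  then show False using s by simp
qed

lemma theta_vector_shifts:
  "thE \<tau> (- x) = thE \<tau> x" "thO \<tau> (- x) = thO \<tau> x"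
  "thE \<tau> (x + 1/2) = thE \<tau> x" "thO \<tau> (x + 1/2) = - thO \<tau> x"
  "thE \<tau> (x + \<tau>/2) = exp (- pi * \<i> * \<tau> / 2 - 2 * pi * \<i> * x) * thO \<tau> x"
  "thO \<tau> (x + \<tau>/2) = exp (- pi * \<i> * \<tau> / 2 - 2 * pi * \<i> * x) * thE \<tau> x"
proof -
  show "thE \<tau> (- x) = thE \<tau> x" "thO \<tau> (- x) = thO \<tau> x"
    using thseries_index_1[of "2 * \<tau>" "- 1/2"]
    by (simp_all add: thE_def thO_def thseries_neg)
  have a: "2 * (x + 1/2) = 2 * x + 1" by simp
  show "thE \<tau> (x + 1/2) = thE \<tau> x" "thO \<tau> (x + 1/2) = - thO \<tau> x"
    unfolding thE_def thO_def a thseries_shift_1 by simp_all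
  have b: "2 * (x + \<tau>/2) = 2 * x + (2 * \<tau>) / 2" by simp
  show "thE \<tau> (x + \<tau>/2) = exp (- pi * \<i> * \<tau> / 2 - 2 * pi * \<i> * x) * thO \<tau> x"
    "thO \<tau> (x + \<tau>/2) = exp (- pi * \<i> * \<tau> / 2 - 2 * pi * \<i> * x) * thE \<tau> x"
    unfolding thE_def thO_def b thseries_half_period
    using thseries_index_1[of "2 * \<tau>" 0] by (simp_all add: algebra_simps)
qed

text \<open>
  Differentiating the midpoint equation in \<open>s\<close> at \<open>s = 0\<close> gives a linear differential equation for \<open>k\<close>.
\<close>

lemma midpoint_multiplicative_imp_exp:
  fixes k :: "complex \<Rightarrow> complex"
  assumes h: "k holomorphic_on UNIV" and nz: "\<And>x. k x \<noteq> 0"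
    and m: "\<And>s t. k s * k t = (k ((s + t) / 2))\<^sup>2"
  shows "\<exists>A B. \<forall>x. k x = B * exp (A * x)"
proof -
  have d: "(k has_field_derivative deriv k x) (at x)" for x
    using h by (simp add: holomorphic_derivI)
  have e: "deriv k s * k t = k ((s + t) / 2) * deriv k ((s + t) / 2)" for s t
  proof -
    have "((\<lambda>s. k s * k t) has_field_derivative deriv k s * k t) (at s)"
      by (rule derivative_eq_intros d refl)+ simp
    moreover have "((\<lambda>s. (k ((s + t) / 2))\<^sup>2) has_field_derivative k ((s + t) / 2) * deriv k ((s + t) / 2)) (at s)"
    proof -
      have "((\<lambda>s. k ((s + t) / 2)) has_field_derivative deriv k ((s + t) / 2) * (1/2)) (at s)"
        by (rule DERIV_chain2[OF d]) (auto intro!: derivative_eq_intros)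
      from DERIV_power[OF this, of 2] show ?thesis by (simp add: mult_ac)
    qed
    ultimately show ?thesis unfolding m by (rule DERIV_unique)
  qed
  define A where "A = deriv k 0 / k 0"
  have A: "deriv k u = A * k u" for u
  proof -
    have "deriv k 0 * k (2 * u) = k u * deriv k u" using e[of 0 "2 * u"] by simp
    moreover have "k 0 * k (2 * u) = (k u)\<^sup>2" using m[of 0 "2 * u"] by simp
    ultimately have "k u * (k 0 * deriv k u) = k u * (deriv k 0 * k u)"
      by algebra
    then show ?thesis using nz by (simp add: A_def field_simps)
  qed
  have "((\<lambda>x. k x * exp (- A * x)) has_field_derivative 0) (at x)" for x
    by (rule derivative_eq_intros d refl)+ (simp add: A)
  then have "\<exists>c. \<forall>x. k x * exp (- A * x) = c"
    using has_field_derivative_zero_constant[of UNIV "\<lambda>x. k x * exp (- A * x)"] by (simp add: has_field_derivative_at_within)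
  then obtain c where "\<And>x. k x * exp (- A * x) = c" by blast
  then have "k x = c * exp (A * x)" for x by (simp add: exp_minus field_simps) 
  then show ?thesis by blast
qed

text \<open>
  If \<open>c\<close> is a zero, the vectors \<open>(thE, thO)\<close> at \<open>x\<close> and at \<open>x - c\<close> are parallel for every \<open>x\<close>. Their ratio \<open>k\<close> is
  entire and satisfies \<open>k s * k t = (k ((s + t) / 2))\<^sup>2\<close>, hence it is exponential. Comparing its value at \<open>0\<close> with those at \<open>1/2\<close> and
  \<open>\<tau>/2\<close>, where the vector changes in a known way, puts \<open>c\<close> into the lattice. This replaces
  counting zeros in a period parallelogram.
\<close>

lemma theta1_zero_in_lattice:
  assumes \<tau>: "Im \<tau> > 0" and c: "theta1 \<tau> c = 0"
  shows "c \<in> period_lattice \<tau>"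
proof -
  note sh = theta_vector_shifts
  have par: "thE \<tau> x * thO \<tau> (x - c) = thO \<tau> x * thE \<tau> (x - c)" for x
    using theta1_product[OF \<tau>, of x "c - x"] sh(1,2)[of \<tau> "x - c"] c by simp
  define k where "k x = (if thE \<tau> x \<noteq> 0 then thE \<tau> (x - c) / thE \<tau> x else thO \<tau> (x - c) / thO \<tau> x)" for x
  have nz: "thE \<tau> x \<noteq> 0 \<or> thO \<tau> x \<noteq> 0" for x by (rule theta_vector_nonzero[OF \<tau>])
  have kE: "thE \<tau> (x - c) = k x * thE \<tau> x" and kO: "thO \<tau> (x - c) = k x * thO \<tau> x" for x
    using nz[of x] par[of x] by (auto simp: k_def field_simps)
  have k0: "k x \<noteq> 0" for x using nz[of "x - c"] kE[of x] kO[of x] by auto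
  have kuniq: "k x = u" if "thE \<tau> (x - c) = u * thE \<tau> x" "thO \<tau> (x - c) = u * thO \<tau> x" for x u
    using nz[of x] that by (auto simp: k_def)
  have contE: "continuous_on UNIV (thE \<tau>)" and contO: "continuous_on UNIV (thO \<tau>)"
    by (simp_all add: holomorphic_on_imp_continuous_on thE_holomorphic thO_holomorphic \<tau>)
  have kh: "k holomorphic_on UNIV"
  proof -
    have "k holomorphic_on {x. thE \<tau> x \<noteq> 0} \<union> {x. thO \<tau> x \<noteq> 0}"
    proof (rule holomorphic_on_Un)
      have "(\<lambda>x. thE \<tau> (x - c) / thE \<tau> x) holomorphic_on {x. thE \<tau> x \<noteq> 0}"
        by (intro holomorphic_intros holomorphic_on_compose_gen[OF _ thE_holomorphic[OF \<tau>], unfolded o_def]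
            holomorphic_on_subset[OF thE_holomorphic[OF \<tau>]]) auto
      then show "k holomorphic_on {x. thE \<tau> x \<noteq> 0}"
        by (rule holomorphic_transform) (simp add: kE)
      have "(\<lambda>x. thO \<tau> (x - c) / thO \<tau> x) holomorphic_on {x. thO \<tau> x \<noteq> 0}"
        by (intro holomorphic_intros holomorphic_on_compose_gen[OF _ thO_holomorphic[OF \<tau>], unfolded o_def]
            holomorphic_on_subset[OF thO_holomorphic[OF \<tau>]]) auto
      then show "k holomorphic_on {x. thO \<tau> x \<noteq> 0}"
        by (rule holomorphic_transform) (simp add: kO)
      show "open {x. thE \<tau> x \<noteq> 0}" "open {x. thO \<tau> x \<noteq> 0}"
        using open_Collect_neq contE contO continuous_on_const by blast+
    qed
    moreover have "{x. thE \<tau> x \<noteq> 0} \<union> {x. thO \<tau> x \<noteq> 0} = UNIV" using nz by auto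
    ultimately show ?thesis by simp
  qed
  have key: "theta1 \<tau> (s - c) * theta1 \<tau> (t - c) = k ((s + t) / 2) * (theta1 \<tau> s * theta1 \<tau> t)" for s t
  proof -
    have "theta1 \<tau> (((s + t) / 2 - c) + (s - t) / 2) * theta1 \<tau> (((s + t) / 2 - c) - (s - t) / 2)
        = k ((s + t) / 2) * (theta1 \<tau> ((s + t) / 2 + (s - t) / 2) * theta1 \<tau> ((s + t) / 2 - (s - t) / 2))"
      unfolding theta1_product[OF \<tau>] kE kO by (simp add: algebra_simps)
    moreover have "((s + t) / 2 - c) + (s - t) / 2 = s - c" "((s + t) / 2 - c) - (s - t) / 2 = t - c"
      "(s + t) / 2 + (s - t) / 2 = s" "(s + t) / 2 - (s - t) / 2 = t" by (simp_all add: field_simps)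
    ultimately show ?thesis by simp
  qed
  have mult: "k s * k t = (k ((s + t) / 2))\<^sup>2" if "theta1 \<tau> s \<noteq> 0" "theta1 \<tau> t \<noteq> 0" for s t
  proof -
    have "(k s * k t) * (theta1 \<tau> s * theta1 \<tau> t)\<^sup>2 = (theta1 \<tau> (s - c) * theta1 \<tau> (t - c))\<^sup>2"
      using key[of s s] key[of t t] by (simp add: power2_eq_square mult_ac)
    also have "\<dots> = (k ((s + t) / 2))\<^sup>2 * (theta1 \<tau> s * theta1 \<tau> t)\<^sup>2"
      unfolding key by (simp add: power_mult_distrib)
    finally show ?thesis using that by simp
  qed
  \<comment> \<open>Both sides are entire in either variable, so the zeros of \<open>theta1\<close> are no exception.\<close>
  obtain x0 where x0: "theta1 \<tau> x0 \<noteq> 0" using theta1_nonzero[OF \<tau>] .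
  define W where "W = {x. theta1 \<tau> x \<noteq> 0}"
  have W: "open W" "x0 islimpt W"
  proof -
    show o: "open W" unfolding W_def
      by (rule open_Collect_neq) (auto intro: holomorphic_on_imp_continuous_on theta1_holomorphic[OF \<tau>])
    show "x0 islimpt W" using o x0 by (simp add: W_def interior_limit_point interior_open)
  qed
  have ext: "f x = g x" if "f holomorphic_on UNIV" "g holomorphic_on UNIV" "\<And>x. x \<in> W \<Longrightarrow> f x = g x"
    for f g :: "complex \<Rightarrow> complex" and x
    using analytic_continuation[of "\<lambda>x. f x - g x" UNIV W x0 x] that W by (simp add: holomorphic_on_diff connected_UNIV)
  have kh': "(\<lambda>x. k ((x + t) / 2)) holomorphic_on UNIV" "(\<lambda>x. k ((t + x) / 2)) holomorphic_on UNIV" for t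
    by (intro holomorphic_intros holomorphic_on_compose_gen[OF _ kh, unfolded o_def]; auto)+
  have mult1: "k s * k t = (k ((s + t) / 2))\<^sup>2" if "theta1 \<tau> t \<noteq> 0" for s t
    by (rule ext[of "\<lambda>s. k s * k t" "\<lambda>s. (k ((s + t) / 2))\<^sup>2"])
      (auto intro!: holomorphic_intros kh kh' mult that simp: W_def)
  have mult2: "k s * k t = (k ((s + t) / 2))\<^sup>2" for s t
    by (rule ext[of "\<lambda>t. k s * k t" "\<lambda>t. (k ((s + t) / 2))\<^sup>2"])
      (auto intro!: holomorphic_intros kh kh' mult1 simp: W_def)
  obtain A B where AB: "\<And>x. k x = B * exp (A * x)"
    using midpoint_multiplicative_imp_exp[OF kh k0 mult2] by blast
  have B: "B \<noteq> 0" using k0[of 0] AB[of 0] by auto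
  \<comment> \<open>The shift by \<open>1/2\<close> acts on \<open>(thE, thO)\<close> by constants, so \<open>k\<close> is unchanged and its exponent is quantized.\<close>
  have "k (1/2) = k 0"
  proof (rule kuniq)
    have e: "1/2 - c = (0 - c) + 1/2" by simp
    show "thE \<tau> (1/2 - c) = k 0 * thE \<tau> (1/2)" "thO \<tau> (1/2 - c) = k 0 * thO \<tau> (1/2)"
      unfolding e sh(3,4) kE kO using sh(3,4)[of \<tau> 0] by simp_all
  qed
  then have "exp (A / 2) = 1" using AB[of "1/2"] AB[of 0] B by simp
  then obtain n :: int where n: "A = 4 * pi * \<i> * of_int n"
    unfolding exp_eq_1 by (auto simp: complex_eq_iff)
  \<comment> \<open>The shift by \<open>\<tau>/2\<close> exchanges the components and its factor depends on the argument; this is where \<open>c\<close> enters.\<close>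
  have "k (\<tau>/2) = exp (2 * pi * \<i> * c) * k 0"
  proof (rule kuniq)
    have e: "\<tau>/2 - c = (0 - c) + \<tau>/2" by simp
    have ee: "exp (- pi * \<i> * \<tau> / 2 - 2 * pi * \<i> * (0 - c)) = exp (2 * pi * \<i> * c) * exp (- pi * \<i> * \<tau> / 2)"
      unfolding exp_add[symmetric] by simp
    show "thE \<tau> (\<tau>/2 - c) = exp (2 * pi * \<i> * c) * k 0 * thE \<tau> (\<tau>/2)"
      "thO \<tau> (\<tau>/2 - c) = exp (2 * pi * \<i> * c) * k 0 * thO \<tau> (\<tau>/2)"
      unfolding e sh(5,6)[of \<tau> "0 - c"] kE kO ee using sh(5,6)[of \<tau> 0] by simp_all
  qed
  then have "exp (A * \<tau> / 2) = exp (2 * pi * \<i> * c)" using AB[of "\<tau>/2"] AB[of 0] B by simp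
  from this[unfolded exp_eq] obtain m :: int
    where "A * \<tau> / 2 = 2 * pi * \<i> * c + (of_int (2 * m) * pi) * \<i>" by auto
  then have "(2 * pi * \<i>) * c = (2 * pi * \<i>) * (of_int (- m) + \<tau> * of_int n)"
    unfolding n by (simp add: algebra_simps)
  then have "c = of_int (- m) + \<tau> * of_int n" by (subst (asm) mult_cancel_left) simp
  then show ?thesis unfolding period_lattice_def by blast
qed

lemma theta1_eq_0_iff: "Im \<tau> > 0 \<Longrightarrow> theta1 \<tau> z = 0 \<longleftrightarrow> z \<in> period_lattice \<tau>"
  using theta1_lattice theta1_zero_in_lattice by blast

text \<open>
  Differentiating the product formula along the diagonal shows that a multiple zero at the origin would annihilate the
  Wronskian of \<open>thE\<close> and \<open>thO\<close>, so that these were proportional and \<open>theta1\<close> would vanish.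
\<close>

lemma theta1_deriv_0:
  assumes \<tau>: "Im \<tau> > 0" shows "deriv (theta1 \<tau>) 0 \<noteq> 0"
proof
  assume d0: "deriv (theta1 \<tau>) 0 = 0"
  have d: "(theta1 \<tau> has_field_derivative deriv (theta1 \<tau>) x) (at x)" for x
    using theta1_holomorphic[OF \<tau>] by (simp add: holomorphic_derivI)
  obtain s where s: "theta1 \<tau> s \<noteq> 0" using theta1_nonzero[OF \<tau>] .
  have dE: "(thE \<tau> has_field_derivative deriv (thE \<tau>) x) (at x)"
    and dO: "(thO \<tau> has_field_derivative deriv (thO \<tau>) x) (at x)" for x
    using thE_holomorphic[OF \<tau>] thO_holomorphic[OF \<tau>] by (simp_all add: holomorphic_derivI)
  have w: "thE \<tau> y * deriv (thO \<tau>) y - thO \<tau> y * deriv (thE \<tau>) y = 0" for y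
  proof -
    have "((\<lambda>x. theta1 \<tau> (x + y) * theta1 \<tau> (x - y)) has_field_derivative
        deriv (theta1 \<tau>) (y + y) * theta1 \<tau> (y - y) + deriv (theta1 \<tau>) (y - y) * theta1 \<tau> (y + y)) (at y)"
      by (rule derivative_eq_intros DERIV_chain2[OF d] refl)+ simp
    then have "((\<lambda>x. theta1 \<tau> (x + y) * theta1 \<tau> (x - y)) has_field_derivative 0) (at y)"
      by (simp add: d0 theta1_0[OF \<tau>])
    moreover have "((\<lambda>x. theta1 \<tau> (x + y) * theta1 \<tau> (x - y)) has_field_derivative
       deriv (thE \<tau>) y * thO \<tau> y - deriv (thO \<tau>) y * thE \<tau> y) (at y)"
      unfolding theta1_product[OF \<tau>]
      by (rule derivative_eq_intros dE dO refl)+ simp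
    ultimately have "deriv (thE \<tau>) y * thO \<tau> y - deriv (thO \<tau>) y * thE \<tau> y = 0"
      using DERIV_unique by blast
    then show ?thesis by (simp add: algebra_simps)
  qed
  \<comment> \<open>The Wronskian vanishes identically, so the two components are proportional.\<close>
  obtain y0 where y0: "thE \<tau> y0 \<noteq> 0"
  proof (rule ccontr)
    assume "\<not> thesis"
    then have "thE \<tau> y = 0" for y using that by blast
    then show False
      using theta_vector_nonzero[OF \<tau>, of 0] theta_vector_shifts(5)[of \<tau> 0] by simp
  qed
  have oE: "open {x. thE \<tau> x \<noteq> 0}"
    by (rule open_Collect_neq) (auto intro: holomorphic_on_imp_continuous_on thE_holomorphic[OF \<tau>])
  then obtain r where r: "r > 0" "ball y0 r \<subseteq> {x. thE \<tau> x \<noteq> 0}"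
    using oE[unfolded open_contains_ball, rule_format, of y0] y0 by auto
  have "((\<lambda>x. thO \<tau> x / thE \<tau> x) has_field_derivative 0) (at x within ball y0 r)" if "x \<in> ball y0 r" for x
  proof (rule has_field_derivative_at_within)
    have "thE \<tau> x \<noteq> 0" using that r by auto
    then show "((\<lambda>x. thO \<tau> x / thE \<tau> x) has_field_derivative 0) (at x)"
      using w[of x] by - (rule derivative_eq_intros dE dO refl | simp add: algebra_simps)+
  qed
  then obtain q where q: "\<And>x. x \<in> ball y0 r \<Longrightarrow> thO \<tau> x / thE \<tau> x = q"
    using has_field_derivative_zero_constant[of "ball y0 r" "\<lambda>x. thO \<tau> x / thE \<tau> x"] by auto
  have p: "thO \<tau> x = q * thE \<tau> x" for x
  proof -
    have "thO \<tau> x - q * thE \<tau> x = 0"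
    proof (rule analytic_continuation[of "\<lambda>x. thO \<tau> x - q * thE \<tau> x" UNIV "ball y0 r" y0])
      show "y0 islimpt ball y0 r" using r by (simp add: islimpt_ball)
      show "thO \<tau> z - q * thE \<tau> z = 0" if "z \<in> ball y0 r" for z
        using q[OF that] that r by (auto simp: field_simps)
    qed (auto intro!: holomorphic_intros thE_holomorphic thO_holomorphic \<tau>)
    then show ?thesis by simp
  qed
  have "theta1 \<tau> s * theta1 \<tau> s = 0"
    using theta1_product[OF \<tau>, of s 0] unfolding p by simp
  then show False using s by simp
qed

section \<open>The functions chi\<close>

lemma period_lattice_minus: "- z \<in> period_lattice \<tau> \<longleftrightarrow> z \<in> period_lattice \<tau>"
proof -
  have "- z \<in> period_lattice \<tau>" if "z \<in> period_lattice \<tau>" for z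
  proof -
    from that obtain m n where "z = of_int m + \<tau> * of_int n" by (auto simp: period_lattice_def)
    then have "- z = of_int (- m) + \<tau> * of_int (- n)" by simp
    then show ?thesis unfolding period_lattice_def by blast
  qed
  from this[of z] this[of "- z"] show ?thesis by auto
qed

lemma period_lattice_plus_tau: "z + \<tau> \<in> period_lattice \<tau> \<longleftrightarrow> z \<in> period_lattice \<tau>"
proof -
  have *: "z + \<tau> * of_int k \<in> period_lattice \<tau>" if "z \<in> period_lattice \<tau>" for z k
  proof -
    from that obtain m n where "z = of_int m + \<tau> * of_int n" by (auto simp: period_lattice_def)
    then have "z + \<tau> * of_int k = of_int m + \<tau> * of_int (n + k)" by (simp add: algebra_simps)
    then show ?thesis unfolding period_lattice_def by blast
  qed
  from *[of z 1] *[of "z + \<tau>" "-1"] show ?thesis by auto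
qed

text \<open>
  This separates the singular sets from the origin: for \<open>a > 0\<close> the function \<open>chi_a\<close> is regular at \<open>w = 0\<close> without any subtraction.
\<close>

lemma period_lattice_fraction:
  assumes "Im \<tau> > 0" "0 < a" "a < N"
  shows "of_nat a / of_nat N * \<tau> \<notin> period_lattice \<tau>"
proof
  assume "of_nat a / of_nat N * \<tau> \<in> period_lattice \<tau>"
  then obtain m n where e: "of_nat a / of_nat N * \<tau> = of_int m + \<tau> * of_int n"
    by (auto simp: period_lattice_def)
  define q where "q = real a / real N"
  have r: "(of_nat a / of_nat N :: complex) = of_real q" by (simp add: q_def)
  have "Im (of_nat a / of_nat N * \<tau>) = real a / real N * Im \<tau>"
    unfolding r q_def[symmetric] by simp
  moreover have "Im (of_int m + \<tau> * of_int n) = of_int n * Im \<tau>" by simp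
  ultimately have "real a / real N * Im \<tau> = of_int n * Im \<tau>" by (simp only: e)
  then have "real a / real N = of_int n" using assms(1) by (subst (asm) mult_cancel_right) simp
  then have "real a = real_of_int (n * int N)" using assms by (simp add: field_simps)
  then have "int a = n * int N" by linarith
  moreover have "0 < int a" "int a < int N" using assms by auto
  ultimately show False by (smt (verit) mult_le_cancel_right1 zero_less_mult_pos2)
qed

lemma sing_a_iff:
  "w \<in> sing_a N \<tau> a \<longleftrightarrow> w \<noteq> 0 \<and> w / (2 * pi * \<i>) + of_nat a / of_nat N * \<tau> \<in> period_lattice \<tau>"
proof
  assume "w \<in> sing_a N \<tau> a"
  then show "w \<noteq> 0 \<and> w / (2 * pi * \<i>) + of_nat a / of_nat N * \<tau> \<in> period_lattice \<tau>"
    by (auto simp: sing_a_def lattice_a_def)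
next
  assume w: "w \<noteq> 0 \<and> w / (2 * pi * \<i>) + of_nat a / of_nat N * \<tau> \<in> period_lattice \<tau>"
  have "w / (2 * pi * \<i>) \<in> lattice_a N \<tau> a"
    unfolding lattice_a_def using w
    by (auto intro!: image_eqI[of _ _ "w / (2 * pi * \<i>) + of_nat a / of_nat N * \<tau>"])
  then show "w \<in> sing_a N \<tau> a" unfolding sing_a_def
    by (rule image_eqI[rotated]) simp
qed

text \<open>
  The set \<open>sing_a\<close> leaves out the origin; for \<open>a = 0\<close> the origin is a zero of the denominator as well and has to be excluded separately.
\<close>

lemma theta1_nonzero_off_sing:
  assumes "Im \<tau> > 0" "a < N" "w \<notin> sing_a N \<tau> a" "a \<noteq> 0 \<or> w \<noteq> 0"
  shows "theta1 \<tau> (w / (2 * pi * \<i>) + of_nat a / of_nat N * \<tau>) \<noteq> 0"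
  using assms period_lattice_fraction[of \<tau> a N] by (auto simp: theta1_eq_0_iff sing_a_iff)

lemma theta1_shifted_holomorphic:
  assumes "Im \<tau> > 0" shows "(\<lambda>w. theta1 \<tau> (w / (2 * pi * \<i>) + s)) holomorphic_on S"
  by (rule holomorphic_on_compose_gen[OF _ theta1_holomorphic[OF assms], unfolded o_def])
    (auto intro!: holomorphic_intros)

lemma theta1_isolated_zero:
  assumes \<tau>: "Im \<tau> > 0"
  obtains r where "r > 0" "\<And>z. z \<in> ball 0 r \<Longrightarrow> z \<noteq> 0 \<Longrightarrow> theta1 \<tau> z \<noteq> 0"
proof -
  obtain x where "theta1 \<tau> x \<noteq> 0" using theta1_nonzero[OF \<tau>] .
  then obtain r where "0 < r" "\<And>z. z \<in> ball 0 r - {0} \<Longrightarrow> theta1 \<tau> z \<noteq> 0"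
    using isolated_zeros[OF theta1_holomorphic[OF \<tau>], of 0 x] theta1_0[OF \<tau>] by (auto simp: connected_UNIV)
  then show ?thesis using that by blast
qed

lemma open_compl_sing_a:
  assumes \<tau>: "Im \<tau> > 0" and a: "a < N"
  shows "open (- sing_a N \<tau> a)"
proof -
  let ?f = "\<lambda>w. theta1 \<tau> (w / (2 * pi * \<i>) + of_nat a / of_nat N * \<tau>)"
  have o: "open {w. ?f w \<noteq> 0}"
    by (rule open_Collect_neq[OF holomorphic_on_imp_continuous_on[OF theta1_shifted_holomorphic[OF \<tau>]] continuous_on_const])
  show ?thesis
  proof (cases "a = 0")
    case False
    have "- sing_a N \<tau> a = {w. ?f w \<noteq> 0}"
    proof (rule set_eqI)
      fix w
      show "w \<in> - sing_a N \<tau> a \<longleftrightarrow> w \<in> {w. ?f w \<noteq> 0}"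
        using theta1_nonzero_off_sing[OF \<tau> a, of w] False sing_a_iff[of w N \<tau> a]
          theta1_eq_0_iff[OF \<tau>, of "w / (2 * pi * \<i>) + of_nat a / of_nat N * \<tau>"] by simp blast
    qed
    then show ?thesis using o by simp
  next
    case True
    obtain r where r: "r > 0" "\<And>z. z \<in> ball 0 r \<Longrightarrow> z \<noteq> 0 \<Longrightarrow> theta1 \<tau> z \<noteq> 0"
      using theta1_isolated_zero[OF \<tau>] by blast
    have "- sing_a N \<tau> a = {w. ?f w \<noteq> 0} \<union> ball 0 (2 * pi * r)"
    proof (intro set_eqI iffI)
      fix w assume "w \<in> - sing_a N \<tau> a"
      then show "w \<in> {w. ?f w \<noteq> 0} \<union> ball 0 (2 * pi * r)"
        using theta1_nonzero_off_sing[OF \<tau> a, of w] r(1) True by (cases "w = 0") auto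
    next
      fix w assume w: "w \<in> {w. ?f w \<noteq> 0} \<union> ball 0 (2 * pi * r)"
      have "w / (2 * pi * \<i>) \<in> ball 0 r" if "w \<in> ball 0 (2 * pi * r)"
        using that by (simp add: norm_divide norm_mult field_simps)
      then show "w \<in> - sing_a N \<tau> a"
        using w r(2)[of "w / (2 * pi * \<i>)"] True by (auto simp: sing_a_iff theta1_eq_0_iff[OF \<tau>])
    qed
    then show ?thesis using o by auto
  qed
qed

text \<open>\<open>chig\<close> is \<open>chi_a\<close> before the subtraction of the pole; it depends on \<open>a\<close> only modulo \<open>N\<close>.\<close>

definition chig :: "nat \<Rightarrow> complex \<Rightarrow> nat \<Rightarrow> complex \<Rightarrow> complex \<Rightarrow> complex" where
  "chig N \<tau> a w z = exp (2 * pi * \<i> * of_nat a * z / of_nat N) * chi \<tau> (w + 2 * pi * \<i> * (of_nat a / of_nat N) * \<tau>) z"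

lemma chi_a_chig:
  assumes "a \<noteq> 0 \<or> w \<noteq> 0"
  shows "chi_a N \<tau> a w z = chig N \<tau> a w z - (if a = 0 then 1 / w else 0)"
  using assms by (auto simp: chi_a_def chig_def Let_def algebra_simps)

lemma chi_arg: "(w + 2 * pi * \<i> * (of_nat a / of_nat N) * \<tau>) / (2 * pi * \<i>) = w / (2 * pi * \<i>) + of_nat a / of_nat N * \<tau>"
  by (simp add: add_divide_distrib)

text \<open>
  The four arguments in the Weierstrass identity are chosen so that their pairwise sums and differences become the theta
  arguments of the three products of \<open>chi\<close>; dividing by the common denominator gives the claim.
\<close>

lemma chi_fay:
  assumes \<tau>: "Im \<tau> > 0"
    and nz: "theta1 \<tau> (\<alpha> / (2 * pi * \<i>)) \<noteq> 0" "theta1 \<tau> (\<beta> / (2 * pi * \<i>)) \<noteq> 0" "theta1 \<tau> ((\<alpha> + \<beta>) / (2 * pi * \<i>)) \<noteq> 0"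
      "theta1 \<tau> x \<noteq> 0" "theta1 \<tau> y \<noteq> 0" "theta1 \<tau> (y - x) \<noteq> 0"
  shows "chi \<tau> \<alpha> x * chi \<tau> \<beta> y = chi \<tau> (\<alpha> + \<beta>) x * chi \<tau> \<beta> (y - x) + chi \<tau> (\<alpha> + \<beta>) y * chi \<tau> \<alpha> (x - y)"
proof -
  define A where "A = \<alpha> / (2 * pi * \<i>)"
  define B where "B = \<beta> / (2 * pi * \<i>)"
  have AB: "(\<alpha> + \<beta>) / (2 * pi * \<i>) = A + B" by (simp add: A_def B_def add_divide_distrib)
  have fay: "theta1 \<tau> (A + B + y) * theta1 \<tau> (A + (x - y)) * (theta1 \<tau> B * theta1 \<tau> x)
    - theta1 \<tau> (A + B + x) * theta1 \<tau> A * (theta1 \<tau> (B + (y - x)) * theta1 \<tau> y)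
    + theta1 \<tau> (A + B) * theta1 \<tau> (A + x) * (theta1 \<tau> (B + y) * theta1 \<tau> (y - x)) = 0"
  proof -
    have e: "(A + (B + x)/2) + (y + (B - x)/2) = A + B + y" "(A + (B + x)/2) - (y + (B - x)/2) = A + (x - y)"
      "(B + x)/2 + (B - x)/2 = B" "(B + x)/2 - (B - x)/2 = x"
      "(A + (B + x)/2) + (B + x)/2 = A + B + x" "(A + (B + x)/2) - (B + x)/2 = A"
      "(y + (B - x)/2) + (B - x)/2 = B + (y - x)" "(y + (B - x)/2) - (B - x)/2 = y"
      "(A + (B + x)/2) + (B - x)/2 = A + B" "(A + (B + x)/2) - (B - x)/2 = A + x"
      "(y + (B - x)/2) + (B + x)/2 = B + y" "(y + (B - x)/2) - (B + x)/2 = y - x"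
      by (simp_all add: field_simps)
    show ?thesis
      using theta1_weierstrass[OF \<tau>, of "A + (B + x)/2" "y + (B - x)/2" "(B + x)/2" "(B - x)/2"] unfolding e .
  qed
  have odd: "theta1 \<tau> (x - y) = - theta1 \<tau> (y - x)" using theta1_odd[OF \<tau>, of "y - x"] by simp
  have alg: "k * (AX * d) / (tx * tA) * (k * (BY * d) / (ty * tB))
     = k * (ABX * d) / (tx * tAB) * (k * (BYX * d) / (tyx * tB)) + k * (ABY * d) / (ty * tAB) * (k * (AXY * d) / (- tyx * tA))"
    if "tA \<noteq> 0" "tB \<noteq> 0" "tAB \<noteq> 0" "tx \<noteq> 0" "ty \<noteq> 0" "tyx \<noteq> 0"
      and h: "ABY * AXY * (tB * tx) - ABX * tA * (BYX * ty) + tAB * AX * (BY * tyx) = 0"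
    for k AX d tx tA BY ty tB ABX tAB BYX tyx ABY AXY :: complex
  proof -
    have h': "AX * BY * tAB * tyx = ABX * BYX * tA * ty - ABY * AXY * tx * tB"
      using h by (simp add: algebra_simps)
    have "k * (AX * d) / (tx * tA) * (k * (BY * d) / (ty * tB)) = k * k * d * d / (tx * tA * ty * tB * tAB * tyx) * (AX * BY * tAB * tyx)"
      using that by (simp add: divide_simps)
    also have "\<dots> = k * (ABX * d) / (tx * tAB) * (k * (BYX * d) / (tyx * tB)) + k * (ABY * d) / (ty * tAB) * (k * (AXY * d) / (- tyx * tA))"
      unfolding h' using that by (simp add: divide_simps) (simp add: algebra_simps)
    finally show ?thesis .
  qed
  show ?thesis
    unfolding chi_def AB A_def[symmetric] B_def[symmetric] odd
    by (rule alg[OF nz(1)[folded A_def] nz(2)[folded B_def] nz(3)[unfolded AB] nz(4-6) fay])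
qed

lemma chi_shift_tau: "chi \<tau> (w + 2 * pi * \<i> * \<tau>) z = exp (- 2 * pi * \<i> * z) * chi \<tau> w z"
proof -
  have a: "(w + 2 * pi * \<i> * \<tau>) / (2 * pi * \<i>) = w / (2 * pi * \<i>) + \<tau>" by (simp add: add_divide_distrib)
  have b: "w / (2 * pi * \<i>) + \<tau> + z = (w / (2 * pi * \<i>) + z) + \<tau>" by simp
  have c: "exp (- pi * \<i> * \<tau> - 2 * pi * \<i> * (w / (2 * pi * \<i>) + z)) = exp (- 2 * pi * \<i> * z) * exp (- pi * \<i> * \<tau> - 2 * pi * \<i> * (w / (2 * pi * \<i>)))"
    unfolding exp_add[symmetric] by (simp add: algebra_simps)
  show ?thesis unfolding chi_def a b theta1_plus_tau c by simp
qed

text \<open>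
  The exponential prefactor of \<open>chi_a\<close> compensates the quasi-periodicity of \<open>chi\<close> in \<open>w\<close>.
\<close>

lemma chig_periodic: "N > 0 \<Longrightarrow> chig N \<tau> (a + N) w z = chig N \<tau> a w z"
proof -
  assume N: "N > 0"
  have a: "w + 2 * pi * \<i> * (of_nat (a + N) / of_nat N) * \<tau> = (w + 2 * pi * \<i> * (of_nat a / of_nat N) * \<tau>) + 2 * pi * \<i> * \<tau>"
    using N by (simp add: field_simps)
  have b: "2 * pi * \<i> * of_nat (a + N) * z / of_nat N = 2 * pi * \<i> * of_nat a * z / of_nat N + 2 * pi * \<i> * z"
    using N by (simp add: field_simps)
  show ?thesis unfolding chig_def a b chi_shift_tau exp_add
    by (simp add: exp_minus field_simps)
qed

lemma chig_mod: "b < N \<Longrightarrow> c < N \<Longrightarrow> chig N \<tau> ((b + c) mod N) w z = chig N \<tau> (b + c) w z"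
  using chig_periodic[of N \<tau> "b + c - N" w z] by (cases "b + c < N") (auto simp: le_mod_geq)

lemma chig_fay:
  assumes \<tau>: "Im \<tau> > 0" and N: "b < N" "c < N"
    and sing: "\<alpha> \<notin> sing_a N \<tau> b" "\<beta> \<notin> sing_a N \<tau> c" "\<alpha> + \<beta> \<notin> sing_a N \<tau> ((b + c) mod N)"
    and nz: "\<alpha> \<noteq> 0" "\<beta> \<noteq> 0" "\<alpha> + \<beta> \<noteq> 0"
    and xy: "x \<notin> period_lattice \<tau>" "y \<notin> period_lattice \<tau>" "y - x \<notin> period_lattice \<tau>"
  shows "chig N \<tau> b \<alpha> x * chig N \<tau> c \<beta> y = chig N \<tau> ((b + c) mod N) (\<alpha> + \<beta>) x * chig N \<tau> c \<beta> (y - x)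
    + chig N \<tau> ((b + c) mod N) (\<alpha> + \<beta>) y * chig N \<tau> b \<alpha> (x - y)"
proof -
  have N0: "N > 0" using N by simp
  define s where "s a = 2 * pi * \<i> * (of_nat a / of_nat N) * \<tau>" for a
  have s: "s (b + c) = s b + s c" by (simp add: s_def add_divide_distrib ring_distribs)
  define e where "e a z = exp (2 * pi * \<i> * of_nat a * z / of_nat N)" for a and z :: complex
  have e1: "e b x * e c y = e (b + c) x * e c (y - x)" "e b x * e c y = e (b + c) y * e b (x - y)"
    unfolding e_def exp_add[symmetric] add_divide_distrib[symmetric]
    by (auto intro!: arg_cong[where f = exp] arg_cong[where f = "\<lambda>u. u / of_nat N"] simp: algebra_simps)
  have t1: "theta1 \<tau> ((\<alpha> + s b) / (2 * pi * \<i>)) \<noteq> 0" "theta1 \<tau> ((\<beta> + s c) / (2 * pi * \<i>)) \<noteq> 0"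
    unfolding s_def chi_arg using theta1_nonzero_off_sing[OF \<tau>] N sing nz by blast+
  have t2: "theta1 \<tau> ((\<alpha> + s b + (\<beta> + s c)) / (2 * pi * \<i>)) \<noteq> 0"
  proof -
    have m: "theta1 \<tau> ((\<alpha> + \<beta> + s ((b + c) mod N)) / (2 * pi * \<i>)) \<noteq> 0"
      unfolding s_def chi_arg using theta1_nonzero_off_sing[OF \<tau>, of "(b + c) mod N" N "\<alpha> + \<beta>"] N sing nz by simp
    show ?thesis
    proof (cases "b + c < N")
      case True
      then show ?thesis using m s by (simp add: algebra_simps)
    next
      case False
      then have d: "(b + c) mod N = b + c - N" using N by (simp add: le_mod_geq)
      have "s (b + c) = s (b + c - N) + 2 * pi * \<i> * \<tau>"
        using False N0 by (simp add: s_def of_nat_diff field_simps)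
      then have "(\<alpha> + s b + (\<beta> + s c)) / (2 * pi * \<i>) = (\<alpha> + \<beta> + s ((b + c) mod N)) / (2 * pi * \<i>) + \<tau>"
        unfolding d using s by (simp add: field_simps)
      then show ?thesis using m by (simp add: theta1_eq_0_iff[OF \<tau>] period_lattice_plus_tau)
    qed
  qed
  have "chi \<tau> (\<alpha> + s b) x * chi \<tau> (\<beta> + s c) y = chi \<tau> (\<alpha> + s b + (\<beta> + s c)) x * chi \<tau> (\<beta> + s c) (y - x)
    + chi \<tau> (\<alpha> + s b + (\<beta> + s c)) y * chi \<tau> (\<alpha> + s b) (x - y)"
    by (rule chi_fay[OF \<tau> t1 t2]) (use xy in \<open>auto simp: theta1_eq_0_iff[OF \<tau>]\<close>)
  moreover have "\<alpha> + s b + (\<beta> + s c) = \<alpha> + \<beta> + s (b + c)" by (simp add: s)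
  ultimately have f: "chi \<tau> (\<alpha> + s b) x * chi \<tau> (\<beta> + s c) y = chi \<tau> (\<alpha> + \<beta> + s (b + c)) x * chi \<tau> (\<beta> + s c) (y - x)
    + chi \<tau> (\<alpha> + \<beta> + s (b + c)) y * chi \<tau> (\<alpha> + s b) (x - y)" by simp
  have "(e b x * e c y) * (chi \<tau> (\<alpha> + s b) x * chi \<tau> (\<beta> + s c) y)
    = (e (b + c) x * e c (y - x)) * (chi \<tau> (\<alpha> + \<beta> + s (b + c)) x * chi \<tau> (\<beta> + s c) (y - x))
    + (e (b + c) y * e b (x - y)) * (chi \<tau> (\<alpha> + \<beta> + s (b + c)) y * chi \<tau> (\<alpha> + s b) (x - y))"
    unfolding f distrib_left using e1 by simp
  then show ?thesis
    unfolding chig_mod[OF N] unfolding chig_def s_def[symmetric] e_def[symmetric] by (simp add: mult_ac)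
qed

text \<open>
  Only the indices equal to \<open>0\<close> carry a subtracted pole \<open>1 / w\<close>. Substituting \<open>chi_a_chig\<close> into the
  identity \<open>chig_fay\<close>, the products of two poles cancel and the products of a pole with a function assemble to the right-hand side.
  In the Yang-Baxter equation the three summands are the three derivative terms.
\<close>

lemma chi_a_fay:
  assumes \<tau>: "Im \<tau> > 0" and N: "b < N" "c < N"
    and sing: "\<alpha> \<notin> sing_a N \<tau> b" "\<beta> \<notin> sing_a N \<tau> c" "\<alpha> + \<beta> \<notin> sing_a N \<tau> d"
    and d: "d = (b + c) mod N"
    and nz: "\<alpha> \<noteq> 0" "\<beta> \<noteq> 0" "\<alpha> + \<beta> \<noteq> 0"
    and xy: "x \<notin> period_lattice \<tau>" "y \<notin> period_lattice \<tau>" "y - x \<notin> period_lattice \<tau>"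
  shows "chi_a N \<tau> b \<alpha> x * chi_a N \<tau> c \<beta> y - chi_a N \<tau> d (\<alpha> + \<beta>) x * chi_a N \<tau> c \<beta> (y - x)
      - chi_a N \<tau> d (\<alpha> + \<beta>) y * chi_a N \<tau> b \<alpha> (x - y)
    = of_bool (b = 0) / \<alpha> * (chi_a N \<tau> d (\<alpha> + \<beta>) y - chi_a N \<tau> c \<beta> y)
    + of_bool (c = 0) / \<beta> * (chi_a N \<tau> d (\<alpha> + \<beta>) x - chi_a N \<tau> b \<alpha> x)
    + of_bool (d = 0) / (\<alpha> + \<beta>) * (chi_a N \<tau> b \<alpha> (x - y) + chi_a N \<tau> c \<beta> (y - x))"
proof -
  have f: "chig N \<tau> b \<alpha> x * chig N \<tau> c \<beta> y = chig N \<tau> d (\<alpha> + \<beta>) x * chig N \<tau> c \<beta> (y - x)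
    + chig N \<tau> d (\<alpha> + \<beta>) y * chig N \<tau> b \<alpha> (x - y)"
    unfolding d by (rule chig_fay) (use assms in auto)
  have g: "chig N \<tau> a w z = chi_a N \<tau> a w z + of_bool (a = 0) / w" if "w \<noteq> 0" for a w z
    using that by (simp add: chi_a_chig)
  have zero: "of_bool (d = 0) / (\<alpha> + \<beta>) * (of_bool (c = 0) / \<beta>) + of_bool (d = 0) / (\<alpha> + \<beta>) * (of_bool (b = 0) / \<alpha>)
     = of_bool (b = 0) / \<alpha> * (of_bool (c = 0) / \<beta>)"
  proof -
    have *: "1 / (\<alpha> + \<beta>) * (1 / \<beta>) + 1 / (\<alpha> + \<beta>) * (1 / \<alpha>) = 1 / \<alpha> * (1 / \<beta>)"
      using nz by (simp add: divide_simps)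
    consider "b = 0" "c = 0" | "b = 0" "c \<noteq> 0" | "b \<noteq> 0" "c = 0" | "b \<noteq> 0" "c \<noteq> 0" by blast
    then show ?thesis using d N * by cases simp_all
  qed
  show ?thesis using f unfolding g[OF nz(1)] g[OF nz(2)] g[OF nz(3)] using zero by algebra
qed

text \<open>
  \<open>U\<close> is \<open>theta1 (w / (2 * pi * \<i>)) / w\<close> with its singularity removed; the simplicity of the zero makes it nonzero at the origin.
\<close>

lemma theta1_over_id:
  assumes \<tau>: "Im \<tau> > 0"
    and U_def: "U = (\<lambda>w. if w = 0 then deriv (theta1 \<tau>) 0 / (2 * pi * \<i>) else theta1 \<tau> (w / (2 * pi * \<i>)) / w)"
  shows "U holomorphic_on UNIV" "0 < N \<Longrightarrow> w \<notin> sing_a N \<tau> 0 \<Longrightarrow> U w \<noteq> 0"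
proof -
  let ?f = "\<lambda>w. theta1 \<tau> (w / (2 * pi * \<i>))"
  have hol: "?f holomorphic_on UNIV" using theta1_shifted_holomorphic[OF \<tau>, of 0] by simp
  have "(?f has_field_derivative deriv (theta1 \<tau>) 0 * (1 / (2 * pi * \<i>))) (at 0)"
  proof (rule DERIV_chain2[where g = "\<lambda>w. w / (2 * pi * \<i>)"])
    show "(theta1 \<tau> has_field_derivative deriv (theta1 \<tau>) 0) (at (0 / (2 * pi * \<i>)))"
      using theta1_holomorphic[OF \<tau>] by (simp add: holomorphic_derivI)
  qed (rule DERIV_cdivide[OF DERIV_ident])
  then have d: "deriv ?f 0 = deriv (theta1 \<tau>) 0 / (2 * pi * \<i>)" using DERIV_imp_deriv by fastforce
  have "U = (\<lambda>w. if w = 0 then deriv ?f 0 else (?f w - ?f 0) / (w - 0))"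
    using theta1_0[OF \<tau>] by (intro ext) (simp only: U_def d, simp)
  then show "U holomorphic_on UNIV" using pole_lemma_open[OF hol open_UNIV, of 0] by simp
  assume "0 < N" "w \<notin> sing_a N \<tau> 0"
  then show "U w \<noteq> 0"
    using theta1_nonzero_off_sing[OF \<tau>, of 0 N w] theta1_deriv_0[OF \<tau>] by (auto simp: U_def)
qed

text \<open>
  The function \<open>\<psi>\<close> is \<open>w * chi w z\<close>, continued over the origin with value \<open>1\<close>. So the regularized function is a difference quotient
  of a holomorphic function, which explains both its holomorphy and the value prescribed at \<open>w = 0\<close>.
\<close>

lemma chi_a_0_quotient:
  assumes \<tau>: "Im \<tau> > 0" and z: "z \<notin> period_lattice \<tau>" and N: "N > 0"
    and U_def: "U = (\<lambda>w. if w = 0 then deriv (theta1 \<tau>) 0 / (2 * pi * \<i>) else theta1 \<tau> (w / (2 * pi * \<i>)) / w)"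
    and \<psi>_def: "\<psi> = (\<lambda>w. deriv (theta1 \<tau>) 0 / (2 * pi * \<i> * theta1 \<tau> z) * (theta1 \<tau> (w / (2 * pi * \<i>) + z) * (1 / U w)))"
  shows "\<psi> holomorphic_on - sing_a N \<tau> 0"
    and "chi_a N \<tau> 0 w z = (if w = 0 then deriv \<psi> 0 else (\<psi> w - \<psi> 0) / (w - 0))"
    and "(\<lambda>w. chi_a N \<tau> 0 w z) holomorphic_on - sing_a N \<tau> 0"
proof -
  have tz: "theta1 \<tau> z \<noteq> 0" using z by (simp add: theta1_eq_0_iff[OF \<tau>])
  have U: "U holomorphic_on - sing_a N \<tau> 0" "\<And>w. w \<in> - sing_a N \<tau> 0 \<Longrightarrow> U w \<noteq> 0"
    using theta1_over_id(2)[OF \<tau> U_def N] holomorphic_on_subset[OF theta1_over_id(1)[OF \<tau> U_def] subset_UNIV]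
    by simp_all
  have o: "open (- sing_a N \<tau> 0)" using open_compl_sing_a[OF \<tau> N] .
  have z0: "0 \<in> - sing_a N \<tau> 0" by (simp add: sing_a_iff)
  show psi: "\<psi> holomorphic_on - sing_a N \<tau> 0"
    unfolding \<psi>_def by (intro holomorphic_intros theta1_shifted_holomorphic[OF \<tau>] U)
  have psi0: "\<psi> 0 = 1" using tz theta1_deriv_0[OF \<tau>] by (simp add: \<psi>_def U_def)
  define Q where "Q w = (if w = 0 then deriv \<psi> 0 else (\<psi> w - \<psi> 0) / (w - 0))" for w
  have Qh: "Q holomorphic_on - sing_a N \<tau> 0" unfolding Q_def[abs_def] by (rule pole_lemma_open[OF psi o])
  have eq: "chi \<tau> w z - 1 / w = Q w" if "w \<noteq> 0" for w
  proof -
    have "chi \<tau> w z = \<psi> w / w" using that by (simp add: \<psi>_def U_def chi_def mult_ac)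
    then show ?thesis using that by (simp add: Q_def psi0 diff_divide_distrib)
  qed
  have chi: "chi_a N \<tau> 0 w z = Q w" for w
  proof (cases "w = 0")
    case False
    then show ?thesis using eq by (simp add: chi_a_def Let_def)
  next
    case True
    have "isCont Q 0" using Qh o z0 holomorphic_on_imp_continuous_on continuous_on_eq_continuous_at by blast
    then have "(Q \<longlongrightarrow> Q 0) (at 0)" by (simp add: isCont_def)
    then have "((\<lambda>w. chi \<tau> w z - 1 / w) \<longlongrightarrow> Q 0) (at 0)"
      by (rule Lim_transform_eventually) (auto simp: eventually_at_filter eq)
    then have "Lim (at 0) (\<lambda>w. chi \<tau> w z - 1 / w) = Q 0"
      by (rule tendsto_Lim[rotated]) simp
    then show ?thesis using True by (simp add: chi_a_def Let_def)
  qed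
  then show "chi_a N \<tau> 0 w z = (if w = 0 then deriv \<psi> 0 else (\<psi> w - \<psi> 0) / (w - 0))"
    unfolding Q_def .
  show "(\<lambda>w. chi_a N \<tau> 0 w z) holomorphic_on - sing_a N \<tau> 0"
    using Qh by (simp add: chi)
qed

lemma chig_factor:
  "chig N \<tau> a w z = exp (2 * pi * \<i> * of_nat a * z / of_nat N) * deriv (theta1 \<tau>) 0 / (2 * pi * \<i> * theta1 \<tau> z)
     * (theta1 \<tau> (w / (2 * pi * \<i>) + (of_nat a / of_nat N * \<tau> + z)) * (1 / theta1 \<tau> (w / (2 * pi * \<i>) + of_nat a / of_nat N * \<tau>)))"
  unfolding chig_def chi_def chi_arg by (simp add: add.assoc mult_ac)

lemma chi_a_holomorphic:
  assumes \<tau>: "Im \<tau> > 0" and z: "z \<notin> period_lattice \<tau>" and a: "a < N"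
  shows "(\<lambda>w. chi_a N \<tau> a w z) holomorphic_on - sing_a N \<tau> a"
proof (cases "a = 0")
  case True
  then show ?thesis using chi_a_0_quotient(3)[OF \<tau> z _ refl refl] a by simp
next
  case False
  then have "chi_a N \<tau> a w z = chig N \<tau> a w z" for w by (simp add: chi_a_chig)
  moreover have "(\<lambda>w. chig N \<tau> a w z) holomorphic_on - sing_a N \<tau> a"
    unfolding chig_factor
    by (intro holomorphic_intros theta1_shifted_holomorphic[OF \<tau>])
      (use theta1_nonzero_off_sing[OF \<tau> a] False in auto)
  ultimately show ?thesis by simp
qed

lemma chi_uminus: "Im \<tau> > 0 \<Longrightarrow> chi \<tau> u (- z) = - chi \<tau> (- u) z"
proof -
  assume \<tau>: "Im \<tau> > 0"
  have e: "- u / (2 * pi * \<i>) + z = - (u / (2 * pi * \<i>) + - z)" by simp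
  show ?thesis
    unfolding chi_def e unfolding minus_divide_left[symmetric] theta1_odd[OF \<tau>] by simp
qed

lemma sing_a_uminus:
  assumes "a < N"
  shows "- w \<in> sing_a N \<tau> ((N - a) mod N) \<longleftrightarrow> w \<in> sing_a N \<tau> a"
proof (cases "a = 0")
  case True
  then show ?thesis using period_lattice_minus[of "w / (2 * pi * \<i>)"] by (simp add: sing_a_iff)
next
  case False
  then have m: "(N - a) mod N = N - a" using assms by simp
  have h: "of_nat (N - a) / of_nat N = (1 - of_nat a / of_nat N :: complex)"
    using assms by (simp add: of_nat_diff diff_divide_distrib)
  have e1: "- w / (2 * pi * \<i>) + of_nat (N - a) / of_nat N * \<tau> = - (w / (2 * pi * \<i>) + of_nat a / of_nat N * \<tau>) + \<tau>"
    unfolding h by (simp add: algebra_simps)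
  show ?thesis unfolding sing_a_iff m e1 period_lattice_plus_tau period_lattice_minus by simp
qed

text \<open>
  Reflection of both arguments changes the sign of \<open>chi\<close> as \<open>theta1\<close> is odd, and it sends the index \<open>a\<close> to \<open>- a\<close> modulo \<open>N\<close>.
\<close>

lemma chi_a_uminus:
  assumes \<tau>: "Im \<tau> > 0" and z: "z \<notin> period_lattice \<tau>" and a: "a < N" and w: "w \<notin> sing_a N \<tau> a"
  shows "chi_a N \<tau> a w (- z) = - chi_a N \<tau> ((N - a) mod N) (- w) z"
proof -
  have g: "chig N \<tau> a w (- z) = - chig N \<tau> (N - a) (- w) z" for w
  proof -
    \<comment> \<open>\<open>- a\<close> is represented by \<open>N - a\<close>, at the cost of one full period.\<close>
    have "- (w + 2 * pi * \<i> * (of_nat a / of_nat N) * \<tau>) + 2 * pi * \<i> * \<tau> = - w + 2 * pi * \<i> * (of_nat (N - a) / of_nat N) * \<tau>"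
      using a by (simp add: of_nat_diff field_simps)
    then have "chi \<tau> (- w + 2 * pi * \<i> * (of_nat (N - a) / of_nat N) * \<tau>) z = exp (- 2 * pi * \<i> * z) * chi \<tau> (- (w + 2 * pi * \<i> * (of_nat a / of_nat N) * \<tau>)) z"
      using chi_shift_tau by metis
    moreover have "exp (2 * pi * \<i> * of_nat (N - a) * z / of_nat N) = exp (2 * pi * \<i> * z) * exp (2 * pi * \<i> * of_nat a * (- z) / of_nat N)"
      unfolding exp_add[symmetric] using a by (simp add: of_nat_diff field_simps)
    ultimately show ?thesis
      unfolding chig_def chi_uminus[OF \<tau>] by (simp add: exp_minus)
  qed
  have gen: "chi_a N \<tau> a w (- z) = - chi_a N \<tau> ((N - a) mod N) (- w) z" if "a \<noteq> 0 \<or> w \<noteq> 0" for w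
  proof (cases "a = 0")
    case True
    have "chig N \<tau> N (- w) z = chig N \<tau> 0 (- w) z" using chig_periodic[of N \<tau> 0] a by simp
    then show ?thesis using that True g[of w] by (simp add: chi_a_chig)
  next
    case False
    then have "(N - a) mod N = N - a" "N - a \<noteq> 0" using a by auto
    then show ?thesis using that False g[of w] by (simp add: chi_a_chig)
  qed
  show ?thesis
  proof (cases "a \<noteq> 0 \<or> w \<noteq> 0")
    case False
    then have 0: "a = 0" "w = 0" by auto
    have N: "N > 0" using a by simp
    have c: "isCont (\<lambda>w. chi_a N \<tau> 0 w z) 0" if "z \<notin> period_lattice \<tau>" for z
      using chi_a_holomorphic[OF \<tau> that N] open_compl_sing_a[OF \<tau> N] holomorphic_on_imp_continuous_on continuous_on_eq_continuous_at
      by (metis ComplI sing_a_iff)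
    have 1: "((\<lambda>w. chi_a N \<tau> 0 w (- z)) \<longlongrightarrow> chi_a N \<tau> 0 0 (- z)) (at 0)"
      using c[of "- z"] z by (simp add: period_lattice_minus isCont_def)
    have "isCont (\<lambda>w. - chi_a N \<tau> 0 (- w) z) 0"
      by (intro continuous_intros isCont_o2[of 0 uminus "\<lambda>w. chi_a N \<tau> 0 w z"]) (use c[OF z] in auto)
    then have 2: "((\<lambda>w. - chi_a N \<tau> 0 (- w) z) \<longlongrightarrow> - chi_a N \<tau> 0 (- 0) z) (at 0)"
      unfolding isCont_def .
    have "((\<lambda>w. chi_a N \<tau> 0 w (- z)) \<longlongrightarrow> - chi_a N \<tau> 0 (- 0) z) (at 0)"
      by (rule Lim_transform_eventually[OF 2]) (use gen 0 in \<open>auto simp: eventually_at_filter\<close>)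
    then have "chi_a N \<tau> 0 0 (- z) = - chi_a N \<tau> 0 (- 0) z"
      using 1 LIM_unique by blast
    then show ?thesis using 0 by simp
  qed (rule gen)
qed

text \<open>
  By the Leibniz rule the derivative is a combination of derivatives of \<open>theta1\<close>, hence entire in the parameter \<open>z\<close>.
\<close>

lemma higher_deriv_theta1_product:
  assumes \<tau>: "Im \<tau> > 0" and V: "V holomorphic_on D" and D: "open D" "l \<in> D"
  shows "\<exists>M. M holomorphic_on UNIV \<and> (\<forall>z. M z = (deriv ^^ k) (\<lambda>w. theta1 \<tau> (w / (2 * pi * \<i>) + (s + z)) * V w) l)"
proof -
  define M where "M z = (\<Sum>i = 0..k. of_nat (k choose i) * ((1 / (2 * pi * \<i>)) ^ i * (deriv ^^ i) (theta1 \<tau>) (l / (2 * pi * \<i>) + (s + z))) * (deriv ^^ (k - i)) V l)" for z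
  have h: "(deriv ^^ i) (theta1 \<tau>) holomorphic_on UNIV" for i
    by (rule holomorphic_higher_deriv[OF theta1_holomorphic[OF \<tau>] open_UNIV])
  have "M holomorphic_on UNIV" unfolding M_def[abs_def]
    by (intro holomorphic_intros holomorphic_on_compose_gen[OF _ h, unfolded o_def]) auto
  moreover have "M z = (deriv ^^ k) (\<lambda>w. theta1 \<tau> (w / (2 * pi * \<i>) + (s + z)) * V w) l" for z
  proof -
    have "(deriv ^^ i) (\<lambda>w. theta1 \<tau> (1 / (2 * pi * \<i>) * w + (s + z))) l
       = (1 / (2 * pi * \<i>)) ^ i * (deriv ^^ i) (theta1 \<tau>) (1 / (2 * pi * \<i>) * l + (s + z))" for i
      by (rule higher_deriv_compose_linear'[OF theta1_holomorphic[OF \<tau>] open_UNIV open_UNIV]) auto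
    then have "(deriv ^^ i) (\<lambda>w. theta1 \<tau> (w / (2 * pi * \<i>) + (s + z))) l
       = (1 / (2 * pi * \<i>)) ^ i * (deriv ^^ i) (theta1 \<tau>) (l / (2 * pi * \<i>) + (s + z))" for i by simp
    then show ?thesis
      unfolding M_def by (subst higher_deriv_mult[OF theta1_shifted_holomorphic[OF \<tau>] V D]) simp
  qed
  ultimately show ?thesis by blast
qed

lemma higher_deriv_difference_quotient:
  assumes F: "F holomorphic_on D" and D: "open D" "0 \<in> D"
  shows "(deriv ^^ k) (\<lambda>w. if w = 0 then deriv F 0 else (F w - F 0) / (w - 0)) 0 = (deriv ^^ Suc k) F 0 / of_nat (Suc k)"
proof -
  define Q where "Q w = (if w = 0 then deriv F 0 else (F w - F 0) / (w - 0))" for w :: complex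
  have Q: "Q holomorphic_on D" unfolding Q_def[abs_def] by (rule pole_lemma_open[OF F D(1)])
  have FQ: "F = (\<lambda>w. F 0 + w * Q w)" by (auto simp: Q_def)
  have "(deriv ^^ Suc k) F 0 = (deriv ^^ Suc k) (\<lambda>w. F 0 + w * Q w) 0" using FQ by simp
  also have "\<dots> = (deriv ^^ Suc k) (\<lambda>w. w * Q w) 0"
    by (subst higher_deriv_add[OF _ _ D]) (auto intro!: holomorphic_intros Q)
  also have "\<dots> = (\<Sum>i = 0..Suc k. of_nat (Suc k choose i) * (deriv ^^ i) (\<lambda>w. w) 0 * (deriv ^^ (Suc k - i)) Q 0)"
    by (rule higher_deriv_mult[OF _ Q D]) (auto intro!: holomorphic_intros)
  also have "\<dots> = (\<Sum>i = 0..Suc k. if i = 1 then of_nat (Suc k) * (deriv ^^ k) Q 0 else 0)"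
    by (rule sum.cong) (auto simp: higher_deriv_ident)
  also have "\<dots> = of_nat (Suc k) * (deriv ^^ k) Q 0" by simp
  finally show ?thesis unfolding Q_def[abs_def, symmetric] by (simp del: of_nat_Suc funpow.simps)
qed

text \<open>
  The parameter \<open>z\<close> occurs in \<open>theta1 (w + z) / theta1 z\<close>. The denominator gives the simple pole. At \<open>z = 0\<close> the
  numerator cancels against the factor \<open>theta1 w\<close> of the denominator of \<open>chi\<close>, so the residue in \<open>z\<close> is constant in \<open>w\<close> and its
  \<open>w\<close>-derivatives vanish.
\<close>

lemma chi_a_deriv_residue:
  assumes \<tau>: "Im \<tau> > 0" and a: "a < N" and l: "l \<notin> sing_a N \<tau> a"
  shows "\<exists>G e. e > 0 \<and> G holomorphic_on ball 0 e \<and> G 0 = (if k = 0 then 1 / (2 * pi * \<i>) else 0) \<and>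
    (\<forall>z. z \<in> ball 0 e \<and> z \<noteq> 0 \<longrightarrow> (deriv ^^ k) (\<lambda>w. chi_a N \<tau> a w z) l = G z / z)"
proof -
  let ?c = "2 * pi * \<i> :: complex"
  obtain e where e: "e > 0" "\<And>z. z \<in> ball 0 e \<Longrightarrow> z \<noteq> 0 \<Longrightarrow> theta1 \<tau> z \<noteq> 0"
    using theta1_isolated_zero[OF \<tau>] by blast
  define Tq where "Tq z = (if z = 0 then deriv (theta1 \<tau>) 0 else (theta1 \<tau> z - theta1 \<tau> 0) / (z - 0))" for z
  have Tq: "Tq holomorphic_on ball 0 e"
    unfolding Tq_def[abs_def] by (rule pole_lemma_open) (auto intro: holomorphic_on_subset[OF theta1_holomorphic[OF \<tau>]])
  have Tq0: "Tq z \<noteq> 0" if "z \<in> ball 0 e" for z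
    using e(2)[OF that] theta1_deriv_0[OF \<tau>] theta1_0[OF \<tau>] by (auto simp: Tq_def)
  have th: "theta1 \<tau> z = z * Tq z" for z by (simp add: Tq_def theta1_0[OF \<tau>])
  have zL: "z \<notin> period_lattice \<tau>" if "z \<in> ball 0 e" "z \<noteq> 0" for z
    using e(2)[OF that] by (simp add: theta1_eq_0_iff[OF \<tau>])
  have oD: "open (- sing_a N \<tau> a)" by (rule open_compl_sing_a[OF \<tau> a])
  show ?thesis
  proof (cases "a = 0 \<and> l = 0")
    case True
    \<comment> \<open>At the origin \<open>chi_a\<close> is a difference quotient, so one more derivative of the numerator is taken.\<close>
    define U where "U = (\<lambda>w. if w = 0 then deriv (theta1 \<tau>) 0 / ?c else theta1 \<tau> (w / ?c) / w)"
    have D0: "open (- sing_a N \<tau> 0)" "0 \<in> - sing_a N \<tau> 0" using oD l True by auto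
    have U: "U holomorphic_on - sing_a N \<tau> 0" "\<And>w. w \<in> - sing_a N \<tau> 0 \<Longrightarrow> U w \<noteq> 0"
      using theta1_over_id(2)[OF \<tau> U_def, of N] a holomorphic_on_subset[OF theta1_over_id(1)[OF \<tau> U_def] subset_UNIV]
      by simp_all
    have V: "(\<lambda>w. 1 / U w) holomorphic_on - sing_a N \<tau> 0" by (intro holomorphic_intros U)
    obtain M where M: "M holomorphic_on UNIV"
      "\<And>z. M z = (deriv ^^ Suc k) (\<lambda>w. theta1 \<tau> (w / ?c + (0 + z)) * (1 / U w)) 0"
      using higher_deriv_theta1_product[OF \<tau> V D0] by blast
    have M0: "M 0 = (if k = 0 then 1 else 0)"
    proof -
      have "M 0 = (deriv ^^ Suc k) (\<lambda>w. w) 0"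
        unfolding M(2)
      proof (rule higher_deriv_cong_ev)
        have "eventually (\<lambda>w. w \<in> - sing_a N \<tau> 0) (nhds 0)" using D0 by (rule eventually_nhds_in_open)
        then show "eventually (\<lambda>w. theta1 \<tau> (w / ?c + (0 + 0)) * (1 / U w) = w) (nhds 0)"
        proof eventually_elim
          case (elim w)
          have "theta1 \<tau> (w / ?c) = w * U w" by (simp add: U_def theta1_0[OF \<tau>])
          then show ?case using U(2)[OF elim] by simp
        qed
      qed simp
      then show ?thesis unfolding higher_deriv_ident by simp
    qed
    define G where "G z = deriv (theta1 \<tau>) 0 / (?c * Tq z) * M z / of_nat (Suc k)" for z
    have "G holomorphic_on ball 0 e"
      unfolding G_def[abs_def] by (intro holomorphic_intros Tq holomorphic_on_subset[OF M(1)]) (use Tq0 in auto)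
    moreover have "G 0 = (if k = 0 then 1 / ?c else 0)"
      using theta1_deriv_0[OF \<tau>] by (simp add: G_def M0 Tq_def)
    moreover have "(deriv ^^ k) (\<lambda>w. chi_a N \<tau> a w z) l = G z / z" if z: "z \<in> ball 0 e \<and> z \<noteq> 0" for z
    proof -
      have zL': "z \<notin> period_lattice \<tau>" using zL z by blast
      have N: "N > 0" using a by simp
      note q = chi_a_0_quotient[OF \<tau> zL' N U_def refl]
      have "(deriv ^^ k) (\<lambda>w. chi_a N \<tau> a w z) l
         = (deriv ^^ Suc k) (\<lambda>w. deriv (theta1 \<tau>) 0 / (?c * theta1 \<tau> z) * (theta1 \<tau> (w / ?c + z) * (1 / U w))) 0 / of_nat (Suc k)"
        using True higher_deriv_difference_quotient[OF q(1) D0, of k] by (simp only: q(2))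
      also have "(deriv ^^ Suc k) (\<lambda>w. deriv (theta1 \<tau>) 0 / (?c * theta1 \<tau> z) * (theta1 \<tau> (w / ?c + z) * (1 / U w))) 0
         = deriv (theta1 \<tau>) 0 / (?c * theta1 \<tau> z) * (deriv ^^ Suc k) (\<lambda>w. theta1 \<tau> (w / ?c + z) * (1 / U w)) 0"
        by (rule higher_deriv_cmult[OF _ D0(2) D0(1)]) (intro holomorphic_intros theta1_shifted_holomorphic[OF \<tau>] U)
      also have "\<dots> = deriv (theta1 \<tau>) 0 / (?c * theta1 \<tau> z) * M z" unfolding M(2) by simp
      finally show ?thesis by (simp add: G_def th[of z] mult_ac)
    qed
    ultimately show ?thesis using e(1) by blast
  next
    case False
    define s where "s = of_nat a / of_nat N * \<tau>"
    have N0: "of_nat N \<noteq> (0::complex)" using a by simp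
    define D where "D = - sing_a N \<tau> a - (if a = 0 then {0} else {})"
    have D: "open D" "l \<in> D" using oD l False by (auto simp: D_def intro: open_Diff)
    have nz: "theta1 \<tau> (w / ?c + s) \<noteq> 0" if "w \<in> D" for w
      using theta1_nonzero_off_sing[OF \<tau> a, of w] that by (auto simp: D_def s_def split: if_splits)
    have V: "(\<lambda>w. 1 / theta1 \<tau> (w / ?c + s)) holomorphic_on D"
      by (intro holomorphic_intros theta1_shifted_holomorphic[OF \<tau>]) (use nz in auto)
    obtain M where M: "M holomorphic_on UNIV"
      "\<And>z. M z = (deriv ^^ k) (\<lambda>w. theta1 \<tau> (w / ?c + (s + z)) * (1 / theta1 \<tau> (w / ?c + s))) l"
      using higher_deriv_theta1_product[OF \<tau> V D] by blast
    have M0: "M 0 = (if k = 0 then 1 else 0)"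
    proof -
      have "M 0 = (deriv ^^ k) (\<lambda>w. 1) l"
        unfolding M(2)
      proof (rule higher_deriv_cong_ev)
        have "eventually (\<lambda>w. w \<in> D) (nhds l)" using D by (rule eventually_nhds_in_open)
        then show "eventually (\<lambda>w. theta1 \<tau> (w / ?c + (s + 0)) * (1 / theta1 \<tau> (w / ?c + s)) = 1) (nhds l)"
          by eventually_elim (use nz in auto)
      qed simp
      then show ?thesis by simp
    qed
    define p where "p = (if a = 0 then (deriv ^^ k) (\<lambda>w. 1 / w) l else 0)"
    define G where "G z = exp (?c * of_nat a * z / of_nat N) * deriv (theta1 \<tau>) 0 / (?c * Tq z) * M z - z * p" for z
    have "G holomorphic_on ball 0 e"
      unfolding G_def[abs_def] by (intro holomorphic_intros Tq holomorphic_on_subset[OF M(1)]) (use Tq0 N0 in simp_all)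
    moreover have "G 0 = (if k = 0 then 1 / ?c else 0)"
      using theta1_deriv_0[OF \<tau>] by (simp add: G_def M0 Tq_def)
    moreover have "(deriv ^^ k) (\<lambda>w. chi_a N \<tau> a w z) l = G z / z" if z: "z \<in> ball 0 e \<and> z \<noteq> 0" for z
    proof -
      let ?K = "exp (?c * of_nat a * z / of_nat N) * deriv (theta1 \<tau>) 0 / (?c * theta1 \<tau> z)"
      let ?h = "\<lambda>w. theta1 \<tau> (w / ?c + (s + z)) * (1 / theta1 \<tau> (w / ?c + s))"
      have h: "?h holomorphic_on D" by (intro holomorphic_intros theta1_shifted_holomorphic[OF \<tau>] V)
      have i: "(\<lambda>w. if a = 0 then 1 / w else 0) holomorphic_on D"
        by (cases "a = 0") (auto simp: D_def intro!: holomorphic_intros)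
      have "(deriv ^^ k) (\<lambda>w. chi_a N \<tau> a w z) l = (deriv ^^ k) (\<lambda>w. ?K * ?h w - (if a = 0 then 1 / w else 0)) l"
      proof (rule higher_deriv_cong_ev)
        have "eventually (\<lambda>w. w \<in> D) (nhds l)" using D by (rule eventually_nhds_in_open)
        then show "eventually (\<lambda>w. chi_a N \<tau> a w z = ?K * ?h w - (if a = 0 then 1 / w else 0)) (nhds l)"
        proof eventually_elim
          case (elim w)
          then have "a \<noteq> 0 \<or> w \<noteq> 0" by (auto simp: D_def split: if_splits)
          then show ?case by (simp only: chi_a_chig chig_factor s_def)
        qed
      qed simp
      also have "\<dots> = (deriv ^^ k) (\<lambda>w. ?K * ?h w) l - (deriv ^^ k) (\<lambda>w. if a = 0 then 1 / w else 0) l"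
        by (rule higher_deriv_diff[OF _ i D]) (intro holomorphic_intros h)
      also have "(deriv ^^ k) (\<lambda>w. ?K * ?h w) l = ?K * (deriv ^^ k) ?h l"
        by (rule higher_deriv_cmult[OF h D(2,1)])
      also have "(deriv ^^ k) (\<lambda>w. if a = 0 then 1 / w else 0) l = p"
        by (cases "a = 0") (simp_all add: p_def)
      also have "(deriv ^^ k) ?h l = M z" by (simp only: M(2))
      finally show ?thesis using z by (simp add: G_def th[of z] diff_divide_distrib mult_ac)
    qed
    ultimately show ?thesis using e(1) by blast
  qed
qed

section \<open>Linear algebra over the complex numbers\<close>

lemma vector_space_scaleC: "vector_space (scaleC :: complex \<Rightarrow> 'a::complex_vector \<Rightarrow> 'a)"
  by (rule complex_vector.vector_space_axioms)

lemma vector_space_times: "vector_space ((*) :: complex \<Rightarrow> complex \<Rightarrow> complex)"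
  by unfold_locales (simp_all add: algebra_simps)

lemma clinear_iff:
  "clinear f \<longleftrightarrow> (\<forall>x y. f (x + y) = f x + f y) \<and> (\<forall>c x. f (c *\<^sub>C x) = c *\<^sub>C f x)"
  by (simp add: Vector_Spaces.linear_iff vector_space_scaleC)

lemma cfunctional_iff:
  "cfunctional f \<longleftrightarrow> (\<forall>x y. f (x + y) = f x + f y) \<and> (\<forall>c x. f (c *\<^sub>C x) = c * f x)"
  by (simp add: Vector_Spaces.linear_iff vector_space_scaleC vector_space_times)

lemma clinear_simps:
  assumes "clinear f"
  shows "f (x + y) = f x + f y" "f (c *\<^sub>C x) = c *\<^sub>C f x" "f 0 = 0" "f (- x) = - f x" "f (x - y) = f x - f y"
    "f (\<Sum>i\<in>I. g i) = (\<Sum>i\<in>I. f (g i))"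
proof -
  show a: "f (x + y) = f x + f y" and s: "f (c *\<^sub>C x) = c *\<^sub>C f x" for x y c
    using assms by (auto simp: clinear_iff)
  show z: "f 0 = 0" using a[of 0 0] by simp
  show m: "f (- x) = - f x" for x using a[of x "- x"] z by (simp add: eq_neg_iff_add_eq_0 add.commute)
  show "f (x - y) = f x - f y" using a[of x "- y"] m by simp
  show "f (\<Sum>i\<in>I. g i) = (\<Sum>i\<in>I. f (g i))" by (induction I rule: infinite_finite_induct) (simp_all add: a z)
qed

lemma cfunctional_simps:
  assumes "cfunctional f"
  shows "f (x + y) = f x + f y" "f (c *\<^sub>C x) = c * f x" "f 0 = 0" "f (- x) = - f x" "f (x - y) = f x - f y"
    "f (\<Sum>i\<in>I. g i) = (\<Sum>i\<in>I. f (g i))"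
proof -
  show a: "f (x + y) = f x + f y" and s: "f (c *\<^sub>C x) = c * f x" for x y c
    using assms by (auto simp: cfunctional_iff)
  show z: "f 0 = 0" using a[of 0 0] by simp
  show m: "f (- x) = - f x" for x using a[of x "- x"] z by (simp add: eq_neg_iff_add_eq_0 add.commute)
  show "f (x - y) = f x - f y" using a[of x "- y"] m by simp
  show "f (\<Sum>i\<in>I. g i) = (\<Sum>i\<in>I. f (g i))" by (induction I rule: infinite_finite_induct) (simp_all add: a z)
qed

lemma cfunctional_compose: "cfunctional \<phi> \<Longrightarrow> clinear f \<Longrightarrow> cfunctional (\<lambda>x. \<phi> (f x))"
  by (simp add: cfunctional_iff clinear_iff)

text \<open>
  A nonzero vector extends to a basis, hence is not annihilated by all functionals. All identities between
  vectors defined by analytic conditions are proved this way, since those conditions are stated through functionals.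
\<close>

lemma functional_separates:
  fixes x y :: "'a::complex_vector"
  assumes "\<And>\<phi>. cfunctional \<phi> \<Longrightarrow> \<phi> x = \<phi> y"
  shows "x = y"
proof (rule ccontr)
  assume "x \<noteq> y"
  interpret P: vector_space_pair "scaleC :: complex \<Rightarrow> 'a \<Rightarrow> 'a" "(*) :: complex \<Rightarrow> complex \<Rightarrow> complex"
    using vector_space_scaleC vector_space_times by (rule vector_space_pair.intro)
  have "complex_vector.independent {x - y}" using \<open>x \<noteq> y\<close> by (simp add: complex_vector.dependent_single)
  then obtain g where g: "cfunctional g" "g (x - y) = 1"
    using P.linear_independent_extend[of "{x - y}" "\<lambda>_. 1"] by auto
  then show False using assms[OF g(1)] by (simp add: cfunctional_simps)
qed

text \<open>
  The value of the polynomial \<open>p\<close> at the endomorphism \<open>A\<close>.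
\<close>

definition pact :: "complex poly \<Rightarrow> ('a::complex_vector \<Rightarrow> 'a) \<Rightarrow> 'a \<Rightarrow> 'a" where
  "pact p A x = (\<Sum>i\<le>degree p. coeff p i *\<^sub>C (A ^^ i) x)"

lemma pact_ge: "degree p \<le> n \<Longrightarrow> pact p A x = (\<Sum>i\<le>n. coeff p i *\<^sub>C (A ^^ i) x)"
  unfolding pact_def by (rule sum.mono_neutral_left) (auto simp: coeff_eq_0)

lemma pact_0 [simp]: "pact 0 A x = 0" by (simp add: pact_def)

lemma pact_pCons: "pact (pCons a p) A x = a *\<^sub>C x + pact p A (A x)"
proof -
  have "pact (pCons a p) A x = (\<Sum>i\<le>Suc (degree p). coeff (pCons a p) i *\<^sub>C (A ^^ i) x)"
    by (rule pact_ge) (rule degree_pCons_le)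
  also have "\<dots> = a *\<^sub>C x + pact p A (A x)"
    by (simp only: sum.atMost_Suc_shift) (simp add: pact_def funpow_swap1)
  finally show ?thesis .
qed

lemma pact_linear: "clinear A \<Longrightarrow> clinear (pact p A)"
proof (induction p)
  case 0
  then show ?case by (simp add: clinear_iff)
next
  case (pCons a p)
  then show ?case by (simp add: clinear_iff pact_pCons scaleC_add_right scaleC_scaleC mult.commute add_ac)
qed

lemma pact_commute: "clinear A \<Longrightarrow> pact p A (A x) = A (pact p A x)"
  by (induction p arbitrary: x) (simp_all add: pact_pCons clinear_simps)

lemma pact_add: "pact (p + q) A x = pact p A x + pact q A x"
  by (subst (1 2 3) pact_ge[where n = "max (degree p) (degree q)"])
    (auto simp: degree_add_le_max scaleC_add_left sum.distrib)

lemma pact_smult: "pact (smult c p) A x = c *\<^sub>C pact p A x"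
  by (subst (1 2) pact_ge[where n = "degree p"])
    (auto simp: degree_smult_le complex_vector.scale_sum_right)

lemma pact_mult: "clinear A \<Longrightarrow> pact (p * q) A x = pact p A (pact q A x)"
  by (induction p arbitrary: x) (simp_all add: pact_pCons pact_add pact_smult pact_commute)

lemma pact_eigenvector: "A x = l *\<^sub>C x \<Longrightarrow> clinear A \<Longrightarrow> pact p A x = poly p l *\<^sub>C x"
  by (induction p) (simp_all add: pact_pCons scaleC_add_left scaleC_scaleC pact_linear[THEN clinear_simps(2)] )

text \<open>
  The vectors \<open>x, A x, A (A x), \<dots>\<close> cannot all be independent in finite dimension.
\<close>

lemma pact_annihilates_vector:
  fixes A :: "'a::complex_vector \<Rightarrow> 'a"
  assumes fd: "fin_dim_space TYPE('a)"
  shows "\<exists>p. p \<noteq> 0 \<and> pact p A x = 0"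
proof -
  obtain S :: "'a set" where S: "finite S" "complex_vector.span S = UNIV"
    using fd by (auto simp: fin_dim_space_def)
  define n where "n = card S"
  let ?v = "\<lambda>i. (A ^^ i) x"
  have "\<exists>c. (\<exists>i\<le>n. c i \<noteq> 0) \<and> (\<Sum>i\<le>n. c i *\<^sub>C ?v i) = 0"
  proof (cases "inj_on ?v {..n}")
    case False
    then obtain i j where ij: "i \<le> n" "j \<le> n" "i \<noteq> j" "?v i = ?v j" by (auto simp: inj_on_def)
    define c where "c k = (if k = i then 1 else if k = j then - 1 else 0 :: complex)" for k
    have "(\<Sum>k\<le>n. c k *\<^sub>C ?v k) = (\<Sum>k\<in>{i, j}. c k *\<^sub>C ?v k)"
      by (rule sum.mono_neutral_right) (use ij in \<open>auto simp: c_def\<close>)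
    also have "\<dots> = 0" using ij by (simp add: c_def scaleC_one)
    finally show ?thesis using ij by (intro exI[of _ c]) (auto simp: c_def)
  next
    case True
    have "complex_vector.dependent (?v ` {..n})"
    proof (rule ccontr)
      assume "complex_vector.independent (?v ` {..n})"
      then have "card (?v ` {..n}) \<le> n"
        using complex_vector.independent_span_bound[OF S(1)] S(2) by (simp add: n_def)
      then show False using card_image[OF True] by simp
    qed
    then obtain u v where u: "(\<Sum>w\<in>?v ` {..n}. u w *\<^sub>C w) = 0" "v \<in> ?v ` {..n}" "u v \<noteq> 0"
      using complex_vector.dependent_finite[of "?v ` {..n}"] by auto
    have "(\<Sum>i\<le>n. u (?v i) *\<^sub>C ?v i) = 0" using u(1) by (simp add: sum.reindex[OF True] o_def)
    then show ?thesis using u by (intro exI[of _ "\<lambda>i. u (?v i)"]) auto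
  qed
  then obtain c i where c: "i \<le> n" "c i \<noteq> 0" "(\<Sum>i\<le>n. c i *\<^sub>C ?v i) = 0" by blast
  define p where "p = (\<Sum>i\<le>n. monom (c i) i)"
  have cf: "coeff p k = (if k \<le> n then c k else 0)" for k
    by (simp add: p_def coeff_sum)
  have "degree p \<le> n" by (rule degree_le) (simp add: cf)
  then have "pact p A x = 0" using c(3) by (simp add: pact_ge cf)
  moreover have "p \<noteq> 0" using cf[of i] c by auto
  ultimately show ?thesis by blast
qed

lemma pact_annihilates:
  fixes A :: "'a::complex_vector \<Rightarrow> 'a"
  assumes fd: "fin_dim_space TYPE('a)" and A: "clinear A"
  shows "\<exists>p. p \<noteq> 0 \<and> (\<forall>x. pact p A x = 0)"
proof -
  obtain S :: "'a set" where S: "finite S" "complex_vector.span S = UNIV"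
    using fd by (auto simp: fin_dim_space_def)
  have "\<exists>p. p \<noteq> 0 \<and> (\<forall>x\<in>S. pact p A x = 0)"
    using S(1)
  proof induction
    case empty
    then show ?case by (intro exI[of _ 1]) simp
  next
    case (insert x F)
    then obtain p where p: "p \<noteq> 0" "\<forall>x\<in>F. pact p A x = 0" by blast
    obtain q where q: "q \<noteq> 0" "pact q A x = 0" using pact_annihilates_vector[OF fd] by blast
    have "pact (p * q) A y = 0" if "y \<in> insert x F" for y
      using that p q pact_mult[OF A, of p q y] pact_mult[OF A, of q p y]
      by (auto simp: pact_linear[OF A, THEN clinear_simps(3)] mult.commute)
    then show ?case using p q by (intro exI[of _ "p * q"]) auto
  qed
  then obtain p where p: "p \<noteq> 0" "\<forall>x\<in>S. pact p A x = 0" by blast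
  have "pact p A x = 0" for x
  proof -
    have "x \<in> complex_vector.span S" using S by simp
    then show ?thesis
      by (induction rule: complex_vector.span_induct_alt)
        (use p in \<open>auto simp: pact_linear[OF A, THEN clinear_simps(1)] pact_linear[OF A, THEN clinear_simps(2)] pact_linear[OF A, THEN clinear_simps(3)]\<close>)
  qed
  then show ?thesis using p by blast
qed

subsection \<open>Generalized eigenvectors and the resolvent\<close>

text \<open>
  On generalized eigenvectors at \<open>l\<close> this is the nilpotent part of \<open>A\<close>.
\<close>

definition nil :: "('a::complex_vector \<Rightarrow> 'a) \<Rightarrow> complex \<Rightarrow> 'a \<Rightarrow> 'a" where
  "nil A l x = A x - l *\<^sub>C x"

lemma nil_linear: "clinear A \<Longrightarrow> clinear (nil A l)"
  by (simp add: clinear_iff nil_def scaleC_add_right scaleC_scaleC mult.commute complex_vector.scale_right_diff_distrib)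

lemma funpow_linear:
  fixes A :: "'a::complex_vector \<Rightarrow> 'a"
  shows "clinear A \<Longrightarrow> clinear (A ^^ k)"
  by (induction k) (simp_all add: clinear_iff)

text \<open>
  The geometric series of the resolvent is finite on a generalized eigenvector.
\<close>

lemma resolvent_series:
  assumes A: "clinear A" and w: "w \<noteq> l" and K: "(nil A l ^^ K) x = 0"
  shows "w *\<^sub>C (\<Sum>k<K. (1 / (w - l) ^ Suc k) *\<^sub>C (nil A l ^^ k) x)
    - A (\<Sum>k<K. (1 / (w - l) ^ Suc k) *\<^sub>C (nil A l ^^ k) x) = x"
proof -
  let ?u = "\<Sum>k<K. (1 / (w - l) ^ Suc k) *\<^sub>C (nil A l ^^ k) x"
  have "w *\<^sub>C ?u - A ?u = (w - l) *\<^sub>C ?u - nil A l ?u"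
    by (simp add: nil_def complex_vector.scale_left_diff_distrib)
  also have "(w - l) *\<^sub>C ?u = (\<Sum>k<K. (1 / (w - l) ^ k) *\<^sub>C (nil A l ^^ k) x)"
    using w by (simp add: complex_vector.scale_sum_right scaleC_scaleC)
  also have "nil A l ?u = (\<Sum>k<K. (1 / (w - l) ^ Suc k) *\<^sub>C (nil A l ^^ Suc k) x)"
    by (simp add: clinear_simps[OF nil_linear[OF A]])
  also have "(\<Sum>k<K. (1 / (w - l) ^ k) *\<^sub>C (nil A l ^^ k) x) - (\<Sum>k<K. (1 / (w - l) ^ Suc k) *\<^sub>C (nil A l ^^ Suc k) x)
     = (1 / (w - l) ^ 0) *\<^sub>C (nil A l ^^ 0) x - (1 / (w - l) ^ K) *\<^sub>C (nil A l ^^ K) x"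
    by (simp only: sum_subtractf[symmetric] sum_lessThan_telescope'[of "\<lambda>k. (1 / (w - l) ^ k) *\<^sub>C (nil A l ^^ k) x"])
  also have "\<dots> = x" using K by (simp add: scaleC_one)
  finally show ?thesis .
qed

locale invariant_subspace =
  fixes V :: "'a::complex_vector set" and A :: "'a \<Rightarrow> 'a"
  assumes fin_dim: "fin_dim_space TYPE('a)" and lin: "clinear A"
    and subsp: "complex_vector.subspace V" and inv: "\<And>x. x \<in> V \<Longrightarrow> A x \<in> V"
begin

lemma V_simps: "0 \<in> V" "x \<in> V \<Longrightarrow> y \<in> V \<Longrightarrow> x + y \<in> V" "x \<in> V \<Longrightarrow> c *\<^sub>C x \<in> V"
  "x \<in> V \<Longrightarrow> y \<in> V \<Longrightarrow> x - y \<in> V" "(\<And>i. i \<in> I \<Longrightarrow> f i \<in> V) \<Longrightarrow> (\<Sum>i\<in>I. f i) \<in> V"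
  using subsp by (auto intro: complex_vector.subspace_0 complex_vector.subspace_add complex_vector.subspace_scale
      complex_vector.subspace_diff complex_vector.subspace_sum)

lemma nil_in: "x \<in> V \<Longrightarrow> (nil A l ^^ k) x \<in> V"
  by (induction k) (auto simp: nil_def intro: V_simps inv)

lemma nil_mono: "(nil A l ^^ K) x = 0 \<Longrightarrow> K \<le> K' \<Longrightarrow> (nil A l ^^ K') x = 0"
proof -
  assume K: "(nil A l ^^ K) x = 0" "K \<le> K'"
  have "(nil A l ^^ K') x = (nil A l ^^ (K' - K)) ((nil A l ^^ K) x)"
    using K(2) by (simp add: funpow_add[symmetric, THEN fun_cong, simplified])
  then show ?thesis using K by (simp add: clinear_simps[OF funpow_linear[OF nil_linear[OF lin]]])
qed

inductive gsum :: "'a \<Rightarrow> bool" where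
  gev: "x \<in> V \<Longrightarrow> (nil A l ^^ K) x = 0 \<Longrightarrow> gsum x"
| plus: "gsum x \<Longrightarrow> gsum y \<Longrightarrow> gsum (x + y)"

lemma gsum_in: "gsum x \<Longrightarrow> x \<in> V"
  by (induction rule: gsum.induct) (auto intro: V_simps)

text \<open>
  \<open>A - l\<close> is invertible on the generalized eigenvectors at the other eigenvalues, so it misses only those at \<open>l\<close>.
\<close>

lemma gsum_split:
  assumes "gsum y"
  shows "\<exists>y' z K. gsum y' \<and> z \<in> V \<and> (nil A l ^^ K) z = 0 \<and> y = nil A l y' + z"
  using assms
proof induction
  case (gev x m K)
  show ?case
  proof (cases "m = l")
    case True
    have "gsum 0" using gsum.gev[of 0 0 0] V_simps by (simp add: id_def)
    then show ?thesis using gev True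
      by (intro exI[of _ 0] exI[of _ x] exI[of _ K]) (simp add: clinear_simps[OF nil_linear[OF lin]])
  next
    case False
    define u where "u = (\<Sum>k<K. (1 / (l - m) ^ Suc k) *\<^sub>C (nil A m ^^ k) x)"
    have "l *\<^sub>C u - A u = x" unfolding u_def by (rule resolvent_series[OF lin _ gev(2)]) (use False in simp)
    then have e: "x = nil A l (- u)" by (auto simp: nil_def clinear_simps[OF lin])
    have uV: "u \<in> V" unfolding u_def by (intro V_simps nil_in gev)
    have com: "(nil A m ^^ K) ((nil A m ^^ k) x) = 0" for k
      using nil_mono[OF gev(2), of "K + k"] by (simp add: funpow_add)
    have "(nil A m ^^ K) u = 0"
      unfolding u_def using com by (simp add: clinear_simps[OF funpow_linear[OF nil_linear[OF lin]]])
    then have "(nil A m ^^ K) (- u) = 0" by (simp add: clinear_simps[OF funpow_linear[OF nil_linear[OF lin]]])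
    moreover have "- u \<in> V" using V_simps(4)[OF V_simps(1) uV] by simp
    ultimately have "gsum (- u)" by (rule gsum.gev[rotated])
    then show ?thesis using e V_simps(1) by (intro exI[of _ "- u"] exI[of _ 0] exI[of _ 0]) simp
  qed
next
  case (plus x y)
  then obtain x' z K y' z' K' where
    1: "gsum x'" "z \<in> V" "(nil A l ^^ K) z = 0" "x = nil A l x' + z" and
    2: "gsum y'" "z' \<in> V" "(nil A l ^^ K') z' = 0" "y = nil A l y' + z'" by blast
  have "(nil A l ^^ max K K') (z + z') = 0"
    using nil_mono[OF 1(3), of "max K K'"] nil_mono[OF 2(3), of "max K K'"]
    by (simp add: clinear_simps[OF funpow_linear[OF nil_linear[OF lin]]])
  moreover have "x + y = nil A l (x' + y') + (z + z')"
    using 1 2 by (simp add: clinear_simps[OF nil_linear[OF lin]])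
  ultimately show ?case using gsum.plus[OF 1(1) 2(1)] V_simps(2)[OF 1(2) 2(2)] by blast
qed

text \<open>
  Induction on the degree of a polynomial annihilating \<open>x\<close>: for a root \<open>l\<close> the vector \<open>(A - l) x\<close> is annihilated by a polynomial of
  smaller degree, and \<open>gsum_split\<close> removes the factor \<open>A - l\<close> up to a generalized eigenvector at \<open>l\<close>.
\<close>

lemma gsum_all: "x \<in> V \<Longrightarrow> gsum x"
proof -
  have main: "pact p A x = 0 \<Longrightarrow> p \<noteq> 0 \<Longrightarrow> x \<in> V \<Longrightarrow> gsum x" if "degree p = n" for n p x
    using that
  proof (induction n arbitrary: p x)
    case 0
    then obtain a where a: "p = [:a:]" by (auto elim: degree_eq_zeroE)
    then have "a \<noteq> 0" "a *\<^sub>C x = 0" using 0 by (auto simp: pact_pCons)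
    then have "x = 0" by (simp add: complex_vector.scale_eq_0_iff)
    then show ?case using gsum.gev[of 0 0 0] V_simps by simp
  next
    case (Suc n)
    have "\<not> constant (poly p)" using Suc by (simp add: constant_degree)
    then obtain l where "poly p l = 0" using fundamental_theorem_of_algebra by blast
    then obtain q where q: "p = [:- l, 1:] * q" by (auto simp: poly_eq_0_iff_dvd)
    have q0: "q \<noteq> 0" using q Suc by auto
    have "degree p = Suc (degree q)" unfolding q using q0 by (subst degree_mult_eq) auto
    then have dq: "degree q = n" using Suc by simp
    have "pact (q * [:- l, 1:]) A x = 0" using Suc q by (simp only: mult.commute)
    then have "pact q A (pact [:- l, 1:] A x) = 0" by (simp only: pact_mult[OF lin])
    moreover have "pact [:- l, 1:] A x = nil A l x" by (simp add: pact_pCons nil_def scaleC_one)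
    ultimately have "pact q A (nil A l x) = 0" by simp
    then have "gsum (nil A l x)"
      using Suc.IH[of q "nil A l x"] dq q0 nil_in[OF Suc.prems(3), where l = l and k = 1] by simp
    then obtain y' z K where y: "gsum y'" "z \<in> V" "(nil A l ^^ K) z = 0" "nil A l x = nil A l y' + z"
      using gsum_split by blast
    have "(nil A l ^^ Suc K) (x - y') = 0"
      using y by (simp add: funpow_Suc_right clinear_simps[OF nil_linear[OF lin]] del: funpow.simps)
    moreover have "x - y' \<in> V" using V_simps(4)[OF Suc.prems(3) gsum_in[OF y(1)]] .
    ultimately have "gsum (x - y')" by (rule gsum.gev[rotated])
    from gsum.plus[OF y(1) this] show ?case by simp
  qed
  assume "x \<in> V"
  moreover obtain p where "p \<noteq> 0" "pact p A x = 0" using pact_annihilates_vector[OF fin_dim] by blast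
  ultimately show ?thesis using main by blast
qed

text \<open>
  Linear statements about \<open>V\<close> need to be checked on generalized eigenvectors only, where resolvent and functional calculus
  are explicit finite sums.
\<close>

lemma gev_induct [consumes 1, case_names gev plus]:
  assumes "x \<in> V"
    and "\<And>l K x. x \<in> V \<Longrightarrow> (nil A l ^^ K) x = 0 \<Longrightarrow> P x"
    and "\<And>x y. x \<in> V \<Longrightarrow> y \<in> V \<Longrightarrow> P x \<Longrightarrow> P y \<Longrightarrow> P (x + y)"
  shows "P x"
  using gsum_all[OF assms(1)] by induction (auto intro: assms gsum_in)

definition eig :: "complex \<Rightarrow> bool" where
  "eig l \<longleftrightarrow> (\<exists>x\<in>V. x \<noteq> 0 \<and> A x = l *\<^sub>C x)"

lemma gev_eig:
  assumes "x \<in> V" "x \<noteq> 0" "(nil A l ^^ K) x = 0"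
  shows "eig l"
proof -
  define k where "k = (LEAST k. (nil A l ^^ k) x = 0)"
  have k: "(nil A l ^^ k) x = 0" unfolding k_def using assms(3) by (rule LeastI)
  then obtain j where j: "k = Suc j" using assms(2) by (cases k) auto
  then have "(nil A l ^^ j) x \<noteq> 0" using not_less_Least[of j "\<lambda>k. (nil A l ^^ k) x = 0"] k_def by auto
  moreover have "A ((nil A l ^^ j) x) = l *\<^sub>C (nil A l ^^ j) x" using k j by (simp add: nil_def)
  ultimately show ?thesis unfolding eig_def using nil_in[OF assms(1)] by blast
qed

lemma finite_eig: "finite {l. eig l}"
proof -
  obtain p where p: "p \<noteq> 0" "\<And>x. pact p A x = 0" using pact_annihilates[OF fin_dim lin] by blast
  have "{l. eig l} \<subseteq> {l. poly p l = 0}"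
  proof
    fix l assume "l \<in> {l. eig l}"
    then obtain x where x: "x \<noteq> 0" "A x = l *\<^sub>C x" by (auto simp: eig_def)
    then show "l \<in> {l. poly p l = 0}"
      using p(2)[of x] pact_eigenvector[OF x(2) lin, of p] by (simp add: complex_vector.scale_eq_0_iff)
  qed
  then show ?thesis using poly_roots_finite[OF p(1)] finite_subset by blast
qed

text \<open>
  Injectivity is clear; a preimage of a generalized eigenvector is given by its resolvent series.
\<close>

lemma bij_resolvent: "\<not> eig w \<Longrightarrow> bij_betw (\<lambda>v. w *\<^sub>C v - A v) V V"
proof (rule bij_betw_imageI)
  assume w: "\<not> eig w"
  show "inj_on (\<lambda>v. w *\<^sub>C v - A v) V"
  proof (rule inj_onI)
    fix x y assume xy: "x \<in> V" "y \<in> V" "w *\<^sub>C x - A x = w *\<^sub>C y - A y"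
    then have "A (x - y) = w *\<^sub>C (x - y)"
      by (simp add: clinear_simps[OF lin] complex_vector.scale_right_diff_distrib algebra_simps)
    then show "x = y" using w V_simps(4)[OF xy(1,2)] by (auto simp: eig_def)
  qed
  show "(\<lambda>v. w *\<^sub>C v - A v) ` V = V"
  proof
    show "(\<lambda>v. w *\<^sub>C v - A v) ` V \<subseteq> V" by (auto intro: V_simps inv)
    show "V \<subseteq> (\<lambda>v. w *\<^sub>C v - A v) ` V"
    proof
      fix x assume "x \<in> V"
      then show "x \<in> (\<lambda>v. w *\<^sub>C v - A v) ` V"
      proof (induction rule: gev_induct)
        case (gev l K x)
        show ?case
        proof (cases "x = 0")
          case True
          then show ?thesis using V_simps(1) by (intro image_eqI[of _ _ 0]) (auto simp: clinear_simps[OF lin])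
        next
          case False
          then have "w \<noteq> l" using gev_eig[OF gev(1) False gev(2)] w by auto
          from resolvent_series[OF lin this gev(2)] show ?thesis
            by (intro image_eqI[OF sym]) (auto intro!: V_simps nil_in gev)
        qed
      next
        case (plus x y)
        then obtain u v where "u \<in> V" "v \<in> V" "x = w *\<^sub>C u - A u" "y = w *\<^sub>C v - A v" by blast
        then show ?case
          by (intro image_eqI[of _ _ "u + v"]) (auto simp: clinear_simps[OF lin] scaleC_add_right intro: V_simps)
      qed
    qed
  qed
qed

lemma spectrum_eig: "spectrum_on V A = {l. eig l}"
proof -
  have "\<not> bij_betw (\<lambda>v. l *\<^sub>C v - A v) V V" if e: "eig l" for l
  proof
    assume b: "bij_betw (\<lambda>v. l *\<^sub>C v - A v) V V"
    obtain x where x: "x \<in> V" "x \<noteq> 0" "A x = l *\<^sub>C x" using e by (auto simp: eig_def)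
    then have "l *\<^sub>C x - A x = l *\<^sub>C 0 - A 0" by (simp add: clinear_simps[OF lin])
    then show False using b x V_simps(1) by (auto simp: bij_betw_def inj_on_def)
  qed
  then show ?thesis using bij_resolvent by (auto simp: spectrum_on_def)
qed

lemma finite_spectrum: "finite (spectrum_on V A)"
  using finite_eig by (simp add: spectrum_eig)

definition rs :: "complex \<Rightarrow> 'a \<Rightarrow> 'a" where
  "rs w x = inv_into V (\<lambda>u. w *\<^sub>C u - A u) x"

lemma rs_bij: "w \<notin> spectrum_on V A \<Longrightarrow> bij_betw (\<lambda>v. w *\<^sub>C v - A v) V V"
  by (simp add: spectrum_on_def)

lemma rs_in: "w \<notin> spectrum_on V A \<Longrightarrow> x \<in> V \<Longrightarrow> rs w x \<in> V"
  unfolding rs_def using rs_bij[of w] by (metis bij_betw_def inv_into_into)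

lemma rs_eq: "w \<notin> spectrum_on V A \<Longrightarrow> x \<in> V \<Longrightarrow> w *\<^sub>C rs w x - A (rs w x) = x"
  unfolding rs_def using bij_betw_inv_into_right[OF rs_bij[of w]] by blast

lemma rs_unique: "w \<notin> spectrum_on V A \<Longrightarrow> u \<in> V \<Longrightarrow> w *\<^sub>C u - A u = x \<Longrightarrow> rs w x = u"
  unfolding rs_def using bij_betw_inv_into_left[OF rs_bij[of w]] by blast

lemma rs_add: "w \<notin> spectrum_on V A \<Longrightarrow> x \<in> V \<Longrightarrow> y \<in> V \<Longrightarrow> rs w (x + y) = rs w x + rs w y"
proof (rule rs_unique)
  assume a: "w \<notin> spectrum_on V A" "x \<in> V" "y \<in> V"
  show "w *\<^sub>C (rs w x + rs w y) - A (rs w x + rs w y) = x + y"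
    using rs_eq[OF a(1,2)] rs_eq[OF a(1,3)] by (simp add: clinear_simps[OF lin] scaleC_add_right algebra_simps)
qed (auto intro: V_simps rs_in)

lemma rs_scale: "w \<notin> spectrum_on V A \<Longrightarrow> x \<in> V \<Longrightarrow> rs w (c *\<^sub>C x) = c *\<^sub>C rs w x"
proof (rule rs_unique)
  assume a: "w \<notin> spectrum_on V A" "x \<in> V"
  show "w *\<^sub>C (c *\<^sub>C rs w x) - A (c *\<^sub>C rs w x) = c *\<^sub>C x"
    using arg_cong[OF rs_eq[OF a], of "scaleC c"]
    by (simp add: clinear_simps[OF lin] scaleC_scaleC mult.commute complex_vector.scale_right_diff_distrib)
qed (auto intro: V_simps rs_in)

lemma rs_sum: "w \<notin> spectrum_on V A \<Longrightarrow> (\<And>i. i \<in> I \<Longrightarrow> f i \<in> V) \<Longrightarrow> rs w (\<Sum>i\<in>I. f i) = (\<Sum>i\<in>I. rs w (f i))"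
proof (induction I rule: infinite_finite_induct)
  case (insert i I)
  then show ?case by (simp add: rs_add V_simps)
qed (use rs_scale[of w 0 0] V_simps in auto)

lemma rs_gev:
  assumes w: "w \<notin> spectrum_on V A" and x: "x \<in> V" "(nil A l ^^ K) x = 0"
  shows "rs w x = (\<Sum>k<K. (1 / (w - l) ^ Suc k) *\<^sub>C (nil A l ^^ k) x)"
proof (cases "x = 0")
  case True
  then show ?thesis using rs_scale[OF w V_simps(1), of 0]
    by (simp add: clinear_simps[OF funpow_linear[OF nil_linear[OF lin]]])
next
  case False
  then have "w \<noteq> l" using w gev_eig[OF x(1) _ x(2)] by (auto simp: spectrum_eig)
  then show ?thesis
    by (intro rs_unique[OF w] resolvent_series[OF lin _ x(2)]) (auto intro!: V_simps nil_in x)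
qed

end

section \<open>The holomorphic functional calculus\<close>

locale holomorphic_calculus = invariant_subspace V A
  for V :: "'a::complex_vector set" and A :: "'a \<Rightarrow> 'a" +
  fixes D :: "complex set" and H :: "complex \<Rightarrow> complex"
  assumes openD: "open D" and hol: "H holomorphic_on D" and spec: "spectrum_on V A \<subseteq> D"
begin

text \<open>
  The Taylor series of \<open>H\<close> at \<open>l\<close> in the nilpotent part of \<open>A\<close>.
\<close>

definition hc_series :: "complex \<Rightarrow> nat \<Rightarrow> 'a \<Rightarrow> 'a" where
  "hc_series l K x = (\<Sum>k<K. ((deriv ^^ k) H l / fact k) *\<^sub>C (nil A l ^^ k) x)"

text \<open>
  The centres need not be eigenvalues of \<open>A\<close>: when \<open>A\<close> is varied, the discs around the eigenvalues of the
  unperturbed operator are kept.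
\<close>

definition admissible :: "complex set \<Rightarrow> real \<Rightarrow> bool" where
  "admissible C \<rho> \<longleftrightarrow> finite C \<and> 0 < \<rho> \<and> (\<forall>c\<in>C. cball c \<rho> \<subseteq> D \<and> sphere c \<rho> \<inter> spectrum_on V A = {})
     \<and> (\<forall>l\<in>spectrum_on V A. \<exists>!c. c \<in> C \<and> l \<in> ball c \<rho>)"

lemma cauchy_disc:
  assumes \<rho>: "0 < \<rho>" and c: "cball c \<rho> \<subseteq> D" and l: "l \<notin> sphere c \<rho>"
  shows "((\<lambda>w. H w / (w - l) ^ Suc k) has_contour_integral
     (if l \<in> ball c \<rho> then 2 * pi * \<i> * ((deriv ^^ k) H l / fact k) else 0)) (circlepath c \<rho>)"
proof (cases "l \<in> ball c \<rho>")
  case True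
  have "((\<lambda>w. H w / (w - l) ^ Suc k) has_contour_integral ((2 * pi * \<i>) / (fact k) * (deriv ^^ k) H l)) (circlepath c \<rho>)"
    by (rule Cauchy_has_contour_integral_higher_derivative_circlepath[OF _ _ True])
      (use holomorphic_on_imp_continuous_on[OF holomorphic_on_subset[OF hol c]]
        holomorphic_on_subset[OF hol order.trans[OF ball_subset_cball c]] in auto)
  then show ?thesis using True by simp
next
  case False
  then have n: "l \<notin> cball c \<rho>" using l by (auto simp: ball_def cball_def sphere_def)
  have h: "(\<lambda>w. H w / (w - l) ^ Suc k) holomorphic_on D - {l}"
    by (intro holomorphic_intros holomorphic_on_subset[OF hol]) auto
  have sub: "cball c \<rho> \<subseteq> D - {l}" using c n by auto
  have o: "open (D - {l})" using openD by (simp add: open_Diff)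
  have "((\<lambda>w. H w / (w - l) ^ Suc k) has_contour_integral 0) (circlepath c \<rho>)"
  proof (rule Cauchy_theorem_convex[where S = "cball c \<rho>" and K = "{}"])
    show "continuous_on (cball c \<rho>) (\<lambda>w. H w / (w - l) ^ Suc k)"
      using holomorphic_on_imp_continuous_on[OF h] sub by (rule continuous_on_subset)
    fix x assume "x \<in> interior (cball c \<rho>) - {}"
    then have "x \<in> D - {l}" using sub interior_subset by blast
    then show "(\<lambda>w. H w / (w - l) ^ Suc k) field_differentiable at x"
      using h o holomorphic_on_imp_differentiable_at by blast
  qed (use \<rho> in auto)
  then show ?thesis using False by simp
qed

text \<open>
  The resolvent series turns the contour integral into Cauchy integrals for the Taylor coefficients of \<open>H\<close>.
\<close>

lemma circle_gev:
  assumes \<rho>: "0 < \<rho>" and c: "cball c \<rho> \<subseteq> D" "sphere c \<rho> \<inter> spectrum_on V A = {}"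
    and x: "x \<in> V" "(nil A l ^^ K) x = 0" and \<phi>: "cfunctional \<phi>"
  shows "((\<lambda>w. \<phi> (H w *\<^sub>C rs w x)) has_contour_integral \<phi> (if l \<in> ball c \<rho> then (2 * pi * \<i>) *\<^sub>C hc_series l K x else 0)) (circlepath c \<rho>)"
proof -
  have pi: "path_image (circlepath c \<rho>) = sphere c \<rho>" using \<rho> by simp
  have rs: "rs w x = (\<Sum>k<K. (1 / (w - l) ^ Suc k) *\<^sub>C (nil A l ^^ k) x)" if "w \<in> path_image (circlepath c \<rho>)" for w
    by (rule rs_gev[OF _ x]) (use that c(2) pi in auto)
  show ?thesis
  proof (cases "x = 0")
    case True
    have "hc_series l K x = 0" using True by (simp add: hc_series_def clinear_simps[OF funpow_linear[OF nil_linear[OF lin]]])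
    moreover have "((\<lambda>w. \<phi> (H w *\<^sub>C rs w x)) has_contour_integral 0) (circlepath c \<rho>)"
    proof (rule has_contour_integral_eq[OF has_contour_integral_0])
      fix w assume "w \<in> path_image (circlepath c \<rho>)"
      then have "w \<notin> spectrum_on V A" using c(2) unfolding pi by blast
      then have "rs w x = 0" using rs_scale[of w 0 0] V_simps(1) True by simp
      then show "0 = \<phi> (H w *\<^sub>C rs w x)" by (simp add: cfunctional_simps[OF \<phi>])
    qed
    ultimately show ?thesis by (simp add: cfunctional_simps[OF \<phi>])
  next
    case False
    then have "l \<in> spectrum_on V A" using gev_eig[OF x(1) _ x(2)] by (simp add: spectrum_eig)
    then have l: "l \<notin> sphere c \<rho>" using c(2) by blast
    have "((\<lambda>w. \<Sum>k<K. \<phi> ((nil A l ^^ k) x) * (H w / (w - l) ^ Suc k)) has_contour_integral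
      (\<Sum>k<K. \<phi> ((nil A l ^^ k) x) * (if l \<in> ball c \<rho> then 2 * pi * \<i> * ((deriv ^^ k) H l / fact k) else 0))) (circlepath c \<rho>)"
      by (intro has_contour_integral_sum has_contour_integral_lmul cauchy_disc \<rho> c l) auto
    also have "(\<Sum>k<K. \<phi> ((nil A l ^^ k) x) * (if l \<in> ball c \<rho> then 2 * pi * \<i> * ((deriv ^^ k) H l / fact k) else 0))
      = \<phi> (if l \<in> ball c \<rho> then (2 * pi * \<i>) *\<^sub>C hc_series l K x else 0)"
      by (auto simp: hc_series_def cfunctional_simps[OF \<phi>] sum_distrib_left mult_ac)
    finally show ?thesis
      by (rule has_contour_integral_eq)
        (simp add: rs cfunctional_simps[OF \<phi>] sum_distrib_left mult_ac)
  qed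
qed

definition circle_int :: "complex \<Rightarrow> real \<Rightarrow> 'a \<Rightarrow> 'a" where
  "circle_int c \<rho> x = vec_contour_integral (circlepath c \<rho>) (\<lambda>w. H w *\<^sub>C rs w x)"

lemma circle_int_unique:
  assumes "\<And>\<phi>. cfunctional \<phi> \<Longrightarrow> ((\<lambda>w. \<phi> (H w *\<^sub>C rs w x)) has_contour_integral \<phi> I) (circlepath c \<rho>)"
  shows "circle_int c \<rho> x = I"
  unfolding circle_int_def vec_contour_integral_def
proof (rule the_equality)
  show "\<forall>\<phi>. cfunctional \<phi> \<longrightarrow> ((\<lambda>w. \<phi> (H w *\<^sub>C rs w x)) has_contour_integral \<phi> I) (circlepath c \<rho>)"
    using assms by blast
  fix J assume "\<forall>\<phi>. cfunctional \<phi> \<longrightarrow> ((\<lambda>w. \<phi> (H w *\<^sub>C rs w x)) has_contour_integral \<phi> J) (circlepath c \<rho>)"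
  then show "J = I" using assms has_contour_integral_unique by (intro functional_separates) blast
qed

lemma circle_int_ex:
  assumes \<rho>: "0 < \<rho>" and c: "cball c \<rho> \<subseteq> D" "sphere c \<rho> \<inter> spectrum_on V A = {}" and x: "x \<in> V"
  shows "\<exists>I. I \<in> V \<and> (\<forall>\<phi>. cfunctional \<phi> \<longrightarrow> ((\<lambda>w. \<phi> (H w *\<^sub>C rs w x)) has_contour_integral \<phi> I) (circlepath c \<rho>))"
  using x
proof (induction rule: gev_induct)
  case (gev l K x)
  have "(if l \<in> ball c \<rho> then (2 * pi * \<i>) *\<^sub>C hc_series l K x else 0) \<in> V"
    using nil_in[OF gev(1)] by (auto simp: hc_series_def intro!: V_simps)
  then show ?case using circle_gev[OF \<rho> c gev] by blast
next
  case (plus x y)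
  then obtain I J where IJ: "I \<in> V" "J \<in> V"
    "\<And>\<phi>. cfunctional \<phi> \<Longrightarrow> ((\<lambda>w. \<phi> (H w *\<^sub>C rs w x)) has_contour_integral \<phi> I) (circlepath c \<rho>)"
    "\<And>\<phi>. cfunctional \<phi> \<Longrightarrow> ((\<lambda>w. \<phi> (H w *\<^sub>C rs w y)) has_contour_integral \<phi> J) (circlepath c \<rho>)" by blast
  have "((\<lambda>w. \<phi> (H w *\<^sub>C rs w (x + y))) has_contour_integral \<phi> (I + J)) (circlepath c \<rho>)" if \<phi>: "cfunctional \<phi>" for \<phi>
    unfolding cfunctional_simps(1)[OF \<phi>]
  proof (rule has_contour_integral_eq[OF has_contour_integral_add[OF IJ(3)[OF \<phi>] IJ(4)[OF \<phi>]]])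
    fix w assume "w \<in> path_image (circlepath c \<rho>)"
    then have "w \<notin> spectrum_on V A" using c(2) \<rho> by auto
    then show "\<phi> (H w *\<^sub>C rs w x) + \<phi> (H w *\<^sub>C rs w y) = \<phi> (H w *\<^sub>C rs w (x + y))"
      by (simp add: rs_add plus cfunctional_simps[OF \<phi>] algebra_simps)
  qed
  then show ?case using V_simps(2)[OF IJ(1,2)] by blast
qed

lemma circle_int:
  assumes \<rho>: "0 < \<rho>" and c: "cball c \<rho> \<subseteq> D" "sphere c \<rho> \<inter> spectrum_on V A = {}" and x: "x \<in> V"
  shows "circle_int c \<rho> x \<in> V"
    and "cfunctional \<phi> \<Longrightarrow> ((\<lambda>w. \<phi> (H w *\<^sub>C rs w x)) has_contour_integral \<phi> (circle_int c \<rho> x)) (circlepath c \<rho>)"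
proof -
  obtain I where I: "I \<in> V" "\<And>\<phi>. cfunctional \<phi> \<Longrightarrow> ((\<lambda>w. \<phi> (H w *\<^sub>C rs w x)) has_contour_integral \<phi> I) (circlepath c \<rho>)"
    using circle_int_ex[OF assms] by blast
  have "circle_int c \<rho> x = I" by (rule circle_int_unique[OF I(2)])
  then show "circle_int c \<rho> x \<in> V"
    and "cfunctional \<phi> \<Longrightarrow> ((\<lambda>w. \<phi> (H w *\<^sub>C rs w x)) has_contour_integral \<phi> (circle_int c \<rho> x)) (circlepath c \<rho>)"
    using I by simp_all
qed

lemma circle_int_add:
  assumes \<rho>: "0 < \<rho>" and c: "cball c \<rho> \<subseteq> D" "sphere c \<rho> \<inter> spectrum_on V A = {}" and x: "x \<in> V" "y \<in> V"
  shows "circle_int c \<rho> (x + y) = circle_int c \<rho> x + circle_int c \<rho> y"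
proof (rule circle_int_unique)
  fix \<phi> :: "'a \<Rightarrow> complex" assume \<phi>: "cfunctional \<phi>"
  show "((\<lambda>w. \<phi> (H w *\<^sub>C rs w (x + y))) has_contour_integral \<phi> (circle_int c \<rho> x + circle_int c \<rho> y)) (circlepath c \<rho>)"
    unfolding cfunctional_simps(1)[OF \<phi>]
  proof (rule has_contour_integral_eq[OF has_contour_integral_add[OF circle_int(2)[OF \<rho> c x(1) \<phi>] circle_int(2)[OF \<rho> c x(2) \<phi>]]])
    fix w assume "w \<in> path_image (circlepath c \<rho>)"
    then have "w \<notin> spectrum_on V A" using c(2) \<rho> by auto
    then show "\<phi> (H w *\<^sub>C rs w x) + \<phi> (H w *\<^sub>C rs w y) = \<phi> (H w *\<^sub>C rs w (x + y))"
      by (simp add: rs_add x cfunctional_simps[OF \<phi>] algebra_simps)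
  qed
qed

definition circles_int :: "complex set \<Rightarrow> real \<Rightarrow> 'a \<Rightarrow> 'a" where
  "circles_int C \<rho> x = (1 / (2 * pi * \<i>)) *\<^sub>C (\<Sum>c\<in>C. circle_int c \<rho> x)"

lemma circles_int_gev:
  assumes C: "admissible C \<rho>" and x: "x \<in> V" "(nil A l ^^ K) x = 0"
  shows "circles_int C \<rho> x = hc_series l K x"
proof -
  have v: "circle_int c \<rho> x = (if l \<in> ball c \<rho> then (2 * pi * \<i>) *\<^sub>C hc_series l K x else 0)" if "c \<in> C" for c
    by (rule circle_int_unique, rule circle_gev) (use C that x in \<open>auto simp: admissible_def\<close>)
  show ?thesis
  proof (cases "x = 0")
    case True
    then have "hc_series l K x = 0" by (simp add: hc_series_def clinear_simps[OF funpow_linear[OF nil_linear[OF lin]]])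
    then show ?thesis by (simp add: circles_int_def v cong: if_cong)
  next
    case False
    then have "l \<in> spectrum_on V A" using gev_eig[OF x(1) _ x(2)] by (simp add: spectrum_eig)
    then obtain c where c: "c \<in> C" "l \<in> ball c \<rho>" "\<And>c'. c' \<in> C \<Longrightarrow> l \<in> ball c' \<rho> \<Longrightarrow> c' = c"
      using C unfolding admissible_def by blast
    have "(\<Sum>c\<in>C. circle_int c \<rho> x) = (\<Sum>c'\<in>C. if c' = c then (2 * pi * \<i>) *\<^sub>C hc_series l K x else 0)"
    proof (rule sum.cong[OF refl])
      fix c' assume c': "c' \<in> C"
      have "l \<in> ball c' \<rho> \<longleftrightarrow> c' = c" using c(2) c(3)[OF c'] by blast
      then show "circle_int c' \<rho> x = (if c' = c then (2 * pi * \<i>) *\<^sub>C hc_series l K x else 0)"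
        by (simp only: v[OF c'])
    qed
    also have "\<dots> = (2 * pi * \<i>) *\<^sub>C hc_series l K x" using C c(1) by (simp add: admissible_def)
    finally show ?thesis by (simp add: circles_int_def scaleC_scaleC scaleC_one)
  qed
qed

lemma circles_int_add:
  assumes C: "admissible C \<rho>" and x: "x \<in> V" "y \<in> V"
  shows "circles_int C \<rho> (x + y) = circles_int C \<rho> x + circles_int C \<rho> y"
proof -
  have "circle_int c \<rho> (x + y) = circle_int c \<rho> x + circle_int c \<rho> y" if "c \<in> C" for c
    by (rule circle_int_add) (use C that x in \<open>auto simp: admissible_def\<close>)
  then show ?thesis by (simp add: circles_int_def sum.distrib scaleC_add_right)
qed

text \<open>
  On generalized eigenvectors the integral is the Taylor series \<open>hc_series\<close> for every admissible system of discs.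
\<close>

lemma circles_int_unique:
  assumes "admissible C \<rho>" "admissible C' \<rho>'" "x \<in> V"
  shows "circles_int C \<rho> x = circles_int C' \<rho>' x"
  using assms(3) by (induction rule: gev_induct) (simp_all add: circles_int_gev[OF assms(1)] circles_int_gev[OF assms(2)] circles_int_add[OF assms(1)] circles_int_add[OF assms(2)])

text \<open>
  This makes the choice of a radius in \<open>hol_calculus\<close> meaningful.
\<close>

lemma small_discs:
  "\<exists>\<epsilon>>0. \<forall>l\<in>spectrum_on V A. cball l \<epsilon> \<subseteq> D \<and> cball l \<epsilon> \<inter> spectrum_on V A = {l}"
proof -
  have "\<exists>e>0. cball l e \<subseteq> D - (spectrum_on V A - {l})" if "l \<in> spectrum_on V A" for l
  proof -
    have "open (D - (spectrum_on V A - {l}))"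
      by (rule open_Diff[OF openD finite_imp_closed]) (simp add: finite_spectrum)
    moreover have "l \<in> D - (spectrum_on V A - {l})" using that spec by auto
    ultimately show ?thesis by (rule open_contains_cball[THEN iffD1, rule_format])
  qed
  then obtain e where e: "\<And>l. l \<in> spectrum_on V A \<Longrightarrow> e l > 0 \<and> cball l (e l) \<subseteq> D - (spectrum_on V A - {l})"
    by metis
  define \<epsilon> where "\<epsilon> = Min (insert 1 (e ` spectrum_on V A))"
  have 1: "\<epsilon> > 0" unfolding \<epsilon>_def using e finite_spectrum by (subst Min_gr_iff) auto
  have "cball l \<epsilon> \<subseteq> D \<and> cball l \<epsilon> \<inter> spectrum_on V A = {l}" if l: "l \<in> spectrum_on V A" for l
  proof -
    have "\<epsilon> \<le> e l" unfolding \<epsilon>_def using l finite_spectrum by (intro Min_le) auto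
    then have "cball l \<epsilon> \<subseteq> D - (spectrum_on V A - {l})" using e[OF l] subset_cball by blast
    then show ?thesis using l 1 by auto
  qed
  then show ?thesis using 1 by blast
qed

lemma hol_calculus_circles:
  assumes C: "admissible C \<rho>" and x: "x \<in> V"
  shows "hol_calculus V D H A x = circles_int C \<rho> x"
proof -
  define \<epsilon> where "\<epsilon> = (SOME \<epsilon>. 0 < \<epsilon> \<and> (\<forall>l\<in>spectrum_on V A. cball l \<epsilon> \<subseteq> D \<and> cball l \<epsilon> \<inter> spectrum_on V A = {l}))"
  have e: "0 < \<epsilon> \<and> (\<forall>l\<in>spectrum_on V A. cball l \<epsilon> \<subseteq> D \<and> cball l \<epsilon> \<inter> spectrum_on V A = {l})"
    unfolding \<epsilon>_def by (rule someI_ex) (use small_discs in blast)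
  have "sphere l \<epsilon> \<inter> spectrum_on V A = {}" if "l \<in> spectrum_on V A" for l
  proof -
    have "sphere l \<epsilon> \<inter> spectrum_on V A \<subseteq> {l}" using e that sphere_cball[of l \<epsilon>] by blast
    moreover have "l \<notin> sphere l \<epsilon>" using e by auto
    ultimately show ?thesis by blast
  qed
  moreover have "\<exists>!c. c \<in> spectrum_on V A \<and> l \<in> ball c \<epsilon>" if l: "l \<in> spectrum_on V A" for l
  proof (rule ex1I[of _ l])
    show "l \<in> spectrum_on V A \<and> l \<in> ball l \<epsilon>" using l e by simp
    fix c assume c: "c \<in> spectrum_on V A \<and> l \<in> ball c \<epsilon>"
    then have "l \<in> cball c \<epsilon> \<inter> spectrum_on V A" using l ball_subset_cball by blast
    moreover have "cball c \<epsilon> \<inter> spectrum_on V A = {c}" using e c by simp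
    ultimately show "c = l" by simp
  qed
  ultimately have adm: "admissible (spectrum_on V A) \<epsilon>"
    using e finite_spectrum by (simp add: admissible_def)
  have "hol_calculus V D H A x = circles_int (spectrum_on V A) \<epsilon> x"
    unfolding hol_calculus_def Let_def \<epsilon>_def[symmetric] circles_int_def circle_int_def rs_def by simp
  then show ?thesis using circles_int_unique[OF adm C x] by simp
qed

text \<open>
  The perturbation argument needs disjoint closed discs, while \<open>hol_calculus\<close> asks for discs
  that contain no further eigenvalue; a third of such a radius serves.
\<close>

lemma disc_system:
  obtains \<rho> where "\<rho> > 0" "\<And>l. l \<in> spectrum_on V A \<Longrightarrow> cball l \<rho> \<subseteq> D"
    "\<And>l l'. l \<in> spectrum_on V A \<Longrightarrow> l' \<in> spectrum_on V A \<Longrightarrow> l \<noteq> l' \<Longrightarrow> cball l \<rho> \<inter> cball l' \<rho> = {}"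
    "admissible (spectrum_on V A) \<rho>"
proof -
  from small_discs obtain \<epsilon> where
    "0 < \<epsilon> \<and> (\<forall>l\<in>spectrum_on V A. cball l \<epsilon> \<subseteq> D \<and> cball l \<epsilon> \<inter> spectrum_on V A = {l})" ..
  then have e: "\<epsilon> > 0" "\<And>l. l \<in> spectrum_on V A \<Longrightarrow> cball l \<epsilon> \<subseteq> D \<and> cball l \<epsilon> \<inter> spectrum_on V A = {l}"
    by simp_all
  have sub: "cball l (\<epsilon>/3) \<subseteq> cball l \<epsilon>" for l :: complex using e(1) by (intro subset_cball) simp
  have 1: "cball l (\<epsilon>/3) \<subseteq> D" if "l \<in> spectrum_on V A" for l using e(2)[OF that] sub[of l] by blast
  have 2: "cball l (\<epsilon>/3) \<inter> cball l' (\<epsilon>/3) = {}" if "l \<in> spectrum_on V A" "l' \<in> spectrum_on V A" "l \<noteq> l'" for l l'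
  proof (rule equals0I)
    fix y assume "y \<in> cball l (\<epsilon>/3) \<inter> cball l' (\<epsilon>/3)"
    then have "dist l y \<le> \<epsilon>/3" "dist l' y \<le> \<epsilon>/3" by auto
    then have "dist l l' \<le> \<epsilon>" using dist_triangle2[of l l' y] e(1) by simp
    then have "l' \<in> cball l \<epsilon> \<inter> spectrum_on V A" using that by simp
    then show False using e(2)[OF that(1), THEN conjunct2] that(3) by simp
  qed
  have 3: "sphere l (\<epsilon>/3) \<inter> spectrum_on V A = {}" if l: "l \<in> spectrum_on V A" for l
  proof -
    have "sphere l (\<epsilon>/3) \<inter> spectrum_on V A \<subseteq> cball l \<epsilon> \<inter> spectrum_on V A"
      using sub[of l] sphere_cball[of l "\<epsilon>/3"] by blast
    then have "sphere l (\<epsilon>/3) \<inter> spectrum_on V A \<subseteq> {l}" using e(2)[OF l, THEN conjunct2] by simp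
    moreover have "l \<notin> sphere l (\<epsilon>/3)" using e(1) by simp
    ultimately show ?thesis by blast
  qed
  have 4: "\<exists>!c. c \<in> spectrum_on V A \<and> l \<in> ball c (\<epsilon>/3)" if l: "l \<in> spectrum_on V A" for l
  proof (rule ex1I[of _ l])
    show "l \<in> spectrum_on V A \<and> l \<in> ball l (\<epsilon>/3)" using l e(1) by simp
    fix c assume c: "c \<in> spectrum_on V A \<and> l \<in> ball c (\<epsilon>/3)"
    then have "l \<in> cball c (\<epsilon>/3) \<inter> cball l (\<epsilon>/3)" using e(1) ball_subset_cball by auto
    then show "c = l" using 2[of c l] c l by blast
  qed
  have "admissible (spectrum_on V A) (\<epsilon>/3)"
    using e(1) 1 3 4 finite_spectrum by (simp add: admissible_def)
  then show ?thesis using that[of "\<epsilon>/3"] e(1) 1 2 by simp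
qed

lemma hc_gev:
  assumes "x \<in> V" "(nil A l ^^ K) x = 0"
  shows "hol_calculus V D H A x = (\<Sum>k<K. ((deriv ^^ k) H l / fact k) *\<^sub>C (nil A l ^^ k) x)"
proof -
  obtain \<rho> where a: "admissible (spectrum_on V A) \<rho>" by (rule disc_system)
  show ?thesis using hol_calculus_circles[OF a assms(1)] circles_int_gev[OF a assms] by (simp add: hc_series_def)
qed

lemma hc_add:
  assumes "x \<in> V" "y \<in> V"
  shows "hol_calculus V D H A (x + y) = hol_calculus V D H A x + hol_calculus V D H A y"
proof -
  obtain \<rho> where a: "admissible (spectrum_on V A) \<rho>" by (rule disc_system)
  show ?thesis using circles_int_add[OF a assms] by (simp add: hol_calculus_circles[OF a] assms V_simps)
qed

lemma hc_in: "x \<in> V \<Longrightarrow> hol_calculus V D H A x \<in> V"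
proof (induction rule: gev_induct)
  case (gev l K x)
  then show ?case by (simp only: hc_gev) (intro V_simps nil_in)
qed (simp add: hc_add V_simps)

lemma hc_scale: "x \<in> V \<Longrightarrow> hol_calculus V D H A (c *\<^sub>C x) = c *\<^sub>C hol_calculus V D H A x"
proof (induction rule: gev_induct)
  case (gev l K x)
  have "(nil A l ^^ K) (c *\<^sub>C x) = 0" using gev by (simp add: clinear_simps[OF funpow_linear[OF nil_linear[OF lin]]])
  from hc_gev[OF V_simps(3)[OF gev(1), of c] this] show ?case
    by (simp add: hc_gev[OF gev] clinear_simps[OF funpow_linear[OF nil_linear[OF lin]]] complex_vector.scale_sum_right scaleC_scaleC mult.commute)
qed (simp add: hc_add V_simps scaleC_add_right)

lemma hc_circles:
  assumes C: "admissible C \<rho>" and x: "x \<in> V" and \<phi>: "cfunctional \<phi>"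
  shows "\<phi> (hol_calculus V D H A x)
    = 1 / (2 * pi * \<i>) * (\<Sum>c\<in>C. contour_integral (circlepath c \<rho>) (\<lambda>w. H w * \<phi> (rs w x)))"
    and "c \<in> C \<Longrightarrow> (\<lambda>w. H w * \<phi> (rs w x)) contour_integrable_on circlepath c \<rho>"
proof -
  have v: "((\<lambda>w. H w * \<phi> (rs w x)) has_contour_integral \<phi> (circle_int c \<rho> x)) (circlepath c \<rho>)" if "c \<in> C" for c
    using circle_int(2)[of \<rho> c x \<phi>] C that x \<phi> by (simp add: admissible_def cfunctional_simps[OF \<phi>])
  show "c \<in> C \<Longrightarrow> (\<lambda>w. H w * \<phi> (rs w x)) contour_integrable_on circlepath c \<rho>"
    using v contour_integrable_on_def by blast
  have "\<phi> (circle_int c \<rho> x) = contour_integral (circlepath c \<rho>) (\<lambda>w. H w * \<phi> (rs w x))" if "c \<in> C" for c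
    using contour_integral_unique[OF v[OF that]] by simp
  then show "\<phi> (hol_calculus V D H A x)
    = 1 / (2 * pi * \<i>) * (\<Sum>c\<in>C. contour_integral (circlepath c \<rho>) (\<lambda>w. H w * \<phi> (rs w x)))"
    unfolding hol_calculus_circles[OF C x] circles_int_def by (simp add: cfunctional_simps[OF \<phi>])
qed

end

section \<open>The graded Lie algebra\<close>

lemma lie_simps:
  fixes x y z :: "'g::complex_lie_algebra"
  shows lie_zero_left: "lie 0 y = 0" and lie_zero_right: "lie x 0 = 0"
    and lie_minus_left: "lie (- x) y = - lie x y" and lie_minus_right: "lie x (- y) = - lie x y"
    and lie_diff_left: "lie (x - y) z = lie x z - lie y z" and lie_diff_right: "lie x (y - z) = lie x y - lie x z"
    and lie_antisym: "lie x y = - lie y x"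
proof -
  have l: "clinear (\<lambda>x. lie x y)" and r: "clinear (lie x)" for x y :: 'g
    by (simp_all add: clinear_iff lie_add_left lie_add_right lie_scale_left lie_scale_right)
  show "lie 0 y = 0" "lie (- x) y = - lie x y" "lie (x - y) z = lie x z - lie y z"
    using clinear_simps[OF l] by simp_all
  show "lie x 0 = 0" "lie x (- y) = - lie x y" "lie x (y - z) = lie x y - lie x z"
    using clinear_simps[OF r] by simp_all
  have "lie x y + lie y x = 0"
    using lie_self[of "x + y"] unfolding lie_add_left lie_add_right by (simp add: lie_self add.commute)
  then show "lie x y = - lie y x" by (simp add: eq_neg_iff_add_eq_0)
qed

lemma clinear_lie: "clinear (lie x)" "clinear (\<lambda>x. lie x y)"
  by (simp_all add: clinear_iff lie_add_left lie_add_right lie_scale_left lie_scale_right)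

text \<open>
  The Jacobi identity in the form used below: \<open>ad w\<close> is a derivation of the bracket.
\<close>

lemma lie_derivation: "lie w (lie x y) = lie (lie w x) y + lie x (lie w y)"
proof -
  have "lie w (lie x y) + lie x (lie y w) + lie y (lie w x) = 0" by (rule lie_jacobi)
  moreover have "lie x (lie y w) = - lie x (lie w y)" by (subst lie_antisym[of y w]) (simp add: lie_minus_right)
  moreover have "lie y (lie w x) = - lie (lie w x) y" by (rule lie_antisym)
  ultimately show ?thesis by (simp add: algebra_simps)
qed

locale twisted_lie_algebra =
  fixes B :: "'g::complex_lie_algebra \<Rightarrow> 'g \<Rightarrow> complex" and \<mu> :: "'g \<Rightarrow> 'g" and N n :: nat
    and \<tau> :: complex and T T' :: "nat \<Rightarrow> 'g"
  assumes fin_dim: "fin_dim_space TYPE('g)" and form: "invariant_form B"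
    and automorphism: "lie_automorphism \<mu>" and order: "has_order \<mu> N"
    and B_\<mu>: "\<forall>x y. B (\<mu> x) (\<mu> y) = B x y" and \<tau>: "Im \<tau> > 0" and dual: "dual_bases B n T T'"
begin

lemma N_pos: "N > 0" using order by (simp add: has_order_def)

lemma B_sym: "B x y = B y x" using form by (simp add: invariant_form_def)

lemma B_functional: "cfunctional (B x)" "cfunctional (\<lambda>x. B x y)"
  using form by (simp_all add: invariant_form_def)

lemmas B_right = cfunctional_simps[OF B_functional(1)]
lemmas B_left = cfunctional_simps[OF B_functional(2)]

lemma B_nondeg: "(\<And>y. B x y = 0) \<Longrightarrow> x = 0" using form by (simp add: invariant_form_def)

lemma B_invariant: "B (lie x y) z = B x (lie y z)" using form unfolding invariant_form_def by blast

lemma B_skew: "B (lie w x) y = - B x (lie w y)"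
  by (subst lie_antisym) (simp add: B_left B_invariant)

lemma B_dual: "i < n \<Longrightarrow> j < n \<Longrightarrow> B (T i) (T' j) = (if i = j then 1 else 0)"
  using dual by (auto simp: dual_bases_def)

text \<open>
  Both expansions hold on the basis vectors by duality and extend by linearity.
\<close>

lemma expand_T: "x = (\<Sum>i<n. B x (T' i) *\<^sub>C T i)" and expand_T': "x = (\<Sum>i<n. B x (T i) *\<^sub>C T' i)"
proof -
  have "(\<Sum>i<n. B x (T' i) *\<^sub>C T i) = x"
  proof -
    have "x \<in> complex_vector.span (T ` {..<n})" using dual by (simp add: dual_bases_def is_basis_def)
    then show ?thesis
    proof (induction rule: complex_vector.span_induct_alt)
      case base
      then show ?case by (simp add: B_left)
    next
      case (step c t y)
      then obtain j where j: "j < n" "t = T j" by auto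
      have "(\<Sum>i<n. B t (T' i) *\<^sub>C T i) = (\<Sum>i<n. if i = j then T i else 0)"
        by (rule sum.cong) (use j in \<open>auto simp: B_dual scaleC_one\<close>)
      then have "(\<Sum>i<n. B t (T' i) *\<^sub>C T i) = t" using j by simp
      then have "(\<Sum>i<n. (c * B t (T' i)) *\<^sub>C T i) = c *\<^sub>C t"
        by (simp only: scaleC_scaleC[symmetric] complex_vector.scale_sum_right[symmetric])
      then show ?case using step.IH by (simp add: B_left scaleC_add_left sum.distrib)
    qed
  qed
  then show "x = (\<Sum>i<n. B x (T' i) *\<^sub>C T i)" by simp
  have "(\<Sum>i<n. B x (T i) *\<^sub>C T' i) = x"
  proof -
    have "x \<in> complex_vector.span (T' ` {..<n})" using dual by (simp add: dual_bases_def is_basis_def)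
    then show ?thesis
    proof (induction rule: complex_vector.span_induct_alt)
      case base
      then show ?case by (simp add: B_left)
    next
      case (step c t y)
      then obtain j where j: "j < n" "t = T' j" by auto
      have "(\<Sum>i<n. B t (T i) *\<^sub>C T' i) = (\<Sum>i<n. if i = j then T' i else 0)"
        by (rule sum.cong) (use j in \<open>auto simp: B_dual B_sym[of "T' j"] scaleC_one\<close>)
      then have "(\<Sum>i<n. B t (T i) *\<^sub>C T' i) = t" using j by simp
      then have "(\<Sum>i<n. (c * B t (T i)) *\<^sub>C T' i) = c *\<^sub>C t"
        by (simp only: scaleC_scaleC[symmetric] complex_vector.scale_sum_right[symmetric])
      then show ?case using step.IH by (simp add: B_left scaleC_add_left sum.distrib)
    qed
  qed
  then show "x = (\<Sum>i<n. B x (T i) *\<^sub>C T' i)" by simp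
qed

lemma functional_expand: "cfunctional \<phi> \<Longrightarrow> \<phi> x = (\<Sum>i<n. B x (T' i) * \<phi> (T i))"
  by (subst expand_T[of x]) (simp add: cfunctional_simps)

subsection \<open>Eigenspaces of the automorphism\<close>

text \<open>
  The eigenvalue of \<open>\<mu>\<close> on \<open>G a\<close>.
\<close>

definition ev :: "nat \<Rightarrow> complex" where "ev a = exp (2 * pi * \<i> * of_nat a / of_nat N)"

abbreviation G :: "nat \<Rightarrow> 'g set" where "G a \<equiv> eigenspace \<mu> N a"

lemma G_iff: "x \<in> G a \<longleftrightarrow> \<mu> x = ev a *\<^sub>C x" by (simp add: eigenspace_def ev_def)

lemma ev_nz: "ev a \<noteq> 0" by (simp add: ev_def)

lemma ev_power: "ev a = ev 1 ^ a"
  by (simp add: ev_def exp_of_nat_mult[symmetric] field_simps)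

lemma ev_N: "ev 1 ^ N = 1"
  using N_pos by (simp add: ev_def exp_of_nat_mult[symmetric])

lemma ev_add: "ev (a + b) = ev a * ev b" by (metis ev_power power_add)

lemma ev_mod: "ev (a mod N) = ev a"
proof -
  have "ev a = ev 1 ^ (N * (a div N) + a mod N)" by (subst ev_power) simp
  also have "\<dots> = ev (a mod N)" unfolding power_add power_mult ev_N ev_power[of "a mod N"] by simp
  finally show ?thesis by simp
qed

lemma ev_eq_1: "a < N \<Longrightarrow> ev a = 1 \<Longrightarrow> a = 0"
proof -
  assume a: "a < N" "ev a = 1"
  obtain k :: int where "2 * pi * (real a / real N) = of_int (2 * k) * pi"
    using a(2) by (auto simp: ev_def exp_eq_1)
  then have "(2 * pi) * (real a / real N) = (2 * pi) * of_int k" by simp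
  then have "real a / real N = of_int k" by (subst (asm) mult_cancel_left) simp
  then have "real a = of_int (k * int N)" using N_pos by (simp add: field_simps)
  then have "int a = k * int N" by linarith
  then show "a = 0" using a(1) by (metis dvd_triv_right gr_zeroI nat_dvd_not_less of_nat_dvd_iff)
qed

lemma \<mu>_linear: "clinear \<mu>" and \<mu>_lie: "\<mu> (lie x y) = lie (\<mu> x) (\<mu> y)"
  using automorphism by (simp_all add: lie_automorphism_def)

lemmas \<mu>_simps = clinear_simps[OF \<mu>_linear]

lemma G_subspace: "complex_vector.subspace (G a)"
  by (auto simp: complex_vector.subspace_def G_iff \<mu>_simps scaleC_add_right scaleC_scaleC mult.commute)

lemma G_simps: "0 \<in> G a" "x \<in> G a \<Longrightarrow> y \<in> G a \<Longrightarrow> x + y \<in> G a" "x \<in> G a \<Longrightarrow> c *\<^sub>C x \<in> G a"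
  "x \<in> G a \<Longrightarrow> y \<in> G a \<Longrightarrow> x - y \<in> G a" "(\<And>i. i \<in> I \<Longrightarrow> f i \<in> G a) \<Longrightarrow> (\<Sum>i\<in>I. f i) \<in> G a"
  using G_subspace by (auto intro: complex_vector.subspace_0 complex_vector.subspace_add complex_vector.subspace_scale
      complex_vector.subspace_diff complex_vector.subspace_sum)

lemma G_lie: "x \<in> G a \<Longrightarrow> y \<in> G b \<Longrightarrow> lie x y \<in> G ((a + b) mod N)"
  by (simp add: G_iff \<mu>_lie lie_scale_left lie_scale_right scaleC_scaleC ev_mod ev_add)

lemma G_lie_0: "x \<in> G 0 \<Longrightarrow> a < N \<Longrightarrow> y \<in> G a \<Longrightarrow> lie x y \<in> G a"
  using G_lie[of x 0 y a] by simp

lemma G_0: "G 0 = fixed_points \<mu>" by (auto simp: fixed_points_def G_iff ev_def scaleC_one)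

text \<open>
  \<open>\<mu>\<close> preserves \<open>B\<close> and multiplies \<open>B x y\<close> by the nontrivial root of unity with index \<open>a + b\<close>.
\<close>

lemma B_orthogonal: "x \<in> G a \<Longrightarrow> y \<in> G b \<Longrightarrow> (a + b) mod N \<noteq> 0 \<Longrightarrow> B x y = 0"
proof -
  assume xy: "x \<in> G a" "y \<in> G b" "(a + b) mod N \<noteq> 0"
  have "B x y = B (\<mu> x) (\<mu> y)" using B_\<mu> by simp
  also have "\<dots> = ev ((a + b) mod N) * B x y"
    using xy by (simp add: G_iff B_left B_right ev_add ev_mod)
  finally have "(ev ((a + b) mod N) - 1) * B x y = 0" by (simp add: algebra_simps)
  moreover have "ev ((a + b) mod N) \<noteq> 1" using ev_eq_1[of "(a + b) mod N"] xy N_pos by auto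
  ultimately show ?thesis by simp
qed

text \<open>
  The projection onto \<open>G a\<close> along the other eigenspaces, by averaging over the cyclic group generated by \<open>\<mu>\<close>.
\<close>

definition P :: "nat \<Rightarrow> 'g \<Rightarrow> 'g" where
  "P a x = (1 / of_nat N) *\<^sub>C (\<Sum>k<N. inverse (ev a) ^ k *\<^sub>C (\<mu> ^^ k) x)"

lemma P_linear: "clinear (P a)"
  by (simp add: P_def clinear_iff clinear_simps[OF funpow_linear[OF \<mu>_linear]] scaleC_add_right sum.distrib
      complex_vector.scale_sum_right scaleC_scaleC mult.commute mult.left_commute)

lemmas P_simps = clinear_simps[OF P_linear]

lemma ev_inverse_N: "inverse (ev a) ^ N = 1"
  by (subst ev_power) (metis ev_N inverse_1 power_commutes power_inverse power_mult power_one mult.commute)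

lemma P_in: "P a x \<in> G a"
proof -
  define f where "f k = inverse (ev a) ^ k *\<^sub>C (\<mu> ^^ k) x" for k
  have "\<mu> (\<Sum>k<N. f k) = ev a *\<^sub>C (\<Sum>k<N. f (Suc k))"
  proof -
    have "\<mu> (f k) = ev a *\<^sub>C f (Suc k)" for k
      using ev_nz[of a] by (simp add: \<mu>_simps f_def scaleC_scaleC mult.assoc[symmetric])
    then show ?thesis by (simp add: \<mu>_simps complex_vector.scale_sum_right)
  qed
  also have "(\<Sum>k<N. f (Suc k)) = (\<Sum>k<N. f k) + f N - f 0"
    using sum.lessThan_Suc_shift[of f N] by (simp add: algebra_simps)
  also have "f N = f 0" using order by (simp add: f_def ev_inverse_N has_order_def)
  finally have "\<mu> (\<Sum>k<N. f k) = ev a *\<^sub>C (\<Sum>k<N. f k)" by simp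
  then show ?thesis
    unfolding G_iff P_def f_def[symmetric] by (simp add: \<mu>_simps scaleC_scaleC mult.commute)
qed

lemma root_sum: "k < N \<Longrightarrow> (\<Sum>a<N. inverse (ev a) ^ k) = (if k = 0 then of_nat N else 0)"
proof (cases "k = 0")
  case False
  assume k: "k < N"
  have e: "inverse (ev a) ^ k = (inverse (ev k)) ^ a" for a
    by (subst (1 2) ev_power) (simp add: power_mult[symmetric] mult.commute power_inverse[symmetric])
  have "inverse (ev k) \<noteq> 1" using ev_eq_1[OF k] False by (metis inverse_1 inverse_inverse_eq)
  then have "(\<Sum>a<N. inverse (ev k) ^ a) = (inverse (ev k) ^ N - 1) / (inverse (ev k) - 1)" by (rule geometric_sum)
  then show ?thesis using False by (simp add: e ev_inverse_N)
qed simp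

lemma sum_P: "(\<Sum>a<N. P a x) = x"
proof -
  have "(\<Sum>a<N. P a x) = (1 / of_nat N) *\<^sub>C (\<Sum>a<N. \<Sum>k<N. inverse (ev a) ^ k *\<^sub>C (\<mu> ^^ k) x)"
    by (simp add: P_def complex_vector.scale_sum_right)
  also have "(\<Sum>a<N. \<Sum>k<N. inverse (ev a) ^ k *\<^sub>C (\<mu> ^^ k) x) = (\<Sum>k<N. (\<Sum>a<N. inverse (ev a) ^ k) *\<^sub>C (\<mu> ^^ k) x)"
    by (subst sum.swap) (simp add: complex_vector.scale_sum_left)
  also have "\<dots> = (\<Sum>k<N. if k = 0 then of_nat N *\<^sub>C x else 0)"
    by (rule sum.cong) (auto simp: root_sum)
  also have "\<dots> = of_nat N *\<^sub>C x" using N_pos by simp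
  finally show ?thesis using N_pos by (simp add: scaleC_scaleC scaleC_one)
qed

lemma P_same: "x \<in> G a \<Longrightarrow> P a x = x"
proof -
  assume x: "x \<in> G a"
  have "(\<mu> ^^ k) x = ev a ^ k *\<^sub>C x" for k
    using x by (induction k) (simp_all add: \<mu>_simps G_iff scaleC_scaleC scaleC_one mult.commute)
  then have "inverse (ev a) ^ k *\<^sub>C (\<mu> ^^ k) x = x" for k
    using ev_nz[of a] by (simp add: scaleC_scaleC power_mult_distrib[symmetric] scaleC_one)
  moreover have "(\<Sum>k<N. x) = of_nat N *\<^sub>C x" by (induction N) (simp_all add: scaleC_add_left scaleC_one add.commute)
  ultimately show ?thesis using N_pos by (simp add: P_def scaleC_scaleC scaleC_one)
qed

lemma G_Int: "x \<in> G a \<Longrightarrow> x \<in> G b \<Longrightarrow> a < N \<Longrightarrow> b < N \<Longrightarrow> a \<noteq> b \<Longrightarrow> x = 0"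
proof (induction a b rule: linorder_wlog)
  case (le a b)
  have "(ev a - ev b) *\<^sub>C x = 0" using le by (simp add: G_iff complex_vector.scale_left_diff_distrib)
  moreover have "ev b = ev a * ev (b - a)" using le ev_add[of a "b - a"] by simp
  moreover have "ev (b - a) \<noteq> 1" using ev_eq_1[of "b - a"] less_imp_diff_less[OF le(5), of a] le(1,6) by auto
  ultimately show ?case using ev_nz[of a] by (auto simp: complex_vector.scale_eq_0_iff)
next
  case (sym a b)
  then show ?case by blast
qed

lemma P_other: "x \<in> G a \<Longrightarrow> a < N \<Longrightarrow> b < N \<Longrightarrow> a \<noteq> b \<Longrightarrow> P b x = 0"
proof (rule G_Int[where a = a and b = b])
  assume x: "x \<in> G a"
  have com: "(\<mu> ^^ k) y \<in> G a" if "y \<in> G a" for k y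
    using that by (induction k) (simp_all add: G_iff \<mu>_simps)
  show "P b x \<in> G a" unfolding P_def by (intro G_simps com x)
qed (auto intro: P_in)

text \<open>
  The fixed point algebra is orthogonal to the other eigenspaces. In particular \<open>B\<close> is nondegenerate on it.
\<close>

lemma B_P: "B (P 0 x) y = B x (P 0 y)"
proof -
  have "B (P 0 x) y = B (P 0 x) (P 0 y)" for x y
  proof -
    have "B (P 0 x) (\<Sum>a<N. P a y) = (\<Sum>a<N. if a = 0 then B (P 0 x) (P 0 y) else 0)"
      unfolding B_right by (rule sum.cong) (use B_orthogonal[OF P_in P_in] in auto)
    then show ?thesis using N_pos by (simp add: sum_P)
  qed
  from this[of x y] this[of y x] show ?thesis by (simp add: B_sym)
qed

subsection \<open>An auxiliary norm\<close>

text \<open>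
  Estimates uniform along a contour need a norm; any norm will do, as the space is finite-dimensional.
\<close>

definition nrm :: "'g \<Rightarrow> real" where "nrm x = (\<Sum>i<n. cmod (B x (T' i)))"

lemma nrm_nonneg: "0 \<le> nrm x" by (simp add: nrm_def sum_nonneg)

lemma nrm_triangle: "nrm (x + y) \<le> nrm x + nrm y"
  unfolding nrm_def sum.distrib[symmetric] by (rule sum_mono) (simp add: B_left norm_triangle_ineq)

lemma nrm_scale: "nrm (c *\<^sub>C x) = cmod c * nrm x"
  by (simp add: nrm_def B_left norm_mult sum_distrib_left)

lemma nrm_0 [simp]: "nrm 0 = 0" by (simp add: nrm_def B_left)

lemma nrm_eq_0: "nrm x = 0 \<Longrightarrow> x = 0"
proof -
  assume "nrm x = 0"
  then have "\<forall>i<n. B x (T' i) = 0" by (auto simp: nrm_def sum_nonneg_eq_0_iff)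
  then show "x = 0" by (subst expand_T[of x]) simp
qed

lemma nrm_sum: "nrm (\<Sum>i\<in>I. f i) \<le> (\<Sum>i\<in>I. nrm (f i))"
proof (induction I rule: infinite_finite_induct)
  case (insert i I)
  then show ?case using nrm_triangle[of "f i" "sum f I"] by simp
qed simp_all

lemma functional_bound: "cfunctional \<phi> \<Longrightarrow> \<exists>C\<ge>0. \<forall>x. cmod (\<phi> x) \<le> C * nrm x"
proof (intro exI[of _ "\<Sum>i<n. cmod (\<phi> (T i))"] conjI allI)
  assume \<phi>: "cfunctional \<phi>"
  fix x
  have "cmod (\<phi> x) \<le> (\<Sum>i<n. cmod (B x (T' i)) * cmod (\<phi> (T i)))"
    unfolding functional_expand[OF \<phi>, of x] by (rule order.trans[OF norm_sum]) (simp add: norm_mult)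
  also have "\<dots> \<le> (\<Sum>i<n. nrm x * cmod (\<phi> (T i)))"
    by (intro sum_mono mult_right_mono) (auto simp: nrm_def intro: member_le_sum)
  finally show "cmod (\<phi> x) \<le> (\<Sum>i<n. cmod (\<phi> (T i))) * nrm x"
    by (simp add: sum_distrib_left mult.commute)
qed (simp add: sum_nonneg)

lemma lie_bound: "\<exists>K\<ge>0. \<forall>x y. nrm (lie x y) \<le> K * nrm x * nrm y"
proof (intro exI[of _ "\<Sum>i<n. \<Sum>j<n. nrm (lie (T i) (T j))"] conjI allI)
  fix x y
  have x: "lie x y = (\<Sum>i<n. B x (T' i) *\<^sub>C lie (T i) y)" for x y
    by (subst expand_T[of x]) (simp only: clinear_simps[OF clinear_lie(2)])
  have y: "lie x y = (\<Sum>j<n. B y (T' j) *\<^sub>C lie x (T j))" for x y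
    by (subst expand_T[of y]) (simp only: clinear_simps[OF clinear_lie(1)])
  have c: "cmod (B x (T' i)) \<le> nrm x" if "i < n" for i x
    using that by (auto simp: nrm_def intro: member_le_sum)
  have "nrm (lie x y) \<le> (\<Sum>i<n. cmod (B x (T' i)) * nrm (lie (T i) y))"
    by (subst x) (rule order.trans[OF nrm_sum], simp add: nrm_scale)
  also have "\<dots> \<le> (\<Sum>i<n. nrm x * (\<Sum>j<n. nrm y * nrm (lie (T i) (T j))))"
  proof (intro sum_mono mult_mono)
    fix i
    show "nrm (lie (T i) y) \<le> (\<Sum>j<n. nrm y * nrm (lie (T i) (T j)))"
      by (subst y) (rule order.trans[OF nrm_sum], auto simp: nrm_scale intro!: sum_mono mult_right_mono c nrm_nonneg)
  qed (auto intro: c nrm_nonneg)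
  finally show "nrm (lie x y) \<le> (\<Sum>i<n. \<Sum>j<n. nrm (lie (T i) (T j))) * nrm x * nrm y"
    by (simp add: sum_distrib_left mult_ac)
qed (simp add: sum_nonneg nrm_nonneg)

lemma invariant_subspace_G: "\<omega> \<in> G 0 \<Longrightarrow> a < N \<Longrightarrow> invariant_subspace (G a) (lie \<omega>)"
  by (rule invariant_subspace.intro[OF fin_dim clinear_lie(1) G_subspace]) (rule G_lie_0)

end

section \<open>Perturbation of the functional calculus\<close>

locale perturbation = twisted_lie_algebra B \<mu> N n \<tau> T T'
  for B :: "'g::complex_lie_algebra \<Rightarrow> 'g \<Rightarrow> complex" and \<mu> :: "'g \<Rightarrow> 'g" and N n \<tau> T T' +
  fixes \<omega> :: 'g and a :: nat and D :: "complex set" and H :: "complex \<Rightarrow> complex" and \<rho> :: real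
  assumes \<omega>: "\<omega> \<in> G 0" and a: "a < N" and openD: "open D" and holH: "H holomorphic_on D"
    and \<rho>: "\<rho> > 0" and discs: "\<And>l. l \<in> spectrum_on (G a) (lie \<omega>) \<Longrightarrow> cball l \<rho> \<subseteq> D"
    and disjoint: "\<And>l l'. l \<in> spectrum_on (G a) (lie \<omega>) \<Longrightarrow> l' \<in> spectrum_on (G a) (lie \<omega>) \<Longrightarrow> l \<noteq> l'
      \<Longrightarrow> cball l \<rho> \<inter> cball l' \<rho> = {}"
begin

abbreviation "S \<equiv> spectrum_on (G a) (lie \<omega>)"
abbreviation "R \<equiv> invariant_subspace.rs (G a)"

text \<open>
  The complement of the open discs; all contours lie here, and uniform estimates of the resolvent hold here.
\<close>

definition outside :: "complex set" where "outside = {w. \<forall>l\<in>S. \<rho> \<le> dist l w}"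

sublocale I: invariant_subspace "G a" "lie \<omega>" by (rule invariant_subspace_G[OF \<omega> a])

lemma outside_S: "w \<in> outside \<Longrightarrow> w \<notin> S" using \<rho> by (auto simp: outside_def)

lemma sphere_outside: "l \<in> S \<Longrightarrow> w \<in> sphere l \<rho> \<Longrightarrow> w \<in> outside"
  unfolding outside_def
proof (intro CollectI ballI)
  fix l' assume l: "l \<in> S" "w \<in> sphere l \<rho>" "l' \<in> S"
  show "\<rho> \<le> dist l' w"
  proof (cases "l = l'")
    case False
    then have "w \<notin> cball l' \<rho>" using disjoint[OF l(1,3)] l(2) sphere_cball by blast
    then show ?thesis by simp
  qed (use l in simp)
qed

text \<open>
  On a generalized eigenvector the resolvent is a finite sum of inverse powers of the distance to an eigenvalue, which is at least
  \<open>\<rho>\<close> outside the discs. The bounds for the components of a basis give a bound for the operator.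
\<close>

lemma resolvent_bound: "\<exists>M\<ge>0. \<forall>w\<in>outside. \<forall>x\<in>G a. nrm (R (lie \<omega>) w x) \<le> M * nrm x"
proof -
  have "\<exists>M\<ge>0. \<forall>w\<in>outside. nrm (R (lie \<omega>) w x) \<le> M" if "x \<in> G a" for x
    using that
  proof (induction rule: I.gev_induct)
    case (gev l K x)
    let ?f = "\<lambda>k. nrm ((nil (lie \<omega>) l ^^ k) x)"
    have "nrm (R (lie \<omega>) w x) \<le> (\<Sum>k<K. ?f k / \<rho> ^ Suc k)" if w: "w \<in> outside" for w
    proof (cases "x = 0")
      case True
      then have "R (lie \<omega>) w x = 0" using I.rs_scale[OF outside_S[OF w] G_simps(1), of 0] by simp
      then show ?thesis using \<rho> by (simp add: sum_nonneg nrm_nonneg)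
    next
      case False
      then have "l \<in> S" using I.gev_eig[OF gev(1) _ gev(2)] by (simp add: I.spectrum_eig)
      then have d: "\<rho> \<le> cmod (w - l)" using w by (simp add: outside_def dist_norm norm_minus_commute)
      have "nrm (R (lie \<omega>) w x) \<le> (\<Sum>k<K. nrm ((1 / (w - l) ^ Suc k) *\<^sub>C (nil (lie \<omega>) l ^^ k) x))"
        unfolding I.rs_gev[OF outside_S[OF w] gev] by (rule nrm_sum)
      also have "\<dots> \<le> (\<Sum>k<K. ?f k / \<rho> ^ Suc k)"
      proof (rule sum_mono)
        fix k
        have "1 / cmod (w - l) ^ Suc k \<le> 1 / \<rho> ^ Suc k"
          using d \<rho> by (intro divide_left_mono power_mono mult_pos_pos zero_less_power) auto
        then show "nrm ((1 / (w - l) ^ Suc k) *\<^sub>C (nil (lie \<omega>) l ^^ k) x) \<le> ?f k / \<rho> ^ Suc k"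
          using mult_right_mono[OF _ nrm_nonneg[of "(nil (lie \<omega>) l ^^ k) x"], of "1 / cmod (w - l) ^ Suc k" "1 / \<rho> ^ Suc k"]
          by (simp add: nrm_scale norm_divide norm_power norm_mult)
      qed
      finally show ?thesis .
    qed
    moreover have "0 \<le> (\<Sum>k<K. ?f k / \<rho> ^ Suc k)" using \<rho> by (intro sum_nonneg divide_nonneg_pos nrm_nonneg) auto
    ultimately show ?case by blast
  next
    case (plus x y)
    then obtain M1 M2 where M: "M1 \<ge> 0" "M2 \<ge> 0" "\<And>w. w \<in> outside \<Longrightarrow> nrm (R (lie \<omega>) w x) \<le> M1"
      "\<And>w. w \<in> outside \<Longrightarrow> nrm (R (lie \<omega>) w y) \<le> M2" by blast
    have "nrm (R (lie \<omega>) w (x + y)) \<le> M1 + M2" if w: "w \<in> outside" for w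
      using nrm_triangle[of "R (lie \<omega>) w x" "R (lie \<omega>) w y"] M(3,4)[OF w]
      by (simp add: I.rs_add[OF outside_S[OF w] plus(1,2)])
    then show ?case using M by (intro exI[of _ "M1 + M2"]) auto
  qed
  then obtain f where f: "\<And>x. x \<in> G a \<Longrightarrow> f x \<ge> 0" "\<And>x w. x \<in> G a \<Longrightarrow> w \<in> outside \<Longrightarrow> nrm (R (lie \<omega>) w x) \<le> f x"
    by metis
  show ?thesis
  proof (intro exI[of _ "\<Sum>i<n. f (P a (T i))"] conjI ballI)
    show "0 \<le> (\<Sum>i<n. f (P a (T i)))" by (intro sum_nonneg f P_in)
    fix w x assume w: "w \<in> outside" and x: "x \<in> G a"
    have "x = P a (\<Sum>i<n. B x (T' i) *\<^sub>C T i)" using P_same[OF x] expand_T[of x] by simp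
    also have "\<dots> = (\<Sum>i<n. B x (T' i) *\<^sub>C P a (T i))" by (simp add: P_simps)
    finally have "R (lie \<omega>) w x = R (lie \<omega>) w (\<Sum>i<n. B x (T' i) *\<^sub>C P a (T i))" by simp
    also have "\<dots> = (\<Sum>i<n. B x (T' i) *\<^sub>C R (lie \<omega>) w (P a (T i)))"
      by (subst I.rs_sum[OF outside_S[OF w]]) (simp_all add: G_simps P_in I.rs_scale[OF outside_S[OF w] P_in])
    finally have "nrm (R (lie \<omega>) w x) \<le> (\<Sum>i<n. cmod (B x (T' i)) * nrm (R (lie \<omega>) w (P a (T i))))"
      using nrm_sum[of "\<lambda>i. B x (T' i) *\<^sub>C R (lie \<omega>) w (P a (T i))" "{..<n}"] by (simp add: nrm_scale)
    also have "\<dots> \<le> (\<Sum>i<n. nrm x * f (P a (T i)))"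
      by (intro sum_mono mult_mono f P_in w nrm_nonneg) (auto simp: nrm_def intro: member_le_sum)
    finally show "nrm (R (lie \<omega>) w x) \<le> (\<Sum>i<n. f (P a (T i))) * nrm x"
      by (simp add: sum_distrib_left mult.commute)
  qed
qed

text \<open>
  The second resolvent identity with a contraction: if \<open>R (ad (\<omega>' - \<omega>))\<close> has norm at most one half,
  an eigenvector of the perturbed operator at \<open>w\<close> would have at most half its norm, and the perturbed resolvent is at most twice as large.
\<close>

lemma perturbed_resolvent:
  assumes M0: "M \<ge> 0" "\<forall>w\<in>outside. \<forall>x\<in>G a. nrm (R (lie \<omega>) w x) \<le> M * nrm x"
    and K0: "K \<ge> 0" "\<forall>x y. nrm (lie x y) \<le> K * nrm x * nrm y"
    and \<omega>': "\<omega>' \<in> G 0" "M * K * nrm (\<omega>' - \<omega>) \<le> 1/2" and w: "w \<in> outside"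
  shows "w \<notin> spectrum_on (G a) (lie \<omega>')"
    and "x \<in> G a \<Longrightarrow> nrm (R (lie \<omega>') w x) \<le> 2 * M * nrm x"
    and "x \<in> G a \<Longrightarrow> R (lie \<omega>') w x - R (lie \<omega>) w x = R (lie \<omega>) w (lie (\<omega>' - \<omega>) (R (lie \<omega>') w x))"
proof -
  have M: "M \<ge> 0" "\<And>w x. w \<in> outside \<Longrightarrow> x \<in> G a \<Longrightarrow> nrm (R (lie \<omega>) w x) \<le> M * nrm x"
    and K: "K \<ge> 0" "\<And>x y. nrm (lie x y) \<le> K * nrm x * nrm y" using M0 K0 by auto
  interpret I': invariant_subspace "G a" "lie \<omega>'" by (rule invariant_subspace_G[OF \<omega>'(1) a])
  have d0: "\<omega>' - \<omega> \<in> G 0" using \<omega> \<omega>' by (intro G_simps)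
  have wS: "w \<notin> S" by (rule outside_S[OF w])
  have est: "nrm (R (lie \<omega>) w (lie (\<omega>' - \<omega>) y)) \<le> 1/2 * nrm y" if y: "y \<in> G a" for y
  proof -
    have "nrm (R (lie \<omega>) w (lie (\<omega>' - \<omega>) y)) \<le> M * nrm (lie (\<omega>' - \<omega>) y)"
      using G_lie_0[OF d0 a y] by (intro M w)
    also have "\<dots> \<le> M * (K * nrm (\<omega>' - \<omega>) * nrm y)" using M(1) K(2) by (rule mult_left_mono[rotated])
    also have "\<dots> = (M * K * nrm (\<omega>' - \<omega>)) * nrm y" by simp
    also have "\<dots> \<le> 1/2 * nrm y" using \<omega>'(2) nrm_nonneg by (rule mult_right_mono)
    finally show ?thesis .
  qed
  have "\<not> I'.eig w"
  proof
    assume "I'.eig w"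
    then obtain y where y: "y \<in> G a" "y \<noteq> 0" "lie \<omega>' y = w *\<^sub>C y" by (auto simp: I'.eig_def)
    have "R (lie \<omega>) w (lie (\<omega>' - \<omega>) y) = y"
      by (rule I.rs_unique[OF wS y(1)]) (simp add: lie_diff_left y(3))
    then have "nrm y \<le> 1/2 * nrm y" using est[OF y(1)] by simp
    then have "nrm y = 0" using nrm_nonneg[of y] by linarith
    then show False using nrm_eq_0 y(2) by blast
  qed
  then show w': "w \<notin> spectrum_on (G a) (lie \<omega>')" by (simp add: I'.spectrum_eig)
  assume x: "x \<in> G a"
  define y where "y = R (lie \<omega>') w x"
  have y: "y \<in> G a" "w *\<^sub>C y - lie \<omega>' y = x"
    unfolding y_def using I'.rs_in[OF w' x] I'.rs_eq[OF w' x] .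
  have ly: "lie (\<omega>' - \<omega>) y \<in> G a" by (rule G_lie_0[OF d0 a y(1)])
  have "R (lie \<omega>) w (x + lie (\<omega>' - \<omega>) y) = y"
    by (rule I.rs_unique[OF wS y(1)]) (simp add: lie_diff_left y(2)[symmetric])
  then have e: "y = R (lie \<omega>) w x + R (lie \<omega>) w (lie (\<omega>' - \<omega>) y)"
    using I.rs_add[OF wS x ly] by simp
  then show "R (lie \<omega>') w x - R (lie \<omega>) w x = R (lie \<omega>) w (lie (\<omega>' - \<omega>) (R (lie \<omega>') w x))"
    unfolding y_def[symmetric] by (simp add: algebra_simps)
  have "nrm y \<le> nrm (R (lie \<omega>) w x) + nrm (R (lie \<omega>) w (lie (\<omega>' - \<omega>) y))"
    by (subst e) (rule nrm_triangle)
  also have "\<dots> \<le> M * nrm x + 1/2 * nrm y" using M(2)[OF w x] est[OF y(1)] by linarith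
  finally show "nrm (R (lie \<omega>') w x) \<le> 2 * M * nrm x" unfolding y_def by simp
qed

text \<open>
  If no eigenvalue lies outside the discs, the old circles still compute the new functional calculus.
\<close>

lemma perturbed_calculus:
  assumes \<omega>': "\<omega>' \<in> G 0" and out: "\<And>w. w \<in> outside \<Longrightarrow> w \<notin> spectrum_on (G a) (lie \<omega>')"
  shows "holomorphic_calculus (G a) (lie \<omega>') D H"
    and "holomorphic_calculus.admissible (G a) (lie \<omega>') D S \<rho>"
proof -
  interpret I': invariant_subspace "G a" "lie \<omega>'" by (rule invariant_subspace_G[OF \<omega>' a])
  have ball: "\<exists>c\<in>S. l \<in> ball c \<rho>" if "l \<in> spectrum_on (G a) (lie \<omega>')" for l
  proof -
    have "l \<notin> outside" using out that by blast
    then show ?thesis by (auto simp: outside_def not_le)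
  qed
  have "spectrum_on (G a) (lie \<omega>') \<subseteq> D" using ball discs ball_subset_cball by blast
  then interpret C': holomorphic_calculus "G a" "lie \<omega>'" D H
    by unfold_locales (use openD holH in auto)
  show "holomorphic_calculus (G a) (lie \<omega>') D H" by (rule C'.holomorphic_calculus_axioms)
  show "C'.admissible S \<rho>"
    unfolding C'.admissible_def
  proof (intro conjI ballI)
    show "finite S" by (rule I.finite_spectrum)
    show "sphere c \<rho> \<inter> spectrum_on (G a) (lie \<omega>') = {}" if "c \<in> S" for c
      using sphere_outside[OF that] out by blast
    fix l assume "l \<in> spectrum_on (G a) (lie \<omega>')"
    then obtain c where c: "c \<in> S" "l \<in> ball c \<rho>" using ball by blast
    show "\<exists>!c. c \<in> S \<and> l \<in> ball c \<rho>"
    proof (rule ex1I[of _ c])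
      fix c' assume c': "c' \<in> S \<and> l \<in> ball c' \<rho>"
      then show "c' = c" using disjoint[OF c(1), of c'] c(2) ball_subset_cball by blast
    qed (use c in blast)
  qed (use \<rho> discs in auto)
qed

sublocale C: holomorphic_calculus "G a" "lie \<omega>" D H
  by (rule perturbed_calculus(1)[OF \<omega> outside_S])

lemma admissible: "C.admissible S \<rho>"
  by (rule perturbed_calculus(2)[OF \<omega> outside_S])

definition vcont :: "complex set \<Rightarrow> (complex \<Rightarrow> 'g) \<Rightarrow> bool" where
  "vcont U F \<longleftrightarrow> (\<forall>\<phi>. cfunctional \<phi> \<longrightarrow> continuous_on U (\<lambda>w. \<phi> (F w)))"

lemma vcont_lie: "vcont U F \<Longrightarrow> vcont U (\<lambda>w. lie Q (F w))"
  unfolding vcont_def using cfunctional_compose[OF _ clinear_lie(1)] by blast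

lemma vcont_R_const: "x \<in> G a \<Longrightarrow> vcont outside (\<lambda>w. R (lie \<omega>) w x)"
proof (induction rule: I.gev_induct)
  case (gev l K x)
  show ?case
    unfolding vcont_def
  proof (intro allI impI)
    fix \<phi> :: "'g \<Rightarrow> complex" assume \<phi>: "cfunctional \<phi>"
    have "w \<noteq> l \<or> x = 0" if "w \<in> outside" for w
      using outside_S[OF that] I.gev_eig[OF gev(1) _ gev(2)] by (auto simp: I.spectrum_eig)
    then consider "x = 0" | "l \<notin> outside" by blast
    then have "continuous_on outside (\<lambda>w. \<Sum>k<K. 1 / (w - l) ^ Suc k * \<phi> ((nil (lie \<omega>) l ^^ k) x))"
    proof cases
      case 1
      then show ?thesis
        by (simp add: clinear_simps[OF funpow_linear[OF nil_linear[OF I.lin]]] cfunctional_simps[OF \<phi>])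
    next
      case 2
      then show ?thesis by (intro continuous_intros) auto
    qed
    then show "continuous_on outside (\<lambda>w. \<phi> (R (lie \<omega>) w x))"
      by (rule continuous_on_cong[THEN iffD1, rotated 2])
        (simp_all add: I.rs_gev[OF outside_S gev] cfunctional_simps[OF \<phi>])
  qed
next
  case (plus x y)
  show ?case
    unfolding vcont_def
  proof (intro allI impI)
    fix \<phi> :: "'g \<Rightarrow> complex" assume \<phi>: "cfunctional \<phi>"
    have "continuous_on outside (\<lambda>w. \<phi> (R (lie \<omega>) w x) + \<phi> (R (lie \<omega>) w y))"
      using plus(3,4) \<phi> unfolding vcont_def by (intro continuous_intros) auto
    then show "continuous_on outside (\<lambda>w. \<phi> (R (lie \<omega>) w (x + y)))"
      by (rule continuous_on_cong[THEN iffD1, rotated 2])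
        (simp_all add: I.rs_add[OF outside_S plus(1,2)] cfunctional_simps[OF \<phi>])
  qed
qed

text \<open>
  The resolvent depends on \<open>w\<close> as well as its argument; expanding the argument in a basis separates the two.
\<close>

lemma vcont_R:
  assumes F: "vcont outside F" "\<And>w. w \<in> outside \<Longrightarrow> F w \<in> G a"
  shows "vcont outside (\<lambda>w. R (lie \<omega>) w (F w))"
  unfolding vcont_def
proof (intro allI impI)
  fix \<phi> :: "'g \<Rightarrow> complex" assume \<phi>: "cfunctional \<phi>"
  have "continuous_on outside (\<lambda>w. \<Sum>i<n. B (F w) (T' i) * \<phi> (R (lie \<omega>) w (P a (T i))))"
    using F(1) vcont_R_const[OF P_in] \<phi> B_functional(2) unfolding vcont_def by (intro continuous_intros) auto
  then show "continuous_on outside (\<lambda>w. \<phi> (R (lie \<omega>) w (F w)))"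
  proof (rule continuous_on_cong[THEN iffD1, rotated 2])
    fix w assume w: "w \<in> outside"
    have "F w = P a (\<Sum>i<n. B (F w) (T' i) *\<^sub>C T i)" using P_same[OF F(2)[OF w]] expand_T[of "F w"] by simp
    also have "\<dots> = (\<Sum>i<n. B (F w) (T' i) *\<^sub>C P a (T i))" by (simp add: P_simps)
    finally have "R (lie \<omega>) w (F w) = R (lie \<omega>) w (\<Sum>i<n. B (F w) (T' i) *\<^sub>C P a (T i))" by simp
    also have "\<dots> = (\<Sum>i<n. B (F w) (T' i) *\<^sub>C R (lie \<omega>) w (P a (T i)))"
      by (subst I.rs_sum[OF outside_S[OF w]]) (simp_all add: G_simps P_in I.rs_scale[OF outside_S[OF w] P_in])
    finally show "(\<Sum>i<n. B (F w) (T' i) * \<phi> (R (lie \<omega>) w (P a (T i)))) = \<phi> (R (lie \<omega>) w (F w))"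
      by (simp add: cfunctional_simps[OF \<phi>])
  qed simp
qed

text \<open>
  The contour integral of the functional calculus with weight \<open>H\<close>, for scalar functions.
\<close>

definition cint :: "(complex \<Rightarrow> complex) \<Rightarrow> complex" where
  "cint f = 1 / (2 * pi * \<i>) * (\<Sum>l\<in>S. contour_integral (circlepath l \<rho>) (\<lambda>w. H w * f w))"

lemma integrable_cont:
  assumes "continuous_on outside f" "l \<in> S"
  shows "(\<lambda>w. H w * f w) contour_integrable_on circlepath l \<rho>"
proof (rule contour_integrable_continuous_circlepath)
  have s: "sphere l \<rho> \<subseteq> outside" using sphere_outside[OF assms(2)] by blast
  have h: "sphere l \<rho> \<subseteq> D" using discs[OF assms(2)] sphere_cball by blast
  show "continuous_on (path_image (circlepath l \<rho>)) (\<lambda>w. H w * f w)"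
    using \<rho> continuous_on_subset[OF assms(1) s] continuous_on_subset[OF holomorphic_on_imp_continuous_on[OF holH] h]
    by (auto intro!: continuous_intros)
qed

lemma cint_cong: "(\<And>w. w \<in> outside \<Longrightarrow> f w = g w) \<Longrightarrow> cint f = cint g"
  unfolding cint_def using \<rho> sphere_outside
  by (auto intro!: arg_cong2[where f = "(*)"] arg_cong2[where f = "(/)"] sum.cong contour_integral_eq)

lemma cint_add: "continuous_on outside f \<Longrightarrow> continuous_on outside g \<Longrightarrow> cint (\<lambda>w. f w + g w) = cint f + cint g"
proof -
  assume f: "continuous_on outside f" and g: "continuous_on outside g"
  have "contour_integral (circlepath l \<rho>) (\<lambda>w. H w * (f w + g w))
     = contour_integral (circlepath l \<rho>) (\<lambda>w. H w * f w) + contour_integral (circlepath l \<rho>) (\<lambda>w. H w * g w)" if "l \<in> S" for l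
    using contour_integral_add[OF integrable_cont[OF f that] integrable_cont[OF g that]] by (simp add: distrib_left)
  then show ?thesis by (simp add: cint_def sum.distrib distrib_left)
qed

lemma cint_cmult: "continuous_on outside f \<Longrightarrow> cint (\<lambda>w. c * f w) = c * cint f"
proof -
  assume f: "continuous_on outside f"
  have "contour_integral (circlepath l \<rho>) (\<lambda>w. H w * (c * f w)) = c * contour_integral (circlepath l \<rho>) (\<lambda>w. H w * f w)" if "l \<in> S" for l
    using contour_integral_lmul[OF integrable_cont[OF f that], of c] by (simp add: mult_ac)
  then show ?thesis by (simp add: cint_def sum_distrib_left mult_ac)
qed

lemma cint_0: "cint (\<lambda>w. 0) = 0" by (simp add: cint_def)

lemma cint_sum:
  "(\<And>i. i \<in> J \<Longrightarrow> continuous_on outside (f i)) \<Longrightarrow> cint (\<lambda>w. \<Sum>i\<in>J. f i w) = (\<Sum>i\<in>J. cint (f i))"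
  by (induction J rule: infinite_finite_induct) (simp_all add: cint_0 cint_add continuous_on_sum)

text \<open>
  Integrating a pole at an eigenvalue extracts a Taylor coefficient of \<open>H\<close>, as the discs are disjoint.
\<close>

lemma cint_pole:
  assumes "p \<in> S"
  shows "cint (\<lambda>w. 1 / (w - p) ^ Suc k) = (deriv ^^ k) H p / fact k"
proof -
  have "contour_integral (circlepath l \<rho>) (\<lambda>w. H w * (1 / (w - p) ^ Suc k)) = (if l = p then 2 * pi * \<i> * ((deriv ^^ k) H p / fact k) else 0)"
    if l: "l \<in> S" for l
  proof -
    have "p \<notin> sphere l \<rho>" using sphere_outside[OF l] outside_S assms by blast
    from contour_integral_unique[OF C.cauchy_disc[OF \<rho> discs[OF l] this, of k]]
    have "contour_integral (circlepath l \<rho>) (\<lambda>w. H w * (1 / (w - p) ^ Suc k)) = (if p \<in> ball l \<rho> then 2 * pi * \<i> * ((deriv ^^ k) H p / fact k) else 0)"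
      by simp
    moreover have "p \<in> ball l \<rho> \<longleftrightarrow> l = p"
    proof
      assume "p \<in> ball l \<rho>"
      then have "p \<in> cball l \<rho> \<inter> cball p \<rho>" using \<rho> by auto
      then show "l = p" using disjoint[OF l assms] by blast
    qed (use \<rho> in simp)
    ultimately show ?thesis by simp
  qed
  then have "(\<Sum>l\<in>S. contour_integral (circlepath l \<rho>) (\<lambda>w. H w * (1 / (w - p) ^ Suc k))) = (\<Sum>l\<in>S. if l = p then 2 * pi * \<i> * ((deriv ^^ k) H p / fact k) else 0)"
    by (rule sum.cong[OF refl])
  also have "\<dots> = 2 * pi * \<i> * ((deriv ^^ k) H p / fact k)" using assms I.finite_spectrum by simp
  finally show ?thesis by (simp add: cint_def)
qed

lemma calculus_cint: "x \<in> G a \<Longrightarrow> cfunctional \<phi> \<Longrightarrow> \<phi> (hol_calculus (G a) D H (lie \<omega>) x) = cint (\<lambda>w. \<phi> (R (lie \<omega>) w x))"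
  using C.hc_circles(1)[OF admissible] by (simp add: cint_def)

text \<open>
  The derivative of the calculus in the direction of \<open>ad Q\<close>: the resolvent \<open>R\<close> has the derivative \<open>R (ad Q) R\<close>. The sum
  over the dual bases assembles a vector from the integrals of its coordinates.
\<close>

definition dcalc :: "'g \<Rightarrow> 'g \<Rightarrow> 'g" where
  "dcalc Q x = (\<Sum>i<n. cint (\<lambda>w. B (R (lie \<omega>) w (lie Q (R (lie \<omega>) w x))) (T' i)) *\<^sub>C T i)"

lemma vcont_dcalc:
  assumes "Q \<in> G 0" "x \<in> G a"
  shows "vcont outside (\<lambda>w. R (lie \<omega>) w (lie Q (R (lie \<omega>) w x)))"
  by (intro vcont_R vcont_lie vcont_R_const assms G_lie_0[OF assms(1) a] I.rs_in outside_S)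

lemma dcalc:
  assumes Q: "Q \<in> G 0" and x: "x \<in> G a" and \<phi>: "cfunctional \<phi>"
  shows "\<phi> (dcalc Q x) = cint (\<lambda>w. \<phi> (R (lie \<omega>) w (lie Q (R (lie \<omega>) w x))))"
proof -
  let ?F = "\<lambda>w. R (lie \<omega>) w (lie Q (R (lie \<omega>) w x))"
  have c: "continuous_on outside (\<lambda>w. B (?F w) (T' i))" for i
    using vcont_dcalc[OF Q x] B_functional(2) unfolding vcont_def by blast
  have "cint (\<lambda>w. \<phi> (?F w)) = cint (\<lambda>w. \<Sum>i<n. \<phi> (T i) * B (?F w) (T' i))"
    by (subst functional_expand[OF \<phi>]) (simp add: mult.commute)
  also have "\<dots> = (\<Sum>i<n. \<phi> (T i) * cint (\<lambda>w. B (?F w) (T' i)))"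
    by (subst cint_sum) (auto intro!: continuous_intros c simp: cint_cmult c)
  also have "\<dots> = \<phi> (dcalc Q x)"
    by (simp add: dcalc_def cfunctional_simps[OF \<phi>] mult.commute)
  finally show ?thesis by simp
qed

lemma tendsto_nrm:
  assumes "\<And>\<phi>. cfunctional \<phi> \<Longrightarrow> ((\<lambda>t. \<phi> (F t)) \<longlongrightarrow> \<phi> L) X"
  shows "((\<lambda>t. nrm (F t - L)) \<longlongrightarrow> 0) X"
proof -
  have "((\<lambda>t. cmod (B (F t - L) (T' i))) \<longlongrightarrow> 0) X" for i
    using assms[OF B_functional(2)[of "T' i"]] by (simp add: B_left tendsto_norm_zero_iff LIM_zero)
  then have "((\<lambda>t. nrm (F t - L)) \<longlongrightarrow> (\<Sum>i<n. 0)) X" unfolding nrm_def by (intro tendsto_sum)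
  then show ?thesis by simp
qed

lemma eventually_outside:
  assumes \<gamma>: "\<And>t. \<gamma> t \<in> G 0" and lim: "((\<lambda>t. nrm (\<gamma> t - \<omega>)) \<longlongrightarrow> 0) X"
  shows "eventually (\<lambda>t. \<forall>w\<in>outside. w \<notin> spectrum_on (G a) (lie (\<gamma> t))) X"
proof -
  obtain M where M': "M \<ge> 0" "\<forall>w\<in>outside. \<forall>x\<in>G a. nrm (R (lie \<omega>) w x) \<le> M * nrm x"
    using resolvent_bound by blast
  obtain K where K': "K \<ge> 0" "\<forall>x y. nrm (lie x y) \<le> K * nrm x * nrm y" using lie_bound by blast
  have M: "M \<ge> 0" "\<And>w x. w \<in> outside \<Longrightarrow> x \<in> G a \<Longrightarrow> nrm (R (lie \<omega>) w x) \<le> M * nrm x"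
    and K: "K \<ge> 0" "\<And>x y. nrm (lie x y) \<le> K * nrm x * nrm y" using M' K' by auto
  have "((\<lambda>t. M * K * nrm (\<gamma> t - \<omega>)) \<longlongrightarrow> M * K * 0) X" by (intro tendsto_intros lim)
  then have "eventually (\<lambda>t. M * K * nrm (\<gamma> t - \<omega>) < 1/2) X" by (rule order_tendstoD(2)) simp
  then show ?thesis
  proof eventually_elim
    case (elim t)
    then show ?case using perturbed_resolvent(1)[OF M' K' \<gamma>, of t] by auto
  qed
qed

text \<open>
  The contours are kept fixed, so only the difference quotients of the resolvents have to converge uniformly on
  the contours. By the second resolvent identity these are \<open>R (ad q) R'\<close> with the difference quotient \<open>q\<close> of the curve and the perturbed
  resolvent \<open>R'\<close>; the error against \<open>R (ad Q) R\<close> is bounded by \<open>nrm (q - Q)\<close> and \<open>nrm (\<gamma> t - \<omega>)\<close>.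
\<close>

lemma calculus_deriv:
  assumes \<gamma>: "\<And>t. \<gamma> t \<in> G 0" "\<gamma> t0 = \<omega>" "has_vec_deriv \<gamma> Q t0"
    and Q: "Q \<in> G 0" and x: "x \<in> G a" and \<phi>: "cfunctional \<phi>"
  shows "((\<lambda>t. \<phi> (hol_calculus (G a) D H (lie (\<gamma> t)) x)) has_field_derivative \<phi> (dcalc Q x)) (at t0)"
proof -
  obtain M where M': "M \<ge> 0" "\<forall>w\<in>outside. \<forall>x\<in>G a. nrm (R (lie \<omega>) w x) \<le> M * nrm x"
    using resolvent_bound by blast
  obtain K where K': "K \<ge> 0" "\<forall>x y. nrm (lie x y) \<le> K * nrm x * nrm y" using lie_bound by blast
  have M: "M \<ge> 0" "\<And>w x. w \<in> outside \<Longrightarrow> x \<in> G a \<Longrightarrow> nrm (R (lie \<omega>) w x) \<le> M * nrm x"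
    and K: "K \<ge> 0" "\<And>x y. nrm (lie x y) \<le> K * nrm x * nrm y" using M' K' by auto
  obtain C where C: "C \<ge> 0" "\<And>x. cmod (\<phi> x) \<le> C * nrm x" using functional_bound[OF \<phi>] by blast
  define q where "q t = (1 / (t - t0)) *\<^sub>C (\<gamma> t - \<omega>)" for t
  define Rt where "Rt t w = R (lie (\<gamma> t)) w x" for t w
  define R0 where "R0 w = R (lie \<omega>) w x" for w
  have lim\<gamma>: "((\<lambda>t. nrm (\<gamma> t - \<omega>)) \<longlongrightarrow> 0) (at t0)"
  proof (rule tendsto_nrm)
    fix \<psi> :: "'g \<Rightarrow> complex" assume "cfunctional \<psi>"
    then have "((\<lambda>t. \<psi> (\<gamma> t)) has_field_derivative \<psi> Q) (at t0)" using \<gamma>(3) by (simp add: has_vec_deriv_def)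
    then show "((\<lambda>t. \<psi> (\<gamma> t)) \<longlongrightarrow> \<psi> \<omega>) (at t0)"
      using DERIV_isCont[of "\<lambda>t. \<psi> (\<gamma> t)"] \<gamma>(2) by (auto simp: isCont_def)
  qed
  have limq: "((\<lambda>t. nrm (q t - Q)) \<longlongrightarrow> 0) (at t0)"
  proof (rule tendsto_nrm)
    fix \<psi> :: "'g \<Rightarrow> complex" assume \<psi>: "cfunctional \<psi>"
    then have "((\<lambda>t. \<psi> (\<gamma> t)) has_field_derivative \<psi> Q) (at t0)" using \<gamma>(3) by (simp add: has_vec_deriv_def)
    then show "((\<lambda>t. \<psi> (q t)) \<longlongrightarrow> \<psi> Q) (at t0)"
      using \<gamma>(2) by (simp add: has_field_derivative_iff q_def cfunctional_simps[OF \<psi>])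
  qed
  have "((\<lambda>t. M * K * nrm (\<gamma> t - \<omega>)) \<longlongrightarrow> M * K * 0) (at t0)" by (intro tendsto_intros lim\<gamma>)
  then have "eventually (\<lambda>t. M * K * nrm (\<gamma> t - \<omega>) < 1/2) (at t0)" by (rule order_tendstoD(2)) simp
  then have near: "eventually (\<lambda>t. t \<noteq> t0 \<and> M * K * nrm (\<gamma> t - \<omega>) \<le> 1/2) (at t0)"
    unfolding eventually_at_filter by eventually_elim auto
  have R0: "R0 w \<in> G a" "nrm (R0 w) \<le> M * nrm x" if "w \<in> outside" for w
    unfolding R0_def using that M(2) x I.rs_in[OF outside_S] by auto
  \<comment> \<open>The two summands bound the effect of replacing \<open>q t\<close> by \<open>Q\<close> and of replacing the perturbed resolvent by the unperturbed one.\<close>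
  define E where "E t = M * (K * nrm (q t - Q) * (2 * M * nrm x)) + M * (K * nrm Q * (M * (K * nrm (\<gamma> t - \<omega>) * (2 * M * nrm x))))" for t
  have limE: "(E \<longlongrightarrow> 0) (at t0)"
  proof -
    have "(E \<longlongrightarrow> M * (K * 0 * (2 * M * nrm x)) + M * (K * nrm Q * (M * (K * 0 * (2 * M * nrm x))))) (at t0)"
      unfolding E_def[abs_def] by (intro tendsto_intros lim\<gamma> limq)
    then show ?thesis by simp
  qed
  have step: "nrm ((1 / (t - t0)) *\<^sub>C (Rt t w - R0 w) - R (lie \<omega>) w (lie Q (R0 w))) \<le> E t"
    if t: "t \<noteq> t0 \<and> M * K * nrm (\<gamma> t - \<omega>) \<le> 1/2" and w: "w \<in> outside" for t w
  proof -
    interpret I': invariant_subspace "G a" "lie (\<gamma> t)" by (rule invariant_subspace_G[OF \<gamma>(1) a])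
    note pr = perturbed_resolvent[OF M' K' \<gamma>(1) conjunct2[OF t] w]
    have wS: "w \<notin> S" by (rule outside_S[OF w])
    have Rt: "Rt t w \<in> G a" "nrm (Rt t w) \<le> 2 * M * nrm x" "Rt t w - R0 w = R (lie \<omega>) w (lie (\<gamma> t - \<omega>) (Rt t w))"
      unfolding Rt_def R0_def using I'.rs_in[OF pr(1) x] pr(2)[OF x] pr(3)[OF x] by simp_all
    have d: "\<gamma> t - \<omega> \<in> G 0" and q0: "q t \<in> G 0" "q t - Q \<in> G 0"
      unfolding q_def using \<omega> \<gamma>(1) Q by (auto intro!: G_simps)
    have in1: "lie (\<gamma> t - \<omega>) (Rt t w) \<in> G a" "lie (q t - Q) (Rt t w) \<in> G a" "lie Q (Rt t w - R0 w) \<in> G a" "lie Q (R0 w) \<in> G a"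
      using G_lie_0[OF _ a] d q0 Q Rt(1) R0(1)[OF w] by (auto intro!: G_simps)
    have "(1 / (t - t0)) *\<^sub>C (Rt t w - R0 w) = R (lie \<omega>) w (lie (q t) (Rt t w))"
      unfolding Rt(3) I.rs_scale[OF wS in1(1), symmetric] by (simp add: q_def lie_scale_left)
    also have "lie (q t) (Rt t w) = (lie (q t - Q) (Rt t w) + lie Q (Rt t w - R0 w)) + lie Q (R0 w)"
      by (simp add: lie_diff_left lie_diff_right)
    also have "R (lie \<omega>) w \<dots> = (R (lie \<omega>) w (lie (q t - Q) (Rt t w)) + R (lie \<omega>) w (lie Q (Rt t w - R0 w))) + R (lie \<omega>) w (lie Q (R0 w))"
      by (simp add: I.rs_add[OF wS] in1 G_simps)
    finally have "nrm ((1 / (t - t0)) *\<^sub>C (Rt t w - R0 w) - R (lie \<omega>) w (lie Q (R0 w)))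
       \<le> nrm (R (lie \<omega>) w (lie (q t - Q) (Rt t w))) + nrm (R (lie \<omega>) w (lie Q (Rt t w - R0 w)))"
      using nrm_triangle by simp
    also have "nrm (R (lie \<omega>) w (lie (q t - Q) (Rt t w))) \<le> M * (K * nrm (q t - Q) * (2 * M * nrm x))"
    proof (rule order.trans[OF M(2)[OF w in1(2)]], rule mult_left_mono[OF _ M(1)], rule order.trans[OF K(2)])
      show "K * nrm (q t - Q) * nrm (Rt t w) \<le> K * nrm (q t - Q) * (2 * M * nrm x)"
        using Rt(2) K(1) nrm_nonneg by (intro mult_left_mono mult_nonneg_nonneg) auto
    qed
    also have "nrm (R (lie \<omega>) w (lie Q (Rt t w - R0 w))) \<le> M * (K * nrm Q * (M * (K * nrm (\<gamma> t - \<omega>) * (2 * M * nrm x))))"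
    proof (rule order.trans[OF M(2)[OF w in1(3)]], rule mult_left_mono[OF _ M(1)], rule order.trans[OF K(2)])
      have "nrm (Rt t w - R0 w) \<le> M * nrm (lie (\<gamma> t - \<omega>) (Rt t w))" unfolding Rt(3) by (rule M(2)[OF w in1(1)])
      also have "\<dots> \<le> M * (K * nrm (\<gamma> t - \<omega>) * (2 * M * nrm x))"
      proof (rule mult_left_mono[OF _ M(1)], rule order.trans[OF K(2)])
        show "K * nrm (\<gamma> t - \<omega>) * nrm (Rt t w) \<le> K * nrm (\<gamma> t - \<omega>) * (2 * M * nrm x)"
          using Rt(2) K(1) nrm_nonneg by (intro mult_left_mono mult_nonneg_nonneg) auto
      qed
      finally show "K * nrm Q * nrm (Rt t w - R0 w) \<le> K * nrm Q * (M * (K * nrm (\<gamma> t - \<omega>) * (2 * M * nrm x)))"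
        using K(1) nrm_nonneg by (intro mult_left_mono mult_nonneg_nonneg) auto
    qed
    finally show ?thesis unfolding E_def by simp
  qed
  define g where "g t w = H w * \<phi> ((1 / (t - t0)) *\<^sub>C (Rt t w - R0 w))" for t w
  define g0 where "g0 w = H w * \<phi> (R (lie \<omega>) w (lie Q (R0 w)))" for w
  have calc: "holomorphic_calculus (G a) (lie (\<gamma> t)) D H" "holomorphic_calculus.admissible (G a) (lie (\<gamma> t)) D S \<rho>"
    if "t \<noteq> t0 \<and> M * K * nrm (\<gamma> t - \<omega>) \<le> 1/2" for t
    using perturbed_calculus[OF \<gamma>(1)[of t]] perturbed_resolvent(1)[OF M' K' \<gamma>(1) conjunct2[OF that]] by blast+
  have int0: "(\<lambda>w. H w * \<phi> (R0 w)) contour_integrable_on circlepath l \<rho>" if "l \<in> S" for l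
    unfolding R0_def using C.hc_circles(2)[OF admissible x \<phi> that] .
  have intt: "(\<lambda>w. H w * \<phi> (Rt t w)) contour_integrable_on circlepath l \<rho>"
    if "t \<noteq> t0 \<and> M * K * nrm (\<gamma> t - \<omega>) \<le> 1/2" "l \<in> S" for l t
    unfolding Rt_def using holomorphic_calculus.hc_circles(2)[OF calc(1)[OF that(1)] calc(2)[OF that(1)] x \<phi> that(2)] .
  have g_eq: "g t = (\<lambda>w. (1 / (t - t0)) * (H w * \<phi> (Rt t w) - H w * \<phi> (R0 w)))" for t
    by (rule ext) (simp add: g_def cfunctional_simps[OF \<phi>] algebra_simps)
  have gint: "g t contour_integrable_on circlepath l \<rho>"
    and gval: "contour_integral (circlepath l \<rho>) (g t) = (1 / (t - t0)) *
      (contour_integral (circlepath l \<rho>) (\<lambda>w. H w * \<phi> (Rt t w)) - contour_integral (circlepath l \<rho>) (\<lambda>w. H w * \<phi> (R0 w)))"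
    if "t \<noteq> t0 \<and> M * K * nrm (\<gamma> t - \<omega>) \<le> 1/2" "l \<in> S" for t l
  proof -
    have d: "(\<lambda>w. H w * \<phi> (Rt t w) - H w * \<phi> (R0 w)) contour_integrable_on circlepath l \<rho>"
      by (rule contour_integrable_diff[OF intt[OF that] int0[OF that(2)]])
    show "g t contour_integrable_on circlepath l \<rho>" unfolding g_eq by (rule contour_integrable_lmul[OF d])
    show "contour_integral (circlepath l \<rho>) (g t) = (1 / (t - t0)) *
      (contour_integral (circlepath l \<rho>) (\<lambda>w. H w * \<phi> (Rt t w)) - contour_integral (circlepath l \<rho>) (\<lambda>w. H w * \<phi> (R0 w)))"
      unfolding g_eq contour_integral_lmul[OF d] contour_integral_diff[OF intt[OF that] int0[OF that(2)]] ..
  qed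
  have lim: "((\<lambda>t. contour_integral (circlepath l \<rho>) (g t)) \<longlongrightarrow> contour_integral (circlepath l \<rho>) g0) (at t0)" if l: "l \<in> S" for l
  proof (rule contour_integral_uniform_limit_circlepath)
    show "eventually (\<lambda>t. g t contour_integrable_on circlepath l \<rho>) (at t0)"
      using near by eventually_elim (rule gint[OF _ l])
    have sD: "sphere l \<rho> \<subseteq> D" using discs[OF l] sphere_cball by blast
    have "bounded (H ` sphere l \<rho>)"
      by (intro compact_imp_bounded compact_continuous_image continuous_on_subset[OF holomorphic_on_imp_continuous_on[OF holH] sD]) simp
    then obtain h where h: "h > 0" "\<And>w. w \<in> sphere l \<rho> \<Longrightarrow> cmod (H w) \<le> h" by (auto simp: bounded_pos)
    show "uniform_limit (sphere l \<rho>) g g0 (at t0)"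
    proof (rule uniform_limitI)
      fix e :: real assume e: "0 < e"
      have "((\<lambda>t. h * (C * E t)) \<longlongrightarrow> h * (C * 0)) (at t0)" by (intro tendsto_intros limE)
      then have "eventually (\<lambda>t. h * (C * E t) < e) (at t0)" by (rule order_tendstoD(2)) (use e in simp)
      then show "\<forall>\<^sub>F t in at t0. \<forall>w\<in>sphere l \<rho>. dist (g t w) (g0 w) < e"
        using near
      proof eventually_elim
        case (elim t)
        show ?case
        proof
          fix w assume w: "w \<in> sphere l \<rho>"
          have "dist (g t w) (g0 w) = cmod (H w) * cmod (\<phi> ((1 / (t - t0)) *\<^sub>C (Rt t w - R0 w) - R (lie \<omega>) w (lie Q (R0 w))))"
            by (simp add: g_def g0_def dist_norm cfunctional_simps(5)[OF \<phi>] norm_mult[symmetric] right_diff_distrib)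
          also have "\<dots> \<le> h * (C * E t)"
          proof (intro mult_mono h(2)[OF w])
            show "cmod (\<phi> ((1 / (t - t0)) *\<^sub>C (Rt t w - R0 w) - R (lie \<omega>) w (lie Q (R0 w)))) \<le> C * E t"
              by (rule order.trans[OF C(2)]) (intro mult_left_mono step[OF elim(2) sphere_outside[OF l w]] C(1))
          qed (use h in auto)
          also have "\<dots> < e" by (rule elim(1))
          finally show "dist (g t w) (g0 w) < e" .
        qed
      qed
    qed
  qed (use \<rho> in auto)
  have "((\<lambda>t. 1 / (2 * pi * \<i>) * (\<Sum>l\<in>S. contour_integral (circlepath l \<rho>) (g t))) \<longlongrightarrow> \<phi> (dcalc Q x)) (at t0)"
    unfolding dcalc[OF Q x \<phi>] cint_def using lim by (intro tendsto_intros) (simp add: g0_def[abs_def] R0_def)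
  then show ?thesis
    unfolding has_field_derivative_iff
  proof (rule Lim_transform_eventually)
    show "\<forall>\<^sub>F t in at t0. 1 / (2 * pi * \<i>) * (\<Sum>l\<in>S. contour_integral (circlepath l \<rho>) (g t)) =
        (\<phi> (hol_calculus (G a) D H (lie (\<gamma> t)) x) - \<phi> (hol_calculus (G a) D H (lie (\<gamma> t0)) x)) / (t - t0)"
      using near
    proof eventually_elim
      case (elim t)
      have 1: "\<phi> (hol_calculus (G a) D H (lie (\<gamma> t)) x) = 1 / (2 * pi * \<i>) * (\<Sum>l\<in>S. contour_integral (circlepath l \<rho>) (\<lambda>w. H w * \<phi> (Rt t w)))"
        unfolding Rt_def by (rule holomorphic_calculus.hc_circles(1)[OF calc[OF elim] x \<phi>])
      have 2: "\<phi> (hol_calculus (G a) D H (lie (\<gamma> t0)) x) = 1 / (2 * pi * \<i>) * (\<Sum>l\<in>S. contour_integral (circlepath l \<rho>) (\<lambda>w. H w * \<phi> (R0 w)))"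
        unfolding R0_def \<gamma>(2) by (rule C.hc_circles(1)[OF admissible x \<phi>])
      have 3: "(\<Sum>l\<in>S. contour_integral (circlepath l \<rho>) (g t)) = (1 / (t - t0)) *
        ((\<Sum>l\<in>S. contour_integral (circlepath l \<rho>) (\<lambda>w. H w * \<phi> (Rt t w))) - (\<Sum>l\<in>S. contour_integral (circlepath l \<rho>) (\<lambda>w. H w * \<phi> (R0 w))))"
        unfolding sum_subtractf[symmetric] sum_distrib_left by (rule sum.cong[OF refl]) (rule gval[OF elim])
      have 4: "k * (1 / d * (u - v)) = (k * u - k * v) / d" for k d u v :: complex
        by (simp add: right_diff_distrib diff_divide_distrib)
      show ?case unfolding 1 2 3 by (rule 4)
    qed
  qed
qed

end

section \<open>Power series in two variables\<close>

(* The symbol $ denotes coefficients of power series from here on. *)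
unbundle no vec_syntax

text \<open>
  A power series \<open>complex fps fps\<close> has the first variable inside and the second outside: \<open>Q $ j $ i\<close> is the
  coefficient of \<open>x^i * y^j\<close>. The three embeddings of \<open>q\<close> are \<open>q x\<close>, \<open>q y\<close> and \<open>q (x + y)\<close>.
\<close>

definition fpsL :: "complex fps \<Rightarrow> complex fps fps" where "fpsL q = fps_const q"
definition fpsR :: "complex fps \<Rightarrow> complex fps fps" where "fpsR q = Abs_fps (\<lambda>j. fps_const (q $ j))"
definition fpsD :: "complex fps \<Rightarrow> complex fps fps" where
  "fpsD q = Abs_fps (\<lambda>j. Abs_fps (\<lambda>i. of_nat ((i + j) choose i) * q $ (i + j)))"

text \<open>
  The coordinate functions \<open>v + x\<close> and \<open>w + y\<close> near the point \<open>(v, w)\<close>.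
\<close>

definition varL :: "complex \<Rightarrow> complex fps fps" where "varL v = fpsL (fps_const v + fps_X)"
definition varR :: "complex \<Rightarrow> complex fps fps" where "varR w = fpsR (fps_const w + fps_X)"

lemma fpsL_nth: "fpsL q $ j $ i = (if j = 0 then q $ i else 0)" by (simp add: fpsL_def)
lemma fpsR_nth: "fpsR q $ j $ i = (if i = 0 then q $ j else 0)" by (simp add: fpsR_def)
lemma fpsD_nth: "fpsD q $ j $ i = of_nat ((i + j) choose i) * q $ (i + j)" by (simp add: fpsD_def)

lemma fpsL_fpsR_nth: "(fpsL p * fpsR q) $ j $ i = p $ i * q $ j"
  by (simp add: fpsL_def fpsR_def)

lemma varR_alt: "varR w = fps_const (fps_const w) + fps_X"
  by (intro fps_ext) (auto simp: varR_def fpsR_def fps_X_def)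

lemma mult_varL_nth: "(Q * varL v) $ j $ i = v * Q $ j $ i + (if i = 0 then 0 else Q $ j $ (i - 1))"
  by (simp add: varL_def fpsL_def distrib_left mult.commute)

lemma mult_varR_nth: "(Q * varR w) $ j $ i = w * Q $ j $ i + (if j = 0 then 0 else Q $ (j - 1) $ i)"
  by (simp add: varR_alt distrib_left mult.commute)

text \<open>
  Power series over an integral domain form an integral domain, so these factors can be cancelled.
\<close>

lemma vars_nonzero: "varL v \<noteq> 0" "varR w \<noteq> 0" "varL v + varR w \<noteq> 0"
proof -
  have 1: "varL v $ 0 $ 1 = 1" by (simp add: varL_def fpsL_nth)
  have 2: "varR w $ 1 $ 0 = 1" by (simp add: varR_def fpsR_nth)
  have 3: "varR w $ 0 $ 1 = 0" by (simp add: varR_def fpsR_nth)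
  show "varL v \<noteq> 0" using 1 by (metis fps_zero_nth zero_neq_one)
  show "varR w \<noteq> 0" using 2 by (metis fps_zero_nth zero_neq_one)
  have "(varL v + varR w) $ 0 $ 1 = 1" using 1 3 by simp
  then show "varL v + varR w \<noteq> 0" by (metis fps_zero_nth zero_neq_one)
qed

text \<open>\<open>geo c\<close> is the expansion of \<open>1 / (c - x)\<close> at \<open>x = 0\<close>.\<close>

definition geo :: "complex \<Rightarrow> complex fps" where "geo c = Abs_fps (\<lambda>k. 1 / c ^ Suc k)"

lemma geo_inverse: "c \<noteq> 0 \<Longrightarrow> geo c * (fps_const c - fps_X) = 1"
proof (rule fps_ext)
  fix k assume "c \<noteq> 0"
  then show "(geo c * (fps_const c - fps_X)) $ k = (1 :: complex fps) $ k"
    by (cases k) (simp_all add: geo_def right_diff_distrib)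
qed

lemma fpsL_1: "fpsL 1 = 1" by (simp add: fpsL_def)
lemma fpsL_mult: "fpsL (p * q) = fpsL p * fpsL q" by (simp add: fpsL_def)
lemma fpsL_diff: "fpsL (p - q) = fpsL p - fpsL q" by (simp add: fpsL_def)

lemma fpsR_1: "fpsR 1 = 1"
  by (intro fps_ext) (auto simp: fpsR_nth fps_one_nth)

text \<open>
  The embedded geometric series invert \<open>z - \<alpha>\<close>, \<open>z - \<beta>\<close> and \<open>z - (\<alpha> + \<beta>)\<close>.
  All relations between resolvents are derived from these three equations by ring arithmetic.
\<close>

lemma geoL: "z \<noteq> v \<Longrightarrow> fpsL (geo (z - v)) * (fps_const (fps_const z) - varL v) = 1"
proof -
  assume "z \<noteq> v"
  then have "geo (z - v) * (fps_const (z - v) - fps_X) = 1" by (intro geo_inverse) simp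
  moreover have "fps_const (z - v) - fps_X = fps_const z - (fps_const v + fps_X)" by (simp add: fps_const_sub[symmetric] del: fps_const_sub)
  moreover have "fps_const (fps_const z) = fpsL (fps_const z)" by (simp add: fpsL_def)
  ultimately show ?thesis by (simp only: varL_def fpsL_mult[symmetric] fpsL_diff[symmetric] fpsL_1)
qed

lemma geoR: "z \<noteq> w \<Longrightarrow> fpsR (geo (z - w)) * (fps_const (fps_const z) - varR w) = 1"
proof (intro fps_ext)
  fix j i assume z: "z \<noteq> w"
  have "(fpsR (geo (z - w)) * (fps_const (fps_const z) - varR w)) $ j $ i
    = (z - w) * fpsR (geo (z - w)) $ j $ i - (if j = 0 then 0 else fpsR (geo (z - w)) $ (j - 1) $ i)"
    unfolding right_diff_distrib fps_sub_nth mult_varR_nth by (simp add: algebra_simps)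
  also have "\<dots> = (1 :: complex fps fps) $ j $ i"
    using z by (cases j) (auto simp: fpsR_nth geo_def fps_one_nth)
  finally show "(fpsR (geo (z - w)) * (fps_const (fps_const z) - varR w)) $ j $ i = (1 :: complex fps fps) $ j $ i" .
qed

lemma geoD: "z \<noteq> v + w \<Longrightarrow> fpsD (geo (z - (v + w))) * (fps_const (fps_const z) - (varL v + varR w)) = 1"
proof (intro fps_ext)
  fix j i assume z: "z \<noteq> v + w"
  define c where "c = z - (v + w)"
  have c: "c \<noteq> 0" using z by (simp add: c_def)
  have "(fpsD (geo c) * (fps_const (fps_const z) - (varL v + varR w))) $ j $ i
    = c * fpsD (geo c) $ j $ i - (if i = 0 then 0 else fpsD (geo c) $ j $ (i - 1)) - (if j = 0 then 0 else fpsD (geo c) $ (j - 1) $ i)"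
    unfolding right_diff_distrib distrib_left fps_sub_nth fps_add_nth mult_varR_nth mult_varL_nth by (simp add: c_def algebra_simps)
  also have "\<dots> = (1 :: complex fps fps) $ j $ i"
  proof (cases i; cases j)
    fix i' j' assume ij: "i = Suc i'" "j = Suc j'"
    have "of_nat (Suc (Suc (i' + j')) choose Suc i') = (of_nat (Suc (i' + j') choose i') + of_nat (Suc (i' + j') choose Suc i') :: complex)"
      by simp
    then show ?thesis using c ij by (simp add: fpsD_nth geo_def fps_one_nth field_simps)
  qed (use c in \<open>simp_all add: fpsD_nth geo_def fps_one_nth\<close>)
  finally show "(fpsD (geo (z - (v + w))) * (fps_const (fps_const z) - (varL v + varR w))) $ j $ i = (1 :: complex fps fps) $ j $ i"
    by (simp only: c_def)
qed

subsection \<open>Expansion of functions of two variables\<close>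

text \<open>
  Iterated expansion: in the second variable for every first variable near \<open>v\<close>, then of each coefficient in the first
  variable. This is enough to expand polynomial expressions in functions of \<open>\<alpha>\<close>, of \<open>\<beta>\<close> and of \<open>\<alpha> + \<beta>\<close>.
\<close>

definition expands2 :: "(complex \<Rightarrow> complex \<Rightarrow> complex) \<Rightarrow> complex \<Rightarrow> complex \<Rightarrow> complex fps fps \<Rightarrow> bool" where
  "expands2 F v w Q \<longleftrightarrow> (\<exists>p. (\<forall>\<^sub>F x in nhds 0. (\<lambda>y. F (v + x) (w + y)) has_fps_expansion p x)
      \<and> (\<forall>j. (\<lambda>x. p x $ j) has_fps_expansion Q $ j))"

lemma expands2_add:
  assumes "expands2 F v w P" "expands2 F' v w Q"
  shows "expands2 (\<lambda>x y. F x y + F' x y) v w (P + Q)"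
proof -
  obtain p q where p: "\<forall>\<^sub>F x in nhds 0. (\<lambda>y. F (v + x) (w + y)) has_fps_expansion p x" "\<And>j. (\<lambda>x. p x $ j) has_fps_expansion P $ j"
    and q: "\<forall>\<^sub>F x in nhds 0. (\<lambda>y. F' (v + x) (w + y)) has_fps_expansion q x" "\<And>j. (\<lambda>x. q x $ j) has_fps_expansion Q $ j"
    using assms unfolding expands2_def by blast
  have "\<forall>\<^sub>F x in nhds 0. (\<lambda>y. F (v + x) (w + y) + F' (v + x) (w + y)) has_fps_expansion p x + q x"
    using p(1) q(1) by eventually_elim (rule has_fps_expansion_add)
  moreover have "(\<lambda>x. (p x + q x) $ j) has_fps_expansion (P + Q) $ j" for j
    using has_fps_expansion_add[OF p(2) q(2)] by simp
  ultimately show ?thesis unfolding expands2_def by (intro exI[of _ "\<lambda>x. p x + q x"]) simp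
qed

lemma expands2_mult:
  assumes "expands2 F v w P" "expands2 F' v w Q"
  shows "expands2 (\<lambda>x y. F x y * F' x y) v w (P * Q)"
proof -
  obtain p q where p: "\<forall>\<^sub>F x in nhds 0. (\<lambda>y. F (v + x) (w + y)) has_fps_expansion p x" "\<And>j. (\<lambda>x. p x $ j) has_fps_expansion P $ j"
    and q: "\<forall>\<^sub>F x in nhds 0. (\<lambda>y. F' (v + x) (w + y)) has_fps_expansion q x" "\<And>j. (\<lambda>x. q x $ j) has_fps_expansion Q $ j"
    using assms unfolding expands2_def by blast
  have "\<forall>\<^sub>F x in nhds 0. (\<lambda>y. F (v + x) (w + y) * F' (v + x) (w + y)) has_fps_expansion p x * q x"
    using p(1) q(1) by eventually_elim (rule has_fps_expansion_mult)
  moreover have "(\<lambda>x. (p x * q x) $ j) has_fps_expansion (P * Q) $ j" for j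
    unfolding fps_mult_nth by (intro has_fps_expansion_sum has_fps_expansion_mult p q)
  ultimately show ?thesis unfolding expands2_def by (intro exI[of _ "\<lambda>x. p x * q x"]) simp
qed

lemma expands2_L:
  assumes "open U" "f holomorphic_on U" "v \<in> U"
  shows "expands2 (\<lambda>x y. f x) v w (fpsL (fps_expansion f v))"
proof -
  have e: "(\<lambda>x. f (v + x)) has_fps_expansion fps_expansion f v"
    by (rule analytic_at_imp_has_fps_expansion) (use assms analytic_at in blast)
  have "(\<lambda>x. fps_const (f (v + x)) $ j) has_fps_expansion fpsL (fps_expansion f v) $ j" for j
    using e by (cases j) (simp_all add: fpsL_def)
  then show ?thesis unfolding expands2_def by (intro exI[of _ "\<lambda>x. fps_const (f (v + x))"]) auto
qed

lemma expands2_R: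
  assumes "open U" "f holomorphic_on U" "w \<in> U"
  shows "expands2 (\<lambda>x y. f y) v w (fpsR (fps_expansion f w))"
proof -
  have e: "(\<lambda>x. f (w + x)) has_fps_expansion fps_expansion f w"
    by (rule analytic_at_imp_has_fps_expansion) (use assms analytic_at in blast)
  then show ?thesis unfolding expands2_def
    by (intro exI[of _ "\<lambda>x. fps_expansion f w"]) (auto simp: fpsR_def)
qed

lemma expands2_D:
  assumes "open U" "f holomorphic_on U" "v + w \<in> U"
  shows "expands2 (\<lambda>x y. f (x + y)) v w (fpsD (fps_expansion f (v + w)))"
proof -
  have "\<forall>\<^sub>F x in nhds 0. x \<in> (\<lambda>x. x + (v + w)) -` U"
    by (rule eventually_nhds_in_open) (use assms in \<open>auto intro!: open_vimage continuous_intros\<close>)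
  then have 1: "\<forall>\<^sub>F x in nhds 0. (\<lambda>y. f ((v + x) + (w + y))) has_fps_expansion fps_expansion f (x + (v + w))"
  proof eventually_elim
    case (elim x)
    have "(\<lambda>y. f ((x + (v + w)) + y)) has_fps_expansion fps_expansion f (x + (v + w))"
      by (rule analytic_at_imp_has_fps_expansion) (use elim assms analytic_at in blast)
    then show ?case by (simp add: add_ac)
  qed
  have 2: "(\<lambda>x. fps_expansion f (x + (v + w)) $ j) has_fps_expansion fpsD (fps_expansion f (v + w)) $ j" for j
  proof -
    have "(\<lambda>x. (deriv ^^ j) f ((v + w) + x)) has_fps_expansion fps_expansion ((deriv ^^ j) f) (v + w)"
      by (rule analytic_at_imp_has_fps_expansion)
        (use holomorphic_higher_deriv[OF assms(2,1)] assms analytic_at in blast)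
    then have "(\<lambda>x. inverse (fact j) * (deriv ^^ j) f ((v + w) + x)) has_fps_expansion fps_const (inverse (fact j)) * fps_expansion ((deriv ^^ j) f) (v + w)"
      by (rule has_fps_expansion_cmult_left)
    moreover have "fps_const (inverse (fact j)) * fps_expansion ((deriv ^^ j) f) (v + w) = fpsD (fps_expansion f (v + w)) $ j"
    proof (rule fps_ext)
      fix i
      have "of_nat ((i + j) choose i) = (fact (i + j) / (fact i * fact j) :: complex)"
        using binomial_fact[of i "i + j", where 'a = complex] by simp
      then show "(fps_const (inverse (fact j)) * fps_expansion ((deriv ^^ j) f) (v + w)) $ i = fpsD (fps_expansion f (v + w)) $ j $ i"
        by (simp add: fps_expansion_def fpsD_nth funpow_add field_simps)
    qed
    ultimately show ?thesis by (simp add: fps_expansion_def add_ac field_simps)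
  qed
  show ?thesis unfolding expands2_def
    using 1 2 by (intro exI[of _ "\<lambda>x. fps_expansion f (x + (v + w))"]) simp
qed

lemma expands2_const: "expands2 (\<lambda>x y. c) v w (fps_const (fps_const c))"
  using expands2_L[of UNIV "\<lambda>_. c" v w]
proof -
  have "fps_expansion (\<lambda>_. c) v = fps_const c"
    by (rule fps_ext) (simp add: fps_expansion_def)
  then show ?thesis using expands2_L[of UNIV "\<lambda>_. c" v w] by (simp add: fpsL_def)
qed

lemma expands2_diff:
  assumes "expands2 F v w P" "expands2 F' v w Q"
  shows "expands2 (\<lambda>x y. F x y - F' x y) v w (P - Q)"
proof -
  have "expands2 (\<lambda>x y. F x y + (- 1) * F' x y) v w (P + fps_const (fps_const (- 1)) * Q)"
    by (intro expands2_add expands2_mult expands2_const assms)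
  moreover have "fps_const (fps_const (- 1 :: complex)) = - 1" by (simp add: fps_const_neg[symmetric] del: fps_const_neg)
  ultimately show ?thesis by simp
qed

lemma fps_expansion_id: "fps_expansion (\<lambda>x. x) v = fps_const v + fps_X"
  by (rule fps_ext) (auto simp: fps_expansion_def fps_X_def)

lemma expands2_varL: "expands2 (\<lambda>x y. x) v w (varL v)"
  using expands2_L[of UNIV "\<lambda>x. x" v w] by (simp add: fps_expansion_id varL_def)

lemma expands2_varR: "expands2 (\<lambda>x y. y) v w (varR w)"
  using expands2_R[of UNIV "\<lambda>x. x" w v] by (simp add: fps_expansion_id varR_def)

lemma expands2_zero:
  assumes "expands2 F v w Q" "r > 0" "\<And>x y. x \<in> ball v r \<Longrightarrow> y \<in> ball w r \<Longrightarrow> F x y = 0"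
  shows "Q = 0"
proof -
  obtain p where p: "\<forall>\<^sub>F x in nhds 0. (\<lambda>y. F (v + x) (w + y)) has_fps_expansion p x" "\<And>j. (\<lambda>x. p x $ j) has_fps_expansion Q $ j"
    using assms(1) unfolding expands2_def by blast
  have b: "\<forall>\<^sub>F x in nhds (0::complex). x \<in> ball 0 r" by (rule eventually_nhds_in_open) (use assms(2) in auto)
  have "\<forall>\<^sub>F x in nhds 0. p x = 0"
    using p(1) b
  proof eventually_elim
    case (elim x)
    have "\<forall>\<^sub>F y in nhds 0. F (v + x) (w + y) = 0"
      using b by eventually_elim (use elim in \<open>auto intro!: assms(3) simp: dist_norm\<close>)
    then have "(\<lambda>y. F (v + x) (w + y)) has_fps_expansion 0" by (simp add: has_fps_expansion_0_iff)
    then show ?case using fps_expansion_unique_complex elim(1) by blast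
  qed
  then have "\<forall>\<^sub>F x in nhds 0. p x $ j = 0" for j by eventually_elim simp
  then have "(\<lambda>x. p x $ j) has_fps_expansion 0" for j by (simp add: has_fps_expansion_0_iff)
  then have "Q $ j = 0" for j using fps_expansion_unique_complex p(2) by blast
  then show ?thesis by (intro fps_ext) simp
qed

lemma continuous_zero_off_finite:
  fixes f :: "complex \<Rightarrow> complex"
  assumes U: "open U" "continuous_on U f" "finite F" and z: "\<And>x. x \<in> U \<Longrightarrow> x \<notin> F \<Longrightarrow> f x = 0" and x: "x \<in> U"
  shows "f x = 0"
proof -
  have "isCont f x" using U x by (simp add: continuous_on_eq_continuous_at)
  then have 1: "(f \<longlongrightarrow> f x) (at x)" by (simp add: isCont_def)
  have "open (U - (F - {x}))" using U by (intro open_Diff finite_imp_closed) auto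
  then have "eventually (\<lambda>y. y \<in> U - (F - {x}) - {x}) (at x)" using x by (intro eventually_at_in_open) auto
  then have "eventually (\<lambda>y. 0 = f y) (at x)" by eventually_elim (use z in auto)
  then have "(f \<longlongrightarrow> 0) (at x)" by (rule Lim_transform_eventually[OF tendsto_const])
  then show ?thesis using 1 LIM_unique by blast
qed

text \<open>
  Both sides of \<open>chi_a_fay\<close>, multiplied by the three possible denominators, are holomorphic near \<open>(v, w)\<close> and agree off the lines
  where a denominator vanishes, hence everywhere, and so do their expansions.
\<close>

lemma chi_a_fay_fps:
  assumes \<tau>: "Im \<tau> > 0" and N: "b < N" "c < N" and d: "d = (b + c) mod N"
    and sing: "v \<notin> sing_a N \<tau> b" "w \<notin> sing_a N \<tau> c" "v + w \<notin> sing_a N \<tau> d"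
    and xy: "x \<notin> period_lattice \<tau>" "y \<notin> period_lattice \<tau>" "y - x \<notin> period_lattice \<tau>"
  defines "e \<equiv> \<lambda>a z. fps_expansion (\<lambda>w. chi_a N \<tau> a w z)"
  shows "varL v * varR w * (varL v + varR w) * (fpsL (e b x v) * fpsR (e c y w) - fpsR (e c (y - x) w) * fpsD (e d x (v + w))
      - fpsL (e b (x - y) v) * fpsD (e d y (v + w)))
    = of_bool (b = 0) * (varR w * (varL v + varR w) * (fpsD (e d y (v + w)) - fpsR (e c y w)))
    + of_bool (c = 0) * (varL v * (varL v + varR w) * (fpsD (e d x (v + w)) - fpsL (e b x v)))
    + of_bool (d = 0) * (varL v * varR w * (fpsL (e b (x - y) v) + fpsR (e c (y - x) w)))"
proof -
  let ?f = "\<lambda>a z w. chi_a N \<tau> a w z"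
  have dN: "d < N" using d N by simp
  have xy': "x - y \<notin> period_lattice \<tau>" using xy(3) period_lattice_minus[of "y - x"] by simp
  note hol = chi_a_holomorphic[OF \<tau>]
  note op = open_compl_sing_a[OF \<tau>]
  have o: "expands2 (\<lambda>x y. of_bool P) v w (of_bool P)" for P
    using expands2_const[of 0 v w] expands2_const[of 1 v w] by (cases P) auto
  define F where "F \<alpha> \<beta> = \<alpha> * \<beta> * (\<alpha> + \<beta>) * (?f b x \<alpha> * ?f c y \<beta> - ?f c (y - x) \<beta> * ?f d x (\<alpha> + \<beta>) - ?f b (x - y) \<alpha> * ?f d y (\<alpha> + \<beta>))
    - (of_bool (b = 0) * (\<beta> * (\<alpha> + \<beta>) * (?f d y (\<alpha> + \<beta>) - ?f c y \<beta>))
    + of_bool (c = 0) * (\<alpha> * (\<alpha> + \<beta>) * (?f d x (\<alpha> + \<beta>) - ?f b x \<alpha>))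
    + of_bool (d = 0) * (\<alpha> * \<beta> * (?f b (x - y) \<alpha> + ?f c (y - x) \<beta>)))" for \<alpha> \<beta>
  have L: "expands2 (\<lambda>\<alpha> \<beta>. ?f b z \<alpha>) v w (fpsL (e b z v))" if "z \<notin> period_lattice \<tau>" for z
    unfolding e_def by (rule expands2_L[OF op hol]) (use N sing that in auto)
  have R: "expands2 (\<lambda>\<alpha> \<beta>. ?f c z \<beta>) v w (fpsR (e c z w))" if "z \<notin> period_lattice \<tau>" for z
    unfolding e_def by (rule expands2_R[OF op hol]) (use N sing that in auto)
  have D: "expands2 (\<lambda>\<alpha> \<beta>. ?f d z (\<alpha> + \<beta>)) v w (fpsD (e d z (v + w)))" if "z \<notin> period_lattice \<tau>" for z
    unfolding e_def by (rule expands2_D[OF op hol]) (use dN sing that in auto)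
  have ex: "expands2 F v w (varL v * varR w * (varL v + varR w) * (fpsL (e b x v) * fpsR (e c y w) - fpsR (e c (y - x) w) * fpsD (e d x (v + w))
      - fpsL (e b (x - y) v) * fpsD (e d y (v + w)))
    - (of_bool (b = 0) * (varR w * (varL v + varR w) * (fpsD (e d y (v + w)) - fpsR (e c y w)))
    + of_bool (c = 0) * (varL v * (varL v + varR w) * (fpsD (e d x (v + w)) - fpsL (e b x v)))
    + of_bool (d = 0) * (varL v * varR w * (fpsL (e b (x - y) v) + fpsR (e c (y - x) w)))))"
    unfolding F_def
    by (intro expands2_diff expands2_add expands2_mult expands2_varL expands2_varR L R D o xy xy')
  obtain r1 where r1: "r1 > 0" "ball v r1 \<subseteq> - sing_a N \<tau> b" using op[OF N(1)] sing(1) by (auto simp: open_contains_ball)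
  obtain r2 where r2: "r2 > 0" "ball w r2 \<subseteq> - sing_a N \<tau> c" using op[OF N(2)] sing(2) by (auto simp: open_contains_ball)
  obtain r3 where r3: "r3 > 0" "ball (v + w) r3 \<subseteq> - sing_a N \<tau> d" using op[OF dN] sing(3) by (auto simp: open_contains_ball)
  define r where "r = min (min r1 r2) (r3 / 2)"
  have r: "r > 0" using r1 r2 r3 by (simp add: r_def)
  have in1: "\<alpha> \<notin> sing_a N \<tau> b" if "\<alpha> \<in> ball v r" for \<alpha> using that r1(2) by (auto simp: r_def)
  have in2: "\<beta> \<notin> sing_a N \<tau> c" if "\<beta> \<in> ball w r" for \<beta> using that r2(2) by (auto simp: r_def)
  have in3: "\<alpha> + \<beta> \<notin> sing_a N \<tau> d" if "\<alpha> \<in> ball v r" "\<beta> \<in> ball w r" for \<alpha> \<beta>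
  proof -
    have "dist (v + w) (\<alpha> + \<beta>) \<le> dist v \<alpha> + dist w \<beta>" by (rule dist_triangle_add)
    also have "\<dots> < r3" using that by (simp add: r_def)
    finally show ?thesis using r3(2) by auto
  qed
  have generic: "F \<alpha> \<beta> = 0" if "\<alpha> \<in> ball v r" "\<beta> \<in> ball w r" "\<alpha> \<noteq> 0" "\<beta> \<noteq> 0" "\<alpha> + \<beta> \<noteq> 0" for \<alpha> \<beta>
  proof -
    have f: "?f b x \<alpha> * ?f c y \<beta> - ?f d x (\<alpha> + \<beta>) * ?f c (y - x) \<beta> - ?f d y (\<alpha> + \<beta>) * ?f b (x - y) \<alpha>
     = of_bool (b = 0) / \<alpha> * (?f d y (\<alpha> + \<beta>) - ?f c y \<beta>) + of_bool (c = 0) / \<beta> * (?f d x (\<alpha> + \<beta>) - ?f b x \<alpha>)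
      + of_bool (d = 0) / (\<alpha> + \<beta>) * (?f b (x - y) \<alpha> + ?f c (y - x) \<beta>)"
      by (rule chi_a_fay[OF \<tau> N in1 in2 in3 d]) (use that xy in auto)
    have alg: "al * be * s * (p - q) - (B * (be * s * X) + C * (al * s * Y) + E * (al * be * Z)) = 0"
      if "p - q = B / al * X + C / be * Y + E / s * Z" "al \<noteq> 0" "be \<noteq> 0" "s \<noteq> 0" for al be s p q X Y Z B C E :: complex
      unfolding that(1) using that(2-4) by (simp add: field_simps)
    show ?thesis unfolding F_def diff_diff_eq
      by (rule alg) (use f that in \<open>simp_all add: diff_diff_eq mult.commute\<close>)
  qed
  have cont: "continuous_on (- sing_a N \<tau> a) (?f a z)" if "a < N" "z \<notin> period_lattice \<tau>" for a z
    using hol[OF that(2,1)] by (rule holomorphic_on_imp_continuous_on)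
  have cf: "continuous_on U (\<lambda>u. ?f a z (g u))" if "a < N" "z \<notin> period_lattice \<tau>" "continuous_on U g" "\<And>u. u \<in> U \<Longrightarrow> g u \<notin> sing_a N \<tau> a"
    for a z g and U :: "complex set"
    by (rule continuous_on_compose2[OF cont[OF that(1,2)] that(3)]) (use that(4) in auto)
  \<comment> \<open>The exceptional lines \<open>\<beta> = 0\<close> and \<open>\<alpha> + \<beta> = 0\<close> meet each line of constant nonzero \<open>\<alpha>\<close> in one point; \<open>\<alpha> = 0\<close> comes last.\<close>
  have zero1: "F \<alpha> \<beta> = 0" if "\<alpha> \<in> ball v r" "\<beta> \<in> ball w r" "\<alpha> \<noteq> 0" for \<alpha> \<beta>
  proof (rule continuous_zero_off_finite[of "ball w r" "F \<alpha>" "{0, - \<alpha>}"])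
    show "continuous_on (ball w r) (F \<alpha>)"
      unfolding F_def[abs_def]
      by (intro continuous_intros cf) (use that(1) in1 in2 in3 N dN xy xy' in auto)
    fix \<beta>' assume "\<beta>' \<in> ball w r" "\<beta>' \<notin> {0, - \<alpha>}"
    then show "F \<alpha> \<beta>' = 0" using generic[OF that(1), of \<beta>'] that(3) by (auto simp: add_eq_0_iff)
  qed (use that in auto)
  have zero2: "F \<alpha> \<beta> = 0" if "\<alpha> \<in> ball v r" "\<beta> \<in> ball w r" for \<alpha> \<beta>
  proof (rule continuous_zero_off_finite[of "ball v r" "\<lambda>\<alpha>. F \<alpha> \<beta>" "{0}"])
    show "continuous_on (ball v r) (\<lambda>\<alpha>. F \<alpha> \<beta>)"
      unfolding F_def[abs_def]
      by (intro continuous_intros cf) (use that(2) in1 in2 in3 N dN xy xy' in auto)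
  qed (use that zero1 in auto)
  from expands2_zero[OF ex r zero2] show ?thesis by simp
qed

section \<open>Trilinear identities on generalized eigenvectors\<close>

context perturbation
begin

text \<open>
  Contour integration of power series that depend on the contour variable is done coefficientwise. It is linear over power series
  not depending on that variable (\<open>CI_mult\<close>), which is why identities between integrands survive integration.
\<close>

definition fcont :: "(complex \<Rightarrow> complex fps fps) \<Rightarrow> bool" where
  "fcont Q \<longleftrightarrow> (\<forall>i j. continuous_on outside (\<lambda>z. Q z $ j $ i))"

definition CI :: "(complex \<Rightarrow> complex fps fps) \<Rightarrow> complex fps fps" where
  "CI Q = Abs_fps (\<lambda>j. Abs_fps (\<lambda>i. cint (\<lambda>z. Q z $ j $ i)))"

lemma CI_nth: "CI Q $ j $ i = cint (\<lambda>z. Q z $ j $ i)" by (simp add: CI_def)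

lemma fps2_mult_nth: "(Q * Q') $ j $ i = (\<Sum>l=0..j. \<Sum>k=0..i. Q $ l $ k * Q' $ (j - l) $ (i - k))"
  for Q Q' :: "complex fps fps"
  by (simp add: fps_mult_nth fps_sum_nth)

lemma fcont_mult: "fcont Q \<Longrightarrow> fcont Q' \<Longrightarrow> fcont (\<lambda>z. Q z * Q' z)"
  unfolding fcont_def fps2_mult_nth by (intro allI continuous_intros) auto

lemma fcont_const: "fcont (\<lambda>z. Q)" by (simp add: fcont_def)

lemma CI_mult: "fcont Q \<Longrightarrow> CI (\<lambda>z. Q z * C) = CI Q * C"
proof (intro fps_ext)
  fix i j assume Q: "fcont Q"
  have c: "continuous_on outside (\<lambda>z. Q z $ l $ k * c)" for l k c
    using Q by (auto simp: fcont_def intro!: continuous_intros)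
  have m: "cint (\<lambda>z. Q z $ l $ k * c) = cint (\<lambda>z. Q z $ l $ k) * c" for l k c
    using cint_cmult[of "\<lambda>z. Q z $ l $ k" c] Q by (simp add: fcont_def mult.commute)
  have "CI (\<lambda>z. Q z * C) $ j $ i = cint (\<lambda>z. \<Sum>l=0..j. \<Sum>k=0..i. Q z $ l $ k * C $ (j - l) $ (i - k))"
    unfolding CI_nth fps2_mult_nth ..
  also have "\<dots> = (\<Sum>l=0..j. cint (\<lambda>z. \<Sum>k=0..i. Q z $ l $ k * C $ (j - l) $ (i - k)))"
    by (rule cint_sum) (intro continuous_on_sum c)
  also have "\<dots> = (\<Sum>l=0..j. \<Sum>k=0..i. cint (\<lambda>z. Q z $ l $ k * C $ (j - l) $ (i - k)))"
    by (intro sum.cong refl cint_sum c)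
  also have "\<dots> = (CI Q * C) $ j $ i" unfolding m fps2_mult_nth CI_nth ..
  finally show "CI (\<lambda>z. Q z * C) $ j $ i = (CI Q * C) $ j $ i" .
qed

lemma CI_diff: "fcont Q \<Longrightarrow> fcont Q' \<Longrightarrow> CI (\<lambda>z. Q z - Q' z) = CI Q - CI Q'"
proof (intro fps_ext)
  fix i j assume Q: "fcont Q" "fcont Q'"
  have "cint (\<lambda>z. Q z $ j $ i + (- 1) * Q' z $ j $ i) = cint (\<lambda>z. Q z $ j $ i) + cint (\<lambda>z. (- 1) * Q' z $ j $ i)"
    using Q by (intro cint_add continuous_intros) (auto simp: fcont_def)
  also have "cint (\<lambda>z. (- 1) * Q' z $ j $ i) = (- 1) * cint (\<lambda>z. Q' z $ j $ i)"
    by (rule cint_cmult) (use Q in \<open>auto simp: fcont_def\<close>)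
  finally show "CI (\<lambda>z. Q z - Q' z) $ j $ i = (CI Q - CI Q') $ j $ i" by (simp add: CI_nth)
qed

lemma CI_cong: "(\<And>z. z \<in> outside \<Longrightarrow> Q z = Q' z) \<Longrightarrow> CI Q = CI Q'"
  by (intro fps_ext) (auto simp: CI_nth intro: cint_cong)

lemma continuous_geo: "p \<in> S \<Longrightarrow> continuous_on outside (\<lambda>z. geo (z - p) $ k)"
  unfolding geo_def using outside_S by (auto intro!: continuous_intros)

lemma continuous_on_cond: "continuous_on U f \<Longrightarrow> continuous_on U (\<lambda>z. if C then f z else 0 :: complex)"
  by (cases C) simp_all

lemma fcont_geo:
  assumes "p \<in> S"
  shows "fcont (\<lambda>z. fpsL (geo (z - p)))" "fcont (\<lambda>z. fpsR (geo (z - p)))" "fcont (\<lambda>z. fpsD (geo (z - p)))"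
  unfolding fcont_def fpsL_nth fpsR_nth fpsD_nth
  by (intro allI continuous_on_cond continuous_intros continuous_geo assms)+

lemma cint_geo: "p \<in> S \<Longrightarrow> cint (\<lambda>z. geo (z - p) $ k) = fps_expansion H p $ k"
  unfolding geo_def fps_expansion_def fps_nth_Abs_fps by (rule cint_pole)

lemma CI_geo:
  assumes p: "p \<in> S"
  shows "CI (\<lambda>z. fpsL (geo (z - p))) = fpsL (fps_expansion H p)"
    and "CI (\<lambda>z. fpsR (geo (z - p))) = fpsR (fps_expansion H p)"
    and "CI (\<lambda>z. fpsD (geo (z - p))) = fpsD (fps_expansion H p)"
  by (intro fps_ext; simp add: CI_nth fpsL_nth fpsR_nth fpsD_nth cint_0 cint_geo[OF p] cint_cmult[OF continuous_geo[OF p]])+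

text \<open>
  \<open>- geo (- z - v)\<close> expands \<open>1 / (z + \<alpha>)\<close> at \<open>\<alpha> = v\<close>, the resolvent of \<open>- ad \<omega>\<close>, which is the adjoint of \<open>ad \<omega>\<close> for \<open>B\<close>.
\<close>

lemma reflected_geo_nth: "(- geo (- z - v)) $ k = (- 1) ^ k * geo (z - (- v)) $ k"
proof -
  have "- (1 / (- (z + v)) ^ Suc k) = (- 1) ^ k * (1 / (z + v) ^ Suc k)"
    by (cases "even k") (simp_all add: power_minus_odd power_minus_even del: power_Suc minus_add_distrib)
  then show ?thesis by (simp add: geo_def)
qed

lemma CI_reflected:
  assumes p: "- v \<in> S"
  shows "fcont (\<lambda>z. fpsL (- geo (- z - v)))"
    and "CI (\<lambda>z. fpsL (- geo (- z - v))) = fpsL (Abs_fps (\<lambda>k. (- 1) ^ k * fps_expansion H (- v) $ k))"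
proof -
  show "fcont (\<lambda>z. fpsL (- geo (- z - v)))"
    unfolding fcont_def fpsL_nth reflected_geo_nth by (intro allI continuous_on_cond continuous_intros continuous_geo p)
  show "CI (\<lambda>z. fpsL (- geo (- z - v))) = fpsL (Abs_fps (\<lambda>k. (- 1) ^ k * fps_expansion H (- v) $ k))"
  proof (intro fps_ext)
    fix j i
    have "cint (\<lambda>z. (- 1) ^ i * geo (z - (- v)) $ i) = (- 1) ^ i * fps_expansion H (- v) $ i"
      by (simp only: cint_cmult[OF continuous_geo[OF p]] cint_geo[OF p])
    then show "CI (\<lambda>z. fpsL (- geo (- z - v))) $ j $ i = fpsL (Abs_fps (\<lambda>k. (- 1) ^ k * fps_expansion H (- v) $ k)) $ j $ i"
      by (cases "j = 0") (simp_all only: CI_nth fpsL_nth reflected_geo_nth fps_nth_Abs_fps cint_0 if_True if_False simp_thms)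
  qed
qed

end

locale gev_pair = twisted_lie_algebra B \<mu> N n \<tau> T T'
  for B :: "'g::complex_lie_algebra \<Rightarrow> 'g \<Rightarrow> complex" and \<mu> :: "'g \<Rightarrow> 'g" and N n \<tau> T T' +
  fixes \<omega> Y Z :: 'g and v w :: complex and b c K :: nat
  assumes \<omega>: "\<omega> \<in> G 0" and b: "b < N" and c: "c < N" and Y: "Y \<in> G b" and Z: "Z \<in> G c"
    and nY: "(nil (lie \<omega>) v ^^ K) Y = 0" and nZ: "(nil (lie \<omega>) w ^^ K) Z = 0" and K: "K > 0"
begin

definition u :: "nat \<Rightarrow> nat \<Rightarrow> 'g" where
  "u i j = lie ((nil (lie \<omega>) v ^^ i) Y) ((nil (lie \<omega>) w ^^ j) Z)"

text \<open>\<open>Ev Q\<close> is the result of applying the two-variable function \<open>Q\<close> of the commuting operators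
  \<open>lie \<omega>\<close> on the first and on the second factor to the bracket of \<open>Y\<close> and \<open>Z\<close>.\<close>

definition Ev :: "complex fps fps \<Rightarrow> 'g" where
  "Ev Q = (\<Sum>j<K. \<Sum>i<K. (Q $ j $ i) *\<^sub>C u i j)"

lemma IY: "invariant_subspace (G b) (lie \<omega>)" and IZ: "invariant_subspace (G c) (lie \<omega>)"
  and ID: "invariant_subspace (G ((b + c) mod N)) (lie \<omega>)"
  using invariant_subspace_G[OF \<omega>] b c by simp_all

lemma nY_in: "(nil (lie \<omega>) v ^^ i) Y \<in> G b" by (rule invariant_subspace.nil_in[OF IY Y])
lemma nZ_in: "(nil (lie \<omega>) w ^^ i) Z \<in> G c" by (rule invariant_subspace.nil_in[OF IZ Z])

lemma u_in: "u i j \<in> G ((b + c) mod N)"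
  unfolding u_def by (rule G_lie[OF nY_in nZ_in])

lemma u_zero: "K \<le> i \<or> K \<le> j \<Longrightarrow> u i j = 0"
  unfolding u_def using invariant_subspace.nil_mono[OF IY nY] invariant_subspace.nil_mono[OF IZ nZ]
  by (auto simp: lie_zero_left lie_zero_right)

lemma lie_u: "lie \<omega> (u i j) = (v + w) *\<^sub>C u i j + u (Suc i) j + u i (Suc j)"
  unfolding u_def
  by (subst lie_derivation) (simp add: nil_def lie_diff_left lie_diff_right lie_scale_left lie_scale_right scaleC_add_left)

lemma Ev_in: "Ev Q \<in> G ((b + c) mod N)"
  unfolding Ev_def by (intro G_simps u_in)

lemma Ev_diff: "Ev (Q - Q') = Ev Q - Ev Q'"
  by (simp add: Ev_def complex_vector.scale_left_diff_distrib sum_subtractf)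
lemma Ev_0: "Ev 0 = 0" by (simp add: Ev_def)
lemma Ev_const: "Ev (Q * fps_const (fps_const k)) = k *\<^sub>C Ev Q"
  by (simp add: Ev_def complex_vector.scale_sum_right scaleC_scaleC mult.commute)

lemma sum_shift:
  assumes "f K = 0"
  shows "(\<Sum>i<K. p i *\<^sub>C f (Suc i)) = (\<Sum>i<K. (if i = 0 then 0 else p (i - 1)) *\<^sub>C f i)"
proof -
  have "(\<Sum>i<Suc K. (if i = 0 then 0 else p (i - 1)) *\<^sub>C f i) = (\<Sum>i<K. p i *\<^sub>C f (Suc i))"
    by (subst sum.lessThan_Suc_shift) simp
  then show ?thesis using assms by simp
qed

text \<open>
  The derivation property: on brackets \<open>ad \<omega>\<close> acts as the sum of its actions on the two factors.
\<close>

lemma lie_Ev: "lie \<omega> (Ev Q) = Ev (Q * (varL v + varR w))"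
proof -
  have 1: "(\<Sum>j<K. \<Sum>i<K. (Q $ j $ i) *\<^sub>C u (Suc i) j) = (\<Sum>j<K. \<Sum>i<K. (if i = 0 then 0 else Q $ j $ (i - 1)) *\<^sub>C u i j)"
    by (rule sum.cong[OF refl], rule sum_shift) (simp add: u_zero)
  have "(\<Sum>j<K. \<Sum>i<K. (Q $ j $ i) *\<^sub>C u i (Suc j)) = (\<Sum>i<K. \<Sum>j<K. (Q $ j $ i) *\<^sub>C u i (Suc j))" by (rule sum.swap)
  also have "\<dots> = (\<Sum>i<K. \<Sum>j<K. (if j = 0 then 0 else Q $ (j - 1) $ i) *\<^sub>C u i j)"
    by (rule sum.cong[OF refl], rule sum_shift) (simp add: u_zero)
  also have "\<dots> = (\<Sum>j<K. \<Sum>i<K. (if j = 0 then 0 else Q $ (j - 1) $ i) *\<^sub>C u i j)" by (rule sum.swap)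
  finally have 2: "(\<Sum>j<K. \<Sum>i<K. (Q $ j $ i) *\<^sub>C u i (Suc j)) = (\<Sum>j<K. \<Sum>i<K. (if j = 0 then 0 else Q $ (j - 1) $ i) *\<^sub>C u i j)" .
  have "lie \<omega> (Ev Q) = (\<Sum>j<K. \<Sum>i<K. (Q $ j $ i) *\<^sub>C lie \<omega> (u i j))"
    by (simp add: Ev_def clinear_simps[OF clinear_lie(1)])
  also have "\<dots> = (\<Sum>j<K. \<Sum>i<K. ((v + w) * Q $ j $ i) *\<^sub>C u i j) + (\<Sum>j<K. \<Sum>i<K. (Q $ j $ i) *\<^sub>C u (Suc i) j) + (\<Sum>j<K. \<Sum>i<K. (Q $ j $ i) *\<^sub>C u i (Suc j))"
    by (simp add: lie_u scaleC_add_right sum.distrib scaleC_scaleC mult.commute)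
  also have "\<dots> = Ev (Q * (varL v + varR w))"
    unfolding 1 2 Ev_def sum.distrib[symmetric] scaleC_add_left[symmetric]
    by (simp only: distrib_left fps_add_nth mult_varL_nth mult_varR_nth) (simp add: algebra_simps)
  finally show ?thesis .
qed

lemma Ev_pair:
  "lie (\<Sum>i<K. (p $ i) *\<^sub>C (nil (lie \<omega>) v ^^ i) Y) (\<Sum>j<K. (q $ j) *\<^sub>C (nil (lie \<omega>) w ^^ j) Z) = Ev (fpsL p * fpsR q)"
proof -
  have "lie (\<Sum>i<K. (p $ i) *\<^sub>C (nil (lie \<omega>) v ^^ i) Y) (\<Sum>j<K. (q $ j) *\<^sub>C (nil (lie \<omega>) w ^^ j) Z)
     = (\<Sum>j<K. \<Sum>i<K. (p $ i * q $ j) *\<^sub>C u i j)"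
    by (simp add: clinear_simps[OF clinear_lie(1)] clinear_simps[OF clinear_lie(2)] u_def scaleC_scaleC
        complex_vector.scale_sum_right mult.commute)
  then show ?thesis by (simp add: Ev_def fpsL_fpsR_nth)
qed

lemma fps_1_apply: "(\<Sum>i<K. ((1 :: complex fps) $ i) *\<^sub>C f i) = f 0"
proof -
  have "(\<Sum>i<K. ((1 :: complex fps) $ i) *\<^sub>C f i) = (\<Sum>i<K. if i = 0 then f 0 else 0)"
    by (rule sum.cong) (auto simp: scaleC_one)
  then show ?thesis using K by simp
qed

text \<open>
  The brackets are generalized eigenvectors at \<open>v + w\<close>, as the two nilpotent parts add up; if this is not an eigenvalue,
  they vanish.
\<close>

lemma u_trivial:
  assumes "v + w \<notin> spectrum_on (G ((b + c) mod N)) (lie \<omega>)"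
  shows "u i j = 0"
proof (rule ccontr)
  assume nz: "u i j \<noteq> 0"
  have nl: "nil (lie \<omega>) (v + w) (u i j) = u (Suc i) j + u i (Suc j)" for i j
    by (simp add: nil_def lie_u)
  have "(nil (lie \<omega>) (v + w) ^^ m) (u i j) = 0" if "2 * K \<le> m + i + j" for m i j
    using that
  proof (induction m arbitrary: i j)
    case 0
    then have "K \<le> i \<or> K \<le> j" by linarith
    then show ?case by (simp add: u_zero)
  next
    case (Suc m)
    have "(nil (lie \<omega>) (v + w) ^^ Suc m) (u i j) = (nil (lie \<omega>) (v + w) ^^ m) (u (Suc i) j + u i (Suc j))"
      by (simp only: funpow_Suc_right o_apply nl)
    also have "\<dots> = 0"
      using Suc by (simp add: clinear_simps[OF funpow_linear[OF nil_linear[OF clinear_lie(1)]]])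
    finally show ?case .
  qed
  from this[of "2 * K" i j] have "(nil (lie \<omega>) (v + w) ^^ (2 * K)) (u i j) = 0" by simp
  then have "invariant_subspace.eig (G ((b + c) mod N)) (lie \<omega>) (v + w)"
    using invariant_subspace.gev_eig[OF ID u_in nz] by blast
  then show False using assms by (simp add: invariant_subspace.spectrum_eig[OF ID])
qed

lemma Ev_trivial: "v + w \<notin> spectrum_on (G ((b + c) mod N)) (lie \<omega>) \<Longrightarrow> Ev Q = 0"
  by (simp add: Ev_def u_trivial)

text \<open>
  By \<open>lie_Ev\<close> the resolvent of \<open>ad \<omega>\<close> on brackets is the inverse of \<open>z - (\<alpha> + \<beta>)\<close>.
\<close>

lemma rs_Ev:
  assumes z: "z \<notin> spectrum_on (G ((b + c) mod N)) (lie \<omega>)" "z \<noteq> v + w"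
  shows "invariant_subspace.rs (G ((b + c) mod N)) (lie \<omega>) z (Ev Q) = Ev (Q * fpsD (geo (z - (v + w))))"
proof (rule invariant_subspace.rs_unique[OF ID z(1) Ev_in])
  let ?g = "fpsD (geo (z - (v + w)))"
  have "z *\<^sub>C Ev (Q * ?g) - lie \<omega> (Ev (Q * ?g)) = Ev (Q * (?g * (fps_const (fps_const z) - (varL v + varR w))))"
    unfolding lie_Ev Ev_const[symmetric] Ev_diff[symmetric] by (simp add: algebra_simps)
  then show "z *\<^sub>C Ev (Q * ?g) - lie \<omega> (Ev (Q * ?g)) = Ev Q" unfolding geoD[OF z(2)] by simp
qed

lemma rs_Y: "z \<notin> spectrum_on (G b) (lie \<omega>) \<Longrightarrow>
    invariant_subspace.rs (G b) (lie \<omega>) z Y = (\<Sum>k<K. (geo (z - v) $ k) *\<^sub>C (nil (lie \<omega>) v ^^ k) Y)"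
  using invariant_subspace.rs_gev[OF IY _ Y nY] by (simp add: geo_def)

lemma rs_Z: "z \<notin> spectrum_on (G c) (lie \<omega>) \<Longrightarrow>
    invariant_subspace.rs (G c) (lie \<omega>) z Z = (\<Sum>k<K. (geo (z - w) $ k) *\<^sub>C (nil (lie \<omega>) w ^^ k) Z)"
  using invariant_subspace.rs_gev[OF IZ _ Z nZ] by (simp add: geo_def)

lemma lie_Y_series: "lie Y (\<Sum>j<K. (q $ j) *\<^sub>C (nil (lie \<omega>) w ^^ j) Z) = Ev (fpsR q)"
  using Ev_pair[of 1 q] by (simp add: fps_1_apply fpsL_1 del: fps_one_nth)

lemma lie_series_Z: "lie (\<Sum>i<K. (p $ i) *\<^sub>C (nil (lie \<omega>) v ^^ i) Y) Z = Ev (fpsL p)"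
  using Ev_pair[of p 1] by (simp add: fps_1_apply fpsR_1 del: fps_one_nth)

end

locale pair_at = gev_pair B \<mu> N n \<tau> T T' \<omega> Y Z v w b c K + perturbation B \<mu> N n \<tau> T T' \<omega> a D H \<rho>
  for B :: "'g::complex_lie_algebra \<Rightarrow> 'g \<Rightarrow> complex" and \<mu> :: "'g \<Rightarrow> 'g" and N n \<tau> T T' \<omega> Y Z v w b c K a D H \<rho>
begin

lemma cint_Ev:
  assumes Q: "fcont Q" and \<phi>: "cfunctional \<phi>"
  shows "cint (\<lambda>z. \<phi> (Ev (Q z))) = \<phi> (Ev (CI Q))"
proof -
  have c: "continuous_on outside (\<lambda>z. Q z $ j $ i)" for i j using Q by (simp add: fcont_def)
  have c': "continuous_on outside (\<lambda>z. \<phi> (u i j) * Q z $ j $ i)" for i j by (intro continuous_intros c)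
  have "cint (\<lambda>z. \<phi> (Ev (Q z))) = cint (\<lambda>z. \<Sum>j<K. \<Sum>i<K. \<phi> (u i j) * Q z $ j $ i)"
    by (simp add: Ev_def cfunctional_simps[OF \<phi>] mult.commute)
  also have "\<dots> = (\<Sum>j<K. cint (\<lambda>z. \<Sum>i<K. \<phi> (u i j) * Q z $ j $ i))"
    by (rule cint_sum) (intro continuous_on_sum c')
  also have "\<dots> = (\<Sum>j<K. \<Sum>i<K. cint (\<lambda>z. \<phi> (u i j) * Q z $ j $ i))"
    by (intro sum.cong refl cint_sum c')
  also have "\<dots> = \<phi> (Ev (CI Q))"
    unfolding cint_cmult[OF c] by (simp add: Ev_def CI_nth cfunctional_simps[OF \<phi>] mult.commute)
  finally show ?thesis .
qed

text \<open>
  A function of \<open>ad \<omega>\<close> acts on a bracket as the same function of \<open>\<alpha> + \<beta>\<close>.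
\<close>

lemma calculus_Ev:
  assumes a: "a = (b + c) mod N" and s: "v + w \<in> S"
  shows "hol_calculus (G a) D H (lie \<omega>) (Ev Q) = Ev (Q * fpsD (fps_expansion H (v + w)))"
proof (rule functional_separates)
  fix \<phi> :: "'g \<Rightarrow> complex" assume \<phi>: "cfunctional \<phi>"
  have f: "fcont (\<lambda>z. fpsD (geo (z - (v + w))) * Q)" by (intro fcont_mult fcont_const fcont_geo s)
  have "\<phi> (hol_calculus (G a) D H (lie \<omega>) (Ev Q)) = cint (\<lambda>z. \<phi> (R (lie \<omega>) z (Ev Q)))"
    by (rule calculus_cint[OF _ \<phi>]) (simp add: a Ev_in)
  also have "\<dots> = cint (\<lambda>z. \<phi> (Ev (fpsD (geo (z - (v + w))) * Q)))"
  proof (rule cint_cong)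
    fix z assume z: "z \<in> outside"
    then have "z \<notin> S" by (rule outside_S)
    moreover from this have "z \<noteq> v + w" using s by blast
    ultimately show "\<phi> (R (lie \<omega>) z (Ev Q)) = \<phi> (Ev (fpsD (geo (z - (v + w))) * Q))"
      using rs_Ev[of z Q] by (simp add: a mult.commute)
  qed
  also have "\<dots> = \<phi> (Ev (CI (\<lambda>z. fpsD (geo (z - (v + w))) * Q)))" by (rule cint_Ev[OF f \<phi>])
  also have "CI (\<lambda>z. fpsD (geo (z - (v + w))) * Q) = Q * fpsD (fps_expansion H (v + w))"
    unfolding CI_mult[OF fcont_geo(3)[OF s]] CI_geo[OF s] by (rule mult.commute)
  finally show "\<phi> (hol_calculus (G a) D H (lie \<omega>) (Ev Q)) = \<phi> (Ev (Q * fpsD (fps_expansion H (v + w))))" .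
qed

text \<open>
  The derivative in the direction \<open>Y\<close>, applied to \<open>Z\<close>, is the divided difference \<open>(H (\<alpha> + \<beta>) - H \<beta>) / \<alpha>\<close>: the integrand
  is \<open>1 / ((z - \<beta>) * (z - (\<alpha> + \<beta>)))\<close>, and multiplication by \<open>\<alpha>\<close> splits it into partial fractions.
\<close>

lemma dcalc_Y_Z:
  assumes a: "a = c" "b = 0" and w: "w \<in> S" and s: "v + w \<in> S"
  shows "\<exists>Q. dcalc Y Z = Ev Q \<and> Q * varL v = fpsD (fps_expansion H (v + w)) - fpsR (fps_expansion H w)"
proof (intro exI conjI)
  let ?Q = "\<lambda>z. fpsR (geo (z - w)) * fpsD (geo (z - (v + w)))"
  have f: "fcont ?Q" by (intro fcont_mult fcont_geo w s)
  have d: "(b + c) mod N = c" using a c by simp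
  show "dcalc Y Z = Ev (CI ?Q)"
  proof (rule functional_separates)
    fix \<phi> :: "'g \<Rightarrow> complex" assume \<phi>: "cfunctional \<phi>"
    have "\<phi> (dcalc Y Z) = cint (\<lambda>z. \<phi> (R (lie \<omega>) z (lie Y (R (lie \<omega>) z Z))))"
      by (rule dcalc[OF _ _ \<phi>]) (use Y Z a in simp_all)
    also have "\<dots> = cint (\<lambda>z. \<phi> (Ev (?Q z)))"
    proof (rule cint_cong)
      fix z assume "z \<in> outside"
      then have z: "z \<notin> S" by (rule outside_S)
      then have "z \<noteq> v + w" using s by blast
      then show "\<phi> (R (lie \<omega>) z (lie Y (R (lie \<omega>) z Z))) = \<phi> (Ev (?Q z))"
        using z rs_Z[of z] rs_Ev[of z "fpsR (geo (z - w))"] unfolding d a(1) by (simp add: lie_Y_series)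
    qed
    also have "\<dots> = \<phi> (Ev (CI ?Q))" by (rule cint_Ev[OF f \<phi>])
    finally show "\<phi> (dcalc Y Z) = \<phi> (Ev (CI ?Q))" .
  qed
  have "CI ?Q * varL v = CI (\<lambda>z. ?Q z * varL v)" by (rule CI_mult[OF f, symmetric])
  also have "\<dots> = CI (\<lambda>z. fpsD (geo (z - (v + w))) - fpsR (geo (z - w)))"
  proof (rule CI_cong)
    fix z assume "z \<in> outside"
    then have z: "z \<notin> S" by (rule outside_S)
    have 1: "fpsR (geo (z - w)) * (fps_const (fps_const z) - varR w) = 1" by (rule geoR) (use z w in blast)
    have 2: "fpsD (geo (z - (v + w))) * (fps_const (fps_const z) - (varL v + varR w)) = 1" by (rule geoD) (use z s in blast)
    show "?Q z * varL v = fpsD (geo (z - (v + w))) - fpsR (geo (z - w))" using 1 2 by algebra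
  qed
  also have "\<dots> = fpsD (fps_expansion H (v + w)) - fpsR (fps_expansion H w)"
    by (simp only: CI_diff[OF fcont_geo(3)[OF s] fcont_geo(2)[OF w]] CI_geo[OF s] CI_geo[OF w])
  finally show "CI ?Q * varL v = fpsD (fps_expansion H (v + w)) - fpsR (fps_expansion H w)" .
qed

text \<open>
  The same with the roles exchanged gives \<open>(H (\<alpha> + \<beta>) - H \<alpha>) / \<beta>\<close>; the antisymmetry of the bracket is responsible for the sign.
\<close>

lemma dcalc_Z_Y:
  assumes a: "a = b" "c = 0" and v: "v \<in> S" and s: "v + w \<in> S"
  shows "\<exists>Q. dcalc Z Y = - Ev Q \<and> Q * varR w = fpsD (fps_expansion H (v + w)) - fpsL (fps_expansion H v)"
proof (intro exI conjI)
  let ?Q = "\<lambda>z. fpsL (geo (z - v)) * fpsD (geo (z - (v + w)))"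
  have f: "fcont ?Q" by (intro fcont_mult fcont_geo v s)
  have d: "(b + c) mod N = b" using a b by simp
  show "dcalc Z Y = - Ev (CI ?Q)"
  proof (rule functional_separates)
    fix \<phi> :: "'g \<Rightarrow> complex" assume \<phi>: "cfunctional \<phi>"
    have n: "cfunctional (\<lambda>x. \<phi> (- x))" using \<phi> by (simp add: cfunctional_iff cfunctional_simps[OF \<phi>])
    have "\<phi> (dcalc Z Y) = cint (\<lambda>z. \<phi> (R (lie \<omega>) z (lie Z (R (lie \<omega>) z Y))))"
      by (rule dcalc[OF _ _ \<phi>]) (use Y Z a in simp_all)
    also have "\<dots> = cint (\<lambda>z. \<phi> (- Ev (?Q z)))"
    proof (rule cint_cong)
      fix z assume "z \<in> outside"
      then have z: "z \<notin> S" by (rule outside_S)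
      then have zs: "z \<noteq> v + w" using s by blast
      have "lie Z (R (lie \<omega>) z Y) = - Ev (fpsL (geo (z - v)))"
        using z rs_Y[of z] lie_antisym[of Z] by (simp add: a lie_series_Z)
      also have "\<dots> = (- 1) *\<^sub>C Ev (fpsL (geo (z - v)))" by (simp add: complex_vector.scale_minus_left scaleC_one)
      finally have e: "lie Z (R (lie \<omega>) z Y) = (- 1) *\<^sub>C Ev (fpsL (geo (z - v)))" .
      have "R (lie \<omega>) z (lie Z (R (lie \<omega>) z Y)) = (- 1) *\<^sub>C R (lie \<omega>) z (Ev (fpsL (geo (z - v))))"
        unfolding e by (rule I.rs_scale[OF z]) (use Ev_in d a in simp)
      also have "\<dots> = - Ev (?Q z)"
        using z rs_Ev[of z "fpsL (geo (z - v))"] zs unfolding d a(1)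
        by (simp add: complex_vector.scale_minus_left scaleC_one)
      finally show "\<phi> (R (lie \<omega>) z (lie Z (R (lie \<omega>) z Y))) = \<phi> (- Ev (?Q z))" by simp
    qed
    also have "\<dots> = \<phi> (- Ev (CI ?Q))" by (rule cint_Ev[OF f n])
    finally show "\<phi> (dcalc Z Y) = \<phi> (- Ev (CI ?Q))" .
  qed
  have "CI ?Q * varR w = CI (\<lambda>z. ?Q z * varR w)" by (rule CI_mult[OF f, symmetric])
  also have "\<dots> = CI (\<lambda>z. fpsD (geo (z - (v + w))) - fpsL (geo (z - v)))"
  proof (rule CI_cong)
    fix z assume "z \<in> outside"
    then have z: "z \<notin> S" by (rule outside_S)
    have 1: "fpsL (geo (z - v)) * (fps_const (fps_const z) - varL v) = 1" by (rule geoL) (use z v in blast)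
    have 2: "fpsD (geo (z - (v + w))) * (fps_const (fps_const z) - (varL v + varR w)) = 1" by (rule geoD) (use z s in blast)
    show "?Q z * varR w = fpsD (geo (z - (v + w))) - fpsL (geo (z - v))" using 1 2 by algebra
  qed
  also have "\<dots> = fpsD (fps_expansion H (v + w)) - fpsL (fps_expansion H v)"
    by (simp only: CI_diff[OF fcont_geo(3)[OF s] fcont_geo(1)[OF v]] CI_geo[OF s] CI_geo[OF v])
  finally show "CI ?Q * varR w = fpsD (fps_expansion H (v + w)) - fpsL (fps_expansion H v)" .
qed

text \<open>
  In the direction of the third vector \<open>X\<close>, the invariance of \<open>B\<close> moves one resolvent to \<open>Y\<close>, where it becomes the resolvent of
  \<open>- ad \<omega>\<close>. The integrand \<open>1 / ((z + \<alpha>) * (z - \<beta>))\<close> integrates to \<open>(H \<beta> - H (- \<alpha>)) / (\<alpha> + \<beta>)\<close>.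
\<close>

lemma dcalc_X_Z:
  assumes a: "a = c" and X: "X \<in> G 0" and v: "- v \<in> S" and w: "w \<in> S"
  shows "\<exists>Q. B Y (dcalc X Z) = - B X (Ev Q) \<and>
    Q * (varL v + varR w) = fpsR (fps_expansion H w) - fpsL (Abs_fps (\<lambda>k. (- 1) ^ k * fps_expansion H (- v) $ k))"
proof (intro exI conjI)
  let ?Q = "\<lambda>z. fpsL (- geo (- z - v)) * fpsR (geo (z - w))"
  have f: "fcont ?Q" by (intro fcont_mult fcont_geo w CI_reflected v)
  have n: "cfunctional (\<lambda>x. - B X x)"
    by (simp add: cfunctional_iff B_right)
  have "B Y (dcalc X Z) = cint (\<lambda>z. B Y (R (lie \<omega>) z (lie X (R (lie \<omega>) z Z))))"
    by (rule dcalc[OF X _ B_functional(1)]) (use Z a in simp)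
  also have "\<dots> = cint (\<lambda>z. - B X (Ev (?Q z)))"
  proof (rule cint_cong)
    fix z assume "z \<in> outside"
    then have z: "z \<notin> S" by (rule outside_S)
    then have zv: "- z \<noteq> v" using v by auto
    \<comment> \<open>\<open>Y' = (z + ad \<omega>)\<^sup>-\<^sup>1 Y\<close>, the adjoint resolvent applied to \<open>Y\<close>.\<close>
    define Y' where "Y' = (\<Sum>k<K. ((- geo (- z - v)) $ k) *\<^sub>C (nil (lie \<omega>) v ^^ k) Y)"
    have "Y' = - (\<Sum>k<K. (1 / (- z - v) ^ Suc k) *\<^sub>C (nil (lie \<omega>) v ^^ k) Y)"
      by (simp add: Y'_def geo_def complex_vector.scale_minus_left sum_negf)
    then have Y': "Y = z *\<^sub>C Y' + lie \<omega> Y'"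
      using resolvent_series[OF clinear_lie(1) zv nY]
      by (simp add: complex_vector.scale_minus_left complex_vector.scale_minus_right lie_minus_right)
    define q where "q = lie X (R (lie \<omega>) z Z)"
    have q: "q \<in> G a" unfolding q_def by (intro G_lie_0[OF X] I.rs_in[OF z]) (use Z a c in auto)
    have "B Y (R (lie \<omega>) z q) = B Y' (z *\<^sub>C R (lie \<omega>) z q - lie \<omega> (R (lie \<omega>) z q))"
      by (subst Y') (simp add: B_left B_right B_skew)
    also have "\<dots> = B Y' q" by (simp add: I.rs_eq[OF z q])
    also have "\<dots> = B (lie Y' X) (R (lie \<omega>) z Z)" unfolding q_def by (rule B_invariant[symmetric])
    also have "lie Y' X = - lie X Y'" by (rule lie_antisym)
    also have "B (- lie X Y') (R (lie \<omega>) z Z) = - B X (lie Y' (R (lie \<omega>) z Z))" by (simp add: B_left B_invariant)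
    also have "lie Y' (R (lie \<omega>) z Z) = Ev (?Q z)"
    proof -
      have e: "R (lie \<omega>) z Z = (\<Sum>k<K. (geo (z - w) $ k) *\<^sub>C (nil (lie \<omega>) w ^^ k) Z)"
        using rs_Z[of z] z unfolding a by blast
      show ?thesis unfolding e Y'_def by (rule Ev_pair)
    qed
    finally show "B Y (R (lie \<omega>) z (lie X (R (lie \<omega>) z Z))) = - B X (Ev (?Q z))" by (simp only: q_def)
  qed
  also have "\<dots> = - B X (Ev (CI ?Q))" by (rule cint_Ev[OF f n])
  finally show "B Y (dcalc X Z) = - B X (Ev (CI ?Q))" .
  have "CI ?Q * (varL v + varR w) = CI (\<lambda>z. ?Q z * (varL v + varR w))" by (rule CI_mult[OF f, symmetric])
  also have "\<dots> = CI (\<lambda>z. fpsR (geo (z - w)) - fpsL (- geo (- z - v)))"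
  proof (rule CI_cong)
    fix z assume "z \<in> outside"
    then have z: "z \<notin> S" by (rule outside_S)
    have 1: "fpsR (geo (z - w)) * (fps_const (fps_const z) - varR w) = 1" by (rule geoR) (use z w in blast)
    have "fpsL (geo (- z - v)) * (fps_const (fps_const (- z)) - varL v) = 1" by (rule geoL) (use z v in auto)
    moreover have "fpsL (- geo (- z - v)) = - fpsL (geo (- z - v))" by (simp add: fpsL_def)
    moreover have "fps_const (fps_const (- z)) = - fps_const (fps_const z)" by simp
    ultimately have 2: "fpsL (- geo (- z - v)) * (fps_const (fps_const z) + varL v) = 1" by algebra
    show "?Q z * (varL v + varR w) = fpsR (geo (z - w)) - fpsL (- geo (- z - v))" using 1 2 by algebra
  qed
  also have "\<dots> = fpsR (fps_expansion H w) - fpsL (Abs_fps (\<lambda>k. (- 1) ^ k * fps_expansion H (- v) $ k))"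
    by (simp only: CI_diff[OF fcont_geo(2)[OF w] CI_reflected(1)[OF v]] CI_geo[OF w] CI_reflected(2)[OF v])
  finally show "CI ?Q * (varL v + varR w) = fpsR (fps_expansion H w) - fpsL (Abs_fps (\<lambda>k. (- 1) ^ k * fps_expansion H (- v) $ k))" .
qed

end

section \<open>The operator R and its derivative\<close>

context perturbation
begin

lemma continuous_dcalc:
  assumes "Q \<in> G 0" "x \<in> G a" "cfunctional \<phi>"
  shows "continuous_on outside (\<lambda>w. \<phi> (R (lie \<omega>) w (lie Q (R (lie \<omega>) w x))))"
  using vcont_dcalc[OF assms(1,2)] assms(3) by (simp add: vcont_def)

lemma dcalc_unique:
  assumes "\<And>\<phi>. cfunctional \<phi> \<Longrightarrow> cint (\<lambda>w. \<phi> (R (lie \<omega>) w (lie Q (R (lie \<omega>) w x)))) = \<phi> y" "Q \<in> G 0" "x \<in> G a"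
  shows "dcalc Q x = y"
  by (rule functional_separates) (simp add: dcalc assms)

lemma rs_lie_in: "Q \<in> G 0 \<Longrightarrow> x \<in> G a \<Longrightarrow> w \<in> outside \<Longrightarrow> lie Q (R (lie \<omega>) w x) \<in> G a"
  using I.rs_in[OF outside_S] G_lie_0 a by blast

lemma dcalc_add_right:
  assumes Q: "Q \<in> G 0" and x: "x \<in> G a" "y \<in> G a"
  shows "dcalc Q (x + y) = dcalc Q x + dcalc Q y"
proof (rule dcalc_unique[OF _ Q G_simps(2)[OF x]])
  fix \<phi> :: "'g \<Rightarrow> complex" assume \<phi>: "cfunctional \<phi>"
  have "cint (\<lambda>w. \<phi> (R (lie \<omega>) w (lie Q (R (lie \<omega>) w (x + y))))) =
    cint (\<lambda>w. \<phi> (R (lie \<omega>) w (lie Q (R (lie \<omega>) w x))) + \<phi> (R (lie \<omega>) w (lie Q (R (lie \<omega>) w y))))"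
    by (rule cint_cong)
      (simp add: I.rs_add[OF outside_S] x lie_add_right rs_lie_in Q cfunctional_simps[OF \<phi>])
  also have "\<dots> = \<phi> (dcalc Q x + dcalc Q y)"
    by (simp add: cint_add continuous_dcalc dcalc Q x \<phi> cfunctional_simps[OF \<phi>])
  finally show "cint (\<lambda>w. \<phi> (R (lie \<omega>) w (lie Q (R (lie \<omega>) w (x + y))))) = \<phi> (dcalc Q x + dcalc Q y)" .
qed

lemma dcalc_add_left:
  assumes Q: "Q \<in> G 0" "Q' \<in> G 0" and x: "x \<in> G a"
  shows "dcalc (Q + Q') x = dcalc Q x + dcalc Q' x"
proof (rule dcalc_unique[OF _ G_simps(2)[OF Q] x])
  fix \<phi> :: "'g \<Rightarrow> complex" assume \<phi>: "cfunctional \<phi>"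
  have "cint (\<lambda>w. \<phi> (R (lie \<omega>) w (lie (Q + Q') (R (lie \<omega>) w x)))) =
    cint (\<lambda>w. \<phi> (R (lie \<omega>) w (lie Q (R (lie \<omega>) w x))) + \<phi> (R (lie \<omega>) w (lie Q' (R (lie \<omega>) w x))))"
    by (rule cint_cong)
      (simp add: I.rs_add[OF outside_S] x lie_add_left rs_lie_in Q cfunctional_simps[OF \<phi>])
  also have "\<dots> = \<phi> (dcalc Q x + dcalc Q' x)"
    by (simp add: cint_add continuous_dcalc dcalc Q x \<phi> cfunctional_simps[OF \<phi>])
  finally show "cint (\<lambda>w. \<phi> (R (lie \<omega>) w (lie (Q + Q') (R (lie \<omega>) w x)))) = \<phi> (dcalc Q x + dcalc Q' x)" .
qed

lemma dcalc_scale_left: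
  assumes Q: "Q \<in> G 0" and x: "x \<in> G a"
  shows "dcalc (k *\<^sub>C Q) x = k *\<^sub>C dcalc Q x"
proof (rule dcalc_unique[OF _ G_simps(3)[OF Q] x])
  fix \<phi> :: "'g \<Rightarrow> complex" assume \<phi>: "cfunctional \<phi>"
  have "cint (\<lambda>w. \<phi> (R (lie \<omega>) w (lie (k *\<^sub>C Q) (R (lie \<omega>) w x)))) =
    cint (\<lambda>w. k * \<phi> (R (lie \<omega>) w (lie Q (R (lie \<omega>) w x))))"
    by (rule cint_cong)
      (simp add: I.rs_scale[OF outside_S] x lie_scale_left rs_lie_in Q cfunctional_simps[OF \<phi>])
  also have "\<dots> = \<phi> (k *\<^sub>C dcalc Q x)"
    by (simp add: cint_cmult continuous_dcalc dcalc Q x \<phi> cfunctional_simps[OF \<phi>])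
  finally show "cint (\<lambda>w. \<phi> (R (lie \<omega>) w (lie (k *\<^sub>C Q) (R (lie \<omega>) w x)))) = \<phi> (k *\<^sub>C dcalc Q x)" .
qed

lemma dcalc_in:
  assumes Q: "Q \<in> G 0" and x: "x \<in> G a"
  shows "dcalc Q x \<in> G a"
proof -
  have "dcalc Q x = P a (dcalc Q x)"
  proof (rule dcalc_unique[OF _ Q x])
    fix \<phi> :: "'g \<Rightarrow> complex" assume \<phi>: "cfunctional \<phi>"
    have "cint (\<lambda>w. \<phi> (R (lie \<omega>) w (lie Q (R (lie \<omega>) w x)))) = cint (\<lambda>w. \<phi> (P a (R (lie \<omega>) w (lie Q (R (lie \<omega>) w x)))))"
      by (rule cint_cong) (simp add: P_same I.rs_in[OF outside_S] rs_lie_in Q x)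
    also have "\<dots> = \<phi> (P a (dcalc Q x))"
      by (rule dcalc[OF Q x cfunctional_compose[OF \<phi> P_linear], symmetric])
    finally show "cint (\<lambda>w. \<phi> (R (lie \<omega>) w (lie Q (R (lie \<omega>) w x)))) = \<phi> (P a (dcalc Q x))" .
  qed
  then show ?thesis using P_in by metis
qed

lemma dcalc_trivial:
  assumes Q: "Q \<in> G 0" and x: "x \<in> G a" and z: "\<And>w. w \<in> outside \<Longrightarrow> lie Q (R (lie \<omega>) w x) = 0"
  shows "dcalc Q x = 0"
proof (rule dcalc_unique[OF _ Q x])
  fix \<phi> :: "'g \<Rightarrow> complex" assume \<phi>: "cfunctional \<phi>"
  have "R (lie \<omega>) w 0 = 0" if "w \<in> outside" for w
    using I.rs_scale[OF outside_S[OF that] G_simps(1), of 0] by simp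
  then have "cint (\<lambda>w. \<phi> (R (lie \<omega>) w (lie Q (R (lie \<omega>) w x)))) = cint (\<lambda>w. 0)"
    by (intro cint_cong) (simp add: z cfunctional_simps[OF \<phi>])
  then show "cint (\<lambda>w. \<phi> (R (lie \<omega>) w (lie Q (R (lie \<omega>) w x)))) = \<phi> 0"
    by (simp add: cint_0 cfunctional_simps[OF \<phi>])
qed

text \<open>Along an orbit of the adjoint action the resolvent changes by conjugation: with
  \<open>ad [X, \<omega>] = [ad X, ad \<omega>]\<close> the integrand telescopes to a commutator of \<open>ad X\<close> with the resolvent.\<close>

lemma dcalc_orbit:
  assumes X: "X \<in> G 0" and x: "x \<in> G a"
  shows "dcalc (lie X \<omega>) x = lie X (hol_calculus (G a) D H (lie \<omega>) x) - hol_calculus (G a) D H (lie \<omega>) (lie X x)"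
proof (rule dcalc_unique[OF _ G_lie_0[OF X N_pos \<omega>] x])
  fix \<phi> :: "'g \<Rightarrow> complex" assume \<phi>: "cfunctional \<phi>"
  have Xx: "lie X x \<in> G a" by (rule G_lie_0[OF X a x])
  have c1: "continuous_on outside (\<lambda>w. \<phi> (lie X (R (lie \<omega>) w x)))"
    using vcont_lie[OF vcont_R_const[OF x]] \<phi> by (simp add: vcont_def)
  have c2: "continuous_on outside (\<lambda>w. \<phi> (R (lie \<omega>) w (lie X x)))"
    using vcont_R_const[OF Xx] \<phi> by (simp add: vcont_def)
  have "cint (\<lambda>w. \<phi> (R (lie \<omega>) w (lie (lie X \<omega>) (R (lie \<omega>) w x))))
    = cint (\<lambda>w. \<phi> (lie X (R (lie \<omega>) w x)) + (- 1) * \<phi> (R (lie \<omega>) w (lie X x)))"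
  proof (rule cint_cong)
    fix w assume w: "w \<in> outside"
    have wS: "w \<notin> S" by (rule outside_S[OF w])
    define y where "y = R (lie \<omega>) w x"
    have y: "y \<in> G a" unfolding y_def by (rule I.rs_in[OF wS x])
    have Xy: "lie X y \<in> G a" by (rule G_lie_0[OF X a y])
    have e: "lie \<omega> y = w *\<^sub>C y - x" using I.rs_eq[OF wS x] unfolding y_def by (simp add: algebra_simps)
    have "lie (lie X \<omega>) y = lie X (lie \<omega> y) - lie \<omega> (lie X y)"
      using lie_derivation[of X \<omega> y] by simp
    also have "\<dots> = (w *\<^sub>C lie X y - lie \<omega> (lie X y)) - lie X x"
      by (simp add: e lie_diff_right lie_scale_right)
    finally have 1: "lie (lie X \<omega>) y + lie X x = w *\<^sub>C lie X y - lie \<omega> (lie X y)" by simp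
    have "R (lie \<omega>) w (lie (lie X \<omega>) y + lie X x) = lie X y"
      by (rule I.rs_unique[OF wS Xy 1[symmetric]])
    then have "R (lie \<omega>) w (lie (lie X \<omega>) y) + R (lie \<omega>) w (lie X x) = lie X y"
      using I.rs_add[OF wS G_lie_0[OF G_lie_0[OF X N_pos \<omega>] a y] Xx] by simp
    then have "R (lie \<omega>) w (lie (lie X \<omega>) y) = lie X y - R (lie \<omega>) w (lie X x)" by (simp add: eq_diff_eq)
    then show "\<phi> (R (lie \<omega>) w (lie (lie X \<omega>) (R (lie \<omega>) w x)))
        = \<phi> (lie X (R (lie \<omega>) w x)) + (- 1) * \<phi> (R (lie \<omega>) w (lie X x))"
      by (simp add: y_def cfunctional_simps[OF \<phi>])
  qed
  also have "\<dots> = cint (\<lambda>w. \<phi> (lie X (R (lie \<omega>) w x))) + (- 1) * cint (\<lambda>w. \<phi> (R (lie \<omega>) w (lie X x)))"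
    unfolding cint_cmult[OF c2, symmetric] by (rule cint_add[OF c1]) (intro continuous_intros c2)
  also have "\<dots> = \<phi> (lie X (hol_calculus (G a) D H (lie \<omega>) x) - hol_calculus (G a) D H (lie \<omega>) (lie X x))"
    using calculus_cint[OF x cfunctional_compose[OF \<phi> clinear_lie(1)[of X]]] calculus_cint[OF Xx \<phi>]
    by (simp add: cfunctional_simps[OF \<phi>])
  finally show "cint (\<lambda>w. \<phi> (R (lie \<omega>) w (lie (lie X \<omega>) (R (lie \<omega>) w x))))
    = \<phi> (lie X (hol_calculus (G a) D H (lie \<omega>) x) - hol_calculus (G a) D H (lie \<omega>) (lie X x))" .
qed

end

context twisted_lie_algebra
begin

definition chi_op :: "'g \<Rightarrow> complex \<Rightarrow> nat \<Rightarrow> 'g \<Rightarrow> 'g" where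
  "chi_op \<omega> z a = hol_calculus (G a) (- sing_a N \<tau> a) (\<lambda>w. chi_a N \<tau> a w z) (lie \<omega>)"

text \<open>
  The operator on the whole algebra, put together from its blocks on the eigenspaces.
\<close>

definition Rop :: "'g \<Rightarrow> complex \<Rightarrow> 'g \<Rightarrow> 'g" where
  "Rop \<omega> z x = (\<Sum>a<N. chi_op \<omega> z a (P a x))"

text \<open>
  \<open>ad \<omega>\<close> is skew for \<open>B\<close>, so \<open>ad \<omega> - v\<close> on the left is \<open>- (ad \<omega> + v)\<close> on the right, which is invertible on generalized
  eigenvectors at \<open>w\<close> unless \<open>w = - v\<close>. Moving factors to the left annihilates \<open>y\<close>.
\<close>

lemma B_gev_orthogonal:
  assumes "\<omega> \<in> G 0"
  shows "(nil (lie \<omega>) v ^^ K) y = 0 \<Longrightarrow> (nil (lie \<omega>) w ^^ M) x = 0 \<Longrightarrow> w \<noteq> - v \<Longrightarrow> B y x = 0"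
proof (induction K arbitrary: x y)
  case 0
  then show ?case by (simp add: B_left)
next
  case (Suc K)
  let ?u = "\<Sum>k<M. (1 / (- v - w) ^ Suc k) *\<^sub>C (nil (lie \<omega>) w ^^ k) x"
  define u where "u = ?u"
  have x: "x = - v *\<^sub>C u - lie \<omega> u"
    unfolding u_def using resolvent_series[OF clinear_lie(1) _ Suc.prems(2), of "- v"] Suc.prems(3) by metis
  have "(nil (lie \<omega>) w ^^ M) ((nil (lie \<omega>) w ^^ k) x) = (nil (lie \<omega>) w ^^ k) ((nil (lie \<omega>) w ^^ M) x)" for k
    by (metis add.commute comp_apply funpow_add)
  then have u: "(nil (lie \<omega>) w ^^ M) u = 0"
    using Suc.prems(2) by (simp add: u_def clinear_simps[OF funpow_linear[OF nil_linear[OF clinear_lie(1)]]])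
  have "(nil (lie \<omega>) v ^^ K) (nil (lie \<omega>) v y) = 0" using Suc.prems(1) by (simp add: funpow_Suc_right del: funpow.simps)
  then have "B (nil (lie \<omega>) v y) u = 0" by (rule Suc.IH) (use u Suc.prems in auto)
  moreover have "B y x = B (nil (lie \<omega>) v y) u"
    by (subst x) (simp add: nil_def B_left B_right B_skew)
  ultimately show ?case by simp
qed

end

locale dynamical_point = twisted_lie_algebra B \<mu> N n \<tau> T T'
  for B :: "'g::complex_lie_algebra \<Rightarrow> 'g \<Rightarrow> complex" and \<mu> :: "'g \<Rightarrow> 'g" and N n \<tau> T T' +
  fixes \<omega> :: 'g
  assumes dom: "\<omega> \<in> dyn_domain \<mu> N \<tau>"
begin

abbreviation "\<Omega> \<equiv> period_lattice \<tau>"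
abbreviation "spec a \<equiv> spectrum_on (G a) (lie \<omega>)"
abbreviation "dom_a a \<equiv> - sing_a N \<tau> a"

lemma \<omega>: "\<omega> \<in> G 0" using dom by (simp add: dyn_domain_def G_0)

lemma inv_G: "a < N \<Longrightarrow> invariant_subspace (G a) (lie \<omega>)" by (rule invariant_subspace_G[OF \<omega>])

text \<open>
  On a trivial eigenspace the spectrum is empty, so the condition defining the domain extends to every index below \<open>N\<close>.
\<close>

lemma spec_dom: "a < N \<Longrightarrow> spec a \<subseteq> dom_a a"
proof (cases "a \<in> eigen_index \<mu> N")
  case True
  then show ?thesis using dom by (auto simp: dyn_domain_def)
next
  case False
  assume a: "a < N"
  then have "G a = {0}" using False by (simp add: eigen_index_def)
  then show ?thesis
    unfolding invariant_subspace.spectrum_eig[OF inv_G[OF a]] invariant_subspace.eig_def[OF inv_G[OF a]] by simp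
qed

lemma calc: "a < N \<Longrightarrow> z \<notin> \<Omega> \<Longrightarrow> holomorphic_calculus (G a) (lie \<omega>) (dom_a a) (\<lambda>w. chi_a N \<tau> a w z)"
  by (intro holomorphic_calculus.intro holomorphic_calculus_axioms.intro inv_G open_compl_sing_a[OF \<tau>]
      chi_a_holomorphic[OF \<tau>] spec_dom)

text \<open>
  A radius that depends on \<open>\<omega>\<close> and \<open>a\<close> only, so that it can be used for all spectral parameters \<open>z\<close>.
\<close>

definition rad :: "nat \<Rightarrow> real" where
  "rad a = (SOME \<rho>. \<rho> > 0 \<and> (\<forall>l. l \<in> spec a \<longrightarrow> cball l \<rho> \<subseteq> dom_a a) \<and>
    (\<forall>l l'. l \<in> spec a \<longrightarrow> l' \<in> spec a \<longrightarrow> l \<noteq> l' \<longrightarrow> cball l \<rho> \<inter> cball l' \<rho> = {}))"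

lemma pert:
  assumes a: "a < N" and z: "z \<notin> \<Omega>"
  shows "perturbation B \<mu> N n \<tau> T T' \<omega> a (dom_a a) (\<lambda>w. chi_a N \<tau> a w z) (rad a)"
proof -
  obtain \<rho> where "\<rho> > 0" "\<And>l. l \<in> spec a \<Longrightarrow> cball l \<rho> \<subseteq> dom_a a"
    "\<And>l l'. l \<in> spec a \<Longrightarrow> l' \<in> spec a \<Longrightarrow> l \<noteq> l' \<Longrightarrow> cball l \<rho> \<inter> cball l' \<rho> = {}"
    by (rule holomorphic_calculus.disc_system[OF calc[OF a z]]) (rule that)
  then have "\<exists>\<rho>. \<rho> > 0 \<and> (\<forall>l. l \<in> spec a \<longrightarrow> cball l \<rho> \<subseteq> dom_a a) \<and>
    (\<forall>l l'. l \<in> spec a \<longrightarrow> l' \<in> spec a \<longrightarrow> l \<noteq> l' \<longrightarrow> cball l \<rho> \<inter> cball l' \<rho> = {})"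
    by (intro exI[of _ \<rho>]) simp
  from someI_ex[OF this] have "rad a > 0 \<and> (\<forall>l. l \<in> spec a \<longrightarrow> cball l (rad a) \<subseteq> dom_a a) \<and>
    (\<forall>l l'. l \<in> spec a \<longrightarrow> l' \<in> spec a \<longrightarrow> l \<noteq> l' \<longrightarrow> cball l (rad a) \<inter> cball l' (rad a) = {})"
    unfolding rad_def .
  then show ?thesis
    using \<omega> a open_compl_sing_a[OF \<tau> a] chi_a_holomorphic[OF \<tau> z a]
    by (intro perturbation.intro twisted_lie_algebra_axioms perturbation_axioms.intro) simp_all
qed

lemma chi_op_simps:
  assumes "a < N" "z \<notin> \<Omega>" "x \<in> G a"
  shows "y \<in> G a \<Longrightarrow> chi_op \<omega> z a (x + y) = chi_op \<omega> z a x + chi_op \<omega> z a y"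
    "chi_op \<omega> z a (c *\<^sub>C x) = c *\<^sub>C chi_op \<omega> z a x" "chi_op \<omega> z a x \<in> G a"
  unfolding chi_op_def using assms holomorphic_calculus.hc_add[OF calc] holomorphic_calculus.hc_scale[OF calc]
    holomorphic_calculus.hc_in[OF calc] by simp_all

lemma chi_op_0: "a < N \<Longrightarrow> z \<notin> \<Omega> \<Longrightarrow> chi_op \<omega> z a 0 = 0"
  using chi_op_simps(2)[of a z 0 0] by (simp add: G_simps)

lemma Rop_linear: "z \<notin> \<Omega> \<Longrightarrow> clinear (Rop \<omega> z)"
  by (simp add: clinear_iff Rop_def P_simps chi_op_simps P_in sum.distrib complex_vector.scale_sum_right)

lemma Rop_G: "a < N \<Longrightarrow> z \<notin> \<Omega> \<Longrightarrow> x \<in> G a \<Longrightarrow> Rop \<omega> z x = chi_op \<omega> z a x"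
proof -
  assume *: "a < N" "z \<notin> \<Omega>" "x \<in> G a"
  have "(\<Sum>b<N. chi_op \<omega> z b (P b x)) = (\<Sum>b<N. if b = a then chi_op \<omega> z a x else 0)"
    by (rule sum.cong) (use * in \<open>auto simp: P_same P_other[OF *(3,1)] chi_op_0\<close>)
  then show ?thesis using *(1) by (simp add: Rop_def)
qed

lemma Rop_in: "a < N \<Longrightarrow> z \<notin> \<Omega> \<Longrightarrow> x \<in> G a \<Longrightarrow> Rop \<omega> z x \<in> G a"
  by (simp add: Rop_G chi_op_simps)

lemma Rop_gev:
  assumes a: "a < N" "z \<notin> \<Omega>" "x \<in> G a" and x: "(nil (lie \<omega>) l ^^ K) x = 0"
  shows "Rop \<omega> z x = (\<Sum>k<K. (fps_expansion (\<lambda>w. chi_a N \<tau> a w z) l $ k) *\<^sub>C (nil (lie \<omega>) l ^^ k) x)"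
  using holomorphic_calculus.hc_gev[OF calc[OF a(1,2)] a(3) x] by (simp add: Rop_G[OF a] chi_op_def fps_expansion_def)

lemma clinear_eq_on_G:
  assumes "clinear f" "clinear g" "\<And>a x. a < N \<Longrightarrow> x \<in> G a \<Longrightarrow> f x = g x"
  shows "f = g"
proof
  fix x
  have "f (\<Sum>a<N. P a x) = g (\<Sum>a<N. P a x)"
    unfolding clinear_simps(6)[OF assms(1)] clinear_simps(6)[OF assms(2)]
    by (rule sum.cong) (auto intro: assms(3) P_in)
  then show "f x = g x" by (simp add: sum_P)
qed

lemma R_op_Rr: "z \<notin> \<Omega> \<Longrightarrow> R_op \<mu> N \<tau> \<omega> z = Rop \<omega> z"
  unfolding R_op_def
proof (rule the_equality)
  assume z: "z \<notin> \<Omega>"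
  show "clinear (Rop \<omega> z) \<and> (\<forall>a\<in>eigen_index \<mu> N. \<forall>x\<in>G a.
      Rop \<omega> z x = hol_calculus (G a) (dom_a a) (\<lambda>w. chi_a N \<tau> a w z) (lie \<omega>) x)"
    using Rop_linear[OF z] Rop_G[OF _ z] unfolding chi_op_def eigen_index_def by simp
  fix f assume f: "clinear f \<and> (\<forall>a\<in>eigen_index \<mu> N. \<forall>x\<in>G a.
      f x = hol_calculus (G a) (dom_a a) (\<lambda>w. chi_a N \<tau> a w z) (lie \<omega>) x)"
  show "f = Rop \<omega> z"
  proof (rule clinear_eq_on_G)
    fix a x assume a: "a < N" "x \<in> G a"
    show "f x = Rop \<omega> z x"
    proof (cases "x = 0")
      case True
      then show ?thesis using f clinear_simps(3)[of f] clinear_simps(3)[OF Rop_linear[OF z]] by simp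
    next
      case False
      then have "a \<in> eigen_index \<mu> N" using a by (auto simp: eigen_index_def)
      then show ?thesis using f a by (simp add: Rop_G z chi_op_def)
    qed
  qed (use f Rop_linear[OF z] in auto)
qed

subsection \<open>Skew symmetry\<close>

lemma opposite_lt: "(N - b) mod N < N" using N_pos by simp

lemma opposite: "a < N \<Longrightarrow> b < N \<Longrightarrow> (a + b) mod N = 0 \<Longrightarrow> a = (N - b) mod N"
proof -
  assume a: "a < N" "b < N" "(a + b) mod N = 0"
  then obtain k where k: "a + b = N * k" by (auto simp: mod_eq_0_iff_dvd)
  have "k < 2" using a(1,2) k by (metis add_strict_mono mult_2_right mult_less_cancel1)
  then consider "k = 0" | "k = 1" by linarith
  then show ?thesis
  proof cases
    case 2
    then have "a = N - b" using k a by simp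
    then show ?thesis using a by (cases "b = 0") simp_all
  qed (use k in simp)
qed

text \<open>
  \<open>G b\<close> and \<open>G (- b)\<close> are dual by \<open>B\<close>, and \<open>ad \<omega>\<close> is skew. This places \<open>- v\<close> in the
  domain of the function that appears in the derivative term for \<open>X\<close>.
\<close>

lemma opposite_spec:
  assumes b: "b < N" and v: "v \<in> spec b"
  shows "- v \<in> spec ((N - b) mod N)"
proof (rule ccontr)
  assume n: "- v \<notin> spec ((N - b) mod N)"
  obtain y where y: "y \<in> G b" "y \<noteq> 0" "lie \<omega> y = v *\<^sub>C y"
    using v by (auto simp: invariant_subspace.spectrum_eig[OF inv_G[OF b]] invariant_subspace.eig_def[OF inv_G[OF b]])
  have y1: "(nil (lie \<omega>) v ^^ 1) y = 0" using y(3) by (simp add: nil_def)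
  let ?a = "(N - b) mod N"
  interpret I: invariant_subspace "G ?a" "lie \<omega>" by (rule inv_G[OF opposite_lt])
  have 1: "B y x = 0" if "x \<in> G ?a" for x
    using that
  proof (induction rule: I.gev_induct)
    case (gev w K x)
    show ?case
    proof (cases "x = 0")
      case False
      then have "w \<in> spec ?a"
        using I.gev_eig[OF gev(1) False gev(2)] by (simp add: I.spectrum_eig)
      then have "w \<noteq> - v" using n by auto
      then show ?thesis using B_gev_orthogonal[OF \<omega> y1 gev(2)] by simp
    qed (simp add: B_right)
  qed (simp add: B_right)
  have "B y x = 0" for x
  proof -
    have "B y (P a x) = 0" if "a < N" for a
    proof (cases "(a + b) mod N = 0")
      case True
      then show ?thesis using 1 P_in[of a x] opposite[OF that b True] by simp
    next
      case False
      then show ?thesis using B_orthogonal[OF y(1) P_in[of a x]] by (simp add: add.commute)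
    qed
    then have "B y (\<Sum>a<N. P a x) = 0" by (simp add: B_right)
    then show ?thesis by (simp add: sum_P)
  qed
  then show False using B_nondeg y(2) by blast
qed

text \<open>
  \<open>chi_a_uminus\<close> read on Taylor coefficients.
\<close>

lemma expansion_opposite:
  assumes b: "b < N" and z: "z \<notin> \<Omega>" and l: "l \<notin> sing_a N \<tau> b"
  shows "fps_expansion (\<lambda>w. chi_a N \<tau> b w (- z)) l $ k
    = - ((- 1) ^ k * fps_expansion (\<lambda>w. chi_a N \<tau> ((N - b) mod N) w z) (- l) $ k)"
proof -
  let ?f = "\<lambda>w. chi_a N \<tau> ((N - b) mod N) w z"
  have o: "open (dom_a b)" "open (dom_a ((N - b) mod N))" by (intro open_compl_sing_a[OF \<tau>] b opposite_lt)+
  have h: "?f holomorphic_on dom_a ((N - b) mod N)" by (rule chi_a_holomorphic[OF \<tau> z opposite_lt])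
  have m: "- w \<in> dom_a ((N - b) mod N)" if "w \<in> dom_a b" for w using that sing_a_uminus[OF b, of w] by simp
  have hm: "(\<lambda>w. ?f (- w)) holomorphic_on dom_a b"
  proof -
    have "(?f \<circ> uminus) holomorphic_on dom_a b"
      by (rule holomorphic_on_compose_gen[OF _ h]) (use m in \<open>auto intro!: holomorphic_on_minus holomorphic_on_ident\<close>)
    then show ?thesis by (simp add: o_def)
  qed
  have "(deriv ^^ k) (\<lambda>w. chi_a N \<tau> b w (- z)) l = (deriv ^^ k) (\<lambda>w. - ?f (- w)) l"
    by (rule higher_deriv_transform_within_open[OF chi_a_holomorphic[OF \<tau> _ b] _ o(1)])
      (use hm l z chi_a_uminus[OF \<tau> z b] in \<open>auto simp: period_lattice_minus intro!: holomorphic_intros\<close>)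
  also have "\<dots> = - (deriv ^^ k) (\<lambda>w. ?f (- w)) l"
    by (rule higher_deriv_uminus[OF hm o(1)]) (use l in simp)
  also have "(deriv ^^ k) (\<lambda>w. ?f (- 1 * w)) l = (- 1) ^ k * (deriv ^^ k) ?f (- 1 * l)"
    by (rule higher_deriv_compose_linear[OF h o]) (use l m in auto)
  then have "(deriv ^^ k) (\<lambda>w. ?f (- w)) l = (- 1) ^ k * (deriv ^^ k) ?f (- l)" by simp
  finally show ?thesis by (simp add: fps_expansion_def)
qed

text \<open>
  The adjoint of \<open>H (ad \<omega>)\<close> is \<open>H (- ad \<omega>)\<close>, and \<open>chi_a_uminus\<close> identifies it. The argument
  compares Taylor series on generalized eigenvectors, those with nonopposite eigenvalues being orthogonal.
\<close>

lemma Rop_skew: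
  assumes z: "z \<notin> \<Omega>"
  shows "B (Rop \<omega> z y) x = - B y (Rop \<omega> (- z) x)"
proof -
  have z': "- z \<notin> \<Omega>" using z by (simp add: period_lattice_minus)
  note L = clinear_simps[OF Rop_linear[OF z]] and L' = clinear_simps[OF Rop_linear[OF z']]
  have homog_gev: "B (Rop \<omega> z y) x = - B y (Rop \<omega> (- z) x)"
    if b: "b < N" "a < N" "(a + b) mod N = 0" and y: "y \<in> G b" "(nil (lie \<omega>) l ^^ K) y = 0"
      and x: "x \<in> G a" "(nil (lie \<omega>) m ^^ M) x = 0" for a b l m K M x y
  proof (cases "m = - l \<and> y \<noteq> 0")
    case False
    have "(nil (lie \<omega>) l ^^ K) ((nil (lie \<omega>) l ^^ k) y) = (nil (lie \<omega>) l ^^ k) ((nil (lie \<omega>) l ^^ K) y)" for k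
      by (metis add.commute comp_apply funpow_add)
    then have 1: "(nil (lie \<omega>) l ^^ K) (Rop \<omega> z y) = 0"
      using y(2) by (simp add: Rop_gev[OF b(1) z y] clinear_simps[OF funpow_linear[OF nil_linear[OF clinear_lie(1)]]])
    have "(nil (lie \<omega>) m ^^ M) ((nil (lie \<omega>) m ^^ k) x) = (nil (lie \<omega>) m ^^ k) ((nil (lie \<omega>) m ^^ M) x)" for k
      by (metis add.commute comp_apply funpow_add)
    then have 2: "(nil (lie \<omega>) m ^^ M) (Rop \<omega> (- z) x) = 0"
      using x(2) by (simp add: Rop_gev[OF b(2) z' x] clinear_simps[OF funpow_linear[OF nil_linear[OF clinear_lie(1)]]])
    show ?thesis
    proof (cases "y = 0")
      case False
      then have "m \<noteq> - l" using \<open>\<not> (m = - l \<and> y \<noteq> 0)\<close> by simp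
      then show ?thesis using B_gev_orthogonal[OF \<omega> 1 x(2)] B_gev_orthogonal[OF \<omega> y(2) 2] by simp
    qed (simp add: L B_left)
  next
    case True
    have ls: "l \<notin> sing_a N \<tau> b"
      using invariant_subspace.gev_eig[OF inv_G[OF b(1)] y(1) _ y(2)] True spec_dom[OF b(1)]
      by (auto simp: invariant_subspace.spectrum_eig[OF inv_G[OF b(1)]])
    have ab: "a = (N - b) mod N" "b = (N - a) mod N" using opposite b by (simp_all add: add.commute)
    have ms: "m \<notin> sing_a N \<tau> a" using sing_a_uminus[OF b(1), of l] True ls by (simp add: ab(1)[symmetric])
    have sh: "B ((nil (lie \<omega>) l ^^ k) y) x = (- 1) ^ k * B y ((nil (lie \<omega>) m ^^ k) x)" for k
    proof (induction k arbitrary: x)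
      case (Suc k)
      have "B ((nil (lie \<omega>) l ^^ Suc k) y) x = - B ((nil (lie \<omega>) l ^^ k) y) (nil (lie \<omega>) m x)"
        using True by (simp add: nil_def B_left B_right B_skew)
      also have "\<dots> = (- 1) ^ Suc k * B y ((nil (lie \<omega>) m ^^ k) (nil (lie \<omega>) m x))" by (simp add: Suc)
      finally show ?case by (simp add: funpow_Suc_right del: funpow.simps)
    qed simp
    let ?M = "max K M"
    have y2: "(nil (lie \<omega>) l ^^ ?M) y = 0" by (rule invariant_subspace.nil_mono[OF inv_G[OF b(1)] y(2)]) simp
    have x2: "(nil (lie \<omega>) m ^^ ?M) x = 0" by (rule invariant_subspace.nil_mono[OF inv_G[OF b(2)] x(2)]) simp
    have "fps_expansion (\<lambda>w. chi_a N \<tau> a w (- z)) m $ k = - ((- 1) ^ k * fps_expansion (\<lambda>w. chi_a N \<tau> b w z) l $ k)" for k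
      using expansion_opposite[OF b(2) z ms, of k] True by (simp add: ab(2)[symmetric])
    then show ?thesis
      unfolding Rop_gev[OF b(1) z y(1) y2] Rop_gev[OF b(2) z' x(1) x2]
      by (simp add: B_left B_right sh sum_negf mult_ac)
  qed
  have homogeneous: "B (Rop \<omega> z y) x = - B y (Rop \<omega> (- z) x)"
    if b: "b < N" "a < N" and y: "y \<in> G b" and x: "x \<in> G a" for a b x y
  proof (cases "(a + b) mod N = 0")
    case False
    then show ?thesis
      using B_orthogonal[OF Rop_in[OF b(1) z y] x] B_orthogonal[OF y Rop_in[OF b(2) z' x]] by (simp add: add.commute)
  next
    case True
    interpret Ib: invariant_subspace "G b" "lie \<omega>" by (rule inv_G[OF b(1)])
    interpret Ia: invariant_subspace "G a" "lie \<omega>" by (rule inv_G[OF b(2)])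
    from y show ?thesis
    proof (induction rule: Ib.gev_induct)
      case (gev l K y)
      note y = gev
      from x show ?case
      proof (induction rule: Ia.gev_induct)
        case (gev m M x)
        show ?case by (rule homog_gev[OF b True y gev])
      qed (simp add: L' B_right)
    qed (simp add: L B_left)
  qed
  have components: "B (Rop \<omega> z (P b y)) (P a x) = - B (P b y) (Rop \<omega> (- z) (P a x))" if "b < N" "a < N" for a b
    by (rule homogeneous[OF that P_in P_in])
  have "B (Rop \<omega> z (\<Sum>b<N. P b y)) (\<Sum>a<N. P a x) = - B (\<Sum>b<N. P b y) (Rop \<omega> (- z) (\<Sum>a<N. P a x))"
    unfolding L L' B_left B_right sum_negf[symmetric]
    by (intro sum.cong refl) (simp add: components)
  then show ?thesis by (simp add: sum_P)
qed

end

context dynamical_point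
begin

subsection \<open>Derivatives along curves\<close>

definition dchi_op :: "complex \<Rightarrow> nat \<Rightarrow> 'g \<Rightarrow> 'g \<Rightarrow> 'g" where
  "dchi_op z a = perturbation.dcalc B \<mu> N n T T' \<omega> a (\<lambda>w. chi_a N \<tau> a w z) (rad a)"

text \<open>
  The derivative of \<open>Rop\<close> in the direction \<open>Q\<close>, block by block.
\<close>

definition dRop :: "complex \<Rightarrow> 'g \<Rightarrow> 'g \<Rightarrow> 'g" where
  "dRop z Q x = (\<Sum>a<N. dchi_op z a Q (P a x))"

lemma dchi_op_simps:
  assumes a: "a < N" and z: "z \<notin> \<Omega>" and Q: "Q \<in> G 0" and x: "x \<in> G a"
  shows "y \<in> G a \<Longrightarrow> dchi_op z a Q (x + y) = dchi_op z a Q x + dchi_op z a Q y"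
    "Q' \<in> G 0 \<Longrightarrow> dchi_op z a (Q + Q') x = dchi_op z a Q x + dchi_op z a Q' x"
    "dchi_op z a (k *\<^sub>C Q) x = k *\<^sub>C dchi_op z a Q x"
    "dchi_op z a Q x \<in> G a"
  unfolding dchi_op_def by (intro perturbation.dcalc_add_right[OF pert[OF a z]] perturbation.dcalc_add_left[OF pert[OF a z]]
      perturbation.dcalc_scale_left[OF pert[OF a z]] perturbation.dcalc_in[OF pert[OF a z]] assms; assumption)+

lemma dchi_op_0: "a < N \<Longrightarrow> z \<notin> \<Omega> \<Longrightarrow> Q \<in> G 0 \<Longrightarrow> dchi_op z a Q 0 = 0"
  using dchi_op_simps(1)[of a z Q 0 0] by (simp add: G_simps)

lemma dRop_G: "a < N \<Longrightarrow> z \<notin> \<Omega> \<Longrightarrow> Q \<in> G 0 \<Longrightarrow> x \<in> G a \<Longrightarrow> dRop z Q x = dchi_op z a Q x"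
proof -
  assume *: "a < N" "z \<notin> \<Omega>" "Q \<in> G 0" "x \<in> G a"
  have "(\<Sum>b<N. dchi_op z b Q (P b x)) = (\<Sum>b<N. if b = a then dchi_op z a Q x else 0)"
    by (rule sum.cong) (use * in \<open>auto simp: P_same P_other[OF *(4,1)] dchi_op_0\<close>)
  then show ?thesis using *(1) by (simp add: dRop_def)
qed

lemma dRop_in: "a < N \<Longrightarrow> z \<notin> \<Omega> \<Longrightarrow> Q \<in> G 0 \<Longrightarrow> x \<in> G a \<Longrightarrow> dRop z Q x \<in> G a"
  by (simp add: dRop_G dchi_op_simps)

lemma dRop_simps:
  assumes z: "z \<notin> \<Omega>" and Q: "Q \<in> G 0"
  shows "dRop z Q (x + y) = dRop z Q x + dRop z Q y"
    "Q' \<in> G 0 \<Longrightarrow> dRop z (Q + Q') x = dRop z Q x + dRop z Q' x"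
    "dRop z (k *\<^sub>C Q) x = k *\<^sub>C dRop z Q x"
    "dRop z Q 0 = 0" "dRop z 0 x = 0"
proof -
  show "dRop z Q (x + y) = dRop z Q x + dRop z Q y"
    unfolding dRop_def P_simps sum.distrib[symmetric]
    by (rule sum.cong) (simp_all add: dchi_op_simps(1) z Q P_in)
  then show "dRop z Q 0 = 0" by (simp add: dRop_def P_simps dchi_op_0 z Q)
  show "dRop z (Q + Q') x = dRop z Q x + dRop z Q' x" if "Q' \<in> G 0"
    unfolding dRop_def P_simps sum.distrib[symmetric]
    by (rule sum.cong) (simp_all add: dchi_op_simps(2) z Q P_in that)
  show s: "dRop z (k *\<^sub>C Q) x = k *\<^sub>C dRop z Q x" for k
    unfolding dRop_def complex_vector.scale_sum_right
    by (rule sum.cong) (simp_all add: dchi_op_simps(3) z Q P_in)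
  show "dRop z 0 x = 0" using s[of 0] by simp
qed

lemma dRop_sum_left: "z \<notin> \<Omega> \<Longrightarrow> (\<And>i. i \<in> I \<Longrightarrow> f i \<in> G 0) \<Longrightarrow> dRop z (\<Sum>i\<in>I. f i) x = (\<Sum>i\<in>I. dRop z (f i) x)"
  by (induction I rule: infinite_finite_induct) (simp_all add: dRop_simps(5)[OF _ G_simps(1)] dRop_simps(2) G_simps)

lemma dRop_orbit:
  assumes z: "z \<notin> \<Omega>" and X: "X \<in> G 0"
  shows "dRop z (lie X \<omega>) x = lie X (Rop \<omega> z x) - Rop \<omega> z (lie X x)"
proof -
  have X\<omega>: "lie X \<omega> \<in> G 0" by (rule G_lie_0[OF X N_pos \<omega>])
  have "dRop z (lie X \<omega>) (P a x) = lie X (Rop \<omega> z (P a x)) - Rop \<omega> z (lie X (P a x))" if a: "a < N" for a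
    unfolding dRop_G[OF a z X\<omega> P_in] dchi_op_def perturbation.dcalc_orbit[OF pert[OF a z] X P_in]
      Rop_G[OF a z P_in] Rop_G[OF a z G_lie_0[OF X a P_in]] chi_op_def ..
  then have "(\<Sum>a<N. dRop z (lie X \<omega>) (P a x)) = (\<Sum>a<N. lie X (Rop \<omega> z (P a x)) - Rop \<omega> z (lie X (P a x)))"
    by simp
  also have "\<dots> = lie X (Rop \<omega> z (\<Sum>a<N. P a x)) - Rop \<omega> z (lie X (\<Sum>a<N. P a x))"
    by (simp only: sum_subtractf clinear_simps(6)[OF clinear_lie(1)] clinear_simps(6)[OF Rop_linear[OF z]])
  also have "(\<Sum>a<N. dRop z (lie X \<omega>) (P a x)) = (\<Sum>a<N. dchi_op z a (lie X \<omega>) (P a x))"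
    by (rule sum.cong) (simp_all add: dRop_G z X\<omega> P_in)
  finally show ?thesis by (simp add: dRop_def sum_P)
qed

lemma Rop_deriv:
  assumes z: "z \<notin> \<Omega>" and \<gamma>: "\<And>t. \<gamma> t \<in> G 0" "\<gamma> t0 = \<omega>" "has_vec_deriv \<gamma> Q t0" and Q: "Q \<in> G 0" and \<phi>: "cfunctional \<phi>"
  shows "((\<lambda>t. \<phi> (Rop (\<gamma> t) z x)) has_field_derivative \<phi> (dRop z Q x)) (at t0)"
proof -
  have "((\<lambda>t. \<Sum>a<N. \<phi> (chi_op (\<gamma> t) z a (P a x))) has_field_derivative (\<Sum>a<N. \<phi> (dchi_op z a Q (P a x)))) (at t0)"
    unfolding chi_op_def dchi_op_def
    by (rule DERIV_sum) (rule perturbation.calculus_deriv[OF pert[OF _ z] \<gamma> Q P_in \<phi>], simp)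
  then show ?thesis by (simp add: Rop_def dRop_def cfunctional_simps[OF \<phi>])
qed

text \<open>
  The domain is open along curves: by continuity the perturbed spectrum stays in the discs around the old one.
\<close>

lemma eventually_dyn_domain:
  assumes \<gamma>: "\<And>t. \<gamma> t \<in> G 0" "\<gamma> t0 = \<omega>" "has_vec_deriv \<gamma> Q t0" and z: "z \<notin> \<Omega>"
  shows "eventually (\<lambda>t. \<gamma> t \<in> dyn_domain \<mu> N \<tau>) (nhds t0)"
proof -
  have l: "((\<lambda>t. nrm (\<gamma> t - \<omega>)) \<longlongrightarrow> 0) (at t0)"
  proof (rule perturbation.tendsto_nrm[OF pert[OF N_pos z]])
    fix \<psi> :: "'g \<Rightarrow> complex" assume "cfunctional \<psi>"
    then have "((\<lambda>t. \<psi> (\<gamma> t)) has_field_derivative \<psi> Q) (at t0)" using \<gamma>(3) by (simp add: has_vec_deriv_def)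
    then show "((\<lambda>t. \<psi> (\<gamma> t)) \<longlongrightarrow> \<psi> \<omega>) (at t0)"
      using DERIV_isCont[of "\<lambda>t. \<psi> (\<gamma> t)"] \<gamma>(2) by (auto simp: isCont_def)
  qed
  have "eventually (\<lambda>t. \<forall>a\<in>{..<N}. spectrum_on (G a) (lie (\<gamma> t)) \<subseteq> dom_a a) (at t0)"
  proof (rule eventually_ball_finite[OF finite_lessThan], rule ballI)
    fix a assume "a \<in> {..<N}"
    then have a: "a < N" by simp
    show "eventually (\<lambda>t. spectrum_on (G a) (lie (\<gamma> t)) \<subseteq> dom_a a) (at t0)"
      using perturbation.eventually_outside[OF pert[OF a z] \<gamma>(1) l]
    proof eventually_elim
      case (elim t)
      have "holomorphic_calculus (G a) (lie (\<gamma> t)) (dom_a a) (\<lambda>w. chi_a N \<tau> a w z)"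
        by (rule perturbation.perturbed_calculus(1)[OF pert[OF a z] \<gamma>(1)]) (use elim in blast)
      then show ?case by (rule holomorphic_calculus.spec)
    qed
  qed
  then have "eventually (\<lambda>t. \<gamma> t \<in> dyn_domain \<mu> N \<tau>) (at t0)"
  proof eventually_elim
    case (elim t)
    then show ?case using \<gamma>(1)[of t] by (fastforce simp: dyn_domain_def G_0 eigen_index_def)
  qed
  then show ?thesis using dom \<gamma>(2) by (auto simp: eventually_at_filter elim!: eventually_mono)
qed

subsection \<open>The trilinear form of the dynamical Yang-Baxter equation\<close>

text \<open>
  The pairing of the dynamical Yang-Baxter expression with \<open>X\<close>, \<open>Y\<close>, \<open>Z\<close> in the three factors, for
  \<open>x = z1 - z2\<close> and \<open>y = z1 - z3\<close>. Operators on \<open>X\<close> have been moved to the other arguments by skew symmetry, and the sum over the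
  coordinates of the fixed point algebra has become the projection \<open>P 0\<close>.
\<close>

definition yang_baxter :: "complex \<Rightarrow> complex \<Rightarrow> 'g \<Rightarrow> 'g \<Rightarrow> 'g \<Rightarrow> complex" where
  "yang_baxter x y X Y Z = B X (lie (Rop \<omega> x Y) (Rop \<omega> y Z)) + B X (Rop \<omega> x (lie (Rop \<omega> (y - x) Z) Y))
    - B X (Rop \<omega> y (lie (Rop \<omega> (x - y) Y) Z)) - B X (dRop y (P 0 Y) Z) + B X (dRop x (P 0 Z) Y) + B Y (dRop (y - x) (P 0 X) Z)"

text \<open>
  All six terms are functions of \<open>\<alpha>\<close> and \<open>\<beta>\<close> applied to the bracket of \<open>Y\<close> and \<open>Z\<close> and paired with \<open>X\<close>. Their sum \<open>W\<close>
  vanishes after multiplication with \<open>\<alpha> * \<beta> * (\<alpha> + \<beta>)\<close> by \<open>chi_a_fay_fps\<close>, hence it vanishes. If \<open>v + w\<close> is not an eigenvalue,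
  the expansions there are meaningless, but then all brackets vanish.
\<close>

lemma yang_baxter_gev:
  assumes xy: "x \<notin> \<Omega>" "y \<notin> \<Omega>" "y - x \<notin> \<Omega>"
    and abc: "a < N" "b < N" "c < N" "(a + (b + c) mod N) mod N = 0"
    and X: "X \<in> G a" and Y0: "Y \<in> G b" "(nil (lie \<omega>) v ^^ K1) Y = 0" and Z0: "Z \<in> G c" "(nil (lie \<omega>) w ^^ K2) Z = 0"
    and nz: "Y \<noteq> 0" "Z \<noteq> 0"
  shows "yang_baxter x y X Y Z = 0"
proof -
  define d where "d = (b + c) mod N"
  \<comment> \<open>A common positive order of nilpotency; positivity makes the constant coefficient occur in the sums.\<close>
  define K where "K = Suc (max K1 K2)"
  have dN: "d < N" using N_pos by (simp add: d_def)
  have yx: "x - y \<notin> \<Omega>" using xy(3) period_lattice_minus[of "y - x" \<tau>] by simp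
  interpret Ib: invariant_subspace "G b" "lie \<omega>" by (rule inv_G[OF abc(2)])
  interpret Ic: invariant_subspace "G c" "lie \<omega>" by (rule inv_G[OF abc(3)])
  have nY: "(nil (lie \<omega>) v ^^ K) Y = 0" by (rule Ib.nil_mono[OF Y0(2)]) (simp add: K_def)
  have nZ: "(nil (lie \<omega>) w ^^ K) Z = 0" by (rule Ic.nil_mono[OF Z0(2)]) (simp add: K_def)
  have v: "v \<in> spec b" using Ib.gev_eig[OF Y0(1) nz(1) nY] by (simp add: Ib.spectrum_eig)
  have w: "w \<in> spec c" using Ic.gev_eig[OF Z0(1) nz(2) nZ] by (simp add: Ic.spectrum_eig)
  interpret E: gev_pair B \<mu> N n \<tau> T T' \<omega> Y Z v w b c K
    by unfold_locales (use \<omega> abc Y0 Z0 nY nZ in \<open>simp_all add: K_def\<close>)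
  let ?e = "\<lambda>a z. fps_expansion (\<lambda>w. chi_a N \<tau> a w z)"
  define f1 f2 f3 f4 f5 f6 where f: "f1 = ?e b x v" "f2 = ?e c y w" "f3 = ?e d x (v + w)"
      "f4 = ?e c (y - x) w" "f5 = ?e d y (v + w)" "f6 = ?e b (x - y) v"
  have RY: "Rop \<omega> z Y = (\<Sum>k<K. (?e b z v $ k) *\<^sub>C (nil (lie \<omega>) v ^^ k) Y)" if "z \<notin> \<Omega>" for z
    by (rule Rop_gev[OF abc(2) that Y0(1) nY])
  have RZ: "Rop \<omega> z Z = (\<Sum>k<K. (?e c z w $ k) *\<^sub>C (nil (lie \<omega>) w ^^ k) Z)" if "z \<notin> \<Omega>" for z
    by (rule Rop_gev[OF abc(3) that Z0(1) nZ])
  have pa: "pair_at B \<mu> N n \<tau> T T' \<omega> Y Z v w b c K a' (dom_a a') (\<lambda>w. chi_a N \<tau> a' w z) (rad a')"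
    if "a' < N" "z \<notin> \<Omega>" for a' z
    by (intro pair_at.intro E.gev_pair_axioms pert that)
  note RL = clinear_simps[OF Rop_linear]
  have t1: "lie (Rop \<omega> x Y) (Rop \<omega> y Z) = E.Ev (fpsL f1 * fpsR f2)"
    unfolding RY[OF xy(1)] RZ[OF xy(2)] f by (rule E.Ev_pair)
  have s2: "lie (Rop \<omega> (y - x) Z) Y = - E.Ev (fpsR f4)"
    unfolding RZ[OF xy(3)] f by (subst lie_antisym) (simp only: E.lie_Y_series)
  have s3: "lie (Rop \<omega> (x - y) Y) Z = E.Ev (fpsL f6)"
    unfolding RY[OF yx] f by (rule E.lie_series_Z)
  have Pother: "P 0 u = 0" if "u \<in> G a'" "a' < N" "a' \<noteq> 0" for a' u using P_other[OF that(1,2) N_pos that(3)] .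
  have Pzero: "P 0 u = u" if "u \<in> G 0" for u using P_same[OF that] .
  \<comment> \<open>The derivative term for \<open>X\<close> is present exactly if the bracket of \<open>Y\<close> and \<open>Z\<close> lies in the fixed point algebra.\<close>
  have a0: "a = 0 \<longleftrightarrow> d = 0" using opposite[OF abc(1) dN] abc(1,4) dN unfolding d_def
    by (metis add_0 add.right_neutral mod_less)
  have D4: "\<exists>Q. B Y (dRop (y - x) (P 0 X) Z) = - B X (E.Ev Q) \<and>
      Q * (varL v + varR w) = of_bool (d = 0) * (fpsR f4 + fpsL f6)"
  proof (cases "a = 0")
    case True
    then have d0: "d = 0" and X0: "X \<in> G 0" using a0 X by simp_all
    have "(N - b) mod N = c" using d0 opposite[of c b] abc by (simp add: d_def add.commute)
    then have cb: "c = (N - b) mod N" by simp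
    have vc: "- v \<in> spec c" using opposite_spec[OF abc(2) v] cb by simp
    obtain Q where Q: "B Y (dchi_op (y - x) c X Z) = - B X (E.Ev Q)"
      "Q * (varL v + varR w) = fpsR f4 - fpsL (Abs_fps (\<lambda>k. (- 1) ^ k * ?e c (y - x) (- v) $ k))"
      using pair_at.dcalc_X_Z[OF pa[OF abc(3) xy(3)] refl X0 vc w] unfolding dchi_op_def f by blast
    have "fpsL (Abs_fps (\<lambda>k. (- 1) ^ k * ?e c (y - x) (- v) $ k)) = - fpsL f6"
    proof -
      have vb: "v \<notin> sing_a N \<tau> b" using v spec_dom[OF abc(2)] by auto
      have "f6 $ k = - ((- 1) ^ k * ?e c (y - x) (- v) $ k)" for k
        using expansion_opposite[OF abc(2) xy(3) vb, of k] cb by (simp add: f)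
      then have "f6 = - Abs_fps (\<lambda>k. (- 1) ^ k * ?e c (y - x) (- v) $ k)" by (intro fps_ext) simp
      then show ?thesis by (simp add: fpsL_def)
    qed
    then show ?thesis using Q d0 dRop_G[OF abc(3) xy(3) X0 Z0(1)] by (intro exI[of _ Q]) (simp add: Pzero[OF X0])
  next
    case False
    then show ?thesis
      using a0 by (intro exI[of _ 0]) (simp add: Pother[OF X abc(1)] dRop_simps(5)[OF xy(3) G_simps(1)] E.Ev_0 B_right)
  qed
  then obtain Q4 where Q4: "B Y (dRop (y - x) (P 0 X) Z) = - B X (E.Ev Q4)"
      "Q4 * (varL v + varR w) = of_bool (d = 0) * (fpsR f4 + fpsL f6)" by blast
  show ?thesis
  proof (cases "v + w \<in> spec d")
    case True
    have sing: "v \<notin> sing_a N \<tau> b" "w \<notin> sing_a N \<tau> c" "v + w \<notin> sing_a N \<tau> d"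
      using v w True spec_dom abc dN by auto
    have t2: "Rop \<omega> x (lie (Rop \<omega> (y - x) Z) Y) = - E.Ev (fpsR f4 * fpsD f3)"
      using pair_at.calculus_Ev[OF pa[OF dN xy(1)] d_def True]
      by (simp add: s2 RL xy Rop_G[OF dN] E.Ev_in d_def[symmetric] E.Ev_in[folded d_def] chi_op_def f)
    have t3: "Rop \<omega> y (lie (Rop \<omega> (x - y) Y) Z) = E.Ev (fpsL f6 * fpsD f5)"
      using pair_at.calculus_Ev[OF pa[OF dN xy(2)] d_def True]
      by (simp add: s3 Rop_G[OF dN xy(2)] E.Ev_in[folded d_def] chi_op_def f)
    have "\<exists>Q. dRop y (P 0 Y) Z = E.Ev Q \<and> Q * varL v = of_bool (b = 0) * (fpsD f5 - fpsR f2)"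
    proof (cases "b = 0")
      case b0: True
      then have dc: "d = c" using abc by (simp add: d_def)
      have Y00: "Y \<in> G 0" using Y0 b0 by simp
      show ?thesis
        using pair_at.dcalc_Y_Z[OF pa[OF abc(3) xy(2)] refl b0 w] True dc b0
        by (simp add: Pzero[OF Y00] dRop_G[OF abc(3) xy(2) Y00 Z0(1)] dchi_op_def f)
    next
      case False
      then show ?thesis
        by (intro exI[of _ 0]) (simp add: Pother[OF Y0(1) abc(2)] dRop_simps(5)[OF xy(2) G_simps(1)] E.Ev_0)
    qed
    then obtain Q2 where Q2: "dRop y (P 0 Y) Z = E.Ev Q2" "Q2 * varL v = of_bool (b = 0) * (fpsD f5 - fpsR f2)" by blast
    have "\<exists>Q. dRop x (P 0 Z) Y = - E.Ev Q \<and> Q * varR w = of_bool (c = 0) * (fpsD f3 - fpsL f1)"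
    proof (cases "c = 0")
      case c0: True
      then have db: "d = b" using abc by (simp add: d_def)
      have Z00: "Z \<in> G 0" using Z0 c0 by simp
      show ?thesis
        using pair_at.dcalc_Z_Y[OF pa[OF abc(2) xy(1)] refl c0 v] True db c0
        by (simp add: Pzero[OF Z00] dRop_G[OF abc(2) xy(1) Z00 Y0(1)] dchi_op_def f)
    next
      case False
      then show ?thesis
        by (intro exI[of _ 0]) (simp add: Pother[OF Z0(1) abc(3)] dRop_simps(5)[OF xy(1) G_simps(1)] E.Ev_0)
    qed
    then obtain Q3 where Q3: "dRop x (P 0 Z) Y = - E.Ev Q3" "Q3 * varR w = of_bool (c = 0) * (fpsD f3 - fpsL f1)" by blast
    define W where "W = fpsL f1 * fpsR f2 - fpsR f4 * fpsD f3 - fpsL f6 * fpsD f5 - Q2 - Q3 - Q4"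
    have "yang_baxter x y X Y Z = B X (E.Ev W)"
      unfolding yang_baxter_def t1 t2 t3 Q2(1) Q3(1) Q4(1) W_def by (simp add: E.Ev_diff B_right)
    moreover have "varL v * varR w * (varL v + varR w) * W = 0"
    proof -
      have fay: "varL v * varR w * (varL v + varR w) * (fpsL f1 * fpsR f2 - fpsR f4 * fpsD f3 - fpsL f6 * fpsD f5)
        = of_bool (b = 0) * (varR w * (varL v + varR w) * (fpsD f5 - fpsR f2))
        + of_bool (c = 0) * (varL v * (varL v + varR w) * (fpsD f3 - fpsL f1))
        + of_bool (d = 0) * (varL v * varR w * (fpsR f4 + fpsL f6))"
        unfolding f add.commute[of "fpsR (fps_expansion (\<lambda>w. chi_a N \<tau> c w (y - x)) w)"]
        by (rule chi_a_fay_fps[OF \<tau> abc(2,3) d_def sing xy])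
      show ?thesis using fay Q2(2) Q3(2) Q4(2) unfolding W_def by algebra
    qed
    then have "W = 0" using vars_nonzero by simp
    ultimately show ?thesis by (simp add: E.Ev_0 B_right)
  next
    case False
    then have Ev: "E.Ev Q = 0" for Q using E.Ev_trivial d_def by simp
    have D2: "dRop y (P 0 Y) Z = 0"
    proof (cases "b = 0")
      case b0: True
      have Y00: "Y \<in> G 0" using Y0 b0 by simp
      have "dchi_op y c Y Z = 0" unfolding dchi_op_def
      proof (rule perturbation.dcalc_trivial[OF pert[OF abc(3) xy(2)] Y00 Z0(1)])
        fix u assume "u \<in> perturbation.outside \<mu> N \<omega> c (rad c)"
        then have u: "u \<notin> spec c" by (rule perturbation.outside_S[OF pert[OF abc(3) xy(2)]])
        show "lie Y (Ic.rs u Z) = 0" by (simp only: E.rs_Z[OF u] E.lie_Y_series Ev)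
      qed
      then show ?thesis by (simp add: Pzero[OF Y00] dRop_G[OF abc(3) xy(2) Y00 Z0(1)])
    qed (simp add: Pother[OF Y0(1) abc(2)] dRop_simps(5)[OF xy(2) G_simps(1)])
    have D3: "dRop x (P 0 Z) Y = 0"
    proof (cases "c = 0")
      case c0: True
      have Z00: "Z \<in> G 0" using Z0 c0 by simp
      have "dchi_op x b Z Y = 0" unfolding dchi_op_def
      proof (rule perturbation.dcalc_trivial[OF pert[OF abc(2) xy(1)] Z00 Y0(1)])
        fix u assume "u \<in> perturbation.outside \<mu> N \<omega> b (rad b)"
        then have u: "u \<notin> spec b" by (rule perturbation.outside_S[OF pert[OF abc(2) xy(1)]])
        show "lie Z (Ib.rs u Y) = 0" by (subst lie_antisym) (simp only: E.rs_Y[OF u] E.lie_series_Z Ev, simp)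
      qed
      then show ?thesis by (simp add: Pzero[OF Z00] dRop_G[OF abc(2) xy(1) Z00 Y0(1)])
    qed (simp add: Pother[OF Z0(1) abc(3)] dRop_simps(5)[OF xy(1) G_simps(1)])
    show ?thesis unfolding yang_baxter_def t1 s2 s3 D2 D3 Q4(1) Ev using RL(3) xy by (simp add: B_right)
  qed
qed

lemma yang_baxter_0: "x \<notin> \<Omega> \<Longrightarrow> y \<notin> \<Omega> \<Longrightarrow> y - x \<notin> \<Omega> \<Longrightarrow> Y = 0 \<or> Z = 0 \<Longrightarrow> yang_baxter x y X Y Z = 0"
  using period_lattice_minus[of "y - x" \<tau>]
  by (auto simp: yang_baxter_def clinear_simps[OF Rop_linear] lie_zero_left lie_zero_right B_right B_left P_simps
     dRop_simps(5)[OF _ G_simps(1)] dRop_simps(4)[OF _ P_in])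

lemma yang_baxter_add:
  assumes "x \<notin> \<Omega>" "y \<notin> \<Omega>" "y - x \<notin> \<Omega>"
  shows "yang_baxter x y (X + X') Y Z = yang_baxter x y X Y Z + yang_baxter x y X' Y Z"
    "yang_baxter x y X (Y + Y') Z = yang_baxter x y X Y Z + yang_baxter x y X Y' Z"
    "yang_baxter x y X Y (Z + Z') = yang_baxter x y X Y Z + yang_baxter x y X Y Z'"
  using period_lattice_minus[of "y - x" \<tau>]
  by (simp_all add: assms yang_baxter_def clinear_simps[OF Rop_linear] lie_add_left lie_add_right B_right B_left P_simps
      dRop_simps(1,2)[OF _ P_in] P_in)

lemma yang_baxter_sum:
  assumes "x \<notin> \<Omega>" "y \<notin> \<Omega>" "y - x \<notin> \<Omega>" "\<And>a b c. a < N \<Longrightarrow> b < N \<Longrightarrow> c < N \<Longrightarrow> yang_baxter x y (P a X) (P b Y) (P c Z) = 0"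
  shows "yang_baxter x y X Y Z = 0"
proof -
  note add = yang_baxter_add[OF assms(1-3)]
  have 0: "yang_baxter x y 0 Y Z = 0" "yang_baxter x y X 0 Z = 0" "yang_baxter x y X Y 0 = 0" for X Y Z
    using add(1)[of 0 0] add(2)[of _ 0 0] add(3)[of _ _ 0 0] by simp_all
  have "yang_baxter x y (\<Sum>a\<in>I. f a) Y Z = (\<Sum>a\<in>I. yang_baxter x y (f a) Y Z)"
    "yang_baxter x y X (\<Sum>a\<in>I. f a) Z = (\<Sum>a\<in>I. yang_baxter x y X (f a) Z)"
    "yang_baxter x y X Y (\<Sum>a\<in>I. f a) = (\<Sum>a\<in>I. yang_baxter x y X Y (f a))" for I :: "nat set" and f X Y Z
    by (induction I rule: infinite_finite_induct) (simp_all add: 0 add)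
  then have "yang_baxter x y (\<Sum>a<N. P a X) (\<Sum>a<N. P a Y) (\<Sum>a<N. P a Z) = 0" by (simp add: assms(4))
  then show ?thesis by (simp add: sum_P)
qed

text \<open>
  By trilinearity the vectors may be taken in eigenspaces of \<open>\<mu>\<close> and, for \<open>Y\<close> and \<open>Z\<close>, to be generalized eigenvectors of \<open>ad \<omega>\<close>.
  If the indices do not add up to \<open>0\<close>, every term vanishes by orthogonality.
\<close>

lemma yang_baxter_vanishes:
  assumes xy: "x \<notin> \<Omega>" "y \<notin> \<Omega>" "y - x \<notin> \<Omega>"
  shows "yang_baxter x y X Y Z = 0"
proof (rule yang_baxter_sum[OF xy])
  fix a b c assume abc: "a < N" "b < N" "c < N"
  have yx: "x - y \<notin> \<Omega>" using xy(3) period_lattice_minus[of "y - x" \<tau>] by simp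
  have "yang_baxter x y X Y Z = 0" if X: "X \<in> G a" and Y: "Y \<in> G b" and Z: "Z \<in> G c" for X Y Z
  proof (cases "(a + (b + c) mod N) mod N = 0")
    case True
    interpret Ib: invariant_subspace "G b" "lie \<omega>" by (rule inv_G[OF abc(2)])
    interpret Ic: invariant_subspace "G c" "lie \<omega>" by (rule inv_G[OF abc(3)])
    from Y show ?thesis
    proof (induction rule: Ib.gev_induct)
      case (gev v K1 Y)
      note Y = gev
      from Z show ?case
      proof (induction rule: Ic.gev_induct)
        case (gev w K2 Z)
        show ?case
        proof (cases "Y = 0 \<or> Z = 0")
          case True
          then show ?thesis by (rule yang_baxter_0[OF xy])
        next
          case False
          then show ?thesis using yang_baxter_gev[OF xy abc True X Y gev] by blast
        qed
      qed (simp add: yang_baxter_add[OF xy])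
    qed (simp add: yang_baxter_add[OF xy])
  next
    case False
    let ?d = "(b + c) mod N"
    have dN: "?d < N" using N_pos by simp
    have z: "B X u = 0" if "u \<in> G ?d" for u by (rule B_orthogonal[OF X that False])
    have 1: "lie (Rop \<omega> x Y) (Rop \<omega> y Z) \<in> G ?d" by (rule G_lie[OF Rop_in[OF abc(2) xy(1) Y] Rop_in[OF abc(3) xy(2) Z]])
    have 2: "Rop \<omega> x (lie (Rop \<omega> (y - x) Z) Y) \<in> G ?d"
      using Rop_in[OF dN xy(1), of "lie (Rop \<omega> (y - x) Z) Y"] G_lie[OF Rop_in[OF abc(3) xy(3) Z] Y] by (simp add: add.commute)
    have 3: "Rop \<omega> y (lie (Rop \<omega> (x - y) Y) Z) \<in> G ?d"
      by (rule Rop_in[OF dN xy(2) G_lie[OF Rop_in[OF abc(2) yx Y] Z]])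
    have Pcase: "P 0 u = 0 \<or> a' = 0 \<and> P 0 u = u" if "u \<in> G a'" "a' < N" for u a'
      using P_other[OF that N_pos] P_same[of u 0] that by (cases "a' = 0") auto
    have 4: "dRop y (P 0 Y) Z \<in> G ?d"
    proof (cases "b = 0")
      case True
      then show ?thesis using dRop_in[OF abc(3) xy(2) P_in Z] abc by simp
    qed (use P_other[OF Y abc(2) N_pos] in \<open>simp add: dRop_simps(5)[OF xy(2) G_simps(1)] G_simps\<close>)
    have 5: "dRop x (P 0 Z) Y \<in> G ?d"
    proof (cases "c = 0")
      case True
      then show ?thesis using dRop_in[OF abc(2) xy(1) P_in Y] abc by simp
    qed (use P_other[OF Z abc(3) N_pos] in \<open>simp add: dRop_simps(5)[OF xy(1) G_simps(1)] G_simps\<close>)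
    have 6: "B Y (dRop (y - x) (P 0 X) Z) = 0"
    proof (cases "a = 0")
      case True
      then show ?thesis using B_orthogonal[OF Y dRop_in[OF abc(3) xy(3) P_in Z]] False by simp
    qed (use P_other[OF X abc(1) N_pos] in \<open>simp add: dRop_simps(5)[OF xy(3) G_simps(1)] B_right\<close>)
    show ?thesis unfolding yang_baxter_def by (simp add: z 1 2 3 4 5 6)
  qed
  then show "yang_baxter x y (P a X) (P b Y) (P c Z) = 0" using P_in by blast
qed

end

section \<open>Residue, equivariance and partial derivatives\<close>

text \<open>
  A pole of order at most one with residue \<open>c\<close>, in a form closed under linear combinations.
\<close>

definition simple_pole :: "(complex \<Rightarrow> complex) \<Rightarrow> complex \<Rightarrow> bool" where
  "simple_pole h c \<longleftrightarrow> (\<exists>g e. e > 0 \<and> g holomorphic_on ball 0 e \<and> g 0 = c \<and> (\<forall>z\<in>ball 0 e. z \<noteq> 0 \<longrightarrow> h z = g z / z))"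

lemma simple_pole_0: "simple_pole (\<lambda>z. 0) 0"
  unfolding simple_pole_def by (intro exI[of _ "\<lambda>z. 0"] exI[of _ 1]) auto

lemma simple_pole_add: "simple_pole f c \<Longrightarrow> simple_pole g d \<Longrightarrow> simple_pole (\<lambda>z. f z + g z) (c + d)"
proof -
  assume "simple_pole f c" "simple_pole g d"
  then obtain p e q e' where p: "e > 0" "p holomorphic_on ball 0 e" "p 0 = c" "\<forall>z\<in>ball 0 e. z \<noteq> 0 \<longrightarrow> f z = p z / z"
    and q: "e' > 0" "q holomorphic_on ball 0 e'" "q 0 = d" "\<forall>z\<in>ball 0 e'. z \<noteq> 0 \<longrightarrow> g z = q z / z"
    unfolding simple_pole_def by blast
  show ?thesis unfolding simple_pole_def
    by (intro exI[of _ "\<lambda>z. p z + q z"] exI[of _ "min e e'"])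
      (use p q in \<open>auto simp: add_divide_distrib intro!: holomorphic_intros elim: holomorphic_on_subset\<close>)
qed

lemma simple_pole_cmult: "simple_pole f c \<Longrightarrow> simple_pole (\<lambda>z. k * f z) (k * c)"
proof -
  assume "simple_pole f c"
  then obtain p e where p: "e > 0" "p holomorphic_on ball 0 e" "p 0 = c" "\<forall>z\<in>ball 0 e. z \<noteq> 0 \<longrightarrow> f z = p z / z"
    unfolding simple_pole_def by blast
  show ?thesis unfolding simple_pole_def
    by (intro exI[of _ "\<lambda>z. k * p z"] exI[of _ e]) (use p in \<open>auto intro!: holomorphic_intros\<close>)
qed

lemma simple_pole_sum: "(\<And>i. i \<in> I \<Longrightarrow> simple_pole (f i) (c i)) \<Longrightarrow> simple_pole (\<lambda>z. \<Sum>i\<in>I. f i z) (\<Sum>i\<in>I. c i)"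
  by (induction I rule: infinite_finite_induct) (simp_all add: simple_pole_0 simple_pole_add)

lemma simple_pole_cong:
  assumes "simple_pole f c" "r > 0" "\<And>z. z \<in> ball 0 r \<Longrightarrow> z \<noteq> 0 \<Longrightarrow> g z = f z"
  shows "simple_pole g c"
proof -
  obtain p e where p: "e > 0" "p holomorphic_on ball 0 e" "p 0 = c" "\<forall>z\<in>ball 0 e. z \<noteq> 0 \<longrightarrow> f z = p z / z"
    using assms(1) unfolding simple_pole_def by blast
  show ?thesis unfolding simple_pole_def
    by (intro exI[of _ p] exI[of _ "min e r"]) (use p assms(2,3) in \<open>auto elim: holomorphic_on_subset\<close>)
qed

lemma simple_pole_residue:
  assumes "simple_pole h c"
  shows "isolated_singularity_at h 0" "residue h 0 = c"
proof -
  obtain p e where p: "e > 0" "p holomorphic_on ball 0 e" "p 0 = c" "\<forall>z\<in>ball 0 e. z \<noteq> 0 \<longrightarrow> h z = p z / z"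
    using assms unfolding simple_pole_def by blast
  have "(\<lambda>z. p z / z) holomorphic_on ball 0 e - {0}"
    by (intro holomorphic_intros holomorphic_on_subset[OF p(2)]) auto
  then have "h holomorphic_on ball 0 e - {0}"
    by (rule holomorphic_transform) (use p(4) in auto)
  then show "isolated_singularity_at h 0"
    unfolding isolated_singularity_at_def using p(1) by (auto simp: analytic_on_open open_Diff)
  have "eventually (\<lambda>z. h z = p z / (z - 0)) (at 0)"
    unfolding eventually_at using p(1,4) by (intro exI[of _ e]) (auto simp: dist_norm)
  then have "residue h 0 = residue (\<lambda>z. p z / (z - 0)) 0" by (rule residue_cong) simp
  also have "\<dots> = c" using residue_simple[of "ball 0 e" 0 p] p by simp
  finally show "residue h 0 = c" .
qed

context twisted_lie_algebra
begin

text \<open>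
  The tensor with the operator \<open>L\<close> as its matrix; for linear \<open>L\<close> it is \<open>\<Sum> L (T \<beta>) \<otimes> T' \<beta>\<close>.
\<close>

definition tensor_of :: "('g \<Rightarrow> 'g) \<Rightarrow> 'g tensor2" where
  "tensor_of L = (\<Sum>\<alpha><n. \<Sum>\<beta><n. B (T \<alpha>) (L (T \<beta>)) *\<^sub>C (T' \<alpha> \<otimes>\<^sub>t T' \<beta>))"

lemma functional_tensor_of:
  "cfunctional \<phi> \<Longrightarrow> \<phi> (tensor_of L) = (\<Sum>\<alpha><n. \<Sum>\<beta><n. \<phi> (T' \<alpha> \<otimes>\<^sub>t T' \<beta>) * B (T \<alpha>) (L (T \<beta>)))"
  by (simp add: tensor_of_def cfunctional_simps mult.commute)

text \<open>
  The exponential series is majorized by a scalar one; in every coordinate the curve is an entire power series, whose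
  linear coefficient is the derivative at \<open>0\<close>.
\<close>

lemma endo_exp_lie:
  fixes X v :: 'g
  defines "\<gamma> \<equiv> \<lambda>x. endo_exp (\<lambda>u. x *\<^sub>C lie X u) v"
  shows "X \<in> G 0 \<Longrightarrow> v \<in> G 0 \<Longrightarrow> \<gamma> x \<in> G 0" "\<gamma> 0 = v" "has_vec_deriv \<gamma> (lie X v) 0"
proof -
  define A where "A k = (lie X ^^ k) v" for k
  have pow: "((\<lambda>u. x *\<^sub>C lie X u) ^^ k) v = x ^ k *\<^sub>C A k" for x k
    by (induction k) (simp_all add: A_def lie_scale_right scaleC_scaleC scaleC_one mult.commute)
  obtain K where K: "K \<ge> 0" "\<And>x y. nrm (lie x y) \<le> K * nrm x * nrm y" using lie_bound by blast
  have nA: "nrm (A k) \<le> (K * nrm X) ^ k * nrm v" for k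
  proof (induction k)
    case (Suc k)
    have "nrm (A (Suc k)) \<le> (K * nrm X) * nrm (A k)" using K(2)[of X "A k"] by (simp add: A_def)
    also have "\<dots> \<le> (K * nrm X) * ((K * nrm X) ^ k * nrm v)"
      by (intro mult_left_mono Suc mult_nonneg_nonneg K(1) nrm_nonneg)
    finally show ?case by (simp add: mult_ac)
  qed (simp add: A_def)
  define c where "c \<phi> k = \<phi> (A k) / fact k" for \<phi> :: "'g \<Rightarrow> complex" and k
  have conv: "summable (\<lambda>k. c \<phi> k * x ^ k)" if \<phi>: "cfunctional \<phi>" for \<phi> x
  proof -
    obtain C where C: "C \<ge> 0" "\<And>x. cmod (\<phi> x) \<le> C * nrm x" using functional_bound[OF \<phi>] by blast
    have "summable (\<lambda>k. (C * nrm v) * (inverse (fact k) * (K * nrm X * cmod x) ^ k))"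
      by (intro summable_mult summable_exp)
    then show ?thesis
    proof (rule summable_comparison_test[rotated], intro exI[of _ 0] allI impI)
      fix k
      have "norm (c \<phi> k * x ^ k) = cmod (\<phi> (A k)) * (cmod x ^ k / fact k)"
        by (simp add: c_def norm_mult norm_divide norm_power)
      also have "\<dots> \<le> (C * ((K * nrm X) ^ k * nrm v)) * (cmod x ^ k / fact k)"
        by (intro mult_right_mono order.trans[OF C(2)] mult_left_mono nA C(1)) auto
      also have "\<dots> = (C * nrm v) * (inverse (fact k) * (K * nrm X * cmod x) ^ k)"
        by (simp add: power_mult_distrib divide_inverse mult_ac)
      finally show "norm (c \<phi> k * x ^ k) \<le> (C * nrm v) * (inverse (fact k) * (K * nrm X * cmod x) ^ k)" .
    qed
  qed
  have summand: "\<phi> (inverse (fact k) *\<^sub>C ((\<lambda>u. x *\<^sub>C lie X u) ^^ k) v) = c \<phi> k * x ^ k" if "cfunctional \<phi>" for \<phi> k x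
    by (simp add: pow c_def cfunctional_simps[OF that] divide_inverse mult_ac)
  have val: "\<phi> (\<gamma> x) = (suminf (\<lambda>k. c \<phi> k * x ^ k))" if \<phi>: "cfunctional \<phi>" for \<phi> x
  proof -
    define s where "s = (\<Sum>i<n. (suminf (\<lambda>k. c (\<lambda>y. B y (T' i)) k * x ^ k)) *\<^sub>C T i)"
    have s: "(\<lambda>k. c \<phi> k * x ^ k) sums \<phi> s" if \<phi>: "cfunctional \<phi>" for \<phi>
    proof -
      have "(\<lambda>k. \<Sum>i<n. c (\<lambda>y. B y (T' i)) k * x ^ k * \<phi> (T i)) sums (\<Sum>i<n. (suminf (\<lambda>k. c (\<lambda>y. B y (T' i)) k * x ^ k)) * \<phi> (T i))"
        by (intro sums_sum sums_mult2 summable_sums conv B_functional)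
      moreover have "c \<phi> k * x ^ k = (\<Sum>i<n. c (\<lambda>y. B y (T' i)) k * x ^ k * \<phi> (T i))" for k
        unfolding c_def functional_expand[OF \<phi>, of "A k"]
        by (simp add: sum_divide_distrib sum_distrib_left sum_distrib_right mult_ac)
      ultimately show ?thesis by (simp add: s_def cfunctional_simps[OF \<phi>])
    qed
    have "\<gamma> x = s"
      unfolding \<gamma>_def endo_exp_def vec_suminf_def
    proof (rule the_equality)
      show "\<forall>\<phi>. cfunctional \<phi> \<longrightarrow> (\<lambda>k. \<phi> (inverse (fact k) *\<^sub>C ((\<lambda>u. x *\<^sub>C lie X u) ^^ k) v)) sums \<phi> s"
        by (auto simp: summand s)
      fix s' assume s': "\<forall>\<phi>. cfunctional \<phi> \<longrightarrow> (\<lambda>k. \<phi> (inverse (fact k) *\<^sub>C ((\<lambda>u. x *\<^sub>C lie X u) ^^ k) v)) sums \<phi> s'"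
      show "s' = s"
      proof (rule functional_separates)
        fix \<phi> :: "'g \<Rightarrow> complex" assume \<phi>: "cfunctional \<phi>"
        then have "(\<lambda>k. c \<phi> k * x ^ k) sums \<phi> s'" using s' by (simp add: summand)
        then show "\<phi> s' = \<phi> s" using s[OF \<phi>] by (rule sums_unique2)
      qed
    qed
    then show ?thesis using sums_unique[OF s[OF \<phi>]] by simp
  qed
  show "\<gamma> x \<in> G 0" if X: "X \<in> G 0" and v: "v \<in> G 0"
  proof -
    have A: "A k \<in> G 0" for k by (induction k) (simp_all add: A_def v G_lie_0[OF X N_pos])
    have "P 0 (\<gamma> x) = \<gamma> x"
    proof (rule functional_separates)
      fix \<phi> :: "'g \<Rightarrow> complex" assume \<phi>: "cfunctional \<phi>"
      have "\<phi> (P 0 (\<gamma> x)) = (suminf (\<lambda>k. c (\<lambda>u. \<phi> (P 0 u)) k * x ^ k))" by (rule val[OF cfunctional_compose[OF \<phi> P_linear]])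
      also have "\<dots> = \<phi> (\<gamma> x)" by (simp add: val[OF \<phi>] c_def P_same[OF A])
      finally show "\<phi> (P 0 (\<gamma> x)) = \<phi> (\<gamma> x)" .
    qed
    then show ?thesis using P_in by metis
  qed
  show "\<gamma> 0 = v"
  proof (rule functional_separates)
    fix \<phi> :: "'g \<Rightarrow> complex" assume \<phi>: "cfunctional \<phi>"
    show "\<phi> (\<gamma> 0) = \<phi> v" by (simp add: val[OF \<phi>] powser_zero) (simp add: c_def A_def)
  qed
  show "has_vec_deriv \<gamma> (lie X v) 0"
    unfolding has_vec_deriv_def
  proof (intro allI impI)
    fix \<phi> :: "'g \<Rightarrow> complex" assume \<phi>: "cfunctional \<phi>"
    have "((\<lambda>x. suminf (\<lambda>k. c \<phi> k * x ^ k)) has_field_derivative (suminf (\<lambda>k. diffs (c \<phi>) k * 0 ^ k))) (at 0)"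
      by (rule termdiffs_strong_converges_everywhere[OF conv[OF \<phi>]])
    also have "(suminf (\<lambda>k. diffs (c \<phi>) k * 0 ^ k)) = \<phi> (lie X v)"
      by (simp add: powser_zero diffs_def) (simp add: c_def A_def)
    finally show "((\<lambda>x. \<phi> (\<gamma> x)) has_field_derivative \<phi> (lie X v)) (at 0)" unfolding val[OF \<phi>] .
  qed
qed

subsection \<open>Coordinates on the fixed point algebra\<close>

lemma fixed_eq_0:
  assumes T0: "is_basis (G 0) m T0" and y: "y \<in> G 0" "\<And>i. i < m \<Longrightarrow> B y (T0 i) = 0"
  shows "y = 0"
proof (rule B_nondeg)
  fix x
  have "P 0 x \<in> complex_vector.span (T0 ` {..<m})" using T0 P_in by (simp add: is_basis_def)
  then have "B y (P 0 x) = 0"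
  proof (induction rule: complex_vector.span_induct_alt)
    case (step c u w)
    then show ?case using y(2) by (auto simp: B_right)
  qed (simp add: B_right)
  then show "B y x = 0" using B_P[of y x] P_same[OF y(1)] by simp
qed

text \<open>
  The coordinate functionals of the basis \<open>T0\<close> are represented by vectors because \<open>B\<close> is nondegenerate, and their projections to the
  fixed point algebra represent the same functionals there. Varying the \<open>j\<close>-th coordinate alone means moving in the direction
  \<open>S j\<close>.
\<close>

lemma dual_coordinates:
  assumes T0: "is_basis (G 0) m T0"
  shows "\<exists>S. (\<forall>j<m. S j \<in> G 0) \<and> (\<forall>i<m. \<forall>j<m. B (S j) (T0 i) = (if i = j then 1 else 0))"
proof -
  interpret F: vector_space_pair "scaleC :: complex \<Rightarrow> 'g \<Rightarrow> 'g" "(*) :: complex \<Rightarrow> complex \<Rightarrow> complex"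
    using vector_space_scaleC vector_space_times by (rule vector_space_pair.intro)
  have ind: "\<not> complex_vector.dependent (T0 ` {..<m})" and inj: "inj_on T0 {..<m}" using T0 by (simp_all add: is_basis_def)
  have "\<exists>s. s \<in> G 0 \<and> (\<forall>i<m. B s (T0 i) = (if i = j then 1 else 0))" if j: "j < m" for j
  proof -
    obtain f where f: "cfunctional f" "\<forall>x\<in>T0 ` {..<m}. f x = (if x = T0 j then 1 else 0)"
      using F.linear_independent_extend[OF ind, of "\<lambda>x. if x = T0 j then 1 else 0"] by blast
    define s where "s = (\<Sum>i<n. f (T i) *\<^sub>C T' i)"
    have s: "B s x = f x" for x
      unfolding functional_expand[OF f(1), of x] s_def by (simp add: B_left B_sym[of x] mult.commute)
    have "B (P 0 s) (T0 i) = (if i = j then 1 else 0)" if i: "i < m" for i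
    proof -
      have "T0 i \<in> G 0" using T0 i complex_vector.span_base[of "T0 i" "T0 ` {..<m}"] by (simp add: is_basis_def)
      then have "B (P 0 s) (T0 i) = f (T0 i)" by (simp add: B_P P_same s)
      then show ?thesis using f(2) i j inj by (auto simp: inj_on_def)
    qed
    then show ?thesis using P_in by blast
  qed
  then have "\<forall>j. \<exists>s. j < m \<longrightarrow> s \<in> G 0 \<and> (\<forall>i<m. B s (T0 i) = (if i = j then 1 else 0))" by blast
  from choice[OF this] show ?thesis by blast
qed

context
  fixes m :: nat and T0 S :: "nat \<Rightarrow> 'g"
  assumes T0: "is_basis (G 0) m T0" and S: "\<And>j. j < m \<Longrightarrow> S j \<in> G 0"
    and dual_S: "\<And>i j. i < m \<Longrightarrow> j < m \<Longrightarrow> B (S j) (T0 i) = (if i = j then 1 else 0)"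
begin

lemma B_sum_S: "i < m \<Longrightarrow> B (\<Sum>j<m. k j *\<^sub>C S j) (T0 i) = k i"
proof -
  assume i: "i < m"
  have "B (\<Sum>j<m. k j *\<^sub>C S j) (T0 i) = (\<Sum>j<m. if j = i then k i else 0)"
    unfolding B_left by (rule sum.cong) (use i in \<open>auto simp: dual_S\<close>)
  then show ?thesis using i by simp
qed

lemma sum_S_in: "(\<Sum>j<m. k j *\<^sub>C S j) \<in> G 0" by (intro G_simps S) simp

lemma coord_point_eq: "coord_point B (G 0) m T0 k = (\<Sum>j<m. k j *\<^sub>C S j)"
  unfolding coord_point_def
proof (rule the_equality)
  show "(\<Sum>j<m. k j *\<^sub>C S j) \<in> G 0 \<and> (\<forall>i<m. B (\<Sum>j<m. k j *\<^sub>C S j) (T0 i) = k i)"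
    by (simp add: sum_S_in B_sum_S)
  fix x assume x: "x \<in> G 0 \<and> (\<forall>i<m. B x (T0 i) = k i)"
  have "x - (\<Sum>j<m. k j *\<^sub>C S j) = 0"
  proof (rule fixed_eq_0[OF T0])
    show "x - (\<Sum>j<m. k j *\<^sub>C S j) \<in> G 0" using x by (intro G_simps(4) sum_S_in) simp
    show "B (x - (\<Sum>j<m. k j *\<^sub>C S j)) (T0 i) = 0" if "i < m" for i
      using x that by (simp add: B_left(5) B_sum_S)
  qed
  then show "x = (\<Sum>j<m. k j *\<^sub>C S j)" by simp
qed

text \<open>
  Dual bases of the fixed point algebra: this turns the sum over \<open>j\<close> in the Yang-Baxter equation into a derivative in the
  direction \<open>P 0 x\<close>.
\<close>

lemma P_expand: "P 0 x = (\<Sum>j<m. B x (T0 j) *\<^sub>C S j)"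
proof -
  have T0_in: "T0 j \<in> G 0" if "j < m" for j
    using T0 that complex_vector.span_base[of "T0 j" "T0 ` {..<m}"] by (simp add: is_basis_def)
  have "P 0 x - (\<Sum>j<m. B x (T0 j) *\<^sub>C S j) = 0"
  proof (rule fixed_eq_0[OF T0])
    show "P 0 x - (\<Sum>j<m. B x (T0 j) *\<^sub>C S j) \<in> G 0" by (intro G_simps(4) P_in sum_S_in)
    show "B (P 0 x - (\<Sum>j<m. B x (T0 j) *\<^sub>C S j)) (T0 i) = 0" if "i < m" for i
      using that by (simp add: B_left(5) B_sum_S B_P P_same T0_in)
  qed
  then show ?thesis by simp
qed

lemma coord_curve:
  assumes \<omega>: "\<omega> \<in> G 0" and j: "j < m"
  defines "\<gamma> \<equiv> \<lambda>t. coord_point B (G 0) m T0 ((\<lambda>i. B \<omega> (T0 i))(j := t))"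
  shows "\<gamma> t \<in> G 0" "\<gamma> (B \<omega> (T0 j)) = \<omega>" "has_vec_deriv \<gamma> (S j) (B \<omega> (T0 j))"
proof -
  have \<gamma>: "\<gamma> t = \<omega> + (t - B \<omega> (T0 j)) *\<^sub>C S j" for t
  proof -
    have "\<gamma> t = (\<Sum>i<m. B \<omega> (T0 i) *\<^sub>C S i + (if i = j then (t - B \<omega> (T0 j)) *\<^sub>C S j else 0))"
      unfolding \<gamma>_def coord_point_eq by (rule sum.cong) (auto simp: complex_vector.scale_left_diff_distrib)
    also have "\<dots> = P 0 \<omega> + (t - B \<omega> (T0 j)) *\<^sub>C S j" using j by (simp add: sum.distrib P_expand)
    finally show ?thesis by (simp add: P_same[OF \<omega>])
  qed
  show "\<gamma> t \<in> G 0" unfolding \<gamma>_def coord_point_eq by (rule sum_S_in)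
  show "\<gamma> (B \<omega> (T0 j)) = \<omega>" by (simp add: \<gamma>)
  show "has_vec_deriv \<gamma> (S j) (B \<omega> (T0 j))"
    unfolding has_vec_deriv_def
  proof (intro allI impI)
    fix \<phi> :: "'g \<Rightarrow> complex" assume "cfunctional \<phi>"
    then show "((\<lambda>t. \<phi> (\<gamma> t)) has_field_derivative \<phi> (S j)) (at (B \<omega> (T0 j)))"
      by (auto simp: \<gamma> cfunctional_simps intro!: derivative_eq_intros)
  qed
qed

end

end

context dynamical_point
begin

lemma r_mat_eq: "z \<notin> \<Omega> \<Longrightarrow> r_mat B \<mu> N n T T' \<tau> \<omega> z = tensor_of (Rop \<omega> z)"
  by (simp add: r_mat_def tensor_of_def R_op_Rr)

lemma r_mat_skew:
  assumes z: "z \<notin> \<Omega>"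
  shows "r_mat_transposed B \<mu> N n T T' \<tau> \<omega> z + r_mat B \<mu> N n T T' \<tau> \<omega> (- z) = 0"
proof -
  have z': "- z \<notin> \<Omega>" using z by (simp add: period_lattice_minus)
  have "r_mat_transposed B \<mu> N n T T' \<tau> \<omega> z = (\<Sum>\<alpha><n. \<Sum>\<beta><n. - (B (T \<beta>) (Rop \<omega> (- z) (T \<alpha>)) *\<^sub>C (T' \<beta> \<otimes>\<^sub>t T' \<alpha>)))"
    unfolding r_mat_transposed_def R_op_Rr[OF z]
  proof (intro sum.cong refl)
    fix \<alpha> \<beta>
    have "B (T \<alpha>) (Rop \<omega> z (T \<beta>)) = B (Rop \<omega> z (T \<beta>)) (T \<alpha>)" by (rule B_sym)
    also have "\<dots> = - B (T \<beta>) (Rop \<omega> (- z) (T \<alpha>))" by (rule Rop_skew[OF z])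
    finally show "B (T \<alpha>) (Rop \<omega> z (T \<beta>)) *\<^sub>C (T' \<beta> \<otimes>\<^sub>t T' \<alpha>) = - (B (T \<beta>) (Rop \<omega> (- z) (T \<alpha>)) *\<^sub>C (T' \<beta> \<otimes>\<^sub>t T' \<alpha>))"
      by (simp add: complex_vector.scale_minus_left)
  qed
  also have "\<dots> = - r_mat B \<mu> N n T T' \<tau> \<omega> (- z)"
    unfolding r_mat_eq[OF z'] tensor_of_def sum_negf by (subst sum.swap) (rule refl)
  finally show ?thesis by simp
qed

lemma r_mat_deriv:
  assumes z: "z \<notin> \<Omega>" and \<gamma>: "\<And>t. \<gamma> t \<in> G 0" "\<gamma> t0 = \<omega>" "has_vec_deriv \<gamma> Q t0" and Q: "Q \<in> G 0"
  shows "has_vec_deriv (\<lambda>t. r_mat B \<mu> N n T T' \<tau> (\<gamma> t) z) (tensor_of (dRop z Q)) t0"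
  unfolding has_vec_deriv_def
proof (intro allI impI)
  fix \<phi> :: "'g tensor2 \<Rightarrow> complex" assume \<phi>: "cfunctional \<phi>"
  have 1: "((\<lambda>t. \<phi> (tensor_of (Rop (\<gamma> t) z))) has_field_derivative \<phi> (tensor_of (dRop z Q))) (at t0)"
    unfolding functional_tensor_of[OF \<phi>]
    by (intro DERIV_sum DERIV_cmult Rop_deriv[OF z \<gamma> Q] B_functional)
  have 2: "eventually (\<lambda>t. \<phi> (r_mat B \<mu> N n T T' \<tau> (\<gamma> t) z) = \<phi> (tensor_of (Rop (\<gamma> t) z))) (nhds t0)"
    using eventually_dyn_domain[OF \<gamma> z]
  proof eventually_elim
    case (elim t)
    then interpret t: dynamical_point B \<mu> N n \<tau> T T' "\<gamma> t" by unfold_locales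
    show ?case by (simp add: t.r_mat_eq[OF z])
  qed
  show "((\<lambda>t. \<phi> (r_mat B \<mu> N n T T' \<tau> (\<gamma> t) z)) has_field_derivative \<phi> (tensor_of (dRop z Q))) (at t0)"
    by (rule DERIV_cong_ev[OF refl 2 refl, THEN iffD2]) (rule 1)
qed

text \<open>
  Of the Taylor coefficients of \<open>chi_a\<close> in \<open>w\<close> only the constant one has a pole at \<open>z = 0\<close>, with the same residue for all \<open>a\<close> and at all
  eigenvalues.
\<close>

lemma Rop_residue:
  assumes \<phi>: "cfunctional \<phi>"
  shows "simple_pole (\<lambda>z. \<phi> (Rop \<omega> z x)) (1 / (2 * pi * \<i>) * \<phi> x)"
proof -
  obtain r where "r > 0" "\<And>z. z \<in> ball 0 r \<Longrightarrow> z \<noteq> 0 \<Longrightarrow> theta1 \<tau> z \<noteq> 0" by (rule theta1_isolated_zero[OF \<tau>]) (rule that)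
  then have r: "r > 0" "\<And>z. z \<in> ball 0 r \<Longrightarrow> z \<noteq> 0 \<Longrightarrow> z \<notin> \<Omega>" by (auto simp: theta1_eq_0_iff[OF \<tau>])
  let ?c = "1 / (2 * pi * \<i>) :: complex"
  have add: "simple_pole (\<lambda>z. \<phi> (Rop \<omega> z (\<Sum>i\<in>I. f i))) (?c * \<phi> (\<Sum>i\<in>I. f i))"
    if "\<And>i. i \<in> I \<Longrightarrow> simple_pole (\<lambda>z. \<phi> (Rop \<omega> z (f i))) (?c * \<phi> (f i))" for f and I :: "nat set"
  proof (rule simple_pole_cong[OF _ r(1)])
    show "simple_pole (\<lambda>z. \<Sum>i\<in>I. \<phi> (Rop \<omega> z (f i))) (?c * \<phi> (\<Sum>i\<in>I. f i))"
      unfolding cfunctional_simps[OF \<phi>] sum_distrib_left by (rule simple_pole_sum[OF that])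
    show "\<phi> (Rop \<omega> z (\<Sum>i\<in>I. f i)) = (\<Sum>i\<in>I. \<phi> (Rop \<omega> z (f i)))" if "z \<in> ball 0 r" "z \<noteq> 0" for z
      by (simp add: clinear_simps[OF Rop_linear[OF r(2)[OF that]]] cfunctional_simps[OF \<phi>])
  qed
  have hom: "simple_pole (\<lambda>z. \<phi> (Rop \<omega> z x)) (?c * \<phi> x)" if a: "a < N" and x: "x \<in> G a" for a x
  proof -
    interpret I: invariant_subspace "G a" "lie \<omega>" by (rule inv_G[OF a])
    from x show ?thesis
    proof (induction rule: I.gev_induct)
      case (gev l K x)
      show ?case
      proof (cases "x = 0")
        case True
        show ?thesis unfolding True
          by (rule simple_pole_cong[OF _ r(1), of "\<lambda>z. 0"])
            (simp_all add: cfunctional_simps[OF \<phi>] simple_pole_0 clinear_simps[OF Rop_linear] r(2))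
      next
        case False
        then have "l \<in> spec a" using I.gev_eig[OF gev(1) _ gev(2)] by (simp add: I.spectrum_eig)
        then have l: "l \<notin> sing_a N \<tau> a" using spec_dom[OF a] by auto
        have "K > 0" using gev(2) False by (cases K) auto
        show ?thesis
        proof (rule simple_pole_cong[OF _ r(1)])
          let ?f = "\<lambda>z. \<Sum>k<K. (\<phi> ((nil (lie \<omega>) l ^^ k) x) / fact k) * (deriv ^^ k) (\<lambda>w. chi_a N \<tau> a w z) l"
          have "simple_pole ?f (\<Sum>k<K. (\<phi> ((nil (lie \<omega>) l ^^ k) x) / fact k) * (if k = 0 then ?c else 0))"
          proof (intro simple_pole_sum simple_pole_cmult)
            fix k
            show "simple_pole (\<lambda>z. (deriv ^^ k) (\<lambda>w. chi_a N \<tau> a w z) l) (if k = 0 then ?c else 0)"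
              using chi_a_deriv_residue[OF \<tau> a l, of k] unfolding simple_pole_def by blast
          qed
          also have "(\<Sum>k<K. (\<phi> ((nil (lie \<omega>) l ^^ k) x) / fact k) * (if k = 0 then ?c else 0))
              = (\<Sum>k<K. if k = 0 then ?c * \<phi> x else 0)"
            by (rule sum.cong) auto
          also have "\<dots> = ?c * \<phi> x" using \<open>K > 0\<close> by simp
          finally show "simple_pole ?f (?c * \<phi> x)" .
          show "\<phi> (Rop \<omega> z x) = ?f z" if "z \<in> ball 0 r" "z \<noteq> 0" for z
            by (simp add: Rop_gev[OF a r(2)[OF that] gev] fps_expansion_def cfunctional_simps[OF \<phi>] mult.commute)
        qed
      qed
    next
      case (plus x y)
      show ?case
        by (rule simple_pole_cong[OF _ r(1), of "\<lambda>z. \<phi> (Rop \<omega> z x) + \<phi> (Rop \<omega> z y)"])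
          (use simple_pole_add[OF plus(3,4)] in
            \<open>simp_all add: cfunctional_simps[OF \<phi>] clinear_simps[OF Rop_linear] r(2) distrib_left\<close>)
    qed
  qed
  have "simple_pole (\<lambda>z. \<phi> (Rop \<omega> z (\<Sum>a<N. P a x))) (?c * \<phi> (\<Sum>a<N. P a x))"
    by (rule add, rule hom[OF _ P_in]) simp
  then show ?thesis by (simp add: sum_P)
qed

end

section \<open>Tensors in the enveloping algebra\<close>

lemma free_lin_fscale: "free_lin f (fscale c p) = c *\<^sub>C free_lin f p"
proof -
  have "Poly_Mapping.keys (fscale c p) \<subseteq> Poly_Mapping.keys p" by (auto simp: in_keys_iff)
  then have "free_lin f (fscale c p) = (\<Sum>k\<in>Poly_Mapping.keys p. Poly_Mapping.lookup (fscale c p) k *\<^sub>C f k)"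
    by (intro free_lin_superset) simp_all
  then show ?thesis by (simp add: free_lin_def complex_vector.scale_sum_right scaleC_scaleC)
qed

lemma place_linear: "clinear (place k l)"
proof -
  have 1: "place k l (x + y) = place k l x + place k l y" for x y by transfer (simp add: free_lin_add)
  have 2: "place k l (c *\<^sub>C x) = c *\<^sub>C place k l x" for c x by transfer (simp add: free_lin_fscale)
  show ?thesis by (simp add: clinear_iff 1 2)
qed

lemma leg_linear: "clinear (leg k)" by (simp add: clinear_iff leg_add leg_scale)

lemmas leg_simps = clinear_simps[OF leg_linear]

text \<open>
  In the commutators of the Yang-Baxter equation only the factors in the common tensor factor fail to commute.
  The next three lemmas collect them for the three pairs of positions.
\<close>

lemma ring_commutator_12_13:
  fixes a b c :: "'r::ring"
  assumes "b * a' = a' * b" "c * a = a * c" "c * b = b * c"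
  shows "a * b * (a' * c) - a' * c * (a * b) = (a * a' - a' * a) * b * c"
proof -
  have "a * b * (a' * c) = a * (b * a') * c" by (simp only: mult.assoc)
  also have "\<dots> = a * a' * b * c" by (simp only: assms mult.assoc)
  finally have 1: "a * b * (a' * c) = a * a' * b * c" .
  have "a' * c * (a * b) = a' * (c * a) * b" by (simp only: mult.assoc)
  also have "\<dots> = a' * a * (c * b)" by (simp only: assms(2) mult.assoc)
  also have "\<dots> = a' * a * b * c" by (simp only: assms(3) mult.assoc)
  finally show ?thesis unfolding 1 by (simp add: left_diff_distrib)
qed

lemma ring_commutator_12_23:
  fixes a b c :: "'r::ring"
  assumes "b' * a = a * b'" "c * a = a * c" "c * b = b * c"
  shows "a * b * (b' * c) - b' * c * (a * b) = a * (b * b' - b' * b) * c"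
proof -
  have 1: "a * b * (b' * c) = a * (b * b') * c" by (simp only: mult.assoc)
  have "b' * c * (a * b) = b' * (c * a) * b" by (simp only: mult.assoc)
  also have "\<dots> = (b' * a) * (c * b)" by (simp only: assms(2) mult.assoc)
  also have "\<dots> = a * (b' * b) * c" by (simp only: assms(1,3) mult.assoc)
  finally show ?thesis unfolding 1 by (simp add: left_diff_distrib right_diff_distrib)
qed

lemma ring_commutator_13_23:
  fixes a b c :: "'r::ring"
  assumes "b * a = a * b" "c * b = b * c" "c' * a = a * c'"
  shows "a * c * (b * c') - b * c' * (a * c) = a * b * (c * c' - c' * c)"
proof -
  have "a * c * (b * c') = a * (c * b) * c'" by (simp only: mult.assoc)
  also have "\<dots> = a * b * (c * c')" by (simp only: assms(2) mult.assoc)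
  finally have 1: "a * c * (b * c') = a * b * (c * c')" .
  have "b * c' * (a * c) = b * (c' * a) * c" by (simp only: mult.assoc)
  also have "\<dots> = (b * a) * (c' * c)" by (simp only: assms(3) mult.assoc)
  also have "\<dots> = a * b * (c' * c)" by (simp only: assms(1) mult.assoc)
  finally show ?thesis unfolding 1 by (simp only: right_diff_distrib)
qed

lemma commutator_sum:
  "commutator (\<Sum>i\<in>I. f i) (\<Sum>j\<in>J. g j) = (\<Sum>i\<in>I. \<Sum>j\<in>J. commutator (f i) (g j))"
  by (simp add: commutator_def sum_product sum_subtractf sum.swap[of _ J I])

context twisted_lie_algebra
begin

lemma place_tensor_of: "place k l (tensor_of L) = (\<Sum>\<alpha><n. \<Sum>\<beta><n. B (T \<alpha>) (L (T \<beta>)) *\<^sub>C (leg k (T' \<alpha>) * leg l (T' \<beta>)))"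
  by (simp add: tensor_of_def clinear_simps[OF place_linear] place_tens)

text \<open>
  The first argument of \<open>B\<close> is the basis vector with which an expression is paired.
\<close>

lemma leg_expand: "leg k x = (\<Sum>\<alpha><n. B (T \<alpha>) x *\<^sub>C leg k (T' \<alpha>))"
  by (subst expand_T'[of x]) (simp add: leg_simps B_sym[of x])

lemma place_tensor_of_left: "place k l (tensor_of L) = (\<Sum>\<beta><n. leg k (L (T \<beta>)) * leg l (T' \<beta>))"
  unfolding place_tensor_of
  by (subst sum.swap) (subst leg_expand[of k "L _"], simp add: sum_distrib_right scaleC_mult_left)

text \<open>
  The element of the triple tensor product with given components with respect to the dual basis. Only the values of \<open>f\<close> on basis vectors matter, so an
  equation in the enveloping algebra follows from an equation between trilinear forms.
\<close>

definition tensor3 :: "('g \<Rightarrow> 'g \<Rightarrow> 'g \<Rightarrow> complex) \<Rightarrow> ('g, 3) uea_power" where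
  "tensor3 f = (\<Sum>\<alpha><n. \<Sum>\<beta><n. \<Sum>\<gamma><n. f (T \<alpha>) (T \<beta>) (T \<gamma>) *\<^sub>C (leg 1 (T' \<alpha>) * leg 2 (T' \<beta>) * leg 3 (T' \<gamma>)))"

lemma tensor3_cong: "(\<And>\<alpha> \<beta> \<gamma>. \<alpha> < n \<Longrightarrow> \<beta> < n \<Longrightarrow> \<gamma> < n \<Longrightarrow> f (T \<alpha>) (T \<beta>) (T \<gamma>) = g (T \<alpha>) (T \<beta>) (T \<gamma>)) \<Longrightarrow> tensor3 f = tensor3 g"
  unfolding tensor3_def by (intro sum.cong refl) simp

lemma tensor3_add: "tensor3 f + tensor3 g = tensor3 (\<lambda>X Y Z. f X Y Z + g X Y Z)"
  by (simp add: tensor3_def scaleC_add_left sum.distrib)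

lemma tensor3_diff: "tensor3 f - tensor3 g = tensor3 (\<lambda>X Y Z. f X Y Z - g X Y Z)"
  by (simp add: tensor3_def complex_vector.scale_left_diff_distrib sum_subtractf)

lemma tensor3_0: "tensor3 (\<lambda>X Y Z. 0) = 0" by (simp add: tensor3_def)

lemma tensor3_sum: "(\<Sum>i\<in>I. tensor3 (f i)) = tensor3 (\<lambda>X Y Z. \<Sum>i\<in>I. f i X Y Z)"
  by (induction I rule: infinite_finite_induct) (simp_all add: tensor3_0 tensor3_add)

lemma tensor3_pure: "leg 1 x * leg 2 y * leg 3 z = tensor3 (\<lambda>X Y Z. B X x * B Y y * B Z z)"
proof -
  have "leg 1 x * leg 2 y * leg 3 z = (\<Sum>\<alpha><n. B (T \<alpha>) x *\<^sub>C leg 1 (T' \<alpha>)) * (\<Sum>\<beta><n. B (T \<beta>) y *\<^sub>C leg 2 (T' \<beta>))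
      * (\<Sum>\<gamma><n. B (T \<gamma>) z *\<^sub>C leg (3::3) (T' \<gamma>))"
    by (simp only: leg_expand[symmetric])
  also have "\<dots> = (\<Sum>\<alpha><n. \<Sum>\<beta><n. \<Sum>\<gamma><n. B (T \<alpha>) x *\<^sub>C leg 1 (T' \<alpha>) * (B (T \<beta>) y *\<^sub>C leg 2 (T' \<beta>)) * (B (T \<gamma>) z *\<^sub>C leg 3 (T' \<gamma>)))"
    by (simp only: sum_distrib_left sum_distrib_right) (subst (2) sum.swap, subst (1) sum.swap, subst (2) sum.swap, rule refl)
  also have "\<dots> = tensor3 (\<lambda>X Y Z. B X x * B Y y * B Z z)"
    unfolding tensor3_def scaleC_mult_left scaleC_mult_right scaleC_scaleC by (simp only: mult_ac)
  finally show ?thesis .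
qed

text \<open>
  Sums over dual bases are evaluated on basis vectors, which requires no linearity of \<open>h\<close>.
\<close>

lemma B_delta: "\<beta> < n \<Longrightarrow> (\<Sum>\<alpha><n. B (T \<beta>) (T' \<alpha>) * h \<alpha>) = h \<beta>"
proof -
  assume \<beta>: "\<beta> < n"
  have "(\<Sum>\<alpha><n. B (T \<beta>) (T' \<alpha>) * h \<alpha>) = (\<Sum>\<alpha><n. if \<alpha> = \<beta> then h \<beta> else 0)"
    by (rule sum.cong) (use \<beta> in \<open>auto simp: B_dual\<close>)
  then show ?thesis using \<beta> by simp
qed

lemma contract: "clinear L \<Longrightarrow> (\<Sum>\<beta><n. B u (T' \<beta>) * B x (L (T \<beta>))) = B x (L u)"
  by (subst (2) expand_T[of u]) (simp add: clinear_simps B_right)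

lemma legs_distinct: "(1::3) \<noteq> 2" "(1::3) \<noteq> 3" "(2::3) \<noteq> 3" by simp_all

text \<open>
  In the first factor the bracket of \<open>L (T \<beta>)\<close> and \<open>M (T \<gamma>)\<close> remains, and the other two factors select \<open>Y\<close> and \<open>Z\<close>.
\<close>

lemma commutator_12_13:
  "commutator (place 1 2 (tensor_of L)) (place 1 3 (tensor_of M)) = tensor3 (\<lambda>X Y Z. B X (lie (L Y) (M Z)))"
proof -
  have "commutator (leg (1::3) x * leg 2 y) (leg 1 x' * leg 3 z) = leg 1 (lie x x') * leg 2 y * leg 3 z" for x x' y z :: 'g
    unfolding commutator_def leg_lie[symmetric]
    by (rule ring_commutator_12_13) (rule leg_commute, simp)+
  then have "commutator (place 1 2 (tensor_of L)) (place 1 3 (tensor_of M))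
    = tensor3 (\<lambda>X Y Z. \<Sum>\<beta><n. \<Sum>\<gamma><n. B X (lie (L (T \<beta>)) (M (T \<gamma>))) * B Y (T' \<beta>) * B Z (T' \<gamma>))"
    by (simp add: place_tensor_of_left commutator_sum tensor3_pure tensor3_sum)
  also have "\<dots> = tensor3 (\<lambda>X Y Z. B X (lie (L Y) (M Z)))"
  proof (rule tensor3_cong)
    fix \<alpha> \<beta>' \<gamma>' assume b: "\<beta>' < n" "\<gamma>' < n"
    have "(\<Sum>\<beta><n. \<Sum>\<gamma><n. B (T \<alpha>) (lie (L (T \<beta>)) (M (T \<gamma>))) * B (T \<beta>') (T' \<beta>) * B (T \<gamma>') (T' \<gamma>))
      = (\<Sum>\<beta><n. B (T \<beta>') (T' \<beta>) * (\<Sum>\<gamma><n. B (T \<gamma>') (T' \<gamma>) * B (T \<alpha>) (lie (L (T \<beta>)) (M (T \<gamma>)))))"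
      by (simp add: sum_distrib_left mult_ac)
    then show "(\<Sum>\<beta><n. \<Sum>\<gamma><n. B (T \<alpha>) (lie (L (T \<beta>)) (M (T \<gamma>))) * B (T \<beta>') (T' \<beta>) * B (T \<gamma>') (T' \<gamma>))
      = B (T \<alpha>) (lie (L (T \<beta>')) (M (T \<gamma>')))"
      by (simp only: B_delta b)
  qed
  finally show ?thesis .
qed

text \<open>
  The bracket occurs in the second factor; invariance of \<open>B\<close> moves it into the argument of \<open>L\<close>.
\<close>

lemma commutator_12_23:
  assumes L: "clinear L"
  shows "commutator (place 1 2 (tensor_of L)) (place 2 3 (tensor_of M)) = tensor3 (\<lambda>X Y Z. B X (L (lie (M Z) Y)))"
proof -
  have "commutator (leg (1::3) x * leg 2 y) (leg 2 y' * leg 3 z) = leg 1 x * leg 2 (lie y y') * leg 3 z" for x y' y z :: 'g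
    unfolding commutator_def leg_lie[symmetric]
    by (rule ring_commutator_12_23) (rule leg_commute, simp)+
  then have "commutator (place 1 2 (tensor_of L)) (place 2 3 (tensor_of M))
    = tensor3 (\<lambda>X Y Z. \<Sum>\<beta><n. \<Sum>\<gamma><n. B X (L (T \<beta>)) * B Y (lie (T' \<beta>) (M (T \<gamma>))) * B Z (T' \<gamma>))"
    by (simp add: place_tensor_of_left commutator_sum tensor3_pure tensor3_sum)
  also have "\<dots> = tensor3 (\<lambda>X Y Z. B X (L (lie (M Z) Y)))"
  proof (rule tensor3_cong)
    fix \<alpha> \<beta>' \<gamma>' assume b: "\<beta>' < n" "\<gamma>' < n"
    have e: "B Y (lie (T' \<beta>) W) = B (lie W Y) (T' \<beta>)" for Y W \<beta>
      by (simp only: B_skew lie_antisym[of "T' \<beta>"] B_right)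
    have "(\<Sum>\<beta><n. \<Sum>\<gamma><n. B (T \<alpha>) (L (T \<beta>)) * B (T \<beta>') (lie (T' \<beta>) (M (T \<gamma>))) * B (T \<gamma>') (T' \<gamma>))
      = (\<Sum>\<beta><n. \<Sum>\<gamma><n. B (T \<gamma>') (T' \<gamma>) * (B (lie (M (T \<gamma>)) (T \<beta>')) (T' \<beta>) * B (T \<alpha>) (L (T \<beta>))))"
      unfolding e by (simp add: mult_ac)
    also have "\<dots> = B (T \<alpha>) (L (lie (M (T \<gamma>')) (T \<beta>')))" by (simp only: B_delta b contract[OF L])
    finally show "(\<Sum>\<beta><n. \<Sum>\<gamma><n. B (T \<alpha>) (L (T \<beta>)) * B (T \<beta>') (lie (T' \<beta>) (M (T \<gamma>))) * B (T \<gamma>') (T' \<gamma>))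
      = B (T \<alpha>) (L (lie (M (T \<gamma>')) (T \<beta>')))" .
  qed
  finally show ?thesis .
qed

text \<open>
  Both operators are moved to their arguments \<open>X\<close> and \<open>Y\<close> by skewness, which leaves \<open>Z\<close> paired with a bracket; then \<open>L\<close> is moved back.
\<close>

lemma commutator_13_23:
  assumes L: "\<And>u v. B (L u) v = - B u (L' v)" and M: "\<And>u v. B (M u) v = - B u (M' v)"
  shows "commutator (place 1 3 (tensor_of L)) (place 2 3 (tensor_of M)) = tensor3 (\<lambda>X Y Z. - B X (L (lie (M' Y) Z)))"
proof -
  have "commutator (leg (1::3) x * leg 3 z) (leg 2 y * leg 3 z') = leg 1 x * leg 2 y * leg 3 (lie z z')" for x z' y z :: 'g
    unfolding commutator_def leg_lie[symmetric]
    by (rule ring_commutator_13_23) (rule leg_commute, simp)+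
  then have "commutator (place 1 3 (tensor_of L)) (place 2 3 (tensor_of M))
    = tensor3 (\<lambda>X Y Z. \<Sum>\<beta><n. \<Sum>\<gamma><n. B X (L (T \<beta>)) * B Y (M (T \<gamma>)) * B Z (lie (T' \<beta>) (T' \<gamma>)))"
    by (simp add: place_tensor_of_left commutator_sum tensor3_pure tensor3_sum)
  also have "\<dots> = tensor3 (\<lambda>X Y Z. - B X (L (lie (M' Y) Z)))"
  proof (rule tensor3_cong)
    fix \<alpha> \<beta>' \<gamma>'
    let ?X = "T \<alpha>" and ?Y = "T \<beta>'" and ?Z = "T \<gamma>'"
    have 1: "B u (L v) = - B (L' u) v" and 2: "B u (M v) = - B (M' u) v" for u v
      unfolding B_sym[of u] L M by (simp_all only: B_sym[of v])
    have "(\<Sum>\<beta><n. \<Sum>\<gamma><n. B ?X (L (T \<beta>)) * B ?Y (M (T \<gamma>)) * B ?Z (lie (T' \<beta>) (T' \<gamma>)))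
      = B ?Z (lie (\<Sum>\<beta><n. B (L' ?X) (T \<beta>) *\<^sub>C T' \<beta>) (\<Sum>\<gamma><n. B (M' ?Y) (T \<gamma>) *\<^sub>C T' \<gamma>))"
      by (simp add: 1 2 clinear_simps[OF clinear_lie(1)] clinear_simps[OF clinear_lie(2)] B_right sum_distrib_left mult_ac)
        (rule sum.swap)
    also have "\<dots> = B ?Z (lie (L' ?X) (M' ?Y))" by (simp only: expand_T'[symmetric])
    also have "\<dots> = B (lie (M' ?Y) ?Z) (L' ?X)"
      unfolding B_invariant[of "M' ?Y" ?Z "L' ?X"] B_invariant[of ?Z "L' ?X" "M' ?Y", symmetric] by (rule B_sym)
    also have "\<dots> = - B ?X (L (lie (M' ?Y) ?Z))" by (simp only: 1 minus_minus B_sym[of "L' ?X"])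
    finally show "(\<Sum>\<beta><n. \<Sum>\<gamma><n. B ?X (L (T \<beta>)) * B ?Y (M (T \<gamma>)) * B ?Z (lie (T' \<beta>) (T' \<gamma>)))
      = - B ?X (L (lie (M' ?Y) ?Z))" .
  qed
  finally show ?thesis .
qed

lemma leg_place_simps:
  "leg 1 u * place 2 3 (tensor_of D) = tensor3 (\<lambda>X Y Z. B X u * B Y (D Z))"
  "leg 2 u * place 1 3 (tensor_of D) = tensor3 (\<lambda>X Y Z. B Y u * B X (D Z))"
  "leg 3 u * place 1 2 (tensor_of D) = tensor3 (\<lambda>X Y Z. B Z u * B X (D Y))"
proof -
  have 2: "leg (2::3) u * (leg 1 x * leg 3 z) = leg 1 x * leg 2 u * leg 3 z" for x z
    by (metis mult.assoc leg_commute legs_distinct(1))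
  have 3: "leg (3::3) u * (leg 1 x * leg 2 y) = leg 1 x * leg 2 y * leg 3 u" for x y
  proof -
    have "leg (3::3) u * (leg 1 x * leg 2 y) = leg 1 x * leg 3 u * leg 2 y"
      by (simp only: mult.assoc[symmetric] leg_commute[OF legs_distinct(2)])
    also have "\<dots> = leg 1 x * leg 2 y * leg 3 u"
      by (simp only: mult.assoc leg_commute[OF legs_distinct(3)])
    finally show ?thesis .
  qed
  have "leg 1 u * place 2 3 (tensor_of D) = tensor3 (\<lambda>X Y Z. \<Sum>\<beta><n. B X u * B Y (D (T \<beta>)) * B Z (T' \<beta>))"
    by (simp add: place_tensor_of_left sum_distrib_left mult.assoc[symmetric] tensor3_pure tensor3_sum)
  also have "\<dots> = tensor3 (\<lambda>X Y Z. B X u * B Y (D Z))"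
  proof (rule tensor3_cong)
    fix \<alpha> \<beta> \<gamma> assume g: "\<gamma> < n"
    have "(\<Sum>b<n. B (T \<alpha>) u * B (T \<beta>) (D (T b)) * B (T \<gamma>) (T' b)) = (\<Sum>b<n. B (T \<gamma>) (T' b) * (B (T \<alpha>) u * B (T \<beta>) (D (T b))))"
      by (simp add: mult_ac)
    then show "(\<Sum>b<n. B (T \<alpha>) u * B (T \<beta>) (D (T b)) * B (T \<gamma>) (T' b)) = B (T \<alpha>) u * B (T \<beta>) (D (T \<gamma>))"
      by (simp only: B_delta[OF g])
  qed
  finally show "leg 1 u * place 2 3 (tensor_of D) = tensor3 (\<lambda>X Y Z. B X u * B Y (D Z))" .
  have "leg 2 u * place 1 3 (tensor_of D) = tensor3 (\<lambda>X Y Z. \<Sum>\<beta><n. B X (D (T \<beta>)) * B Y u * B Z (T' \<beta>))"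
    by (simp add: place_tensor_of_left sum_distrib_left 2 tensor3_pure tensor3_sum)
  also have "\<dots> = tensor3 (\<lambda>X Y Z. B Y u * B X (D Z))"
  proof (rule tensor3_cong)
    fix \<alpha> \<beta> \<gamma> assume g: "\<gamma> < n"
    have "(\<Sum>b<n. B (T \<alpha>) (D (T b)) * B (T \<beta>) u * B (T \<gamma>) (T' b)) = (\<Sum>b<n. B (T \<gamma>) (T' b) * (B (T \<beta>) u * B (T \<alpha>) (D (T b))))"
      by (simp add: mult_ac)
    then show "(\<Sum>b<n. B (T \<alpha>) (D (T b)) * B (T \<beta>) u * B (T \<gamma>) (T' b)) = B (T \<beta>) u * B (T \<alpha>) (D (T \<gamma>))"
      by (simp only: B_delta[OF g])
  qed
  finally show "leg 2 u * place 1 3 (tensor_of D) = tensor3 (\<lambda>X Y Z. B Y u * B X (D Z))" .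
  have "leg 3 u * place 1 2 (tensor_of D) = tensor3 (\<lambda>X Y Z. \<Sum>\<beta><n. B X (D (T \<beta>)) * B Y (T' \<beta>) * B Z u)"
    by (simp add: place_tensor_of_left sum_distrib_left 3 tensor3_pure tensor3_sum)
  also have "\<dots> = tensor3 (\<lambda>X Y Z. B Z u * B X (D Y))"
  proof (rule tensor3_cong)
    fix \<alpha> \<beta> \<gamma> assume g: "\<beta> < n"
    have "(\<Sum>b<n. B (T \<alpha>) (D (T b)) * B (T \<beta>) (T' b) * B (T \<gamma>) u) = (\<Sum>b<n. B (T \<beta>) (T' b) * (B (T \<gamma>) u * B (T \<alpha>) (D (T b))))"
      by (simp add: mult_ac)
    then show "(\<Sum>b<n. B (T \<alpha>) (D (T b)) * B (T \<beta>) (T' b) * B (T \<gamma>) u) = B (T \<gamma>) u * B (T \<alpha>) (D (T \<beta>))"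
      by (simp only: B_delta[OF g])
  qed
  finally show "leg 3 u * place 1 2 (tensor_of D) = tensor3 (\<lambda>X Y Z. B Z u * B X (D Y))" .
qed

text \<open>The Casimir tensor \<open>\<Sum> T \<beta> \<otimes> T' \<beta>\<close> is invariant, so \<open>ad X\<close> on the second factor can be moved to the argument of \<open>L\<close>.\<close>

lemma adjoint_action_place:
  assumes L: "clinear L" and kl: "k \<noteq> l"
  shows "place k l (tensor_of (\<lambda>u. lie X (L u) - L (lie X u))) = commutator (leg k X + leg l X) (place k l (tensor_of L))"
proof -
  have "(\<Sum>\<beta><n. leg k (L (lie X (T \<beta>))) * leg l (T' \<beta>)) = (\<Sum>\<beta><n. \<Sum>\<gamma><n. B (lie X (T \<beta>)) (T' \<gamma>) *\<^sub>C (leg k (L (T \<gamma>)) * leg l (T' \<beta>)))"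
    by (subst expand_T[of "lie X (T _)"])
      (simp add: clinear_simps[OF L] leg_simps sum_distrib_right scaleC_mult_left)
  also have "\<dots> = (\<Sum>\<gamma><n. \<Sum>\<beta><n. - (B (T \<beta>) (lie X (T' \<gamma>)) *\<^sub>C (leg k (L (T \<gamma>)) * leg l (T' \<beta>))))"
    by (subst sum.swap) (simp add: B_skew complex_vector.scale_minus_left)
  also have "\<dots> = - (\<Sum>\<gamma><n. leg k (L (T \<gamma>)) * leg l (lie X (T' \<gamma>)))"
    by (subst leg_expand[of l "lie X (T' _)"]) (simp add: sum_distrib_left scaleC_mult_right sum_negf)
  finally have inv: "(\<Sum>\<beta><n. leg k (L (lie X (T \<beta>))) * leg l (T' \<beta>)) = - (\<Sum>\<gamma><n. leg k (L (T \<gamma>)) * leg l (lie X (T' \<gamma>)))" .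
  have "commutator (leg k X + leg l X) (leg k x * leg l y) = leg k (lie X x) * leg l y + leg k x * leg l (lie X y)" for x y
  proof -
    have "leg l X * (leg k x * leg l y) = leg k x * (leg l X * leg l y)"
      by (simp only: mult.assoc[symmetric] leg_commute[OF kl[symmetric]])
    moreover have "leg k x * leg l y * leg k X = leg k x * leg k X * leg l y"
      by (simp only: mult.assoc leg_commute[OF kl[symmetric]])
    ultimately show ?thesis
      unfolding commutator_def leg_lie[symmetric] by (simp add: distrib_left distrib_right left_diff_distrib right_diff_distrib mult.assoc)
  qed
  then have "commutator (leg k X + leg l X) (place k l (tensor_of L)) = (\<Sum>\<beta><n. leg k (lie X (L (T \<beta>))) * leg l (T' \<beta>) + leg k (L (T \<beta>)) * leg l (lie X (T' \<beta>)))"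
    using commutator_sum[of "\<lambda>_. leg k X + leg l X" "{()}" "\<lambda>\<beta>. leg k (L (T \<beta>)) * leg l (T' \<beta>)" "{..<n}"]
    by (simp add: place_tensor_of_left)
  then show ?thesis
    by (simp add: place_tensor_of_left leg_simps left_diff_distrib sum_subtractf inv sum.distrib)
qed

end

section \<open>The properties of the dynamical r-matrix\<close>

lemma tens_simps:
  "x \<otimes>\<^sub>t (y + y') = x \<otimes>\<^sub>t y + x \<otimes>\<^sub>t y'" "x \<otimes>\<^sub>t (c *\<^sub>C y) = c *\<^sub>C (x \<otimes>\<^sub>t y)"
proof -
  show "x \<otimes>\<^sub>t (y + y') = x \<otimes>\<^sub>t y + x \<otimes>\<^sub>t y'"
    by transfer (use tensor2_null.add_right[OF tensor2_null.zero, of _ _ _ 1] in \<open>simp add: tensor2_rel_def diff_diff_eq\<close>)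
  show "x \<otimes>\<^sub>t (c *\<^sub>C y) = c *\<^sub>C (x \<otimes>\<^sub>t y)"
    by transfer (use tensor2_null.scale_right[OF tensor2_null.zero, of _ _ _ 1] in \<open>simp add: tensor2_rel_def fscale_single\<close>)
qed

context dynamical_point
begin

lemma r_mat_partial_deriv:
  assumes z: "z \<notin> \<Omega>" and T0: "is_basis (G 0) m T0" and S: "\<And>j. j < m \<Longrightarrow> S j \<in> G 0"
    and dual_S: "\<And>i j. i < m \<Longrightarrow> j < m \<Longrightarrow> B (S j) (T0 i) = (if i = j then 1 else 0)" and j: "j < m"
  shows "has_partial_deriv B (G 0) m T0 j (\<lambda>\<omega>. r_mat B \<mu> N n T T' \<tau> \<omega> z) (tensor_of (dRop z (S j))) \<omega>"
    and "partial_deriv B (G 0) m T0 j (\<lambda>\<omega>. r_mat B \<mu> N n T T' \<tau> \<omega> z) \<omega> = tensor_of (dRop z (S j))"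
proof -
  note curve = coord_curve[OF T0 S dual_S \<omega> j]
  show d: "has_partial_deriv B (G 0) m T0 j (\<lambda>\<omega>. r_mat B \<mu> N n T T' \<tau> \<omega> z) (tensor_of (dRop z (S j))) \<omega>"
    unfolding has_partial_deriv_def by (rule r_mat_deriv[OF z curve S[OF j]])
  show "partial_deriv B (G 0) m T0 j (\<lambda>\<omega>. r_mat B \<mu> N n T T' \<tau> \<omega> z) \<omega> = tensor_of (dRop z (S j))"
    unfolding partial_deriv_def
  proof (rule the_equality[where P = "\<lambda>D. has_partial_deriv B (G 0) m T0 j (\<lambda>\<omega>. r_mat B \<mu> N n T T' \<tau> \<omega> z) D \<omega>", OF d])
    fix D assume D: "has_partial_deriv B (G 0) m T0 j (\<lambda>\<omega>. r_mat B \<mu> N n T T' \<tau> \<omega> z) D \<omega>"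
    show "D = tensor_of (dRop z (S j))"
    proof (rule functional_separates)
      fix \<phi> :: "'g tensor2 \<Rightarrow> complex" assume \<phi>: "cfunctional \<phi>"
      show "\<phi> D = \<phi> (tensor_of (dRop z (S j)))"
        using D d \<phi> unfolding has_partial_deriv_def has_vec_deriv_def by (blast intro: DERIV_unique)
    qed
  qed
qed

text \<open>
  Each of the six terms has been computed as a \<open>tensor3\<close>; the components add up to \<open>yang_baxter\<close>.
\<close>

lemma r_mat_yang_baxter:
  assumes z: "z1 - z2 \<notin> \<Omega>" "z1 - z3 \<notin> \<Omega>" "z2 - z3 \<notin> \<Omega>"
    and T0: "is_basis (G 0) m T0" and S: "\<And>j. j < m \<Longrightarrow> S j \<in> G 0"
    and dual_S: "\<And>i j. i < m \<Longrightarrow> j < m \<Longrightarrow> B (S j) (T0 i) = (if i = j then 1 else 0)"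
  defines "r \<equiv> \<lambda>z. tensor_of (Rop \<omega> z)" and "d \<equiv> \<lambda>z j. tensor_of (dRop z (S j))"
  shows "commutator (place 1 2 (r (z1 - z2))) (place 1 3 (r (z1 - z3)))
      + commutator (place 1 2 (r (z1 - z2))) (place 2 3 (r (z2 - z3)))
      + commutator (place 1 3 (r (z1 - z3))) (place 2 3 (r (z2 - z3)))
      + (\<Sum>j<m. leg 1 (T0 j) * place 2 3 (d (z2 - z3) j))
      - (\<Sum>j<m. leg 2 (T0 j) * place 1 3 (d (z1 - z3) j))
      + (\<Sum>j<m. leg 3 (T0 j) * place 1 2 (d (z1 - z2) j)) = (0 :: ('g, 3) uea_power)"
proof -
  define x y where xy: "x = z1 - z2" "y = z1 - z3"
  have e: "z1 - z2 = x" "z1 - z3 = y" "z2 - z3 = y - x" by (simp_all add: xy)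
  have z': "x \<notin> \<Omega>" "y \<notin> \<Omega>" "y - x \<notin> \<Omega>" using z by (simp_all add: e)
  have m: "B (Rop \<omega> (y - x) u) v = - B u (Rop \<omega> (x - y) v)" for u v using Rop_skew[OF z'(3)] by simp
  have D: "(\<Sum>j<m. B X (T0 j) * B Y (dRop w (S j) Z)) = B Y (dRop w (P 0 X) Z)" if "w \<notin> \<Omega>" for w X Y Z
  proof -
    have "dRop w (P 0 X) Z = (\<Sum>j<m. B X (T0 j) *\<^sub>C dRop w (S j) Z)"
    proof -
      have "P 0 X = (\<Sum>j<m. B X (T0 j) *\<^sub>C S j)" by (rule P_expand[OF T0]) (simp_all add: S dual_S)
      also have "dRop w \<dots> Z = (\<Sum>j<m. dRop w (B X (T0 j) *\<^sub>C S j) Z)" by (rule dRop_sum_left[OF that]) (simp add: S G_simps)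
      also have "\<dots> = (\<Sum>j<m. B X (T0 j) *\<^sub>C dRop w (S j) Z)" by (rule sum.cong) (simp_all add: dRop_simps(3)[OF that] S)
      finally show ?thesis .
    qed
    then show ?thesis by (simp add: B_right)
  qed
  show ?thesis
    unfolding e r_def d_def commutator_12_13 commutator_12_23[OF Rop_linear[OF z'(1)]]
      commutator_13_23[OF Rop_skew[OF z'(2)] m] leg_place_simps tensor3_sum tensor3_add tensor3_diff
      D[OF z'(1)] D[OF z'(2)] D[OF z'(3)]
  proof (rule trans[OF tensor3_cong tensor3_0])
    fix \<alpha> \<beta> \<gamma>
    show "B (T \<alpha>) (lie (Rop \<omega> x (T \<beta>)) (Rop \<omega> y (T \<gamma>))) + B (T \<alpha>) (Rop \<omega> x (lie (Rop \<omega> (y - x) (T \<gamma>)) (T \<beta>)))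
      + - B (T \<alpha>) (Rop \<omega> y (lie (Rop \<omega> (x - y) (T \<beta>)) (T \<gamma>))) + B (T \<beta>) (dRop (y - x) (P 0 (T \<alpha>)) (T \<gamma>))
      - B (T \<alpha>) (dRop y (P 0 (T \<beta>)) (T \<gamma>)) + B (T \<alpha>) (dRop x (P 0 (T \<gamma>)) (T \<beta>)) = 0"
      using yang_baxter_vanishes[OF z', of "T \<alpha>" "T \<beta>" "T \<gamma>"] unfolding yang_baxter_def by (simp add: algebra_simps)
  qed
qed

lemma r_mat_residue:
  "has_vec_residue (r_mat B \<mu> N n T T' \<tau> \<omega>) ((1 / (2 * pi * \<i>)) *\<^sub>C (\<Sum>\<alpha><n. T' \<alpha> \<otimes>\<^sub>t T \<alpha>)) 0"
  unfolding has_vec_residue_def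
proof (intro allI impI)
  fix \<phi> :: "'g tensor2 \<Rightarrow> complex" assume \<phi>: "cfunctional \<phi>"
  obtain s where "s > 0" "\<And>z. z \<in> ball 0 s \<Longrightarrow> z \<noteq> 0 \<Longrightarrow> theta1 \<tau> z \<noteq> 0"
    by (rule theta1_isolated_zero[OF \<tau>]) (rule that)
  then have s: "s > 0" "\<And>z. z \<in> ball 0 s \<Longrightarrow> z \<noteq> 0 \<Longrightarrow> z \<notin> \<Omega>" by (auto simp: theta1_eq_0_iff[OF \<tau>])
  let ?c = "1 / (2 * pi * \<i>) :: complex"
  have \<phi>_right: "cfunctional (\<lambda>y. \<phi> (x \<otimes>\<^sub>t y))" for x :: 'g
    unfolding cfunctional_iff by (simp add: tens_simps cfunctional_simps[OF \<phi>])
  have "simple_pole (\<lambda>z. \<phi> (r_mat B \<mu> N n T T' \<tau> \<omega> z)) (\<Sum>\<alpha><n. \<Sum>\<beta><n. \<phi> (T' \<alpha> \<otimes>\<^sub>t T' \<beta>) * (?c * B (T \<alpha>) (T \<beta>)))"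
  proof (rule simple_pole_cong[OF _ s(1)])
    show "simple_pole (\<lambda>z. \<Sum>\<alpha><n. \<Sum>\<beta><n. \<phi> (T' \<alpha> \<otimes>\<^sub>t T' \<beta>) * B (T \<alpha>) (Rop \<omega> z (T \<beta>)))
      (\<Sum>\<alpha><n. \<Sum>\<beta><n. \<phi> (T' \<alpha> \<otimes>\<^sub>t T' \<beta>) * (?c * B (T \<alpha>) (T \<beta>)))"
      by (intro simple_pole_sum simple_pole_cmult Rop_residue B_functional)
    show "\<phi> (r_mat B \<mu> N n T T' \<tau> \<omega> z) = (\<Sum>\<alpha><n. \<Sum>\<beta><n. \<phi> (T' \<alpha> \<otimes>\<^sub>t T' \<beta>) * B (T \<alpha>) (Rop \<omega> z (T \<beta>)))"
      if "z \<in> ball 0 s" "z \<noteq> 0" for z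
      by (simp only: r_mat_eq[OF s(2)[OF that]] functional_tensor_of[OF \<phi>])
  qed
  also have "(\<Sum>\<alpha><n. \<Sum>\<beta><n. \<phi> (T' \<alpha> \<otimes>\<^sub>t T' \<beta>) * (?c * B (T \<alpha>) (T \<beta>))) = (\<Sum>\<alpha><n. ?c * \<phi> (T' \<alpha> \<otimes>\<^sub>t T \<alpha>))"
  proof (rule sum.cong[OF refl])
    fix \<alpha>
    have "\<phi> (T' \<alpha> \<otimes>\<^sub>t T \<alpha>) = (\<Sum>\<beta><n. B (T \<alpha>) (T \<beta>) * \<phi> (T' \<alpha> \<otimes>\<^sub>t T' \<beta>))"
      using arg_cong[OF expand_T'[of "T \<alpha>"], of "\<lambda>y. \<phi> (T' \<alpha> \<otimes>\<^sub>t y)"] unfolding cfunctional_simps[OF \<phi>_right] .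
    then show "(\<Sum>\<beta><n. \<phi> (T' \<alpha> \<otimes>\<^sub>t T' \<beta>) * (?c * B (T \<alpha>) (T \<beta>))) = ?c * \<phi> (T' \<alpha> \<otimes>\<^sub>t T \<alpha>)"
      by (simp only: sum_distrib_left) (rule sum.cong, simp_all only: mult_ac)
  qed
  also have "\<dots> = \<phi> (?c *\<^sub>C (\<Sum>\<alpha><n. T' \<alpha> \<otimes>\<^sub>t T \<alpha>))"
    by (simp only: cfunctional_simps[OF \<phi>] sum_distrib_left)
  finally show "isolated_singularity_at (\<lambda>z. \<phi> (r_mat B \<mu> N n T T' \<tau> \<omega> z)) 0 \<and>
      residue (\<lambda>z. \<phi> (r_mat B \<mu> N n T T' \<tau> \<omega> z)) 0 = \<phi> (?c *\<^sub>C (\<Sum>\<alpha><n. T' \<alpha> \<otimes>\<^sub>t T \<alpha>))"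
    by (simp only: simple_pole_residue conj_absorb simp_thms)
qed

text \<open>
  The derivative of \<open>R\<close> along the orbit is the commutator of \<open>ad X\<close> with \<open>R\<close>, and the invariance of the Casimir tensor turns the second half of
  this commutator into the action of \<open>X\<close> on the second factor.
\<close>

lemma r_mat_equivariant:
  assumes z: "z \<notin> \<Omega>" and X: "X \<in> G 0"
  shows "has_vec_deriv (\<lambda>x. r_mat B \<mu> N n T T' \<tau> (endo_exp (\<lambda>v. x *\<^sub>C lie X v) \<omega>) z) (tensor_of (dRop z (lie X \<omega>))) 0"
    and "place 1 2 (tensor_of (dRop z (lie X \<omega>)))
      = commutator (leg 1 X + leg 2 X) (place 1 2 (r_mat B \<mu> N n T T' \<tau> \<omega> z) :: ('g, 2) uea_power)"
proof -
  show "has_vec_deriv (\<lambda>x. r_mat B \<mu> N n T T' \<tau> (endo_exp (\<lambda>v. x *\<^sub>C lie X v) \<omega>) z) (tensor_of (dRop z (lie X \<omega>))) 0"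
    by (rule r_mat_deriv[OF z endo_exp_lie(1)[OF X \<omega>] endo_exp_lie(2,3) G_lie_0[OF X N_pos \<omega>]])
  have e: "dRop z (lie X \<omega>) = (\<lambda>u. lie X (Rop \<omega> z u) - Rop \<omega> z (lie X u))" by (rule ext) (rule dRop_orbit[OF z X])
  show "place 1 2 (tensor_of (dRop z (lie X \<omega>)))
      = commutator (leg 1 X + leg 2 X) (place 1 2 (r_mat B \<mu> N n T T' \<tau> \<omega> z) :: ('g, 2) uea_power)"
    unfolding r_mat_eq[OF z] e by (rule adjoint_action_place[OF Rop_linear[OF z]]) simp
qed

end

theorem proposition2:
  fixes B :: "'g::complex_lie_algebra \<Rightarrow> 'g \<Rightarrow> complex"
    and \<mu> :: "'g \<Rightarrow> 'g"
    and N n m :: nat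
    and \<tau> :: complex
    and T T' T0 :: "nat \<Rightarrow> 'g"
  defines "r \<equiv> r_mat B \<mu> N n T T' \<tau>"
    and "G0 \<equiv> fixed_points \<mu>"
    and "BB \<equiv> dyn_domain \<mu> N \<tau>"
    and "\<Omega> \<equiv> period_lattice \<tau>"
  assumes "fin_dim_space TYPE('g)"
    and "invariant_form B"
    and "lie_automorphism \<mu>"
    and "has_order \<mu> N"
    and "\<forall>x y. B (\<mu> x) (\<mu> y) = B x y"
    and "G0 \<noteq> {0}"
    and "Im \<tau> > 0"
    and "dual_bases B n T T'"
    and "is_basis G0 m T0"
  shows
    "(\<forall>\<omega>\<in>BB. \<forall>z. z \<notin> \<Omega> \<longrightarrow>
        (\<forall>j<m. \<exists>D. has_partial_deriv B G0 m T0 j (\<lambda>\<omega>. r \<omega> z) D \<omega>))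
   \<and> (\<forall>\<omega>\<in>BB. \<forall>z1 z2 z3. z1 - z2 \<notin> \<Omega> \<and> z1 - z3 \<notin> \<Omega> \<and> z2 - z3 \<notin> \<Omega> \<longrightarrow>
        commutator (place 1 2 (r \<omega> (z1 - z2))) (place 1 3 (r \<omega> (z1 - z3)))
      + commutator (place 1 2 (r \<omega> (z1 - z2))) (place 2 3 (r \<omega> (z2 - z3)))
      + commutator (place 1 3 (r \<omega> (z1 - z3))) (place 2 3 (r \<omega> (z2 - z3)))
      + (\<Sum>j<m. leg 1 (T0 j) * place 2 3 (partial_deriv B G0 m T0 j (\<lambda>\<omega>. r \<omega> (z2 - z3)) \<omega>))
      - (\<Sum>j<m. leg 2 (T0 j) * place 1 3 (partial_deriv B G0 m T0 j (\<lambda>\<omega>. r \<omega> (z1 - z3)) \<omega>))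
      + (\<Sum>j<m. leg 3 (T0 j) * place 1 2 (partial_deriv B G0 m T0 j (\<lambda>\<omega>. r \<omega> (z1 - z2)) \<omega>))
      = (0 :: ('g, 3) uea_power))
   \<and> (\<forall>\<omega>\<in>BB. has_vec_residue (r \<omega>) ((1 / (2 * pi * \<i>)) *\<^sub>C (\<Sum>\<alpha><n. T' \<alpha> \<otimes>\<^sub>t T \<alpha>)) 0)
   \<and> (\<forall>\<omega>\<in>BB. \<forall>z. z \<notin> \<Omega> \<longrightarrow> r_mat_transposed B \<mu> N n T T' \<tau> \<omega> z + r \<omega> (- z) = 0)
   \<and> (\<forall>\<omega>\<in>BB. \<forall>z. z \<notin> \<Omega> \<longrightarrow> (\<forall>X\<in>G0. \<exists>D.
        has_vec_deriv (\<lambda>x. r (endo_exp (\<lambda>v. x *\<^sub>C lie X v) \<omega>) z) D 0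
      \<and> place 1 2 D = commutator (leg 1 X + leg 2 X) (place 1 2 (r \<omega> z) :: ('g, 2) uea_power)))"
proof -
  interpret A: twisted_lie_algebra B \<mu> N n \<tau> T T'
    using assms(5-9,11,12) by unfold_locales
  have G0: "G0 = A.G 0" by (simp add: G0_def A.G_0)
  have T0: "is_basis (A.G 0) m T0" using assms(13) by (simp add: G0)
  obtain S where S: "\<forall>j<m. S j \<in> A.G 0" "\<forall>i<m. \<forall>j<m. B (S j) (T0 i) = (if i = j then 1 else 0)"
    using A.dual_coordinates[OF T0] by blast
  have S': "\<And>j. j < m \<Longrightarrow> S j \<in> A.G 0" "\<And>i j. i < m \<Longrightarrow> j < m \<Longrightarrow> B (S j) (T0 i) = (if i = j then 1 else 0)"
    using S by simp_all
  have point: "dynamical_point B \<mu> N n \<tau> T T' \<omega>" if "\<omega> \<in> BB" for \<omega>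
    using that A.twisted_lie_algebra_axioms by (simp add: dynamical_point_def dynamical_point_axioms_def BB_def)
  show ?thesis
  proof (intro conjI ballI allI impI)
    fix \<omega> z j assume *: "\<omega> \<in> BB" "z \<notin> \<Omega>" "j < m"
    interpret D: dynamical_point B \<mu> N n \<tau> T T' \<omega> by (rule point[OF *(1)])
    show "\<exists>D. has_partial_deriv B G0 m T0 j (\<lambda>\<omega>. r \<omega> z) D \<omega>"
      unfolding r_def G0 using D.r_mat_partial_deriv(1)[OF *(2)[unfolded \<Omega>_def] T0 S' *(3)] by blast
  next
    fix \<omega> z1 z2 z3 assume *: "\<omega> \<in> BB" "z1 - z2 \<notin> \<Omega> \<and> z1 - z3 \<notin> \<Omega> \<and> z2 - z3 \<notin> \<Omega>"
    interpret D: dynamical_point B \<mu> N n \<tau> T T' \<omega> by (rule point[OF *(1)])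
    have z: "z1 - z2 \<notin> D.\<Omega>" "z1 - z3 \<notin> D.\<Omega>" "z2 - z3 \<notin> D.\<Omega>" using *(2) by (simp_all add: \<Omega>_def)
    have p: "(\<Sum>j<m. leg k (T0 j) * place l l' (partial_deriv B (A.G 0) m T0 j (\<lambda>\<omega>. r_mat B \<mu> N n T T' \<tau> \<omega> w) \<omega>))
        = (\<Sum>j<m. leg k (T0 j) * place l l' (A.tensor_of (D.dRop w (S j))))" if "w \<notin> D.\<Omega>" for w and k l l' :: 3
      by (rule sum.cong) (simp_all add: D.r_mat_partial_deriv(2)[OF that T0 S'])
    show "commutator (place 1 2 (r \<omega> (z1 - z2))) (place 1 3 (r \<omega> (z1 - z3)))
      + commutator (place 1 2 (r \<omega> (z1 - z2))) (place 2 3 (r \<omega> (z2 - z3)))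
      + commutator (place 1 3 (r \<omega> (z1 - z3))) (place 2 3 (r \<omega> (z2 - z3)))
      + (\<Sum>j<m. leg 1 (T0 j) * place 2 3 (partial_deriv B G0 m T0 j (\<lambda>\<omega>. r \<omega> (z2 - z3)) \<omega>))
      - (\<Sum>j<m. leg 2 (T0 j) * place 1 3 (partial_deriv B G0 m T0 j (\<lambda>\<omega>. r \<omega> (z1 - z3)) \<omega>))
      + (\<Sum>j<m. leg 3 (T0 j) * place 1 2 (partial_deriv B G0 m T0 j (\<lambda>\<omega>. r \<omega> (z1 - z2)) \<omega>))
      = (0 :: ('g, 3) uea_power)"
      unfolding r_def G0 p[OF z(1)] p[OF z(2)] p[OF z(3)] D.r_mat_eq[OF z(1)] D.r_mat_eq[OF z(2)] D.r_mat_eq[OF z(3)]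
      by (rule D.r_mat_yang_baxter[OF z T0 S'])
  next
    fix \<omega> assume "\<omega> \<in> BB"
    then interpret D: dynamical_point B \<mu> N n \<tau> T T' \<omega> by (rule point)
    show "has_vec_residue (r \<omega>) ((1 / (2 * pi * \<i>)) *\<^sub>C (\<Sum>\<alpha><n. T' \<alpha> \<otimes>\<^sub>t T \<alpha>)) 0"
      unfolding r_def by (rule D.r_mat_residue)
  next
    fix \<omega> z assume *: "\<omega> \<in> BB" "z \<notin> \<Omega>"
    interpret D: dynamical_point B \<mu> N n \<tau> T T' \<omega> by (rule point[OF *(1)])
    show "r_mat_transposed B \<mu> N n T T' \<tau> \<omega> z + r \<omega> (- z) = 0"
      unfolding r_def using *(2) by (intro D.r_mat_skew) (simp add: \<Omega>_def)
  next
    fix \<omega> z X assume *: "\<omega> \<in> BB" "z \<notin> \<Omega>" "X \<in> G0"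
    interpret D: dynamical_point B \<mu> N n \<tau> T T' \<omega> by (rule point[OF *(1)])
    show "\<exists>D. has_vec_deriv (\<lambda>x. r (endo_exp (\<lambda>v. x *\<^sub>C lie X v) \<omega>) z) D 0
      \<and> place 1 2 D = commutator (leg 1 X + leg 2 X) (place 1 2 (r \<omega> z) :: ('g, 2) uea_power)"
      unfolding r_def using D.r_mat_equivariant[OF *(2)[unfolded \<Omega>_def] *(3)[unfolded G0]] by blast
  qed
qed

end
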